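(* Let $m\geq 2$ and let $b,c\in\mathbb{R}$ with $c\notin\{\frac{j+m}{m+1}\mid j\in\mathbb{N}\}$ ($\mathbb{N}=\{0,1,2,\dots\}$). (1) There exists an ordering prescription $\rho$ on $S^m$ (for differential operators from $b$-densities to $(b+c)$-densities) which is equivariant under the action of the group $GL(m+1,\mathbb{R})/\mathbb{R}^+$ of all homographies. (2) There exists an ordering prescription $\rho$ on $\mathbb{R}^m$ (for differential operators from $b$-densities to $(b+c)$-densities) which is equivariant under the action of the Lie algebra $\mathfrak{sl}(m+1,\mathbb{R})$ of all infinitesimal homographies.
   Context: $|\Lambda^mT^*M|^b$ is the line bundle of $b$-densities on an $m$-manifold $M$, associated to the frame bundle by $g\cdot\lambda=|\det g|^{-b}\lambda$; $Hom(|\Lambda^mT^*M|^b,|\Lambda^mT^*M|^{b+c})\cong|\Lambda^mT^*M|^c$. Standard ordering: for a torsion-free connection $\nabla$ in $TM$ (and induced connections on densities), $\rho_s(A)(\psi)=i(A)(\mathsf{D}^k\psi)$ for $A\in\Gamma^\infty(S^kTM\otimes|\Lambda^mT^*M|^c)$ and $\psi$ a $b$-density, where $\mathsf{D}\gamma=\sum_jdx^j\vee\nabla_{\partial_j}\gamma$, $i(X_1\vee\dots\vee X_k)=i(X_1)\cdots i(X_k)$ with $i(X)$ insertion into symmetric forms, and $\vee$ is the symmetric product normalized with the factor $\frac1{k!l!}$ times the sum over $S_{k+l}$ (so $v\vee w=v\otimes w+w\otimes v$). The principal symbol of a nonzero differential operator $D$ is the top-degree nonzero component of $\rho_s^{-1}(D)$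 (independent of $\nabla$). An ordering prescription on $M$ is an $\mathbb{R}$-linear bijection $\rho$ from $\bigoplus_k\Gamma^\infty(S^kTM\otimes|\Lambda^mT^*M|^c)$ onto the space of differential operators $\Gamma^\infty(|\Lambda^mT^*M|^b)\to\Gamma^\infty(|\Lambda^mT^*M|^{b+c})$ such that for every $D\neq0$ the top-degree nonzero component of $\rho^{-1}(D)$ is the principal symbol of $D$. Homographies: $GL(m+1,\mathbb{R})$ acts on $S^m\subset\mathbb{R}^{m+1}$ by $\Phi_g(x)=gx/|gx|$, the kernel being the positive multiples of the identity. Equivariance in (1): $\Phi_g^*(\rho(A)\varphi)=\rho(\Phi_g^*A)(\Phi_g^*\varphi)$ for all $g$, all $A$ and all $b$-densities $\varphi$, with natural pull-backs. Infinitesimal homographies on $\mathbb{R}^m$: the action of $\mathfrak{sl}(m+1,\mathbb{R})$ by the infinitesimal generators of the homographies, viewed in a chart of $S^m$ with image $\mathbb{R}^m$ in which they are vector fields with polynomial coefficients of degree at most two, i.e. the span of $\partial_i$, $x^i\partial_j$, $x^i\sum_jx^j\partial_j$ $(1\le i,j\le m)$. Equivariance in (2): $L_X(\rho(A)\varphi)=\rho(L_XA)\varphi+\rho(A)(L_X\varphi)$ for all $X$ in this Lie algebra, all $A$ and all $b$-densities $\varphi$, $L_X$ being the Lie derivative. *)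

theory Defs
  imports "HOL-Analysis.Analysis" "HOL-Combinatorics.Permutations"
begin

section \<open>Smooth functions on open subsets of Euclidean space\<close>

definition partial :: "'m::finite \<Rightarrow> (real^'m \<Rightarrow> real) \<Rightarrow> real^'m \<Rightarrow> real" where
  "partial i f = (\<lambda>x. frechet_derivative f (at x) (axis i 1))"

definition partials :: "'m::finite list \<Rightarrow> (real^'m \<Rightarrow> real) \<Rightarrow> real^'m \<Rightarrow> real" where
  "partials I f = foldr partial I f"

text \<open>For open \<open>S\<close> this is the usual notion of a smooth function: all iterated partial
  derivatives are (Frechet) differentiable, hence continuous, on \<open>S\<close>.\<close>

definition smooth_on :: "(real^'m::finite) set \<Rightarrow> (real^'m \<Rightarrow> real) \<Rightarrow> bool" where
  "smooth_on S f \<longleftrightarrow> (\<forall>I. \<forall>x\<in>S. partials I f differentiable (at x))"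


section \<open>Manifolds, densities and symbols\<close>

text \<open>A manifold is given by a smooth atlas \<open>M\<close>, that is, a set of charts
  \<open>\<kappa> = (U, \<phi>)\<close>, where only the values of \<open>\<phi>\<close> on \<open>U\<close> matter. Sections of the natural bundles
  are families of local representatives, indexed by the charts of \<open>M\<close> and obeying the
  transformation law of the bundle. A representative is a function on the image of its chart;
  it is extended by \<open>0\<close> in order that equal sections are equal as functions.\<close>

type_synonym ('p, 'm) chart = "'p set \<times> ('p \<Rightarrow> real^'m)"
type_synonym ('p, 'm) atlas = "('p, 'm) chart set"
type_synonym ('p, 'm) density = "('p, 'm) chart \<Rightarrow> real^'m \<Rightarrow> real"

definition image_of :: "('p, 'm::finite) chart \<Rightarrow> (real^'m) set" where
  "image_of \<kappa> = snd \<kappa> ` fst \<kappa>"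

definition point :: "('p, 'm::finite) chart \<Rightarrow> real^'m \<Rightarrow> 'p" where
  "point \<kappa> x = inv_into (fst \<kappa>) (snd \<kappa>) x"

text \<open>The coordinate expression of a map \<open>\<Phi>\<close> of the manifold; for \<open>\<Phi> = id\<close> this is the
  change of coordinates from \<open>\<kappa>\<close> to \<open>\<kappa>'\<close>.\<close>

definition in_coords ::
  "('p \<Rightarrow> 'p) \<Rightarrow> ('p, 'm::finite) chart \<Rightarrow> ('p, 'm) chart \<Rightarrow> real^'m \<Rightarrow> real^'m" where
  "in_coords \<Phi> \<kappa> \<kappa>' = (\<lambda>x. snd \<kappa>' (\<Phi> (point \<kappa> x)))"

definition overlap :: "('p, 'm::finite) chart \<Rightarrow> ('p, 'm) chart \<Rightarrow> (real^'m) set" where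
  "overlap \<kappa> \<kappa>' = snd \<kappa> ` (fst \<kappa> \<inter> fst \<kappa>')"

text \<open>Pull-back of a representative along a local diffeomorphism \<open>h\<close>. With
  \<open>g \<cdot> \<lambda> = |det g| powr (-b) * \<lambda>\<close>, a \<open>b\<close>-density is a function on frames with
  \<open>\<lambda>(u g) = |det g| powr b * \<lambda>(u)\<close>.\<close>

definition pull_density ::
  "real \<Rightarrow> (real^'m::finite \<Rightarrow> real^'m) \<Rightarrow> (real^'m \<Rightarrow> real) \<Rightarrow> real^'m \<Rightarrow> real" where
  "pull_density b h f x = \<bar>det (jacobian h (at x))\<bar> powr b * f (h x)"

definition densities :: "('p, 'm::finite) atlas \<Rightarrow> real \<Rightarrow> ('p, 'm) density set" where
  "densities M b = {\<psi>.
     (\<forall>\<kappa> x. \<kappa> \<notin> M \<or> x \<notin> image_of \<kappa> \<longrightarrow> \<psi> \<kappa> x = 0) \<and>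
     (\<forall>\<kappa>\<in>M. smooth_on (image_of \<kappa>) (\<psi> \<kappa>)) \<and>
     (\<forall>\<kappa>\<in>M. \<forall>\<kappa>'\<in>M. \<forall>x\<in>overlap \<kappa> \<kappa>'.
        \<psi> \<kappa> x = pull_density b (in_coords id \<kappa> \<kappa>') (\<psi> \<kappa>') x)}"

text \<open>An element of the direct sum of the spaces of sections of \<open>S\<^sup>k TM \<otimes> |\<Lambda>\<^sup>m T\<^sup>* M|\<^sup>c\<close> is given
  by its components \<open>A \<kappa> x [i1, ..., ik]\<close>, symmetric in the indices:
  its part of degree \<open>k\<close> is the sum over all \<open>i1, ..., ik\<close> of
  \<open>A \<kappa> x [i1, ..., ik] \<partial>\<^sub>i\<^sub>1 \<otimes> ... \<otimes> \<partial>\<^sub>i\<^sub>k \<otimes> |dx\<^sup>1 \<and> ... \<and> dx\<^sup>m|\<^sup>c\<close>.\<close>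

type_synonym ('p, 'm) symbol = "('p, 'm) chart \<Rightarrow> real^'m \<Rightarrow> 'm list \<Rightarrow> real"

definition pull_symbol ::
  "real \<Rightarrow> (real^'m::finite \<Rightarrow> real^'m) \<Rightarrow> (real^'m \<Rightarrow> 'm list \<Rightarrow> real) \<Rightarrow> real^'m \<Rightarrow> 'm list \<Rightarrow> real"
where
  "pull_symbol c h a x I =
     \<bar>det (jacobian h (at x))\<bar> powr c *
     (\<Sum>J | length J = length I.
        (\<Prod>r<length I. matrix_inv (jacobian h (at x)) $ (I ! r) $ (J ! r)) * a (h x) J)"

definition symbols :: "('p, 'm::finite) atlas \<Rightarrow> real \<Rightarrow> ('p, 'm) symbol set" where
  "symbols M c = {A.
     (\<forall>\<kappa> x I. \<kappa> \<notin> M \<or> x \<notin> image_of \<kappa> \<longrightarrow> A \<kappa> x I = 0) \<and>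
     (\<exists>n. \<forall>\<kappa> x I. length I > n \<longrightarrow> A \<kappa> x I = 0) \<and>
     (\<forall>\<kappa> x I J. mset I = mset J \<longrightarrow> A \<kappa> x I = A \<kappa> x J) \<and>
     (\<forall>\<kappa>\<in>M. \<forall>I. smooth_on (image_of \<kappa>) (\<lambda>x. A \<kappa> x I)) \<and>
     (\<forall>\<kappa>\<in>M. \<forall>\<kappa>'\<in>M. \<forall>x\<in>overlap \<kappa> \<kappa>'. \<forall>I.
        A \<kappa> x I = pull_symbol c (in_coords id \<kappa> \<kappa>') (A \<kappa>') x I)}"

definition component :: "nat \<Rightarrow> ('p, 'm::finite) symbol \<Rightarrow> ('p, 'm) symbol" where
  "component k A = (\<lambda>\<kappa> x I. if length I = k then A \<kappa> x I else 0)"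

definition symbol_degree :: "('p, 'm::finite) symbol \<Rightarrow> nat" where
  "symbol_degree A = (GREATEST k. component k A \<noteq> (\<lambda>\<kappa> x I. 0))"

definition top_component :: "('p, 'm::finite) symbol \<Rightarrow> ('p, 'm) symbol" where
  "top_component A = component (symbol_degree A) A"


section \<open>Differential operators\<close>

type_synonym ('p, 'm) operator = "('p, 'm) density \<Rightarrow> ('p, 'm) density"

definition zero_operator :: "('p, 'm::finite) operator" where
  "zero_operator = (\<lambda>\<psi> \<kappa> x. 0)"

text \<open>Differential operators from \<open>b\<close>-densities to \<open>(b + c)\<close>-densities, extended by \<open>0\<close> to
  functions which are not \<open>b\<close>-densities.\<close>

definition diff_ops :: "('p, 'm::finite) atlas \<Rightarrow> real \<Rightarrow> real \<Rightarrow> ('p, 'm) operator set" where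
  "diff_ops M b c = {D.
     (\<forall>\<psi>. \<psi> \<notin> densities M b \<longrightarrow> D \<psi> = (\<lambda>\<kappa> x. 0)) \<and>
     (\<forall>\<psi>\<in>densities M b. D \<psi> \<in> densities M (b + c)) \<and>
     (\<exists>k. \<forall>\<kappa>\<in>M. \<exists>a. (\<forall>I. smooth_on (image_of \<kappa>) (a I)) \<and>
        (\<forall>\<psi>\<in>densities M b. \<forall>x\<in>image_of \<kappa>.
           D \<psi> \<kappa> x = (\<Sum>I | length I \<le> k. a I x * partials I (\<psi> \<kappa>) x)))}"


section \<open>Connections and the standard ordering\<close>

text \<open>A connection in \<open>TM\<close> is given by its Christoffel symbols: \<open>\<Gamma> \<kappa> x k i j\<close> is the coefficient
  of \<open>\<partial>\<^sub>k\<close> in \<open>\<nabla>\<^bsub>\<partial>\<^sub>i\<^esub> \<partial>\<^sub>j\<close> in the chart \<open>\<kappa>\<close>.\<close>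

type_synonym 'm christoffel = "real^'m \<Rightarrow> 'm \<Rightarrow> 'm \<Rightarrow> 'm \<Rightarrow> real"
type_synonym ('p, 'm) connection = "('p, 'm) chart \<Rightarrow> 'm christoffel"

definition torsion_free_connections :: "('p, 'm::finite) atlas \<Rightarrow> ('p, 'm) connection set" where
  "torsion_free_connections M = {\<Gamma>.
     (\<forall>\<kappa>\<in>M. \<forall>k i j. smooth_on (image_of \<kappa>) (\<lambda>x. \<Gamma> \<kappa> x k i j)) \<and>
     (\<forall>\<kappa>\<in>M. \<forall>\<kappa>'\<in>M. \<forall>x\<in>overlap \<kappa> \<kappa>'. \<forall>a i j.
        (let h = in_coords id \<kappa> \<kappa>'; H = jacobian h (at x) in
         (\<Sum>k\<in>UNIV. H $ a $ k * \<Gamma> \<kappa> x k i j) =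
         partials [i, j] (\<lambda>y. h y $ a) x +
         (\<Sum>p\<in>UNIV. \<Sum>q\<in>UNIV. \<Gamma> \<kappa>' (h x) a p q * H $ p $ i * H $ q $ j))) \<and>
     (\<forall>\<kappa>\<in>M. \<forall>x\<in>image_of \<kappa>. \<forall>k i j. \<Gamma> \<kappa> x k i j = \<Gamma> \<kappa> x k j i)}"

text \<open>Covariant derivative along \<open>\<partial>\<^sub>j\<close> of a covariant tensor field with values in the
  \<open>b\<close>-densities, given by its components in a chart.\<close>

definition cov_deriv ::
  "real \<Rightarrow> 'm::finite christoffel \<Rightarrow> 'm \<Rightarrow> (real^'m \<Rightarrow> 'm list \<Rightarrow> real) \<Rightarrow> real^'m \<Rightarrow> 'm list \<Rightarrow> real"
where
  "cov_deriv b \<Gamma> j \<gamma> x I =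
     partial j (\<lambda>y. \<gamma> y I) x
     - (\<Sum>r<length I. \<Sum>l\<in>UNIV. \<Gamma> x l j (I ! r) * \<gamma> x (I[r := l]))
     - b * (\<Sum>i\<in>UNIV. \<Gamma> x i j i) * \<gamma> x I"

text \<open>Components of the symmetric product of symmetric forms of degree \<open>k\<close> and \<open>l\<close>; the index
  list \<open>I\<close> has length \<open>k + l\<close>.\<close>

definition sym_prod :: "nat \<Rightarrow> nat \<Rightarrow> ('m list \<Rightarrow> real) \<Rightarrow> ('m list \<Rightarrow> real) \<Rightarrow> 'm list \<Rightarrow> real" where
  "sym_prod k l \<alpha> \<beta> I =
     (\<Sum>\<pi> | \<pi> permutes {..<k + l}.
        \<alpha> (take k (permute_list \<pi> I)) * \<beta> (drop k (permute_list \<pi> I))) / (fact k * fact l)"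

definition dx :: "'m \<Rightarrow> 'm list \<Rightarrow> real" where
  "dx j I = (if I = [j] then 1 else 0)"

text \<open>The operator \<open>D\<close> on symmetric forms of degree \<open>k\<close> and its powers on densities;
  \<open>sym_deriv_pow b \<Gamma> k f x I\<close> is meant for \<open>length I = k\<close>.\<close>

definition sym_deriv ::
  "real \<Rightarrow> 'm::finite christoffel \<Rightarrow> nat \<Rightarrow> (real^'m \<Rightarrow> 'm list \<Rightarrow> real) \<Rightarrow> real^'m \<Rightarrow> 'm list \<Rightarrow> real"
where
  "sym_deriv b \<Gamma> k \<gamma> x I = (\<Sum>j\<in>UNIV. sym_prod 1 k (dx j) (cov_deriv b \<Gamma> j \<gamma> x) I)"

primrec sym_deriv_pow ::
  "real \<Rightarrow> 'm::finite christoffel \<Rightarrow> nat \<Rightarrow> (real^'m \<Rightarrow> real) \<Rightarrow> real^'m \<Rightarrow> 'm list \<Rightarrow> real"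
where
  "sym_deriv_pow b \<Gamma> 0 f = (\<lambda>x I. f x)"
| "sym_deriv_pow b \<Gamma> (Suc k) f = sym_deriv b \<Gamma> k (sym_deriv_pow b \<Gamma> k f)"

text \<open>Linear extension of \<open>i(X1 \<or> ... \<or> Xk) = i(X1) ... i(Xk)\<close> on forms of degree \<open>k\<close>: by the
  normalization of \<open>\<or>\<close>, the tensor \<open>X1 \<or> ... \<or> Xk\<close> is the sum of all \<open>k!\<close> permutations of
  \<open>X1 \<otimes> ... \<otimes> Xk\<close>, so that full contraction has to be divided by \<open>k!\<close>.\<close>

definition insertion :: "nat \<Rightarrow> ('m::finite list \<Rightarrow> real) \<Rightarrow> ('m list \<Rightarrow> real) \<Rightarrow> real" where
  "insertion k a \<gamma> = (\<Sum>I | length I = k. a I * \<gamma> I) / fact k"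

definition std_ordering ::
  "('p, 'm::finite) atlas \<Rightarrow> real \<Rightarrow> ('p, 'm) connection \<Rightarrow> ('p, 'm) symbol \<Rightarrow> ('p, 'm) operator"
where
  "std_ordering M b \<Gamma> A = (\<lambda>\<psi> \<kappa> x.
     if \<psi> \<in> densities M b \<and> \<kappa> \<in> M \<and> x \<in> image_of \<kappa>
     then \<Sum>k\<le>symbol_degree A. insertion k (A \<kappa> x) (sym_deriv_pow b (\<Gamma> \<kappa>) k (\<psi> \<kappa>) x)
     else 0)"

definition principal_symbol ::
  "('p, 'm::finite) atlas \<Rightarrow> real \<Rightarrow> real \<Rightarrow> ('p, 'm) connection \<Rightarrow> ('p, 'm) operator \<Rightarrow> ('p, 'm) symbol"
where
  "principal_symbol M b c \<Gamma> D = top_component (inv_into (symbols M c) (std_ordering M b \<Gamma>) D)"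

text \<open>The principal symbol does not depend on the connection; all connections are
  admitted here, and the last-but-one clause rules out that there is none.\<close>

definition ordering_prescription ::
  "('p, 'm::finite) atlas \<Rightarrow> real \<Rightarrow> real \<Rightarrow> (('p, 'm) symbol \<Rightarrow> ('p, 'm) operator) \<Rightarrow> bool"
where
  "ordering_prescription M b c \<rho> \<longleftrightarrow>
     bij_betw \<rho> (symbols M c) (diff_ops M b c) \<and>
     (\<forall>A\<in>symbols M c. \<forall>B\<in>symbols M c. \<forall>s t.
        \<rho> (\<lambda>\<kappa> x I. s * A \<kappa> x I + t * B \<kappa> x I) = (\<lambda>\<psi> \<kappa> x. s * \<rho> A \<psi> \<kappa> x + t * \<rho> B \<psi> \<kappa> x)) \<and>
     torsion_free_connections M \<noteq> {} \<and>
     (\<forall>\<Gamma>\<in>torsion_free_connections M. \<forall>D\<in>diff_ops M b c. D \<noteq> zero_operator \<longrightarrow>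
        top_component (inv_into (symbols M c) \<rho> D) = principal_symbol M b c \<Gamma> D)"


section \<open>The sphere and its homographies\<close>

text \<open>The space \<open>\<real>\<^sup>m\<^sup>+\<^sup>1\<close> is modelled by \<open>(real^'m) \<times> real\<close>, with \<open>m = CARD('m)\<close>. The charts are the
  central projections of all open hemispheres onto affine hyperplanes, in all affine coordinates;
  the inverse of such a chart maps \<open>x\<close> to the normalization of \<open>inv g (x, 1)\<close>.
  They generate the standard smooth structure of the sphere.\<close>

definition sphere_atlas :: "((real^'m::finite) \<times> real, 'm) atlas" where
  "sphere_atlas =
     {({p \<in> sphere 0 1. snd (g p) > 0}, \<lambda>p. fst (g p) /\<^sub>R snd (g p)) | g. linear g \<and> bij g}"

definition homography ::
  "((real^'m::finite) \<times> real \<Rightarrow> (real^'m) \<times> real) \<Rightarrow> (real^'m) \<times> real \<Rightarrow> (real^'m) \<times> real" where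
  "homography g p = g p /\<^sub>R norm (g p)"

text \<open>Pull-back of sections along a diffeomorphism \<open>\<Phi>\<close>; the choice of the chart around the image
  point is irrelevant, by the transformation laws.\<close>

definition chart_at :: "('p, 'm::finite) atlas \<Rightarrow> 'p \<Rightarrow> ('p, 'm) chart" where
  "chart_at M p = (SOME \<kappa>. \<kappa> \<in> M \<and> p \<in> fst \<kappa>)"

definition pullback_density ::
  "('p, 'm::finite) atlas \<Rightarrow> real \<Rightarrow> ('p \<Rightarrow> 'p) \<Rightarrow> ('p, 'm) density \<Rightarrow> ('p, 'm) density" where
  "pullback_density M b \<Phi> \<psi> = (\<lambda>\<kappa> x.
     if \<kappa> \<in> M \<and> x \<in> image_of \<kappa>
     then let \<kappa>' = chart_at M (\<Phi> (point \<kappa> x)) in pull_density b (in_coords \<Phi> \<kappa> \<kappa>') (\<psi> \<kappa>') x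
     else 0)"

definition pullback_symbol ::
  "('p, 'm::finite) atlas \<Rightarrow> real \<Rightarrow> ('p \<Rightarrow> 'p) \<Rightarrow> ('p, 'm) symbol \<Rightarrow> ('p, 'm) symbol" where
  "pullback_symbol M c \<Phi> A = (\<lambda>\<kappa> x I.
     if \<kappa> \<in> M \<and> x \<in> image_of \<kappa>
     then let \<kappa>' = chart_at M (\<Phi> (point \<kappa> x)) in pull_symbol c (in_coords \<Phi> \<kappa> \<kappa>') (A \<kappa>') x I
     else 0)"

definition homography_equivariant ::
  "real \<Rightarrow> real \<Rightarrow>
   (((real^'m::finite) \<times> real, 'm) symbol \<Rightarrow> ((real^'m) \<times> real, 'm) operator) \<Rightarrow> bool"
where
  "homography_equivariant b c \<rho> \<longleftrightarrow>
     (\<forall>g. linear g \<and> bij g \<longrightarrow>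
       (\<forall>A\<in>symbols sphere_atlas c. \<forall>\<psi>\<in>densities sphere_atlas b.
          pullback_density sphere_atlas (b + c) (homography g) (\<rho> A \<psi>) =
          \<rho> (pullback_symbol sphere_atlas c (homography g) A)
            (pullback_density sphere_atlas b (homography g) \<psi>)))"


section \<open>Euclidean space and its infinitesimal homographies\<close>

definition euclidean_atlas :: "(real^'m::finite, 'm) atlas" where
  "euclidean_atlas = {(UNIV, id)}"

definition divergence :: "(real^'m::finite \<Rightarrow> real^'m) \<Rightarrow> real^'m \<Rightarrow> real" where
  "divergence X x = (\<Sum>i\<in>UNIV. partial i (\<lambda>y. X y $ i) x)"

text \<open>Lie derivatives along a vector field on \<open>\<real>\<^sup>m\<close>, where the only chart is the identity.\<close>

definition lie_density ::
  "real \<Rightarrow> (real^'m::finite \<Rightarrow> real^'m) \<Rightarrow> (real^'m, 'm) density \<Rightarrow> (real^'m, 'm) density" where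
  "lie_density b X \<psi> = (\<lambda>\<kappa> x.
     (\<Sum>i\<in>UNIV. X x $ i * partial i (\<psi> \<kappa>) x) + b * divergence X x * \<psi> \<kappa> x)"

definition lie_symbol ::
  "real \<Rightarrow> (real^'m::finite \<Rightarrow> real^'m) \<Rightarrow> (real^'m, 'm) symbol \<Rightarrow> (real^'m, 'm) symbol" where
  "lie_symbol c X A = (\<lambda>\<kappa> x I.
     (\<Sum>i\<in>UNIV. X x $ i * partial i (\<lambda>y. A \<kappa> y I) x)
     - (\<Sum>r<length I. \<Sum>l\<in>UNIV. partial l (\<lambda>y. X y $ (I ! r)) x * A \<kappa> x (I[r := l]))
     + c * divergence X x * A \<kappa> x I)"

text \<open>The span of \<open>\<partial>\<^sub>i\<close>, \<open>x\<^sup>i \<partial>\<^sub>j\<close> and \<open>x\<^sup>i \<Sum>\<^sub>j x\<^sup>j \<partial>\<^sub>j\<close>.\<close>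

definition infinitesimal_homographies :: "(real^'m::finite \<Rightarrow> real^'m) set" where
  "infinitesimal_homographies = {\<lambda>x. v + B *v x + (w \<bullet> x) *\<^sub>R x | v B w. True}"

definition infinitesimally_equivariant ::
  "real \<Rightarrow> real \<Rightarrow> ((real^'m::finite, 'm) symbol \<Rightarrow> (real^'m, 'm) operator) \<Rightarrow> bool"
where
  "infinitesimally_equivariant b c \<rho> \<longleftrightarrow>
     (\<forall>X\<in>infinitesimal_homographies.
      \<forall>A\<in>symbols euclidean_atlas c. \<forall>\<psi>\<in>densities euclidean_atlas b.
        lie_density (b + c) X (\<rho> A \<psi>) =
        (\<lambda>\<kappa> x. \<rho> (lie_symbol c X A) \<psi> \<kappa> x + \<rho> A (lie_density b X \<psi>) \<kappa> x))"

end

theory Submission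
  imports Defs
begin

text \<open>
  Let \<open>Q A f = \<Sum>\<^sub>l C\<^sub>l \<langle>div\<^sup>l A, \<partial>\<^sup>k\<^sup>-\<^sup>l f\<rangle>\<close> for a symbol \<open>A\<close> of degree \<open>k\<close>. All changes between central
  projection charts of the sphere are fractional linear; for such a change, with \<open>\<beta>\<close> the logarithmic
  differential of the denominator, transforming an iterated derivative of a density or an iterated
  divergence of a symbol produces correction terms which are powers of \<open>\<beta>\<close> with explicit coefficients. The
  corrections of the two factors cancel as soon as, for \<open>l < k\<close>,
  \<open>C\<^sub>l\<^sub>+\<^sub>1 (l + 1) (\<tau> - 1 - l) = C\<^sub>l (k - l) (\<nu> + k - 1 - l)\<close>, where \<open>\<nu> = b (m + 1)\<close> and
  \<open>\<tau> = 2 k + m - c (m + 1)\<close>, and the hypothesis on \<open>c\<close> makes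
  \<open>\<tau> - 1 - l\<close> nonzero. So the same formula in every chart defines a global operator; as homographies permute the charts, the resulting
  map is equivariant. It is bijective since it can be inverted degree by degree: the leading
  coefficients of an operator form a symbol. The infinitesimal statement follows from the same recursion, the
  first-order part of this calculation, in the single chart \<open>\<real>\<^sup>m\<close>.
\<close>

section \<open>Partial derivatives and contractions\<close>

abbreviation smooth :: "(real^'m::finite \<Rightarrow> real) \<Rightarrow> bool" where
  "smooth \<equiv> smooth_on UNIV"

lemma partial_eqI: "(f has_derivative f') (at x) \<Longrightarrow> partial j f x = f' (axis j 1)"
  unfolding partial_def by (metis frechet_derivative_at)

lemma frechet_works: "f differentiable (at x) \<Longrightarrow> (f has_derivative frechet_derivative f (at x)) (at x)"
  using frechet_derivative_works by blast

lemma partial_const [simp]: "partial j (\<lambda>y. k) = (\<lambda>x. 0)"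
  by (simp add: partial_def)

lemma partial_add:
  "f differentiable (at x) \<Longrightarrow> g differentiable (at x) \<Longrightarrow>
   partial j (\<lambda>y. f y + g y) x = partial j f x + partial j g x"
  by (subst partial_eqI[OF has_derivative_add[OF frechet_works frechet_works]]) (auto simp: partial_def)

lemma partial_diff:
  "f differentiable (at x) \<Longrightarrow> g differentiable (at x) \<Longrightarrow>
   partial j (\<lambda>y. f y - g y) x = partial j f x - partial j g x"
  by (subst partial_eqI[OF has_derivative_diff[OF frechet_works frechet_works]]) (auto simp: partial_def)

lemma partial_mult:
  "f differentiable (at x) \<Longrightarrow> g differentiable (at x) \<Longrightarrow>
   partial j (\<lambda>y. f y * g y) x = partial j f x * g x + f x * partial j g x"
  by (subst partial_eqI[OF has_derivative_mult[OF frechet_works frechet_works]]) (auto simp: partial_def)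

lemma partial_cmult:
  "f differentiable (at x) \<Longrightarrow> partial j (\<lambda>y. k * f y) x = k * partial j f x"
  by (simp add: partial_mult)

lemma partial_sum:
  "(\<And>i. i \<in> A \<Longrightarrow> f i differentiable (at x)) \<Longrightarrow>
   partial j (\<lambda>y. \<Sum>i\<in>A. f i y) x = (\<Sum>i\<in>A. partial j (f i) x)"
  by (subst partial_eqI[OF has_derivative_sum[OF frechet_works]]) (auto simp: partial_def)

lemma partial_coord: "partial j (\<lambda>y. y $ i) x = (if i = j then 1 else 0)"
  by (subst partial_eqI[OF bounded_linear.has_derivative[OF bounded_linear_vec_nth has_derivative_ident]])
    (auto simp: axis_def)

lemma differentiable_coord [simp]: "(\<lambda>y. y $ i) differentiable (at (x::real^'m::finite))"
  using bounded_linear.has_derivative[OF bounded_linear_vec_nth has_derivative_ident] differentiable_def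
  by blast

lemma partial_real_comp:
  assumes "(\<phi> has_real_derivative D) (at (f x))" "f differentiable (at x)"
  shows "partial j (\<lambda>y. \<phi> (f y)) x = D * partial j f x" "(\<lambda>y. \<phi> (f y)) differentiable (at x)"
proof -
  have "((\<lambda>y. \<phi> (f y)) has_derivative (\<lambda>v. D * frechet_derivative f (at x) v)) (at x)"
    using has_derivative_compose[OF frechet_works[OF assms(2)] assms(1)[unfolded has_field_derivative_def]]
    by simp
  then show "partial j (\<lambda>y. \<phi> (f y)) x = D * partial j f x" "(\<lambda>y. \<phi> (f y)) differentiable (at x)"
    by (auto dest: partial_eqI simp: differentiable_def partial_def[of j f])
qed

lemma sum_axis: "(v :: real^'m::finite) = (\<Sum>a\<in>UNIV. v $ a *\<^sub>R axis a 1)"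
  by (simp add: vec_eq_iff axis_def if_distrib sum.delta' cong: if_cong)

lemma frechet_eq_sum_partial:
  assumes "f differentiable (at x)"
  shows "frechet_derivative f (at x) v = (\<Sum>a\<in>UNIV. v $ a * partial a f x)"
proof -
  have lin: "linear (frechet_derivative f (at x))"
    using linear_frechet_derivative[OF assms] .
  have "frechet_derivative f (at x) v = frechet_derivative f (at x) (\<Sum>a\<in>UNIV. v $ a *\<^sub>R axis a 1)"
    using sum_axis[of v] by simp
  then show ?thesis
    by (simp only: linear_sum[OF lin] linear_scale[OF lin] partial_def real_scaleR_def)
qed

lemma partial_chain:
  fixes h :: "real^'m::finite \<Rightarrow> real^'m"
  assumes "(h has_derivative ((*v) H)) (at x)" "f differentiable (at (h x))"
  shows "partial j (\<lambda>y. f (h y)) x = (\<Sum>a\<in>UNIV. H $ a $ j * partial a f (h x))"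
    and "(\<lambda>y. f (h y)) differentiable (at x)"
proof -
  have d: "((\<lambda>y. f (h y)) has_derivative (\<lambda>v. frechet_derivative f (at (h x)) (H *v v))) (at x)"
    using has_derivative_compose[OF assms(1) frechet_works[OF assms(2)]] .
  have "H *v axis j 1 = column j H" by (simp add: matrix_vector_mul_component column_def vec_eq_iff
        matrix_vector_mult_def axis_def if_distrib sum.delta' cong: if_cong)
  then show "partial j (\<lambda>y. f (h y)) x = (\<Sum>a\<in>UNIV. H $ a $ j * partial a f (h x))"
    using d frechet_eq_sum_partial[OF assms(2)] by (simp add: partial_eqI[OF d] column_def)
  show "(\<lambda>y. f (h y)) differentiable (at x)" using d differentiable_def by blast
qed

lemma partial_cong_open:
  assumes "open S" "x \<in> S" "\<And>y. y \<in> S \<Longrightarrow> f y = g y" "f differentiable (at x)"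
  shows "partial j f x = partial j g x" "g differentiable (at x)"
proof -
  show "g differentiable (at x)"
    using has_derivative_transform_within_open[OF frechet_works[OF assms(4)] assms(1,2)] assms(3)
      differentiable_def by blast
  show "partial j f x = partial j g x"
    unfolding partial_def using frechet_derivative_transform_within_open[OF assms(4,1,2)] assms(3) by metis
qed

lemma differentiable_mult_real:
  "f differentiable (at x) \<Longrightarrow> g differentiable (at x) \<Longrightarrow> (\<lambda>y. f y * g y :: real) differentiable (at x)"
  by (rule differentiable_mult)

lemma partials_Nil [simp]: "partials [] f = f" and
  partials_Cons: "partials (i # I) f = partial i (partials I f)" and
  partials_append: "partials (I @ J) f = partials I (partials J f)"
  by (auto simp: partials_def)

lemma smooth_differentiable [intro]: "smooth f \<Longrightarrow> f differentiable (at x)"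
  unfolding smooth_on_def by (metis UNIV_I partials_Nil)

lemma smooth_partials: "smooth f \<Longrightarrow> smooth (partials J f)"
  unfolding smooth_on_def by (metis partials_append)

lemma smooth_partial: "smooth f \<Longrightarrow> smooth (partial j f)"
  using smooth_partials[of f "[j]"] by (simp add: partials_Cons)

lemma smooth_coinduct:
  assumes "P f" and "\<And>f x. P f \<Longrightarrow> f differentiable (at x)" and "\<And>f j. P f \<Longrightarrow> P (partial j f)"
  shows "smooth f"
proof -
  have "P (partials I f)" for I
    by (induction I) (auto simp: assms partials_Cons)
  then show ?thesis using assms(2) by (auto simp: smooth_on_def)
qed

lemma smooth_const [simp, intro]: "smooth (\<lambda>x. k)"
  by (rule smooth_coinduct[where P = "\<lambda>f. \<exists>k. f = (\<lambda>x. k)"]) auto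

lemma smooth_coord [simp, intro]: "smooth (\<lambda>x. x $ i)"
  by (rule smooth_coinduct[where P = "\<lambda>f. (\<exists>k. f = (\<lambda>x. k)) \<or> f = (\<lambda>x. x $ i)"])
    (auto simp: partial_coord[abs_def])

lemma smooth_add [intro]: assumes "smooth f" "smooth g" shows "smooth (\<lambda>x. f x + g x)"
proof (rule smooth_coinduct[where P = "\<lambda>F. \<exists>f g. smooth f \<and> smooth g \<and> F = (\<lambda>x. f x + g x)"])
  show "\<exists>f' g'. smooth f' \<and> smooth g' \<and> (\<lambda>x. f x + g x) = (\<lambda>x. f' x + g' x)" using assms by blast
next
  fix F j assume "\<exists>f g. smooth f \<and> smooth g \<and> F = (\<lambda>x. f x + g x)"
  then obtain f g where *: "smooth f" "smooth g" "F = (\<lambda>x. f x + g x)" by blast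
  then have "partial j F = (\<lambda>x. partial j f x + partial j g x)"
    by (auto simp: partial_add smooth_differentiable)
  then show "\<exists>f g. smooth f \<and> smooth g \<and> partial j F = (\<lambda>x. f x + g x)"
    using * smooth_partial by blast
qed (auto intro: differentiable_add)

lemma smooth_sum [intro]: "(\<And>i. i \<in> A \<Longrightarrow> smooth (f i)) \<Longrightarrow> smooth (\<lambda>x. \<Sum>i\<in>A. f i x)"
  by (induction A rule: infinite_finite_induct) auto

inductive product_sum :: "(real^'m::finite \<Rightarrow> real) \<Rightarrow> bool" where
  product: "smooth f \<Longrightarrow> smooth g \<Longrightarrow> product_sum (\<lambda>x. f x * g x)"
| add: "product_sum f \<Longrightarrow> product_sum g \<Longrightarrow> product_sum (\<lambda>x. f x + g x)"

lemma product_sum_differentiable: "product_sum f \<Longrightarrow> f differentiable (at x)"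
  by (induction rule: product_sum.induct) (auto intro: differentiable_mult_real)

lemma product_sum_partial: "product_sum f \<Longrightarrow> product_sum (partial j f)"
proof (induction rule: product_sum.induct)
  case (product f g)
  have "partial j (\<lambda>x. f x * g x) = (\<lambda>x. partial j f x * g x + f x * partial j g x)"
    using product by (auto simp: partial_mult smooth_differentiable)
  then show ?case
    using product_sum.add[OF product_sum.product product_sum.product,
        OF smooth_partial[OF product(1)] product(2) product(1) smooth_partial[OF product(2)]] by simp
next
  case (add f g)
  then have "partial j (\<lambda>x. f x + g x) = (\<lambda>x. partial j f x + partial j g x)"
    by (auto simp: partial_add product_sum_differentiable)
  then show ?case using add product_sum.add by simp
qed

lemma smooth_mult [intro]: "smooth f \<Longrightarrow> smooth g \<Longrightarrow> smooth (\<lambda>x. f x * g x)"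
  by (rule smooth_coinduct[where P = product_sum])
    (auto intro: product_sum.product product_sum_differentiable product_sum_partial)

lemma smooth_diff [intro]: "smooth f \<Longrightarrow> smooth g \<Longrightarrow> smooth (\<lambda>x. f x - g x)"
  using smooth_add[of f "\<lambda>x. (-1) * g x"] smooth_mult[of "\<lambda>x. -1" g] by simp

lemma smooth_prod [intro]: "(\<And>i. i \<in> A \<Longrightarrow> smooth (f i)) \<Longrightarrow> smooth (\<lambda>x. \<Prod>i\<in>A. f i x)"
  by (induction A rule: infinite_finite_induct) auto

lemma smooth_powr:
  assumes "smooth q" and pos: "\<And>x. q x > 0"
  shows "smooth (\<lambda>x. q x powr r)"
proof (rule smooth_coinduct[where P = "\<lambda>F. \<exists>u r. smooth u \<and> F = (\<lambda>x. u x * q x powr r)"])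
  show "\<exists>u r'. smooth u \<and> (\<lambda>x. q x powr r) = (\<lambda>x. u x * q x powr r')"
    by (rule exI[of _ "\<lambda>x. 1"]) auto
next
  have d: "(\<lambda>x. q x powr r) differentiable (at x)"
    "partial j (\<lambda>x. q x powr r) x = r * q x powr (r - 1) * partial j q x" for r x j
    using partial_real_comp[OF has_real_derivative_powr[OF pos[of x]] smooth_differentiable[OF assms(1)]]
    by auto
  fix F assume "\<exists>u r. smooth u \<and> F = (\<lambda>x. u x * q x powr r)"
  then obtain u r where F: "smooth u" "F = (\<lambda>x. u x * q x powr r)" by blast
  show "F differentiable (at x)" for x
    using F d by (auto intro: differentiable_mult_real)
  fix j
  have "partial j F x = (partial j u x * q x + r * u x * partial j q x) * q x powr (r - 1)" for x
  proof -
    have "q x powr r = q x * q x powr (r - 1)"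
      using pos[of x] powr_mult_base[of "q x" "r - 1"] by simp
    then show ?thesis
      using F d by (simp add: partial_mult smooth_differentiable algebra_simps)
  qed
  moreover have "smooth (\<lambda>x. partial j u x * q x + r * u x * partial j q x)"
    using F assms smooth_partial by (intro smooth_add smooth_mult) auto
  ultimately show "\<exists>u r. smooth u \<and> partial j F = (\<lambda>x. u x * q x powr r)" by blast
qed

lemma has_real_derivative_line:
  assumes "f differentiable (at (p + s *\<^sub>R axis i 1))"
  shows "((\<lambda>s. f (p + s *\<^sub>R axis i 1)) has_real_derivative partial i f (p + s *\<^sub>R axis i 1)) (at s)"
proof -
  have "((\<lambda>s. p + s *\<^sub>R axis i 1) has_derivative (\<lambda>t. t *\<^sub>R axis i (1::real))) (at s)"
    by (auto intro!: derivative_eq_intros)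
  from has_derivative_compose[OF this frechet_works[OF assms]]
  show ?thesis
    unfolding has_field_derivative_def
    by (rule has_derivative_eq_rhs)
      (simp add: linear_scale[OF linear_frechet_derivative[OF assms]] partial_def mult.commute fun_eq_iff)
qed

lemma double_difference:
  assumes f: "smooth f" and t: "t > 0"
  obtains \<xi> \<eta> where "0 < \<xi>" "\<xi> < t" "0 < \<eta>" "\<eta> < t"
    "f (x + t *\<^sub>R axis i 1 + t *\<^sub>R axis j 1) - f (x + t *\<^sub>R axis i 1) - f (x + t *\<^sub>R axis j 1) + f x
      = t\<^sup>2 * partial j (partial i f) (x + \<xi> *\<^sub>R axis i 1 + \<eta> *\<^sub>R axis j 1)"
proof -
  define g where "g s = f (x + t *\<^sub>R axis j 1 + s *\<^sub>R axis i 1) - f (x + s *\<^sub>R axis i 1)" for s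
  have g': "(g has_real_derivative
      (partial i f (x + t *\<^sub>R axis j 1 + s *\<^sub>R axis i 1) - partial i f (x + s *\<^sub>R axis i 1))) (at s)" for s
    unfolding g_def using f by (intro DERIV_diff has_real_derivative_line smooth_differentiable)
  obtain \<xi> where \<xi>: "0 < \<xi>" "\<xi> < t" "g t - g 0 = (t - 0) *
      (partial i f (x + t *\<^sub>R axis j 1 + \<xi> *\<^sub>R axis i 1) - partial i f (x + \<xi> *\<^sub>R axis i 1))"
    using MVT2[OF t g'] by blast
  define k where "k s = partial i f (x + \<xi> *\<^sub>R axis i 1 + s *\<^sub>R axis j 1)" for s
  have k': "(k has_real_derivative partial j (partial i f) (x + \<xi> *\<^sub>R axis i 1 + s *\<^sub>R axis j 1)) (at s)" for s
    unfolding k_def using f by (intro has_real_derivative_line smooth_differentiable smooth_partial)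
  obtain \<eta> where \<eta>: "0 < \<eta>" "\<eta> < t"
     "k t - k 0 = (t - 0) * partial j (partial i f) (x + \<xi> *\<^sub>R axis i 1 + \<eta> *\<^sub>R axis j 1)"
    using MVT2[OF t k'] by blast
  have "g t - g 0 = t * (k t - k 0)" using \<xi>(3) by (simp add: k_def algebra_simps)
  with \<eta>(3) have "g t - g 0 = t\<^sup>2 * partial j (partial i f) (x + \<xi> *\<^sub>R axis i 1 + \<eta> *\<^sub>R axis j 1)"
    by (simp add: power2_eq_square)
  then show ?thesis using that[OF \<xi>(1,2) \<eta>(1,2)] by (simp add: g_def algebra_simps)
qed

lemma partial_commute:
  assumes f: "smooth f"
  shows "partial i (partial j f) x = partial j (partial i f) x"
proof -
  define \<Delta> where "\<Delta> t = f (x + t *\<^sub>R axis i 1 + t *\<^sub>R axis j 1) - f (x + t *\<^sub>R axis i 1)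
    - f (x + t *\<^sub>R axis j 1) + f x" for t :: real
  have lim: "(\<lambda>n. \<Delta> (1 / real (Suc n)) / (1 / real (Suc n))\<^sup>2) \<longlonglongrightarrow> partial j (partial i f) x"
    if \<Delta>: "\<And>t. \<Delta> t = f (x + t *\<^sub>R axis i 1 + t *\<^sub>R axis j 1) - f (x + t *\<^sub>R axis i 1)
    - f (x + t *\<^sub>R axis j 1) + f x" for i j
  proof -
    have "\<exists>\<xi> \<eta>. 0 < \<xi> \<and> \<xi> < 1 / real (Suc n) \<and> 0 < \<eta> \<and> \<eta> < 1 / real (Suc n) \<and>
      \<Delta> (1 / real (Suc n)) = (1 / real (Suc n))\<^sup>2 *
        partial j (partial i f) (x + \<xi> *\<^sub>R axis i 1 + \<eta> *\<^sub>R axis j 1)" for n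
      by (rule double_difference[OF f, of "1 / real (Suc n)" x i j]) (auto simp: \<Delta>)
    then obtain \<xi> \<eta> where *: "\<And>n. 0 < \<xi> n" "\<And>n. \<xi> n < 1 / real (Suc n)" "\<And>n. 0 < \<eta> n"
      "\<And>n. \<eta> n < 1 / real (Suc n)"
      "\<And>n. \<Delta> (1 / real (Suc n)) = (1 / real (Suc n))\<^sup>2 *
        partial j (partial i f) (x + \<xi> n *\<^sub>R axis i 1 + \<eta> n *\<^sub>R axis j 1)" by metis
    have z: "(\<lambda>n. 1 / real (Suc n)) \<longlonglongrightarrow> 0" using lim_1_over_n LIMSEQ_Suc by fastforce
    have "\<xi> \<longlonglongrightarrow> 0" "\<eta> \<longlonglongrightarrow> 0"
      using less_imp_le[OF *(1)] less_imp_le[OF *(2)] less_imp_le[OF *(3)] less_imp_le[OF *(4)]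
      by (auto intro!: tendsto_sandwich[OF _ _ tendsto_const z] always_eventually)
    then have "(\<lambda>n. x + \<xi> n *\<^sub>R axis i 1 + \<eta> n *\<^sub>R axis j 1) \<longlonglongrightarrow> x + 0 *\<^sub>R axis i 1 + 0 *\<^sub>R axis j 1"
      by (intro tendsto_intros)
    moreover have "isCont (partial j (partial i f)) (x + 0 *\<^sub>R axis i 1 + 0 *\<^sub>R axis j 1)"
      by (rule differentiable_imp_continuous_within[OF smooth_differentiable[OF
            smooth_partial[OF smooth_partial[OF f]]]])
    ultimately have "(\<lambda>n. partial j (partial i f) (x + \<xi> n *\<^sub>R axis i 1 + \<eta> n *\<^sub>R axis j 1))
        \<longlonglongrightarrow> partial j (partial i f) (x + 0 *\<^sub>R axis i 1 + 0 *\<^sub>R axis j 1)"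
      by (rule isCont_tendsto_compose[rotated])
    moreover have "\<Delta> (1 / real (Suc n)) / (1 / real (Suc n))\<^sup>2 =
        partial j (partial i f) (x + \<xi> n *\<^sub>R axis i 1 + \<eta> n *\<^sub>R axis j 1)" for n
      unfolding *(5) by (subst nonzero_mult_div_cancel_left) auto
    ultimately show ?thesis by simp
  qed
  show ?thesis
    by (rule LIMSEQ_unique[OF lim[of j i] lim[of i j]]) (simp_all add: \<Delta>_def algebra_simps)
qed

lemma partials_perm:
  assumes f: "smooth f" and "mset I = mset J"
  shows "partials I f = partials J f"
  using assms(2)
proof (induction I arbitrary: J)
  case Nil then show ?case by simp
next
  case (Cons i I)
  then have "i \<in> set J" by (metis list.set_intros(1) mset_eq_setD)
  then obtain J1 J2 where J: "J = J1 @ i # J2" by (meson split_list)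
  have "partials (J1 @ i # J2) f = partials (i # J1 @ J2) f" for J1 J2
  proof (induction J1)
    case (Cons a J1)
    have "partial i (partial a g) = partial a (partial i g)" if "smooth g" for g
      using partial_commute[OF that] by blast
    from this[OF smooth_partials[OF f]] Cons show ?case by (simp add: partials_Cons)
  qed simp
  moreover have "mset I = mset (J1 @ J2)" using Cons.prems J by simp
  ultimately show ?case using Cons.IH[of "J1 @ J2"] J by (metis partials_Cons)
qed

lemma finite_length [simp]: "finite {I :: 'm::finite list. length I = n}"
  using finite_lists_length_eq[of "UNIV :: 'm set" n] by simp

lemma sum_length_Suc:
  "(\<Sum>I :: 'm::finite list | length I = Suc n. g I) = (\<Sum>i\<in>UNIV. \<Sum>I | length I = n. g (i # I))"
proof -
  have "(\<Sum>I :: 'm list | length I = Suc n. g I) =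
      (\<Sum>(i, I)\<in>UNIV \<times> {I. length I = n}. g (i # I))"
    by (rule sum.reindex_bij_witness[of _ "\<lambda>(i, I). i # I" "\<lambda>I. (hd I, tl I)"])
      (auto simp: length_Suc_conv)
  then show ?thesis by (simp add: sum.cartesian_product)
qed

lemma sum_swap_slot:
  assumes "r < n"
  shows "(\<Sum>j\<in>UNIV. \<Sum>I :: 'm::finite list | length I = n. \<phi> j I) =
    (\<Sum>j\<in>UNIV. \<Sum>I | length I = n. \<phi> (I ! r) (I[r := j]))"
  unfolding sum.cartesian_product
  by (rule sum.reindex_bij_witness[of _ "\<lambda>p. (snd p ! r, (snd p)[r := fst p])"
        "\<lambda>p. (snd p ! r, (snd p)[r := fst p])"])
    (use assms in \<open>simp_all add: case_prod_beta mem_Times_iff\<close>)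

definition symmetric_array :: "('m list \<Rightarrow> real) \<Rightarrow> bool" where
  "symmetric_array a \<longleftrightarrow> (\<forall>I J. mset I = mset J \<longrightarrow> a I = a J)"

lemma symmetric_arrayD: "symmetric_array a \<Longrightarrow> mset I = mset J \<Longrightarrow> a I = a J"
  unfolding symmetric_array_def by blast

lemma symmetric_array_slot: "symmetric_array a \<Longrightarrow> symmetric_array (\<lambda>I. a (j # I))"
  unfolding symmetric_array_def[of "\<lambda>I. a (j # I)"]
  by (intro allI impI, erule symmetric_arrayD) simp

definition ctr :: "('m::finite \<Rightarrow> real) \<Rightarrow> ('m list \<Rightarrow> real) \<Rightarrow> 'm list \<Rightarrow> real" where
  "ctr \<beta> a I = (\<Sum>i\<in>UNIV. \<beta> i * a (i # I))"

lemma symmetric_array_ctr: "symmetric_array a \<Longrightarrow> symmetric_array (ctr \<beta> a)"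
  unfolding symmetric_array_def[of "ctr \<beta> a"] ctr_def
  by (intro allI impI sum.cong refl arg_cong[where f = "(*) _"], erule symmetric_arrayD) simp

lemma symmetric_array_ctr_pow: "symmetric_array a \<Longrightarrow> symmetric_array ((ctr \<beta> ^^ l) a)"
  by (induction l) (auto intro: symmetric_array_ctr)

lemma ctr_slot: "symmetric_array a \<Longrightarrow> ctr \<beta> (\<lambda>I. a (j # I)) = (\<lambda>I. ctr \<beta> a (j # I))"
  unfolding ctr_def
  by (intro ext sum.cong refl arg_cong[where f = "(*) _"], erule symmetric_arrayD) simp

lemma ctr_pow_slot:
  "symmetric_array a \<Longrightarrow> (ctr \<beta> ^^ l) (\<lambda>I. a (j # I)) = (\<lambda>I. (ctr \<beta> ^^ l) a (j # I))"
  by (induction l) (auto simp: ctr_slot symmetric_array_ctr_pow)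

lemma ctr_sum: "ctr \<beta> (\<lambda>I. \<Sum>s\<in>A. a s I) = (\<lambda>I. \<Sum>s\<in>A. ctr \<beta> (a s) I)"
  unfolding ctr_def sum_distrib_left by (rule ext) (rule sum.swap)

lemma ctr_scale: "ctr \<beta> (\<lambda>I. k * a I) = (\<lambda>I. k * ctr \<beta> a I)"
  by (auto simp: ctr_def sum_distrib_left mult_ac)

lemma ctr_pow_sum: "(ctr \<beta> ^^ l) (\<lambda>I. \<Sum>s\<in>A. a s I) = (\<lambda>I. \<Sum>s\<in>A. (ctr \<beta> ^^ l) (a s) I)"
  by (induction l) (auto simp: ctr_sum)

lemma ctr_pow_scale: "(ctr \<beta> ^^ l) (\<lambda>I. k * a I) = (\<lambda>I. k * (ctr \<beta> ^^ l) a I)"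
  by (induction l) (auto simp: ctr_scale)

lemma mset_slot_swap:
  assumes "r < length I" shows "mset (I ! r # I[r := j]) = mset (j # I)"
proof -
  have "add_mset (I ! r) (mset I - {#I ! r#}) = mset I" using assms by simp
  then show ?thesis using assms by (metis add_mset_commute mset.simps(2) mset_update)
qed

lemma symmetric_contract_swap:
  fixes a :: "'m::finite list \<Rightarrow> real"
  assumes "symmetric_array a" "r < n"
  shows "(\<Sum>j\<in>UNIV. \<Sum>I | length I = n. a (j # I) * (\<beta> (I ! r) * T (I[r := j]))) =
    (\<Sum>j\<in>UNIV. \<Sum>I | length I = n. a (j # I) * (\<beta> j * T I))"
proof -
  have "a (I ! r # I[r := j]) = a (j # I)" if "length I = n" for I j
    using symmetric_arrayD[OF assms(1) mset_slot_swap] assms(2) that by blast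
  then have "a (I ! r # I[r := j]) * (\<beta> (I[r := j] ! r) * T (I[r := j, r := I ! r])) =
      a (j # I) * (\<beta> j * T I)" if "length I = n" for I j
    using assms(2) that by (metis list_update_id list_update_overwrite nth_list_update_eq)
  then show ?thesis
    by (intro trans[OF sum_swap_slot[OF assms(2), of "\<lambda>j I. a (j # I) * (\<beta> (I ! r) * T (I[r := j]))"]]
        sum.cong refl) auto
qed

definition contract :: "nat \<Rightarrow> ('m::finite list \<Rightarrow> real) \<Rightarrow> (real^'m \<Rightarrow> real) \<Rightarrow> real^'m \<Rightarrow> real" where
  "contract n a f x = (\<Sum>I | length I = n. a I * partials I f x)"

lemma contract_0 [simp]: "contract 0 a f x = a [] * f x"
  by (simp add: contract_def)

lemma contract_Suc:
  "contract (Suc n) a f x = (\<Sum>j\<in>UNIV. \<Sum>I | length I = n. a (j # I) * partial j (partials I f) x)"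
  unfolding contract_def sum_length_Suc by (simp add: partials_Cons)

lemma contract_add: "contract n (\<lambda>I. a I + a' I) f x = contract n a f x + contract n a' f x"
  by (simp add: contract_def sum.distrib algebra_simps)

lemma contract_scale: "contract n (\<lambda>I. k * a I) f x = k * contract n a f x"
  by (simp add: contract_def sum_distrib_left mult_ac)

lemma contract_sum: "contract n (\<lambda>I. \<Sum>s\<in>A. a s I) f x = (\<Sum>s\<in>A. contract n (a s) f x)"
  unfolding contract_def sum_distrib_right by (rule sum.swap)

lemma contract_cong: "(\<And>I. length I = n \<Longrightarrow> a I = a' I) \<Longrightarrow> contract n a f x = contract n a' f x"
  by (auto simp: contract_def intro: sum.cong)

lemma smooth_contract:
  "smooth f \<Longrightarrow> (\<And>I. smooth (\<lambda>x. a x I)) \<Longrightarrow> smooth (\<lambda>x. contract n (a x) f x)"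
  unfolding contract_def by (intro smooth_sum smooth_mult smooth_partials)

lemma partial_contract:
  assumes "smooth f" "\<And>I. length I = n \<Longrightarrow> (\<lambda>x. a x I) differentiable (at x)"
  shows "partial j (\<lambda>x. contract n (a x) f x) x =
    contract n (\<lambda>I. partial j (\<lambda>x. a x I) x) f x + (\<Sum>I | length I = n. a x I * partial j (partials I f) x)"
    and "(\<lambda>x. contract n (a x) f x) differentiable (at x)"
proof -
  have d: "(\<lambda>x. a x I * partials I f x) differentiable (at x)" if "length I = n" for I
    using assms that by (auto intro!: differentiable_mult_real smooth_partials)
  show "(\<lambda>x. contract n (a x) f x) differentiable (at x)"
    unfolding contract_def using d by (auto intro: differentiable_sum)
  show "partial j (\<lambda>x. contract n (a x) f x) x =
    contract n (\<lambda>I. partial j (\<lambda>x. a x I) x) f x + (\<Sum>I | length I = n. a x I * partial j (partials I f) x)"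
    unfolding contract_def
    by (subst partial_sum) (use d assms in \<open>auto simp: partial_mult smooth_partials smooth_differentiable sum.distrib\<close>)
qed

lemma partial_contract_const:
  assumes "smooth f"
  shows "partial j (contract n a f) x = (\<Sum>I | length I = n. a I * partial j (partials I f) x)"
  using partial_contract(1)[OF assms, of n "\<lambda>x. a" x j] by (simp add: contract_def[of n "\<lambda>I. 0"])

lemma sum_partial_contract:
  assumes "smooth f"
  shows "(\<Sum>j\<in>UNIV. partial j (contract n (\<lambda>I. a (j # I)) f) x) = contract (Suc n) a f x"
  by (simp add: partial_contract_const[OF assms] contract_Suc)

subsection \<open>Coefficients\<close>

definition coef :: "real \<Rightarrow> real \<Rightarrow> nat \<Rightarrow> real" where
  "coef \<nu> k l = (\<Prod>r<l. (k - real r) * (\<nu> + k - 1 - real r) / (real r + 1))"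

lemma coef_0 [simp]: "coef \<nu> k 0 = 1"
  by (simp add: coef_def)

lemma coef_Suc: "coef \<nu> k (Suc l) = coef \<nu> k l * ((k - l) * (\<nu> + k - 1 - l) / (real l + 1))"
  by (simp add: coef_def)

lemma coef_Suc_left: "coef \<nu> (k + 1) (Suc l) = (k + 1) * (\<nu> + k) / (real l + 1) * coef \<nu> k l"
proof (induction l)
  case 0 then show ?case by (simp add: coef_def)
next
  case (Suc l)
  have "k + 1 - real (Suc l) = k - l" "\<nu> + (k + 1) - 1 - real (Suc l) = \<nu> + k - 1 - l" by simp_all
  then show ?case unfolding coef_Suc[of \<nu> "k + 1" "Suc l"] Suc coef_Suc[of \<nu> k l]
    by (simp only: times_divide_eq_left times_divide_eq_right divide_divide_eq_left) (simp only: mult_ac)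
qed

lemma coef_pascal:
  "coef \<nu> (k + 1) (Suc l) = coef \<nu> k (Suc l) + (2 * k + \<nu> - l) * coef \<nu> k l"
proof -
  have "(k + 1) * (\<nu> + k) = (k - l) * (\<nu> + k - 1 - l) + (2 * k + \<nu> - l) * (real l + 1)"
    by (simp add: algebra_simps)
  then have "(k + 1) * (\<nu> + k) / (real l + 1) =
      (k - l) * (\<nu> + k - 1 - l) / (real l + 1) + (2 * k + \<nu> - l)"
    by (simp add: add_divide_distrib)
  then show ?thesis unfolding coef_Suc_left coef_Suc[of \<nu> k l] by (simp only: distrib_left mult.commute[of _ "coef \<nu> k l"])
qed

lemma coef_eq_0: "k < l \<Longrightarrow> coef \<nu> (real k) l = 0"
  unfolding coef_def by (rule prod_zero) (auto intro!: bexI[of _ k])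

lemma coef_pascal_sum:
  fixes V :: "nat \<Rightarrow> real"
  shows "(\<Sum>l\<le>Suc k. coef \<nu> (real (Suc k)) l * V l) =
    (\<Sum>l\<le>k. coef \<nu> k l * V l) + (\<Sum>l\<le>k. (2 * real k + \<nu> - l) * coef \<nu> k l * V (Suc l))"
proof -
  have "(\<Sum>l\<le>Suc k. coef \<nu> (real (Suc k)) l * V l) =
      V 0 + (\<Sum>l\<le>k. coef \<nu> (real k + 1) (Suc l) * V (Suc l))"
    by (subst sum.atMost_Suc_shift) (simp add: add.commute)
  also have "\<dots> = V 0 + (\<Sum>l\<le>k. coef \<nu> k (Suc l) * V (Suc l)) +
      (\<Sum>l\<le>k. (2 * real k + \<nu> - l) * coef \<nu> k l * V (Suc l))"
    by (simp only: coef_pascal distrib_right sum.distrib add.assoc)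
  also have "V 0 + (\<Sum>l\<le>k. coef \<nu> k (Suc l) * V (Suc l)) = (\<Sum>l\<le>Suc k. coef \<nu> k l * V l)"
    by (subst sum.atMost_Suc_shift) simp
  also have "\<dots> = (\<Sum>l\<le>k. coef \<nu> k l * V l)"
    by (simp add: coef_eq_0)
  finally show ?thesis .
qed

subsection \<open>Tensor powers\<close>

fun tpow :: "real^'m^'n \<Rightarrow> 'n list \<Rightarrow> 'm list \<Rightarrow> real" where
  "tpow M [] [] = 1"
| "tpow M (i # I) (j # J) = M $ i $ j * tpow M I J"
| "tpow M _ _ = 0"

lemma prod_eq_tpow: "length I = length J \<Longrightarrow> (\<Prod>r<length I. M $ (I ! r) $ (J ! r)) = tpow M I J"
  by (induction I J rule: list_induct2) (simp_all add: prod.lessThan_Suc_shift del: prod.lessThan_Suc)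

lemma tpow_mult:
  fixes M :: "real^'m::finite^'n::finite" and N :: "real^'p::finite^'m"
  shows "length I = n \<Longrightarrow> length L = n \<Longrightarrow>
   (\<Sum>J | length J = n. tpow M I J * tpow N J L) = tpow (M ** N) I L"
proof (induction I arbitrary: n L)
  case Nil then show ?case by simp
next
  case (Cons i I)
  then obtain n' l L' where *: "n = Suc n'" "L = l # L'" "length I = n'" "length L' = n'"
    by (cases L) auto
  have "(\<Sum>J | length J = n. tpow M (i # I) J * tpow N J L) =
      (\<Sum>j\<in>UNIV. M $ i $ j * N $ j $ l * (\<Sum>J | length J = n'. tpow M I J * tpow N J L'))"
    unfolding *(1,2) sum_length_Suc sum_distrib_left by (intro sum.cong refl) simp
  also have "\<dots> = tpow (M ** N) (i # I) L"
    unfolding Cons.IH[OF *(3,4)] *(2) by (simp add: matrix_matrix_mult_def sum_distrib_right)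
  finally show ?case .
qed

lemma tpow_one: "length I = length L \<Longrightarrow> tpow (mat 1) I L = (if I = L then 1 else 0)"
  by (induction I L rule: list_induct2) (auto simp: mat_def)

lemma tpow_inverse:
  fixes M :: "real^'m::finite^'m"
  assumes "M ** N = mat 1" "length I = n"
  shows "(\<Sum>J | length J = n. tpow M I J * (\<Sum>L | length L = n. tpow N J L * a L)) = a I"
proof -
  have "(\<Sum>J | length J = n. tpow M I J * (\<Sum>L | length L = n. tpow N J L * a L)) =
      (\<Sum>L | length L = n. (\<Sum>J | length J = n. tpow M I J * tpow N J L) * a L)"
    unfolding sum_distrib_left sum_distrib_right mult.assoc by (rule sum.swap)
  also have "\<dots> = (\<Sum>L | length L = n. if L = I then a L else 0)"
    by (intro sum.cong refl) (use assms in \<open>auto simp: tpow_mult[OF assms(2)] tpow_one\<close>)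
  also have "\<dots> = a I" by (subst sum.delta) (use assms(2) in auto)
  finally show ?thesis .
qed

section \<open>Projective changes of coordinates\<close>

lemma partial_prod:
  assumes "finite A" "\<And>i. i \<in> A \<Longrightarrow> f i differentiable (at x)"
  shows "(\<lambda>y. \<Prod>i\<in>A. f i y) differentiable (at x) \<and>
    partial j (\<lambda>y. \<Prod>i\<in>A. f i y) x = (\<Sum>k\<in>A. partial j (f k) x * (\<Prod>i\<in>A - {k}. f i x))"
  using assms
proof (induction A rule: finite_induct)
  case empty then show ?case by simp
next
  case (insert a A)
  then have IH: "(\<lambda>y. \<Prod>i\<in>A. f i y) differentiable (at x)"
    "partial j (\<lambda>y. \<Prod>i\<in>A. f i y) x = (\<Sum>k\<in>A. partial j (f k) x * (\<Prod>i\<in>A - {k}. f i x))" by auto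
  have "(\<Prod>i\<in>insert a A - {k}. f i x) = f a x * (\<Prod>i\<in>A - {k}. f i x)" if "k \<in> A" for k
  proof -
    have "insert a A - {k} = insert a (A - {k})" using insert.hyps that by auto
    then show ?thesis using insert.hyps by simp
  qed
  then have "(\<Sum>k\<in>A. partial j (f k) x * (\<Prod>i\<in>insert a A - {k}. f i x)) =
      f a x * (\<Sum>k\<in>A. partial j (f k) x * (\<Prod>i\<in>A - {k}. f i x))"
    unfolding sum_distrib_left by (intro sum.cong refl) simp
  moreover have "insert a A - {a} = A" using insert.hyps by auto
  ultimately show ?case
    using IH insert by (auto simp: partial_mult intro!: differentiable_mult_real)
qed

lemma sum_kronecker:
  "(\<Sum>i\<in>UNIV. (if i = (j::'m::finite) then 1 else 0) * (X i :: real)) = X j"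
  by (subst sum.remove[of _ j]) auto

lemma differentiable_matrix_mult_entry:
  fixes H :: "real^'m::finite \<Rightarrow> real^'m^'m"
  assumes "\<And>a i. (\<lambda>y. H y $ a $ i) differentiable (at x)"
  shows "(\<lambda>y. (K ** H y) $ a $ i) differentiable (at x)"
    and "partial j (\<lambda>y. (K ** H y) $ a $ i) x = (\<Sum>p\<in>UNIV. K $ a $ p * partial j (\<lambda>y. H y $ p $ i) x)"
  unfolding matrix_matrix_mult_def
  using assms by (auto simp: partial_sum partial_cmult differentiable_mult_real
      intro!: differentiable_sum differentiable_mult_real)

lemma partial_det_identity:
  fixes N :: "real^'m::finite \<Rightarrow> real^'m^'m"
  assumes d: "\<And>a i. (\<lambda>y. N y $ a $ i) differentiable (at x)" and one: "N x = mat 1"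
  shows "(\<lambda>y. det (N y)) differentiable (at x)"
    "partial j (\<lambda>y. det (N y)) x = (\<Sum>a\<in>UNIV. partial j (\<lambda>y. N y $ a $ a) x)"
proof -
  let ?T = "\<lambda>p k. partial j (\<lambda>y. N y $ k $ p k) x * (\<Prod>i\<in>UNIV - {k}. N x $ i $ p i)"
  have P: "(\<lambda>y. \<Prod>i\<in>UNIV. N y $ i $ p i) differentiable (at x)"
     "partial j (\<lambda>y. \<Prod>i\<in>UNIV. N y $ i $ p i) x = (\<Sum>k\<in>UNIV. ?T p k)" for p
    using partial_prod[of UNIV "\<lambda>i y. N y $ i $ p i" x j] d by auto
  show "(\<lambda>y. det (N y)) differentiable (at x)"
    unfolding det_def using P by (auto intro!: differentiable_sum differentiable_mult_real)
  have "partial j (\<lambda>y. det (N y)) x = (\<Sum>p | p permutes UNIV. of_int (sign p) * (\<Sum>k\<in>UNIV. ?T p k))"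
    unfolding det_def using P by (simp add: partial_sum partial_cmult differentiable_mult_real)
  also have "\<dots> = (\<Sum>p\<in>{id}. of_int (sign p) * (\<Sum>k\<in>UNIV. ?T p k))"
  proof (rule sum.mono_neutral_right)
    show "\<forall>p\<in>{p. p permutes UNIV} - {id}. of_int (sign p) * (\<Sum>k\<in>UNIV. ?T p k) = 0"
    proof
      fix p :: "'m \<Rightarrow> 'm" assume p: "p \<in> {p. p permutes UNIV} - {id}"
      then obtain a where a: "p a \<noteq> a" by (auto simp: fun_eq_iff)
      then have pa: "p (p a) \<noteq> p a" using p by (metis (no_types) DiffD1 mem_Collect_eq permutes_inverses(2))
      have T0: "?T p k = 0" for k
      proof -
        obtain i where i: "i \<noteq> k" "p i \<noteq> i" using a pa by metis
        then have "N x $ i $ p i = 0" by (simp add: one mat_def)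
        then have "(\<Prod>i\<in>UNIV - {k}. N x $ i $ p i) = 0" using i by (intro prod_zero) auto
        then show ?thesis by simp
      qed
      show "of_int (sign p) * (\<Sum>k\<in>UNIV. ?T p k) = 0" by (simp only: T0) simp
    qed
  qed (auto simp: permutes_id)
  also have "\<dots> = (\<Sum>a\<in>UNIV. partial j (\<lambda>y. N y $ a $ a) x)"
    by (simp add: one mat_def)
  finally show "partial j (\<lambda>y. det (N y)) x = (\<Sum>a\<in>UNIV. partial j (\<lambda>y. N y $ a $ a) x)" .
qed

lemma abs_powr_derivative:
  assumes "t \<noteq> (0::real)"
  shows "((\<lambda>t. \<bar>t\<bar> powr b) has_real_derivative b * (\<bar>t\<bar> powr b) / t) (at t)"
proof (cases "t > 0")
  case True
  have "((\<lambda>t. t powr b) has_real_derivative b * t powr b / t) (at t)"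
    using has_real_derivative_powr[OF True, of b] True by (simp add: powr_diff)
  then show ?thesis
    using True by (auto intro: has_field_derivative_transform_within_open[of _ _ _ "{0<..}"])
next
  case False
  with assms have t: "t < 0" by simp
  have "((\<lambda>t. (- t) powr b) has_real_derivative b * (- t) powr b / t) (at t)"
    using DERIV_chain2[OF has_real_derivative_powr[of "- t" b] DERIV_minus[OF DERIV_ident]] t
    by (simp add: powr_diff)
  then show ?thesis
    using t by (auto intro: has_field_derivative_transform_within_open[of _ _ _ "{..<0}"])
qed

definition div_array :: "(real^'m::finite \<Rightarrow> 'm list \<Rightarrow> real) \<Rightarrow> real^'m \<Rightarrow> 'm list \<Rightarrow> real" where
  "div_array a x I = (\<Sum>i\<in>UNIV. partial i (\<lambda>y. a y (i # I)) x)"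

definition smooth_array :: "(real^'m::finite \<Rightarrow> 'm list \<Rightarrow> real) \<Rightarrow> bool" where
  "smooth_array a \<longleftrightarrow> (\<forall>I. smooth (\<lambda>x. a x I)) \<and> (\<forall>x. symmetric_array (a x))"

lemma smooth_arrayD:
  assumes "smooth_array a"
  shows "smooth (\<lambda>x. a x I)" "symmetric_array (a x)"
  using assms by (auto simp: smooth_array_def)

lemma smooth_array_div: "smooth_array a \<Longrightarrow> smooth_array (div_array a)"
proof -
  assume a: "smooth_array a"
  have "div_array a x I = div_array a x J" if "mset I = mset J" for x I J
  proof -
    have "(\<lambda>y. a y (i # I)) = (\<lambda>y. a y (i # J))" for i
      by (rule ext, rule symmetric_arrayD[OF smooth_arrayD(2)[OF a]]) (simp add: that)
    then show ?thesis unfolding div_array_def by simp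
  qed
  moreover have "smooth (\<lambda>x. div_array a x I)" for I
    unfolding div_array_def by (intro smooth_sum smooth_partial smooth_arrayD(1)[OF a])
  ultimately show ?thesis unfolding smooth_array_def symmetric_array_def[of "div_array a _"] by blast
qed

lemma smooth_array_div_pow: "smooth_array a \<Longrightarrow> smooth_array ((div_array ^^ l) a)"
  by (induction l) (auto intro: smooth_array_div)

locale projective_change =
  fixes S :: "(real^'m::finite) set" and h :: "real^'m \<Rightarrow> real^'m" and H :: "real^'m \<Rightarrow> real^'m^'m"
    and \<beta> :: "real^'m \<Rightarrow> 'm \<Rightarrow> real"
  assumes open_S: "open S"
    and h_derivative: "x \<in> S \<Longrightarrow> (h has_derivative ((*v) (H x))) (at x)"
    and H_invertible: "x \<in> S \<Longrightarrow> invertible (H x)"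
    and H_differentiable: "x \<in> S \<Longrightarrow> (\<lambda>y. H y $ a $ i) differentiable (at x)"
    and H_partial: "x \<in> S \<Longrightarrow>
      partial j (\<lambda>y. H y $ a $ i) x = - (H x $ a $ i * \<beta> x j + H x $ a $ j * \<beta> x i)"
    and \<beta>_differentiable: "x \<in> S \<Longrightarrow> (\<lambda>y. \<beta> y i) differentiable (at x)"
    and \<beta>_partial: "x \<in> S \<Longrightarrow> partial j (\<lambda>y. \<beta> y i) x = - (\<beta> x i * \<beta> x j)"
begin

definition weight :: "real \<Rightarrow> real^'m \<Rightarrow> real" where
  "weight b x = \<bar>det (H x)\<bar> powr b"

lemma H_inverse:
  assumes "x \<in> S"
  shows "H x ** matrix_inv (H x) = mat 1" "matrix_inv (H x) ** H x = mat 1"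
  using H_invertible[OF assms] unfolding invertible_def matrix_inv_def
  by (metis (mono_tags, lifting) someI_ex)+

lemma H_inverse_component:
  assumes "x \<in> S"
  shows "(\<Sum>a\<in>UNIV. matrix_inv (H x) $ j $ a * H x $ a $ i) = (if j = i then 1 else 0)"
    "(\<Sum>j\<in>UNIV. H x $ a $ j * matrix_inv (H x) $ j $ p) = (if a = p then 1 else 0)"
  using H_inverse[OF assms] by (simp_all add: matrix_matrix_mult_def mat_def vec_eq_iff)

lemma det_nonzero: "x \<in> S \<Longrightarrow> det (H x) \<noteq> 0"
  using H_invertible invertible_det_nz by blast

lemma partial_det:
  assumes "x \<in> S"
  shows "(\<lambda>y. det (H y)) differentiable (at x)"
    "partial j (\<lambda>y. det (H y)) x = - ((real CARD('m) + 1) * \<beta> x j * det (H x))"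
proof -
  let ?K = "matrix_inv (H x)"
  have eq: "(\<lambda>y. det (H y)) = (\<lambda>y. det (H x) * det (?K ** H y))"
  proof
    fix y
    have "det (H x) * det (?K ** H y) = det (H x ** ?K) * det (H y)" by (simp add: det_mul)
    then show "det (H y) = det (H x) * det (?K ** H y)" by (simp add: H_inverse[OF assms])
  qed
  note d = differentiable_matrix_mult_entry[where H = H and x = x and K = ?K, OF H_differentiable[OF assms]]
  note D = partial_det_identity[of "\<lambda>y. ?K ** H y" x, OF d(1) H_inverse(2)[OF assms]]
  show "(\<lambda>y. det (H y)) differentiable (at x)"
    unfolding eq using D(1) by (auto intro: differentiable_mult_real)
  have "(\<Sum>a\<in>UNIV. \<Sum>p\<in>UNIV. ?K $ a $ p * partial j (\<lambda>y. H y $ p $ a) x) =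
     - (\<Sum>a\<in>UNIV. (\<Sum>p\<in>UNIV. ?K $ a $ p * H x $ p $ a) * \<beta> x j + (\<Sum>p\<in>UNIV. ?K $ a $ p * H x $ p $ j) * \<beta> x a)"
    by (simp add: H_partial[OF assms] sum_negf sum.distrib sum_distrib_right distrib_left right_diff_distrib
        sum_subtractf mult.assoc)
  also have "\<dots> = - ((real CARD('m) + 1) * \<beta> x j)"
    unfolding H_inverse_component[OF assms] sum.distrib sum_kronecker by (simp add: distrib_right)
  finally show "partial j (\<lambda>y. det (H y)) x = - ((real CARD('m) + 1) * \<beta> x j * det (H x))"
    unfolding eq partial_cmult[OF D(1)] D(2) d(2) by (simp add: det_mul H_inverse[OF assms])
qed

lemma partial_weight:
  assumes "x \<in> S"
  shows "weight b differentiable (at x)"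
    "partial j (weight b) x = - (b * (real CARD('m) + 1) * \<beta> x j * weight b x)"
proof -
  note P = partial_real_comp[OF abs_powr_derivative[OF det_nonzero[OF assms], of b] partial_det(1)[OF assms]]
  show "weight b differentiable (at x)" unfolding weight_def[abs_def] by (rule P(2))
  show "partial j (weight b) x = - (b * (real CARD('m) + 1) * \<beta> x j * weight b x)"
    unfolding weight_def[abs_def] P(1) partial_det(2)[OF assms] using det_nonzero[OF assms] by simp
qed

lemma weight_mult: "x \<in> S \<Longrightarrow> weight b x * weight c x = weight (b + c) x"
  by (simp add: weight_def powr_add)

lemma weight_0: "x \<in> S \<Longrightarrow> weight 0 x = 1"
  using det_nonzero by (simp add: weight_def)

lemma partial_tpow:
  assumes "x \<in> S"
  shows "length J = length I \<Longrightarrow> (\<lambda>y. tpow (H y) J I) differentiable (at x) \<and>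
    partial j (\<lambda>y. tpow (H y) J I) x = - (real (length I) * \<beta> x j * tpow (H x) J I +
      (\<Sum>r<length I. \<beta> x (I ! r) * tpow (H x) J (I[r := j])))"
proof (induction J I rule: list_induct2)
  case Nil then show ?case by simp
next
  case (Cons p J i I)
  note IH = conjunct1[OF Cons.IH] conjunct2[OF Cons.IH]
  show ?case
    by (simp add: partial_mult H_differentiable[OF assms] H_partial[OF assms] IH sum.lessThan_Suc_shift
        differentiable_mult_real algebra_simps sum_distrib_left del: sum.lessThan_Suc)
qed

definition pull_cov :: "real \<Rightarrow> (real^'m \<Rightarrow> 'm list \<Rightarrow> real) \<Rightarrow> real^'m \<Rightarrow> 'm list \<Rightarrow> real" where
  "pull_cov b G x I = weight b x * (\<Sum>J | length J = length I. tpow (H x) J I * G (h x) J)"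

lemma partial_pull_cov:
  assumes "x \<in> S" and G: "\<And>J. length J = length I \<Longrightarrow> (\<lambda>y. G y J) differentiable (at (h x))"
  shows "(\<lambda>y. pull_cov b G y I) differentiable (at x)"
    and "partial j (\<lambda>y. pull_cov b G y I) x =
     (\<Sum>a\<in>UNIV. H x $ a $ j * pull_cov b (\<lambda>y J. partial a (\<lambda>z. G z J) y) x I)
     - (real (length I) + b * (real CARD('m) + 1)) * \<beta> x j * pull_cov b G x I
     - (\<Sum>r<length I. \<beta> x (I ! r) * pull_cov b G x (I[r := j]))"
proof -
  let ?n = "length I"
  note c = partial_chain[OF h_derivative[OF assms(1)] G]
  have d: "(\<lambda>y. tpow (H y) J I * G (h y) J) differentiable (at x)" if "length J = ?n" for J
    using partial_tpow[OF assms(1) that] c(2) that by (auto intro!: differentiable_mult_real)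
  have ds: "(\<lambda>y. \<Sum>J | length J = ?n. tpow (H y) J I * G (h y) J) differentiable (at x)"
    using d by (auto intro!: differentiable_sum)
  show "(\<lambda>y. pull_cov b G y I) differentiable (at x)"
    unfolding pull_cov_def using partial_weight(1)[OF assms(1)] ds by (intro differentiable_mult_real)
  have "partial j (\<lambda>y. \<Sum>J | length J = ?n. tpow (H y) J I * G (h y) J) x =
    (\<Sum>J | length J = ?n. - (real ?n * \<beta> x j * tpow (H x) J I +
      (\<Sum>r<?n. \<beta> x (I ! r) * tpow (H x) J (I[r := j]))) * G (h x) J +
      tpow (H x) J I * (\<Sum>a\<in>UNIV. H x $ a $ j * partial a (\<lambda>z. G z J) (h x)))"
    by (subst partial_sum) (use d partial_tpow[OF assms(1)] c in \<open>auto simp: partial_mult\<close>)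
  also have "\<dots> = (\<Sum>J | length J = ?n. tpow (H x) J I * (\<Sum>a\<in>UNIV. H x $ a $ j * partial a (\<lambda>z. G z J) (h x)))
     - real ?n * \<beta> x j * (\<Sum>J | length J = ?n. tpow (H x) J I * G (h x) J)
     - (\<Sum>J | length J = ?n. \<Sum>r<?n. \<beta> x (I ! r) * (tpow (H x) J (I[r := j]) * G (h x) J))"
    by (simp add: sum_distrib_left sum_distrib_right sum.distrib sum_subtractf algebra_simps)
  also have "(\<Sum>J | length J = ?n. \<Sum>r<?n. \<beta> x (I ! r) * (tpow (H x) J (I[r := j]) * G (h x) J)) =
      (\<Sum>r<?n. \<beta> x (I ! r) * (\<Sum>J | length J = ?n. tpow (H x) J (I[r := j]) * G (h x) J))"
    unfolding sum_distrib_left by (rule sum.swap)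
  also have "(\<Sum>J | length J = ?n. tpow (H x) J I * (\<Sum>a\<in>UNIV. H x $ a $ j * partial a (\<lambda>z. G z J) (h x))) =
      (\<Sum>a\<in>UNIV. H x $ a $ j * (\<Sum>J | length J = ?n. tpow (H x) J I * partial a (\<lambda>z. G z J) (h x)))"
    unfolding sum_distrib_left by (subst sum.swap) (intro sum.cong refl, simp)
  finally have P: "partial j (\<lambda>y. \<Sum>J | length J = ?n. tpow (H y) J I * G (h y) J) x =
    (\<Sum>a\<in>UNIV. H x $ a $ j * (\<Sum>J | length J = ?n. tpow (H x) J I * partial a (\<lambda>z. G z J) (h x)))
     - real ?n * \<beta> x j * (\<Sum>J | length J = ?n. tpow (H x) J I * G (h x) J)
     - (\<Sum>r<?n. \<beta> x (I ! r) * (\<Sum>J | length J = ?n. tpow (H x) J (I[r := j]) * G (h x) J))" .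
  have "partial j (\<lambda>y. pull_cov b G y I) x =
    partial j (weight b) x * (\<Sum>J | length J = ?n. tpow (H x) J I * G (h x) J) +
    weight b x * partial j (\<lambda>y. \<Sum>J | length J = ?n. tpow (H y) J I * G (h y) J) x"
    unfolding pull_cov_def by (rule partial_mult[OF partial_weight(1)[OF assms(1)] ds])
  then show "partial j (\<lambda>y. pull_cov b G y I) x =
     (\<Sum>a\<in>UNIV. H x $ a $ j * pull_cov b (\<lambda>y J. partial a (\<lambda>z. G z J) y) x I)
     - (real (length I) + b * (real CARD('m) + 1)) * \<beta> x j * pull_cov b G x I
     - (\<Sum>r<length I. \<beta> x (I ! r) * pull_cov b G x (I[r := j]))"
    unfolding P partial_weight(2)[OF assms(1)] pull_cov_def length_list_update
    by (simp add: mult.left_commute[of _ "weight b x"] sum_distrib_left[of "weight b x", symmetric])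
      (simp add: algebra_simps)
qed

lemma partial_ctr_pow:
  assumes "x \<in> S" and "\<And>L. (\<lambda>y. g y L) differentiable (at x)"
  shows "(\<lambda>y. (ctr (\<beta> y) ^^ l) (g y) L) differentiable (at x) \<and>
    partial j (\<lambda>y. (ctr (\<beta> y) ^^ l) (g y) L) x =
      (ctr (\<beta> x) ^^ l) (\<lambda>L. partial j (\<lambda>y. g y L) x) L - real l * \<beta> x j * (ctr (\<beta> x) ^^ l) (g x) L"
proof (induction l arbitrary: L)
  case 0 then show ?case using assms(2) by simp
next
  case (Suc l)
  note IH = conjunct1[OF Suc.IH] conjunct2[OF Suc.IH]
  have d: "(\<lambda>y. \<beta> y i * (ctr (\<beta> y) ^^ l) (g y) (i # L)) differentiable (at x)" for i
    using Suc \<beta>_differentiable[OF assms(1)] by (auto intro!: differentiable_mult_real)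
  have "partial j (\<lambda>y. \<Sum>i\<in>UNIV. \<beta> y i * (ctr (\<beta> y) ^^ l) (g y) (i # L)) x =
     (\<Sum>i\<in>UNIV. \<beta> x i * (ctr (\<beta> x) ^^ l) (\<lambda>L. partial j (\<lambda>y. g y L) x) (i # L)
        - real (Suc l) * \<beta> x j * (\<beta> x i * (ctr (\<beta> x) ^^ l) (g x) (i # L)))"
    by (subst partial_sum[OF d])
      (simp add: partial_mult IH \<beta>_differentiable[OF assms(1)] \<beta>_partial[OF assms(1)] algebra_simps)
  then show ?case
    using d by (auto simp: ctr_def[of _ "(ctr _ ^^ _) _"] sum_subtractf sum_distrib_left intro!: differentiable_sum)
qed

lemma sum_partial_ctr_pow:
  assumes x: "x \<in> S" and g: "\<And>L. (\<lambda>y. g y L) differentiable (at x)" and sym: "\<And>y. y \<in> S \<Longrightarrow> symmetric_array (g y)"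
  shows "(\<Sum>j\<in>UNIV. partial j (\<lambda>y. (ctr (\<beta> y) ^^ l) (g y) (j # I)) x) =
    (ctr (\<beta> x) ^^ l) (\<lambda>L. \<Sum>j\<in>UNIV. partial j (\<lambda>y. g y (j # L)) x) I
      - real l * (ctr (\<beta> x) ^^ Suc l) (g x) I"
proof -
  have "partial j (\<lambda>y. g y L) x = partial j (\<lambda>y. g y L') x" if "mset L = mset L'" for j L L'
    by (rule partial_cong_open[OF open_S x _ g]) (rule symmetric_arrayD[OF sym that])
  then have "symmetric_array (\<lambda>L. partial j (\<lambda>y. g y L) x)" for j
    unfolding symmetric_array_def by blast
  note s = ctr_pow_slot[OF this]
  have "(ctr (\<beta> x) ^^ l) (\<lambda>L. \<Sum>j\<in>UNIV. partial j (\<lambda>y. g y (j # L)) x) I =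
    (\<Sum>j\<in>UNIV. (ctr (\<beta> x) ^^ l) (\<lambda>L. partial j (\<lambda>y. g y L) x) (j # I))"
    unfolding ctr_pow_sum s ..
  then show ?thesis
    by (simp add: partial_ctr_pow[OF x g] sum_subtractf ctr_def[of _ "(ctr _ ^^ _) _"] sum_distrib_left mult.assoc)
qed


lemma pull_cov_slot:
  "pull_cov b (\<lambda>y J. partials J f y) x (j # I) =
    (\<Sum>a\<in>UNIV. H x $ a $ j * pull_cov b (\<lambda>y J. partial a (\<lambda>z. partials J f z) y) x I)"
  unfolding pull_cov_def
  by (simp add: sum_length_Suc sum_distrib_left partials_Cons mult_ac)

lemma contract_pull_cov:
  assumes f: "smooth f" and F: "smooth F" and eq: "\<And>y. y \<in> S \<Longrightarrow> F y = weight b y * f (h y)"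
    and x: "x \<in> S" and a: "symmetric_array a"
  shows "(\<Sum>I | length I = k. a I * pull_cov b (\<lambda>y J. partials J f y) x I) =
    (\<Sum>l\<le>k. coef (b * (real CARD('m) + 1)) k l * contract (k - l) ((ctr (\<beta> x) ^^ l) a) F x)"
  using x a
proof (induction k arbitrary: a x)
  case 0
  then show ?case by (simp add: pull_cov_def eq)
next
  case (Suc k)
  let ?\<nu> = "b * (real CARD('m) + 1)"
  let ?G = "\<lambda>y J. partials J f y"
  let ?P = "pull_cov b ?G"
  define W where "W l = (ctr (\<beta> x) ^^ l) a" for l
  note x = Suc.prems(1) and a = Suc.prems(2)
  have dG: "(\<lambda>y. ?G y J) differentiable (at y)" for J y
    by (rule smooth_differentiable[OF smooth_partials[OF f]])
  have rec: "?P x (j # I) = partial j (\<lambda>y. ?P y I) x + (real k + ?\<nu>) * (\<beta> x j * ?P x I)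
      + (\<Sum>r<k. \<beta> x (I ! r) * ?P x (I[r := j]))" if "length I = k" for j I
    using partial_pull_cov(2)[OF x, of I ?G j b, OF dG] that by (simp add: pull_cov_slot algebra_simps)
  have 1: "(\<Sum>j\<in>UNIV. \<Sum>I | length I = k. a (j # I) * partial j (\<lambda>y. ?P y I) x) =
     (\<Sum>j\<in>UNIV. \<Sum>l\<le>k. coef ?\<nu> k l * partial j (\<lambda>y. contract (k - l) ((ctr (\<beta> y) ^^ l) (\<lambda>I. a (j # I))) F y) x)"
  proof (rule sum.cong[OF refl])
    fix j
    have dc: "(\<lambda>y. contract (k - l) ((ctr (\<beta> y) ^^ l) (\<lambda>I. a (j # I))) F y) differentiable (at x)" for l
      using partial_ctr_pow[OF x, of "\<lambda>y I. a (j # I)" l] by (intro partial_contract(2)[OF F]) auto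
    have dP: "(\<lambda>y. a (j # I) * ?P y I) differentiable (at x)" for I
      using partial_pull_cov(1)[OF x, of I ?G b, OF dG] by (intro differentiable_mult_real) auto
    have "(\<Sum>I | length I = k. a (j # I) * partial j (\<lambda>y. ?P y I) x) =
        partial j (\<lambda>y. \<Sum>I | length I = k. a (j # I) * ?P y I) x"
      using dP partial_pull_cov(1)[OF x, of _ ?G b, OF dG] by (simp add: partial_sum partial_cmult)
    also have "\<dots> = partial j (\<lambda>y. \<Sum>l\<le>k. coef ?\<nu> k l * contract (k - l) ((ctr (\<beta> y) ^^ l) (\<lambda>I. a (j # I))) F y) x"
      using dP Suc.IH[OF _ symmetric_array_slot[OF a]]
      by (intro partial_cong_open(1)[OF open_S x]) (auto intro!: differentiable_sum)
    also have "\<dots> = (\<Sum>l\<le>k. coef ?\<nu> k l * partial j (\<lambda>y. contract (k - l) ((ctr (\<beta> y) ^^ l) (\<lambda>I. a (j # I))) F y) x)"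
      using dc by (simp add: partial_sum partial_cmult differentiable_mult_real)
    finally show "(\<Sum>I | length I = k. a (j # I) * partial j (\<lambda>y. ?P y I) x) = \<dots>" .
  qed
  also have "\<dots> = (\<Sum>l\<le>k. coef ?\<nu> k l * (contract (Suc k - l) (W l) F x - real l * contract (k - l) (W (Suc l)) F x))"
    unfolding sum.swap[of _ "{..k}"] sum_distrib_left[symmetric]
  proof (intro sum.cong refl arg_cong[where f = "(*) _"])
    fix l assume l: "l \<in> {..k}"
    have "partial j (\<lambda>y. contract (k - l) ((ctr (\<beta> y) ^^ l) (\<lambda>I. a (j # I))) F y) x =
      (\<Sum>I | length I = k - l. W l (j # I) * partial j (partials I F) x)
       - real l * (\<beta> x j * contract (k - l) (\<lambda>I. W l (j # I)) F x)" for j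
    proof -
      have z: "(ctr (\<beta> x) ^^ l) (\<lambda>L. 0) = (\<lambda>L. 0)" for l
        by (induction l) (auto simp: ctr_def)
      have "contract (k - l) (\<lambda>I. partial j (\<lambda>y. (ctr (\<beta> y) ^^ l) (\<lambda>I. a (j # I)) I) x) F x =
          - (real l * \<beta> x j) * contract (k - l) (\<lambda>I. W l (j # I)) F x"
        using partial_ctr_pow[OF x, of "\<lambda>y I. a (j # I)" l _ j]
        by (simp add: z ctr_pow_slot[OF a] W_def contract_scale[symmetric] contract_def[of _ "\<lambda>I. - _ I"]
             contract_def sum_distrib_left sum_negf mult_ac)
      moreover have "(ctr (\<beta> x) ^^ l) (\<lambda>I. a (j # I)) = (\<lambda>I. W l (j # I))"
        unfolding W_def by (rule ctr_pow_slot[OF a])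
      ultimately show ?thesis
        using partial_ctr_pow[OF x, of "\<lambda>y I. a (j # I)" l _ j]
        by (subst partial_contract(1)[OF F]) auto
    qed
    then have "(\<Sum>j\<in>UNIV. partial j (\<lambda>y. contract (k - l) ((ctr (\<beta> y) ^^ l) (\<lambda>I. a (j # I))) F y) x) =
       contract (Suc (k - l)) (W l) F x - real l * (\<Sum>j\<in>UNIV. \<beta> x j * contract (k - l) (\<lambda>I. W l (j # I)) F x)"
      by (simp add: sum_subtractf contract_Suc sum_distrib_left)
    moreover have "(\<Sum>j\<in>UNIV. \<beta> x j * contract (k - l) (\<lambda>I. W l (j # I)) F x) = contract (k - l) (W (Suc l)) F x"
      unfolding W_def funpow.simps o_def ctr_def[of _ "(ctr _ ^^ _) _", abs_def] contract_sum contract_scale ..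
    ultimately show "(\<Sum>j\<in>UNIV. partial j (\<lambda>y. contract (k - l) ((ctr (\<beta> y) ^^ l) (\<lambda>I. a (j # I))) F y) x) =
       contract (Suc k - l) (W l) F x - real l * contract (k - l) (W (Suc l)) F x"
      using l by (simp add: Suc_diff_le)
  qed
  finally have 1: "(\<Sum>j\<in>UNIV. \<Sum>I | length I = k. a (j # I) * partial j (\<lambda>y. ?P y I) x) = \<dots>" .
  have 2: "(\<Sum>j\<in>UNIV. \<Sum>I | length I = k. a (j # I) * (\<beta> x j * ?P x I)) =
      (\<Sum>l\<le>k. coef ?\<nu> k l * contract (k - l) (W (Suc l)) F x)"
  proof -
    have "(\<Sum>j\<in>UNIV. \<Sum>I | length I = k. a (j # I) * (\<beta> x j * ?P x I)) =
        (\<Sum>I | length I = k. ctr (\<beta> x) a I * ?P x I)"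
      by (subst sum.swap) (simp add: ctr_def sum_distrib_right mult_ac)
    also have "\<dots> = (\<Sum>l\<le>k. coef ?\<nu> k l * contract (k - l) (W (Suc l)) F x)"
      unfolding Suc.IH[OF x symmetric_array_ctr[OF a]] W_def funpow_Suc_right o_def ..
    finally show ?thesis .
  qed
  have 3: "(\<Sum>j\<in>UNIV. \<Sum>I | length I = k. \<Sum>r<k. a (j # I) * (\<beta> x (I ! r) * ?P x (I[r := j]))) =
      real k * (\<Sum>j\<in>UNIV. \<Sum>I | length I = k. a (j # I) * (\<beta> x j * ?P x I))"
  proof -
    have "(\<Sum>j\<in>UNIV. \<Sum>I | length I = k. \<Sum>r<k. a (j # I) * (\<beta> x (I ! r) * ?P x (I[r := j]))) =
       (\<Sum>r<k. \<Sum>j\<in>UNIV. \<Sum>I | length I = k. a (j # I) * (\<beta> x (I ! r) * ?P x (I[r := j])))"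
      by (subst sum.swap[of _ "{..<k}"], subst sum.swap[of _ "{..<k}"]) simp
    also have "\<dots> = (\<Sum>r<k. \<Sum>j\<in>UNIV. \<Sum>I | length I = k. a (j # I) * (\<beta> x j * ?P x I))"
      by (intro sum.cong refl symmetric_contract_swap[OF a]) auto
    finally show ?thesis by simp
  qed
  have "(\<Sum>I | length I = Suc k. a I * ?P x I) =
    (\<Sum>j\<in>UNIV. \<Sum>I | length I = k. a (j # I) * partial j (\<lambda>y. ?P y I) x)
    + (real k + ?\<nu>) * (\<Sum>j\<in>UNIV. \<Sum>I | length I = k. a (j # I) * (\<beta> x j * ?P x I))
    + (\<Sum>j\<in>UNIV. \<Sum>I | length I = k. \<Sum>r<k. a (j # I) * (\<beta> x (I ! r) * ?P x (I[r := j])))"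
    unfolding sum_length_Suc sum_distrib_left sum.distrib[symmetric]
    by (intro sum.cong refl) (simp add: rec distrib_left sum_distrib_left mult.left_commute)
  also have "\<dots> = (\<Sum>l\<le>k. coef ?\<nu> k l * contract (Suc k - l) (W l) F x) +
     (\<Sum>l\<le>k. (2 * real k + ?\<nu> - l) * coef ?\<nu> k l * contract (Suc k - Suc l) (W (Suc l)) F x)"
    unfolding 3 1 2
    by (simp add: sum_distrib_left algebra_simps sum.distrib sum_subtractf)
  also have "\<dots> = (\<Sum>l\<le>Suc k. coef ?\<nu> (real (Suc k)) l * contract (Suc k - l) (W l) F x)"
    by (rule coef_pascal_sum[symmetric])
  finally show ?case unfolding W_def .
qed

end

lemma sum_swap4:
  "(\<Sum>a\<in>A. \<Sum>j\<in>B. \<Sum>i\<in>C. \<Sum>l\<in>D. f a j i l) = (\<Sum>i\<in>C. \<Sum>l\<in>D. \<Sum>j\<in>B. \<Sum>a\<in>A. f a j i l)"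
proof -
  have "(\<Sum>a\<in>A. \<Sum>j\<in>B. \<Sum>i\<in>C. \<Sum>l\<in>D. f a j i l) = (\<Sum>j\<in>B. \<Sum>i\<in>C. \<Sum>l\<in>D. \<Sum>a\<in>A. f a j i l)"
    by (subst sum.swap, rule sum.cong[OF refl], subst sum.swap, rule sum.cong[OF refl], rule sum.swap)
  also have "\<dots> = (\<Sum>i\<in>C. \<Sum>l\<in>D. \<Sum>j\<in>B. \<Sum>a\<in>A. f a j i l)"
    by (subst sum.swap, rule sum.cong[OF refl], rule sum.swap)
  finally show ?thesis .
qed

lemma sum_diff_scaled:
  fixes y :: "'a \<Rightarrow> 'b \<Rightarrow> real"
  assumes "(\<Sum>i\<in>A. \<Sum>l\<in>B. R i l) = q * (\<Sum>i\<in>A. \<Sum>l\<in>B. y i l)"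
  shows "(\<Sum>i\<in>A. \<Sum>l\<in>B. p i l + D * y i l - R i l) = (\<Sum>i\<in>A. \<Sum>l\<in>B. p i l + (D - q) * y i l)"
  unfolding sum_subtractf assms sum.distrib sum_distrib_left[symmetric] by (simp add: algebra_simps)

context projective_change begin

text \<open>The components of a symbol of weight \<open>c\<close> are pushed forward without inverting the Jacobian.\<close>

definition push_related ::
  "real \<Rightarrow> nat \<Rightarrow> (real^'m \<Rightarrow> 'm list \<Rightarrow> real) \<Rightarrow> (real^'m \<Rightarrow> 'm list \<Rightarrow> real) \<Rightarrow> bool"
where
  "push_related c k U A \<longleftrightarrow> (\<forall>y\<in>S. \<forall>J. length J = k \<longrightarrow>
     A (h y) J = weight (- c) y * (\<Sum>I | length I = k. tpow (H y) J I * U y I))"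

lemma sum_H_inverse:
  assumes "x \<in> S"
  shows "(\<Sum>j\<in>UNIV. \<Sum>a\<in>UNIV. matrix_inv (H x) $ j $ a * (H x $ a $ i * X j)) = X i"
    and "(\<Sum>j\<in>UNIV. \<Sum>a\<in>UNIV. matrix_inv (H x) $ j $ a * (H x $ a $ j * Y)) = real CARD('m) * Y"
proof -
  have *: "(\<Sum>a\<in>UNIV. matrix_inv (H x) $ j $ a * (H x $ a $ i * Z)) = (if j = i then 1 else 0) * Z" for i j Z
    unfolding H_inverse_component(1)[OF assms, symmetric] sum_distrib_right by (simp add: mult.assoc)
  show "(\<Sum>j\<in>UNIV. \<Sum>a\<in>UNIV. matrix_inv (H x) $ j $ a * (H x $ a $ i * X j)) = X i"
    unfolding * sum_kronecker ..
  show "(\<Sum>j\<in>UNIV. \<Sum>a\<in>UNIV. matrix_inv (H x) $ j $ a * (H x $ a $ j * Y)) = real CARD('m) * Y"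
    unfolding * by simp
qed

lemma sum_tpow_H_inverse:
  assumes "x \<in> S" "length I = k"
  shows "(\<Sum>j\<in>UNIV. \<Sum>a\<in>UNIV. matrix_inv (H x) $ j $ a *
      (H x $ a $ i * (t * X j) + C * (H x $ a $ i * (\<beta> x j * (t * u)))
       - (H x $ a $ j * (\<beta> x i * (t * u)) + (\<Sum>r<k. \<beta> x (I ! r) * (H x $ a $ i * s j r) * u)))) =
     t * X i + (C - real CARD('m)) * (\<beta> x i * (t * u)) - (\<Sum>r<k. \<beta> x (I ! r) * s i r * u)"
proof -
  have r: "(\<Sum>r<k. \<beta> x (I ! r) * (H x $ a $ i * s j r) * u) = H x $ a $ i * (\<Sum>r<k. \<beta> x (I ! r) * s j r * u)" for j a
    unfolding sum_distrib_left by (simp add: mult_ac)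
  have *: "matrix_inv (H x) $ j $ a *
      (H x $ a $ i * (t * X j) + C * (H x $ a $ i * (\<beta> x j * (t * u)))
       - (H x $ a $ j * (\<beta> x i * (t * u)) + (\<Sum>r<k. \<beta> x (I ! r) * (H x $ a $ i * s j r) * u))) =
     matrix_inv (H x) $ j $ a * (H x $ a $ i * (t * X j + C * (\<beta> x j * (t * u)) - (\<Sum>r<k. \<beta> x (I ! r) * s j r * u)))
     - matrix_inv (H x) $ j $ a * (H x $ a $ j * (\<beta> x i * (t * u)))" for j a
    unfolding r by (simp add: algebra_simps)
  show ?thesis
    unfolding * sum_subtractf by (simp only: sum_H_inverse(1)[OF assms(1), of i "\<lambda>j. t * X j + C * (\<beta> x j * (t * u)) - (\<Sum>r<k. \<beta> x (I ! r) * s j r * u)"] sum_H_inverse(2)[OF assms(1)]) (simp only: algebra_simps)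
qed

lemma push_related_div:
  assumes rel: "push_related c (Suc k) U A"
    and U: "\<And>y I. y \<in> S \<Longrightarrow> (\<lambda>z. U z I) differentiable (at y)" "\<And>y. y \<in> S \<Longrightarrow> symmetric_array (U y)"
    and A: "\<And>y J. (\<lambda>z. A z J) differentiable (at y)"
  shows "push_related c k
    (\<lambda>x I. div_array U x I - (2 * real k + 1 + real CARD('m) - c * (real CARD('m) + 1)) * ctr (\<beta> x) (U x) I)
    (div_array A)"
  unfolding push_related_def
proof (intro ballI allI impI)
  fix x and J :: "'m list" assume x: "x \<in> S" and J: "length J = k"
  let ?K = "matrix_inv (H x)" and ?m = "real CARD('m)"
  let ?C = "c * (?m + 1) - (real k + 1)"
  let ?t = "\<lambda>I. tpow (H x) J I"
  define R where "R a y = weight (- c) y * (\<Sum>i\<in>UNIV. \<Sum>I | length I = k. tpow (H y) (a # J) (i # I) * U y (i # I))" for a y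
  define B where "B a j i I = H x $ a $ i * (?t I * partial j (\<lambda>z. U z (i # I)) x) + ?C * (H x $ a $ i * (\<beta> x j * (?t I * U x (i # I))))
       - (H x $ a $ j * (\<beta> x i * (?t I * U x (i # I))) + (\<Sum>r<k. \<beta> x (I ! r) * (H x $ a $ i * tpow (H x) J (I[r := j])) * U x (i # I)))"
    for a j i I
  have dR: "R a differentiable (at x) \<and> partial j (R a) x = weight (- c) x * (\<Sum>i\<in>UNIV. \<Sum>I | length I = k. B a j i I)" for a j
  proof -
    have T: "(\<lambda>y. tpow (H y) (a # J) (i # I)) differentiable (at x)"
      "partial j (\<lambda>y. tpow (H y) (a # J) (i # I)) x = - ((real k + 1) * \<beta> x j * (H x $ a $ i * ?t I) +
         (\<beta> x i * (H x $ a $ j * ?t I) + (\<Sum>r<k. \<beta> x (I ! r) * (H x $ a $ i * tpow (H x) J (I[r := j])))))"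
      if "length I = k" for i I
      using partial_tpow[OF x, of "a # J" "i # I" j] that J
      by (simp_all add: sum.lessThan_Suc_shift add.commute del: sum.lessThan_Suc)
    have d: "(\<lambda>y. tpow (H y) (a # J) (i # I) * U y (i # I)) differentiable (at x)" if "length I = k" for i I
      using T(1)[OF that] U(1)[OF x] by (rule differentiable_mult_real)
    have ds: "(\<lambda>y. \<Sum>i\<in>UNIV. \<Sum>I | length I = k. tpow (H y) (a # J) (i # I) * U y (i # I)) differentiable (at x)"
      using d by (intro differentiable_sum) auto
    have "partial j (\<lambda>y. \<Sum>i\<in>UNIV. \<Sum>I | length I = k. tpow (H y) (a # J) (i # I) * U y (i # I)) x =
       (\<Sum>i\<in>UNIV. \<Sum>I | length I = k. partial j (\<lambda>y. tpow (H y) (a # J) (i # I)) x * U x (i # I) +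
          H x $ a $ i * ?t I * partial j (\<lambda>z. U z (i # I)) x)"
    proof -
      have "partial j (\<lambda>y. \<Sum>i\<in>UNIV. \<Sum>I | length I = k. tpow (H y) (a # J) (i # I) * U y (i # I)) x =
          (\<Sum>i\<in>UNIV. partial j (\<lambda>y. \<Sum>I | length I = k. tpow (H y) (a # J) (i # I) * U y (i # I)) x)"
        by (rule partial_sum) (use d in \<open>auto intro!: differentiable_sum simp del: tpow.simps\<close>)
      also have "\<dots> = (\<Sum>i\<in>UNIV. \<Sum>I | length I = k. partial j (\<lambda>y. tpow (H y) (a # J) (i # I) * U y (i # I)) x)"
        by (intro sum.cong refl partial_sum) (use d in \<open>auto simp del: tpow.simps\<close>)
      finally show ?thesis
        by (simp add: partial_mult[OF T(1) U(1)[OF x]] del: tpow.simps) (simp only: tpow.simps)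
    qed
    then have "partial j (R a) x = (c * (?m + 1) * \<beta> x j * weight (- c) x) *
         (\<Sum>i\<in>UNIV. \<Sum>I | length I = k. H x $ a $ i * ?t I * U x (i # I)) +
       weight (- c) x * (\<Sum>i\<in>UNIV. \<Sum>I | length I = k. partial j (\<lambda>y. tpow (H y) (a # J) (i # I)) x * U x (i # I) +
          H x $ a $ i * ?t I * partial j (\<lambda>z. U z (i # I)) x)"
      unfolding R_def[abs_def] partial_mult[OF partial_weight(1)[OF x] ds] partial_weight(2)[OF x]
      by simp
    also have "\<dots> = weight (- c) x * (\<Sum>i\<in>UNIV. \<Sum>I | length I = k. B a j i I)"
      unfolding mult.commute[of _ "weight (- c) x"] mult.assoc distrib_left[symmetric] sum_distrib_left[of _ _ UNIV]
        sum_distrib_left[of "c * _"] sum_distrib_left[of "\<beta> x j"] sum_distrib_left[of "?m + 1"] sum_distrib_left[of c]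
        sum.distrib[symmetric] 
    proof (intro sum.cong refl arg_cong[where f = "(*) (weight (- c) x)"])
      fix i :: 'm and I :: "'m list" assume "I \<in> {I. length I = k}"
      then have I: "length I = k" by simp
      show "c * ((?m + 1) * (\<beta> x j * (H x $ a $ i * (?t I * U x (i # I))))) +
          (partial j (\<lambda>y. tpow (H y) (a # J) (i # I)) x * U x (i # I) +
           H x $ a $ i * (?t I * partial j (\<lambda>z. U z (i # I)) x)) = B a j i I"
        unfolding T(2)[OF I] B_def by (simp add: algebra_simps sum_distrib_left)
    qed
    finally show ?thesis
      using ds partial_weight(1)[OF x] by (auto simp: R_def[abs_def] intro: differentiable_mult_real)
  qed
  have AR: "A (h y) (a # J) = R a y" if "y \<in> S" for a y
    using rel that J unfolding push_related_def R_def by (simp add: sum_length_Suc)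
  have "partial j (R a) x = (\<Sum>p\<in>UNIV. H x $ p $ j * partial p (\<lambda>z. A z (a # J)) (h x))" for a j
    using partial_cong_open(1)[OF open_S x, of "\<lambda>y. A (h y) (a # J)" "R a" j] AR
      partial_chain[OF h_derivative[OF x] A] by simp
  then have L: "weight (- c) x * (\<Sum>i\<in>UNIV. \<Sum>I | length I = k. B a j i I) =
      (\<Sum>p\<in>UNIV. H x $ p $ j * partial p (\<lambda>z. A z (a # J)) (h x))" for a j
    using dR by simp
  have "div_array A (h x) J = (\<Sum>a\<in>UNIV. \<Sum>p\<in>UNIV. (if p = a then 1 else 0) * partial p (\<lambda>z. A z (a # J)) (h x))"
    unfolding sum_kronecker div_array_def ..
  also have "\<dots> = (\<Sum>a\<in>UNIV. \<Sum>p\<in>UNIV. \<Sum>j\<in>UNIV. ?K $ j $ a * (H x $ p $ j * partial p (\<lambda>z. A z (a # J)) (h x)))"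
    unfolding H_inverse_component(2)[OF x, symmetric] sum_distrib_right by (simp add: mult_ac)
  also have "\<dots> = (\<Sum>a\<in>UNIV. \<Sum>j\<in>UNIV. ?K $ j $ a * (\<Sum>p\<in>UNIV. H x $ p $ j * partial p (\<lambda>z. A z (a # J)) (h x)))"
    unfolding sum_distrib_left by (rule sum.cong[OF refl], rule sum.swap)
  also have "\<dots> = weight (- c) x * (\<Sum>a\<in>UNIV. \<Sum>j\<in>UNIV. ?K $ j $ a * (\<Sum>i\<in>UNIV. \<Sum>I | length I = k. B a j i I))"
    unfolding L[symmetric] by (simp add: sum_distrib_left mult.left_commute)
  also have "(\<Sum>a\<in>UNIV. \<Sum>j\<in>UNIV. ?K $ j $ a * (\<Sum>i\<in>UNIV. \<Sum>I | length I = k. B a j i I)) =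
     (\<Sum>i\<in>UNIV. \<Sum>I | length I = k. \<Sum>j\<in>UNIV. \<Sum>a\<in>UNIV. ?K $ j $ a * B a j i I)"
    unfolding sum_distrib_left by (rule sum_swap4)
  also have "\<dots> = (\<Sum>i\<in>UNIV. \<Sum>I | length I = k. ?t I * partial i (\<lambda>z. U z (i # I)) x
      + (?C - ?m) * (\<beta> x i * (?t I * U x (i # I))) - (\<Sum>r<k. \<beta> x (I ! r) * tpow (H x) J (I[r := i]) * U x (i # I)))"
    unfolding B_def by (intro sum.cong refl sum_tpow_H_inverse[OF x]) auto
  also have "\<dots> = (\<Sum>i\<in>UNIV. \<Sum>I | length I = k. ?t I * partial i (\<lambda>z. U z (i # I)) x
      + (?C - ?m - real k) * (\<beta> x i * (?t I * U x (i # I))))"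
  proof -
    have "(\<Sum>i\<in>UNIV. \<Sum>I | length I = k. \<Sum>r<k. \<beta> x (I ! r) * tpow (H x) J (I[r := i]) * U x (i # I)) =
      (\<Sum>r<k. \<Sum>i\<in>UNIV. \<Sum>I | length I = k. U x (i # I) * (\<beta> x (I ! r) * tpow (H x) J (I[r := i])))"
      by (subst sum.swap[of _ "{..<k}"], subst sum.swap[of _ "{..<k}"]) (simp add: mult_ac)
    also have "\<dots> = (\<Sum>r<k. \<Sum>i\<in>UNIV. \<Sum>I | length I = k. U x (i # I) * (\<beta> x i * tpow (H x) J I))"
      by (intro sum.cong refl symmetric_contract_swap[OF U(2)[OF x]]) auto
    also have "\<dots> = real k * (\<Sum>i\<in>UNIV. \<Sum>I | length I = k. \<beta> x i * (?t I * U x (i # I)))"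
      by (simp add: mult_ac)
    finally show ?thesis by (rule sum_diff_scaled)
  qed
  also have "\<dots> = (\<Sum>I | length I = k. ?t I * (div_array U x I - (2 * real k + 1 + ?m - c * (?m + 1)) * ctr (\<beta> x) (U x) I))"
    by (subst sum.swap) (simp add: div_array_def ctr_def sum.distrib sum_subtractf sum_distrib_left algebra_simps)
  finally show "div_array A (h x) J = weight (- c) x * (\<Sum>I | length I = k. ?t I *
      (div_array U x I - (2 * real k + 1 + ?m - c * (?m + 1)) * ctr (\<beta> x) (U x) I))" .
qed

end

definition quant_coef :: "real \<Rightarrow> real \<Rightarrow> real \<Rightarrow> nat \<Rightarrow> real" where
  "quant_coef \<nu> \<tau> k l = coef \<nu> k l / (\<Prod>j<l. \<tau> - 1 - real j)"

definition proj_quant ::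
  "real \<Rightarrow> real \<Rightarrow> nat \<Rightarrow> (real^'m::finite \<Rightarrow> 'm list \<Rightarrow> real) \<Rightarrow> (real^'m \<Rightarrow> real) \<Rightarrow> real^'m \<Rightarrow> real"
where
  "proj_quant b c k a f x =
    (\<Sum>l\<le>k. quant_coef (b * (real CARD('m) + 1)) (2 * real k + real CARD('m) - c * (real CARD('m) + 1)) k l *
       contract (k - l) ((div_array ^^ l) a x) f x)"

lemma quant_coef_0 [simp]: "quant_coef \<nu> \<tau> k 0 = 1"
  by (simp add: quant_coef_def)

lemma quant_coef_Suc:
  assumes "\<tau> - 1 - real l \<noteq> 0"
  shows "quant_coef \<nu> \<tau> k (Suc l) * ((real l + 1) * (\<tau> - 1 - l)) = quant_coef \<nu> \<tau> k l * ((k - l) * (\<nu> + k - 1 - l))"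
proof -
  have "(u * (X / s) / (P * t)) * (s * t) = u / P * X" if "s \<noteq> 0" "t \<noteq> 0" for u X s P t :: real
    using that by simp
  from this[of "real l + 1" "\<tau> - 1 - l"] assms show ?thesis
    unfolding quant_coef_def coef_Suc prod.lessThan_Suc by simp
qed

lemma quant_coef_cancel:
  assumes nz: "\<And>j. j < k \<Longrightarrow> \<tau> - 1 - real j \<noteq> 0" and "p + n \<le> k" "i \<le> n"
  shows "quant_coef \<nu> \<tau> (real k) (p + i) * (coef (1 - \<tau>) (real (p + i)) i * coef \<nu> (real (k - p - i)) (n - i)) =
    (-1) ^ i * real (n choose i) * (quant_coef \<nu> \<tau> (real k) p * coef \<nu> (real (k - p)) n)"
  using assms(3)
proof (induction i)
  case 0 then show ?case by simp
next
  case (Suc i)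
  let ?q = "quant_coef \<nu> \<tau> (real k)"
  from Suc obtain n' where n': "n - i = Suc n'" "n - Suc i = n'" by (metis Suc_diff_Suc Suc_le_lessD)
  have ki: "real (k - p - i) = real (k - p - Suc i) + 1" "real (k - p - Suc i) = real k - real p - real i - 1"
    using Suc.prems assms(2) by (auto simp: of_nat_diff)
  have nn: "real n' = real n - real i - 1" using n' Suc.prems by (auto simp: of_nat_diff)
  have z: "\<tau> - 1 - real (p + i) \<noteq> 0" using nz[of "p + i"] Suc.prems assms(2) by simp
  have C: "coef \<nu> (real (k - p - i)) (n - i) =
      (real k - p - i) * (\<nu> + real k - p - i - 1) / (real n - i) * coef \<nu> (real (k - p - Suc i)) (n - Suc i)"
  proof -
    have e: "real (k - p - Suc i) + 1 = real k - p - i" "\<nu> + real (k - p - Suc i) = \<nu> + real k - p - i - 1"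
      "real n' + 1 = real n - i"
      unfolding ki(2) nn by simp_all
    show ?thesis unfolding n' ki(1) unfolding coef_Suc_left unfolding e ..
  qed
  have B: "coef (1 - \<tau>) (real (p + Suc i)) (Suc i) =
      - ((real p + i + 1) * (\<tau> - 1 - (p + i)) / (real i + 1)) * coef (1 - \<tau>) (real (p + i)) i"
  proof -
    have "(real (p + i) + 1) * (1 - \<tau> + real (p + i)) / (real i + 1) =
        - ((real p + i + 1) * (\<tau> - 1 - (p + i)) / (real i + 1))"
      unfolding minus_divide_left by (rule arg_cong[where f = "\<lambda>u. u / _"]) (simp add: algebra_simps)
    then show ?thesis using coef_Suc_left[of "1 - \<tau>" "real (p + i)" i] by (simp add: add.commute add.left_commute)
  qed
  have A: "?q (p + Suc i) * ((real p + i + 1) * (\<tau> - 1 - (p + i))) =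
      ?q (p + i) * ((real k - p - i) * (\<nu> + real k - p - i - 1))"
    using quant_coef_Suc[OF z, of \<nu> "real k"] by (simp add: algebra_simps)
  have ni: "real n - real i \<noteq> 0" using Suc.prems by auto
  have "?q (p + Suc i) * (coef (1 - \<tau>) (real (p + Suc i)) (Suc i) * coef \<nu> (real (k - p - Suc i)) (n - Suc i)) =
     - (?q (p + Suc i) * ((real p + i + 1) * (\<tau> - 1 - (p + i)))) / (real i + 1) *
       (coef (1 - \<tau>) (real (p + i)) i * coef \<nu> (real (k - p - Suc i)) (n - Suc i))"
    unfolding B by simp
  also have "\<dots> = - (real n - i) / (real i + 1) * (?q (p + i) * (coef (1 - \<tau>) (real (p + i)) i * coef \<nu> (real (k - p - i)) (n - i)))"
  proof -
    have "- (q * X) / s * (u * e) = - d / s * (q * (u * (X / d * e)))" if "d \<noteq> 0" for q X s u e d :: real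
      using that by simp
    then show ?thesis unfolding A C using ni by blast
  qed
  also have "\<dots> = (-1) ^ Suc i * (real (n choose i) * (real n - i) / (real i + 1)) * (?q p * coef \<nu> (real (k - p)) n)"
  proof -
    have "- d / s * (e * u * Z) = (- 1 * e) * (u * d / s) * Z" for d s e u Z :: real
      by (simp add: mult_ac)
    then show ?thesis unfolding Suc.IH[OF Suc_leD[OF Suc.prems]] power_Suc by blast
  qed
  also have "real (n choose i) * (real n - i) / (real i + 1) = real (n choose Suc i)"
  proof -
    have "Suc i * (n choose Suc i) = (n - i) * (n choose i)"
      by (simp only: binomial_absorb_comp binomial_absorption)
    then have "real (Suc i * (n choose Suc i)) = real ((n - i) * (n choose i))" by simp
    then have "(real i + 1) * real (n choose Suc i) = (real n - i) * real (n choose i)"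
      using Suc.prems by (simp add: of_nat_diff algebra_simps)
    moreover have "real i + 1 \<noteq> 0" by simp
    ultimately show ?thesis by (simp add: field_simps)
  qed
  finally show ?case .
qed

lemma sum_quant_coef_cancel:
  assumes nz: "\<And>j. j < k \<Longrightarrow> \<tau> - 1 - real j \<noteq> 0" and "p + n \<le> k"
  shows "(\<Sum>i\<le>n. quant_coef \<nu> \<tau> (real k) (p + i) * (coef (1 - \<tau>) (real (p + i)) i * coef \<nu> (real (k - p - i)) (n - i))) =
    (if n = 0 then quant_coef \<nu> \<tau> (real k) p else 0)"
proof (cases "n = 0")
  case False
  have "(\<Sum>i\<le>n. quant_coef \<nu> \<tau> (real k) (p + i) * (coef (1 - \<tau>) (real (p + i)) i * coef \<nu> (real (k - p - i)) (n - i))) =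
     (\<Sum>i\<le>n. (-1) ^ i * real (n choose i)) * (quant_coef \<nu> \<tau> (real k) p * coef \<nu> (real (k - p)) n)"
    unfolding sum_distrib_right by (rule sum.cong[OF refl], subst quant_coef_cancel[OF nz assms(2)]) auto
  then show ?thesis using False choose_alternating_sum[of n, where ?'a = real] by simp
qed simp

lemma sum_triangle_reindex:
  fixes g :: "nat \<Rightarrow> nat \<Rightarrow> nat \<Rightarrow> real"
  shows "(\<Sum>l\<le>k. \<Sum>j\<le>k - l. \<Sum>i\<le>l. g l j i) = (\<Sum>p\<le>k. \<Sum>n\<le>k - p. \<Sum>i\<le>n. g (p + i) (n - i) i)"
  by (simp add: sum.Sigma, rule sum.reindex_bij_witness[of _ "\<lambda>(p, n, i). (p + i, n - i, i)" "\<lambda>(l, j, i). (l - i, i + j, i)"])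
    auto

context projective_change begin

lemma push_related_div_pow:
  assumes a: "smooth_array a" and A: "smooth_array A" and rel: "push_related c k a A"
  defines "\<tau> \<equiv> 2 * real k + real CARD('m) - c * (real CARD('m) + 1)"
  shows "l \<le> k \<Longrightarrow> push_related c (k - l)
     (\<lambda>x I. \<Sum>i\<le>l. coef (1 - \<tau>) (real l) i * (ctr (\<beta> x) ^^ i) ((div_array ^^ (l - i)) a x) I) ((div_array ^^ l) A)"
proof (induction l)
  case 0 then show ?case using rel by simp
next
  case (Suc l)
  define U where "U = (\<lambda>x I. \<Sum>i\<le>l. coef (1 - \<tau>) (real l) i * (ctr (\<beta> x) ^^ i) ((div_array ^^ (l - i)) a x) I)"
  note sm = smooth_arrayD[OF smooth_array_div_pow[OF a]]
  note smA = smooth_arrayD[OF smooth_array_div_pow[OF A]]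
  have d: "(\<lambda>z. (ctr (\<beta> z) ^^ i) ((div_array ^^ n) a z) I) differentiable (at y)" if "y \<in> S" for i n I y
    using partial_ctr_pow[OF that, of "(div_array ^^ n) a"] sm(1) smooth_differentiable by blast
  have dU: "(\<lambda>z. U z I) differentiable (at y)" if "y \<in> S" for y I
    unfolding U_def using d[OF that] by (intro differentiable_sum differentiable_mult_real) auto
  have sU: "symmetric_array (U y)" for y
  proof -
    have "U y I = U y J" if "mset I = mset J" for I J
      unfolding U_def using symmetric_arrayD[OF symmetric_array_ctr_pow[OF sm(2)] that] by simp
    then show ?thesis unfolding symmetric_array_def by blast
  qed
  have kl: "k - l = Suc (k - Suc l)" using Suc.prems by simp
  have "push_related c (Suc (k - Suc l)) U ((div_array ^^ l) A)"
    using Suc.IH Suc.prems unfolding U_def kl[symmetric] by simp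
  from push_related_div[OF this dU sU smooth_differentiable[OF smA(1)]]
  have *: "push_related c (k - Suc l) (\<lambda>x I. div_array U x I -
      (2 * real (k - Suc l) + 1 + real CARD('m) - c * (real CARD('m) + 1)) * ctr (\<beta> x) (U x) I) ((div_array ^^ Suc l) A)"
    by simp
  have mu: "2 * real (k - Suc l) + 1 + real CARD('m) - c * (real CARD('m) + 1) = \<tau> - 1 - 2 * real l"
    using Suc.prems by (simp add: \<tau>_def of_nat_diff)
  have "div_array U x I - (\<tau> - 1 - 2 * real l) * ctr (\<beta> x) (U x) I =
     (\<Sum>i\<le>Suc l. coef (1 - \<tau>) (real (Suc l)) i * (ctr (\<beta> x) ^^ i) ((div_array ^^ (Suc l - i)) a x) I)"
    if x: "x \<in> S" for x I
  proof -
    define V where "V i = (ctr (\<beta> x) ^^ i) ((div_array ^^ (Suc l - i)) a x) I" for i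
    have s: "(\<Sum>j\<in>UNIV. partial j (\<lambda>y. (ctr (\<beta> y) ^^ i) ((div_array ^^ (l - i)) a y) (j # I)) x) =
        V i - real i * V (Suc i)" if "i \<le> l" for i
    proof -
      have "div_array ((div_array ^^ (l - i)) a) x = (\<lambda>L. \<Sum>j\<in>UNIV. partial j (\<lambda>y. (div_array ^^ (l - i)) a y (j # L)) x)"
        by (simp add: div_array_def[abs_def])
      then show ?thesis
        using sum_partial_ctr_pow[OF x smooth_differentiable[OF sm(1)] sm(2), of i "l - i" I] that
        by (simp add: V_def Suc_diff_le)
    qed
    have "div_array U x I = (\<Sum>j\<in>UNIV. partial j (\<lambda>y. U y (j # I)) x)" by (rule div_array_def)
    also have "\<dots> = (\<Sum>j\<in>UNIV. \<Sum>i\<le>l. coef (1 - \<tau>) (real l) i *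
        partial j (\<lambda>y. (ctr (\<beta> y) ^^ i) ((div_array ^^ (l - i)) a y) (j # I)) x)"
      unfolding U_def using d[OF x]
      by (simp add: partial_sum partial_cmult differentiable_mult_real)
    also have "\<dots> = (\<Sum>i\<le>l. coef (1 - \<tau>) (real l) i * (V i - real i * V (Suc i)))"
      by (subst sum.swap) (simp add: sum_distrib_left[symmetric] s)
    finally have D: "div_array U x I = \<dots>" .
    have C: "ctr (\<beta> x) (U x) I = (\<Sum>i\<le>l. coef (1 - \<tau>) (real l) i * V (Suc i))"
      unfolding U_def ctr_sum ctr_scale by (simp add: V_def)
    have "div_array U x I - (\<tau> - 1 - 2 * real l) * ctr (\<beta> x) (U x) I =
        (\<Sum>i\<le>l. coef (1 - \<tau>) (real l) i * V i) + (\<Sum>i\<le>l. (2 * real l + (1 - \<tau>) - i) * coef (1 - \<tau>) (real l) i * V (Suc i))"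
      unfolding D C sum_distrib_left sum.distrib[symmetric] sum_subtractf[symmetric]
      by (rule sum.cong[OF refl]) (simp add: algebra_simps)
    then show ?thesis unfolding coef_pascal_sum[of _ _ V, symmetric] by (simp add: V_def)
  qed
  then show ?case using * unfolding push_related_def mu by simp
qed

theorem proj_quant_covariant:
  assumes a: "smooth_array a" and A: "smooth_array A" and rel: "push_related c k a A"
    and f: "smooth f" and F: "smooth F" and eq: "\<And>y. y \<in> S \<Longrightarrow> F y = weight b y * f (h y)"
    and nz: "\<And>j. j < k \<Longrightarrow> 2 * real k + real CARD('m) - c * (real CARD('m) + 1) - 1 - real j \<noteq> 0"
    and x: "x \<in> S"
  shows "proj_quant b c k a F x = weight (b + c) x * proj_quant b c k A f (h x)"
proof -
  let ?\<nu> = "b * (real CARD('m) + 1)"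
  define \<tau> where "\<tau> = 2 * real k + real CARD('m) - c * (real CARD('m) + 1)"
  define W where "W n p = contract (k - p - n) ((ctr (\<beta> x) ^^ n) ((div_array ^^ p) a x)) F x" for n p
  note sm = smooth_arrayD[OF smooth_array_div_pow[OF a]]
  have T: "weight (b + c) x * contract (k - l) ((div_array ^^ l) A (h x)) f (h x) =
      (\<Sum>j\<le>k - l. \<Sum>i\<le>l. coef ?\<nu> (real (k - l)) j * coef (1 - \<tau>) (real l) i * W (i + j) (l - i))" if l: "l \<le> k" for l
  proof -
    define U where "U I = (\<Sum>i\<le>l. coef (1 - \<tau>) (real l) i * (ctr (\<beta> x) ^^ i) ((div_array ^^ (l - i)) a x) I)" for I
    have U: "(div_array ^^ l) A (h x) J = weight (- c) x * (\<Sum>I | length I = k - l. tpow (H x) J I * U I)"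
      if "length J = k - l" for J
      using push_related_div_pow[OF a A rel l] x that unfolding push_related_def U_def \<tau>_def by blast
    have sU: "symmetric_array U"
    proof -
      have "U I = U J" if "mset I = mset J" for I J
        unfolding U_def using symmetric_arrayD[OF symmetric_array_ctr_pow[OF sm(2)] that] by simp
      then show ?thesis unfolding symmetric_array_def by blast
    qed
    have "weight (b + c) x * contract (k - l) ((div_array ^^ l) A (h x)) f (h x) =
       weight (b + c) x * weight (- c) x * (\<Sum>J | length J = k - l. \<Sum>I | length I = k - l. tpow (H x) J I * U I * partials J f (h x))"
      unfolding contract_def by (simp add: U sum_distrib_left sum_distrib_right mult_ac)
    also have "\<dots> = (\<Sum>I | length I = k - l. U I * pull_cov b (\<lambda>y J. partials J f y) x I)"
      unfolding pull_cov_def weight_mult[OF x] by (subst sum.swap) (simp add: sum_distrib_left mult_ac)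
    also have "\<dots> = (\<Sum>j\<le>k - l. coef ?\<nu> (real (k - l)) j * contract (k - l - j) ((ctr (\<beta> x) ^^ j) U) F x)"
      by (rule contract_pull_cov[OF f F eq x sU])
    also have "\<dots> = (\<Sum>j\<le>k - l. coef ?\<nu> (real (k - l)) j * (\<Sum>i\<le>l. coef (1 - \<tau>) (real l) i * W (i + j) (l - i)))"
    proof (intro sum.cong refl arg_cong[where f = "(*) _"])
      fix j assume j: "j \<in> {..k - l}"
      have "(ctr (\<beta> x) ^^ j) U = (\<lambda>I. \<Sum>i\<le>l. coef (1 - \<tau>) (real l) i *
         (ctr (\<beta> x) ^^ (i + j)) ((div_array ^^ (l - i)) a x) I)"
        unfolding U_def[abs_def] ctr_pow_sum ctr_pow_scale by (simp add: funpow_add add.commute[of _ j])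
      then show "contract (k - l - j) ((ctr (\<beta> x) ^^ j) U) F x = (\<Sum>i\<le>l. coef (1 - \<tau>) (real l) i * W (i + j) (l - i))"
        using l j by (simp add: contract_sum contract_scale W_def diff_diff_add)
    qed
    finally show ?thesis by (simp add: sum_distrib_left mult.assoc)
  qed
  have "weight (b + c) x * proj_quant b c k A f (h x) =
     (\<Sum>l\<le>k. \<Sum>j\<le>k - l. \<Sum>i\<le>l. quant_coef ?\<nu> \<tau> (real k) l * coef ?\<nu> (real (k - l)) j * coef (1 - \<tau>) (real l) i * W (i + j) (l - i))"
  proof -
    have "weight (b + c) x * proj_quant b c k A f (h x) =
       (\<Sum>l\<le>k. quant_coef ?\<nu> \<tau> (real k) l * (weight (b + c) x * contract (k - l) ((div_array ^^ l) A (h x)) f (h x)))"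
      unfolding proj_quant_def \<tau>_def[symmetric] by (simp add: sum_distrib_left mult.left_commute)
    then show ?thesis by (simp add: T sum_distrib_left mult.assoc)
  qed
  also have "\<dots> = (\<Sum>p\<le>k. \<Sum>n\<le>k - p. \<Sum>i\<le>n. quant_coef ?\<nu> \<tau> (real k) (p + i) * coef ?\<nu> (real (k - (p + i))) (n - i) *
      coef (1 - \<tau>) (real (p + i)) i * W (i + (n - i)) (p + i - i))"
    by (rule sum_triangle_reindex)
  also have "\<dots> = (\<Sum>p\<le>k. \<Sum>n\<le>k - p. W n p * (\<Sum>i\<le>n. quant_coef ?\<nu> \<tau> (real k) (p + i) *
      (coef (1 - \<tau>) (real (p + i)) i * coef ?\<nu> (real (k - p - i)) (n - i))))"
    unfolding sum_distrib_left by (intro sum.cong refl) simp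
  also have "\<dots> = (\<Sum>p\<le>k. \<Sum>n\<le>k - p. W n p * (if n = 0 then quant_coef ?\<nu> \<tau> (real k) p else 0))"
    by (intro sum.cong refl arg_cong[where f = "(*) _"] sum_quant_coef_cancel) (use nz in \<open>auto simp: \<tau>_def\<close>)
  also have "\<dots> = (\<Sum>p\<le>k. quant_coef ?\<nu> \<tau> (real k) p * W 0 p)"
    by (intro sum.cong refl, subst sum.remove[of _ 0]) auto
  also have "\<dots> = proj_quant b c k a F x"
    unfolding proj_quant_def \<tau>_def[symmetric] W_def by simp
  finally show ?thesis by simp
qed

end

section \<open>Differential operators in a chart\<close>

lemma finite_length_less [simp]: "finite {J :: 'm::finite list. length J < n}"
proof -
  have "{J :: 'm list. length J < n} = (\<Union>k<n. {J. length J = k})" by auto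
  then show ?thesis by simp
qed

lemma sum_length_less:
  "(\<Sum>J :: 'm::finite list | length J < n. g J) = (\<Sum>k<n. \<Sum>J | length J = k. g J)"
proof -
  have "{J :: 'm list. length J < n} = (\<Union>k\<in>{..<n}. {J. length J = k})" by auto
  then show ?thesis by (simp only:) (subst sum.UNION_disjoint, auto)
qed

definition lower_op :: "nat \<Rightarrow> ((real^'m::finite \<Rightarrow> real) \<Rightarrow> real^'m \<Rightarrow> real) \<Rightarrow> bool" where
  "lower_op n P \<longleftrightarrow> (\<exists>a. (\<forall>J. smooth (a J)) \<and>
     (\<forall>f x. smooth f \<longrightarrow> P f x = (\<Sum>J | length J < n. a J x * partials J f x)))"

lemma lower_op_cong:
  "lower_op n P \<Longrightarrow> (\<And>f x. smooth f \<Longrightarrow> Q f x = P f x) \<Longrightarrow> lower_op n Q"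
  unfolding lower_op_def by auto

lemma lower_op_partials:
  assumes "smooth u" "length I < n"
  shows "lower_op n (\<lambda>f x. u x * partials I f x)"
proof -
  have "(\<Sum>J | length J < n. (if J = I then u x else 0) * partials J f x) = u x * partials I f x" for f x
    using assms(2) by (subst sum.remove[of _ I]) auto
  moreover have "smooth (\<lambda>x. if J = I then u x else 0)" for J
    using assms(1) by (cases "J = I") auto
  ultimately show ?thesis
    unfolding lower_op_def by (intro exI[of _ "\<lambda>J x. if J = I then u x else 0"]) auto
qed

lemma lower_op_zero: "lower_op n (\<lambda>f x. 0)"
  unfolding lower_op_def by (intro exI[of _ "\<lambda>J x. 0"]) auto

lemma lower_op_add:
  assumes "lower_op n P" "lower_op n Q" shows "lower_op n (\<lambda>f x. P f x + Q f x)"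
proof -
  from assms(1) obtain a where a: "\<And>J. smooth (a J)"
    "\<And>f x. smooth f \<Longrightarrow> P f x = (\<Sum>J | length J < n. a J x * partials J f x)"
    unfolding lower_op_def by blast
  from assms(2) obtain a' where a': "\<And>J. smooth (a' J)"
    "\<And>f x. smooth f \<Longrightarrow> Q f x = (\<Sum>J | length J < n. a' J x * partials J f x)"
    unfolding lower_op_def by blast
  have "smooth (\<lambda>x. a J x + a' J x)" for J using a(1) a'(1) by (rule smooth_add)
  then show ?thesis
    unfolding lower_op_def
    by (intro exI[of _ "\<lambda>J x. a J x + a' J x"]) (simp add: a(2) a'(2) sum.distrib distrib_right)
qed

lemma lower_op_mult:
  assumes "smooth u" "lower_op n P" shows "lower_op n (\<lambda>f x. u x * P f x)"
proof -
  from assms obtain a where a: "\<And>J. smooth (a J)"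
    "\<And>f x. smooth f \<Longrightarrow> P f x = (\<Sum>J | length J < n. a J x * partials J f x)"
    unfolding lower_op_def by blast
  have "smooth (\<lambda>x. u x * a J x)" for J using assms(1) a(1) by (rule smooth_mult)
  then show ?thesis
    unfolding lower_op_def
    by (intro exI[of _ "\<lambda>J x. u x * a J x"]) (simp add: a(2) sum_distrib_left mult.assoc)
qed

lemma lower_op_sum: "(\<And>i. i \<in> A \<Longrightarrow> lower_op n (P i)) \<Longrightarrow> lower_op n (\<lambda>f x. \<Sum>i\<in>A. P i f x)"
  by (induction A rule: infinite_finite_induct) (auto intro: lower_op_zero lower_op_add)

lemma lower_op_diff: "lower_op n P \<Longrightarrow> lower_op n Q \<Longrightarrow> lower_op n (\<lambda>f x. P f x - Q f x)"
  using lower_op_add[of n P "\<lambda>f x. - 1 * Q f x"] lower_op_mult[of "\<lambda>x. - 1" n Q] by simp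

lemma lower_op_mono:
  assumes "lower_op n P" "n \<le> n'" shows "lower_op n' P"
proof -
  from assms(1) obtain a where a: "\<And>J. smooth (a J)"
    "\<And>f x. smooth f \<Longrightarrow> P f x = (\<Sum>J | length J < n. a J x * partials J f x)"
    unfolding lower_op_def by blast
  have "lower_op n' (\<lambda>f x. \<Sum>J | length J < n. a J x * partials J f x)"
    by (intro lower_op_sum lower_op_partials a(1)) (use assms(2) in auto)
  then show ?thesis by (rule lower_op_cong) (simp add: a(2))
qed

lemma smooth_lower_op: "lower_op n P \<Longrightarrow> smooth f \<Longrightarrow> smooth (P f)"
proof -
  assume "lower_op n P" and f: "smooth f"
  then obtain a where a: "\<And>J. smooth (a J)" "\<And>x. P f x = (\<Sum>J | length J < n. a J x * partials J f x)"
    unfolding lower_op_def by blast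
  show ?thesis unfolding ext[of "P f", OF a(2)] by (intro smooth_sum smooth_mult a(1) smooth_partials f)
qed

lemma lower_op_partial:
  assumes "lower_op n P" shows "lower_op (Suc n) (\<lambda>f. partial j (P f))"
proof -
  from assms obtain a where a: "\<And>J. smooth (a J)"
    and Pf: "\<And>f x. smooth f \<Longrightarrow> P f x = (\<Sum>J | length J < n. a J x * partials J f x)"
    unfolding lower_op_def by blast
  have 1: "lower_op (Suc n) (\<lambda>f x. partial j (a J) x * partials J f x + a J x * partials (j # J) f x)"
    if "length J < n" for J
    using that by (intro lower_op_add lower_op_partials smooth_partial a) auto
  have 2: "lower_op (Suc n) (\<lambda>f x. \<Sum>J | length J < n. partial j (a J) x * partials J f x + a J x * partials (j # J) f x)"
    by (rule lower_op_sum) (use 1 in auto)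
  show ?thesis
  proof (rule lower_op_cong[OF 2])
    fix f :: "real^'a \<Rightarrow> real" and x assume f: "smooth f"
    show "partial j (P f) x = (\<Sum>J | length J < n. partial j (a J) x * partials J f x + a J x * partials (j # J) f x)"
      unfolding ext[of "P f", OF Pf[OF f]] partials_Cons
      by (subst partial_sum) (auto simp: partial_mult a f smooth_partials smooth_differentiable differentiable_mult_real)
  qed
qed

lemma sum_symmetrize:
  fixes a g :: "'m::finite list \<Rightarrow> real"
  assumes g: "\<And>I J. mset I = mset J \<Longrightarrow> g I = g J"
  shows "(\<Sum>I | length I = k. (\<Sum>J | mset J = mset I. a J) / card {J. mset J = mset I} * g I) =
    (\<Sum>I | length I = k. a I * g I)"
proof -
  have eq: "{J. mset J = mset I} = {J. length J = k \<and> mset J = mset I}" if "length I = k" for I :: "'m list" and k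
    using that mset_eq_length by auto
  have fin: "finite {J. mset J = mset I}" for I :: "'m list"
    using finite_subset[of "{J. mset J = mset I}" "{J. length J = length I}"] mset_eq_length by auto
  have "(\<Sum>I | length I = k. (\<Sum>J | mset J = mset I. a J) / card {J. mset J = mset I} * g I) =
     (\<Sum>I | length I = k. \<Sum>J | length J = k. (if mset J = mset I then a J / card {J. mset J = mset I} * g I else 0))"
  proof (intro sum.cong refl)
    fix I :: "'m list" assume "I \<in> {I. length I = k}"
    then have "(\<Sum>J | mset J = mset I. a J / card {J. mset J = mset I} * g I) =
       (\<Sum>J\<in>{J \<in> {J. length J = k}. mset J = mset I}. a J / card {J. mset J = mset I} * g I)"
      using eq[of I] by simp
    then show "(\<Sum>J | mset J = mset I. a J) / card {J. mset J = mset I} * g I =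
       (\<Sum>J | length J = k. (if mset J = mset I then a J / card {J. mset J = mset I} * g I else 0))"
      unfolding sum_divide_distrib sum_distrib_right by (simp only: sum.inter_filter[OF finite_length])
  qed
  also have "\<dots> = (\<Sum>J | length J = k. \<Sum>I | length I = k. (if mset I = mset J then a J / card {I. mset I = mset J} * g J else 0))"
  proof (subst sum.swap, intro sum.cong refl)
    fix I J :: "'m list"
    show "(if mset J = mset I then a J / card {J. mset J = mset I} * g I else 0) =
        (if mset I = mset J then a J / card {I. mset I = mset J} * g J else 0)"
    proof (cases "mset I = mset J")
      case True
      then show ?thesis using g[OF True] by simp
    qed auto
  qed
  also have "\<dots> = (\<Sum>J | length J = k. a J * g J)"
  proof (intro sum.cong refl)
    fix J :: "'m list" assume "J \<in> {I. length I = k}"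
    then have J: "length J = k" by simp
    have "(\<Sum>I | length I = k. (if mset I = mset J then a J / card {I. mset I = mset J} * g J else 0)) =
        (\<Sum>I | mset I = mset J. a J / card {I. mset I = mset J} * g J)"
      by (simp add: sum.inter_filter[symmetric] eq[OF J, symmetric])
    also have "\<dots> = a J * g J" using fin[of J] by (auto simp: card_eq_0_iff)
    finally show "(\<Sum>I | length I = k. (if mset I = mset J then a J / card {I. mset I = mset J} * g J else 0)) = a J * g J" .
  qed
  finally show ?thesis .
qed

lemma lower_op_smooth_array:
  assumes "lower_op n P"
  obtains a where "smooth_array a" "\<And>f x. smooth f \<Longrightarrow> P f x = (\<Sum>k<n. contract k (a x) f x)"
proof -
  from assms obtain a where a: "\<And>J. smooth (a J)"
    "\<And>f x. smooth f \<Longrightarrow> P f x = (\<Sum>J | length J < n. a J x * partials J f x)"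
    unfolding lower_op_def by blast
  define a' where "a' x I = (\<Sum>J | mset J = mset I. a J x) / card {J. mset J = mset I}" for x I
  have "smooth (\<lambda>x. a' x I)" for I
  proof -
    have "smooth (\<lambda>x. (1 / card {J. mset J = mset I}) * (\<Sum>J | mset J = mset I. a J x))"
      by (intro smooth_mult smooth_sum a(1)) auto
    then show ?thesis by (simp add: a'_def[abs_def])
  qed
  moreover have "symmetric_array (a' x)" for x
    unfolding symmetric_array_def a'_def by (intro allI impI) simp
  moreover have "P f x = (\<Sum>k<n. contract k (a' x) f x)" if "smooth f" for f x
    unfolding a(2)[OF that] sum_length_less contract_def a'_def
    by (intro sum.cong refl sum_symmetrize[symmetric]) (rule fun_cong[OF partials_perm[OF that]])
  ultimately show ?thesis using that[of a'] unfolding smooth_array_def by blast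
qed

subsection \<open>The standard ordering in a chart\<close>

lemma sum_sym_prod_dx:
  fixes C :: "'m::finite \<Rightarrow> 'm list \<Rightarrow> real"
  assumes "length I = Suc k"
  shows "(\<Sum>j\<in>UNIV. sym_prod 1 k (dx j) (C j) I) =
    (\<Sum>\<pi> | \<pi> permutes {..<Suc k}. C (hd (permute_list \<pi> I)) (tl (permute_list \<pi> I))) / fact k"
proof -
  have *: "take 1 (permute_list \<pi> I) = [hd (permute_list \<pi> I)]" "drop 1 (permute_list \<pi> I) = tl (permute_list \<pi> I)" for \<pi>
    using assms length_permute_list[of \<pi> I] by (cases "permute_list \<pi> I"; simp)+
  have "(\<Sum>j\<in>UNIV. dx j (take 1 (permute_list \<pi> I)) * C j (drop 1 (permute_list \<pi> I))) =
     C (hd (permute_list \<pi> I)) (tl (permute_list \<pi> I))" for \<pi>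
    unfolding * dx_def by (simp add: sum_kronecker[of "hd (permute_list \<pi> I)"] eq_commute[of "hd _"])
  then show ?thesis
    unfolding sym_prod_def sum_divide_distrib[symmetric] by (subst sum.swap) simp
qed

lemma lower_op_cov_deriv:
  assumes \<Gamma>: "\<And>k i j. smooth (\<lambda>x. \<Gamma> x k i j)"
    and D: "\<And>I. length I = k \<Longrightarrow> lower_op k (\<lambda>f x. D f x I - fact k * partials I f x)"
    and I: "length I = k"
  shows "lower_op (Suc k) (\<lambda>f x. cov_deriv b \<Gamma> j (D f) x I - fact k * partials (j # I) f x)"
proof -
  have D1: "lower_op (Suc k) (\<lambda>f x. D f x J)" if "length J = k" for J
  proof -
    have "lower_op (Suc k) (\<lambda>f x. (D f x J - fact k * partials J f x) + fact k * partials J f x)"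
      using that by (intro lower_op_add lower_op_mono[OF D[OF that]] lower_op_partials) auto
    then show ?thesis by simp
  qed
  have 1: "lower_op (Suc k) (\<lambda>f. partial j (\<lambda>x. D f x I - fact k * partials I f x))"
    by (rule lower_op_partial[OF D[OF I]])
  have 2: "lower_op (Suc k) (\<lambda>f x. \<Sum>r<length I. \<Sum>l\<in>UNIV. \<Gamma> x l j (I ! r) * D f x (I[r := l]))"
    by (intro lower_op_sum lower_op_mult D1 \<Gamma>) (use I in auto)
  have 3: "lower_op (Suc k) (\<lambda>f x. (b * (\<Sum>i\<in>UNIV. \<Gamma> x i j i)) * D f x I)"
    by (intro lower_op_mult D1 smooth_mult smooth_sum \<Gamma> smooth_const I)
  show ?thesis
  proof (rule lower_op_cong[OF lower_op_diff[OF lower_op_diff[OF 1 2] 3]])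
    fix f :: "real^'a \<Rightarrow> real" and x assume f: "smooth f"
    have "smooth (\<lambda>x. D f x I)" by (rule smooth_lower_op[OF D1[OF I] f])
    then have "partial j (\<lambda>x. D f x I - fact k * partials I f x) x = partial j (\<lambda>x. D f x I) x - fact k * partials (j # I) f x"
      using f by (simp add: partial_diff partial_cmult smooth_partials smooth_differentiable
          differentiable_mult_real partials_Cons)
    then show "cov_deriv b \<Gamma> j (D f) x I - fact k * partials (j # I) f x =
       partial j (\<lambda>x. D f x I - fact k * partials I f x) x -
          (\<Sum>r<length I. \<Sum>l\<in>UNIV. \<Gamma> x l j (I ! r) * D f x (I[r := l])) - (b * (\<Sum>i\<in>UNIV. \<Gamma> x i j i)) * D f x I"
      by (simp add: cov_deriv_def)
  qed
qed

lemma lower_op_sym_deriv_pow: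
  assumes \<Gamma>: "\<And>k i j. smooth (\<lambda>x. \<Gamma> x k i j)"
  shows "length I = k \<Longrightarrow> lower_op k (\<lambda>f x. sym_deriv_pow b \<Gamma> k f x I - fact k * partials I f x)"
proof (induction k arbitrary: I)
  case 0 then show ?case using lower_op_zero by simp
next
  case (Suc k)
  let ?\<Pi> = "{\<pi>. \<pi> permutes {..<Suc k}}"
  let ?h = "\<lambda>\<pi>. hd (permute_list \<pi> I)" and ?t = "\<lambda>\<pi>. tl (permute_list \<pi> I)"
  let ?D = "sym_deriv_pow b \<Gamma> k"
  have ne: "permute_list \<pi> I = ?h \<pi> # ?t \<pi>" for \<pi>
    using Suc.prems length_permute_list[of \<pi> I] by (cases "permute_list \<pi> I") auto
  have lt: "length (?t \<pi>) = k" for \<pi>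
    using Suc.prems length_permute_list[of \<pi> I] by simp
  have c: "lower_op (Suc k) (\<lambda>f x. cov_deriv b \<Gamma> (?h \<pi>) (?D f) x (?t \<pi>) - fact k * partials (?h \<pi> # ?t \<pi>) f x)" for \<pi>
    by (rule lower_op_cov_deriv[OF \<Gamma> Suc.IH lt])
  have "lower_op (Suc k) (\<lambda>f x. (1 / fact k) * (\<Sum>\<pi>\<in>?\<Pi>. cov_deriv b \<Gamma> (?h \<pi>) (?D f) x (?t \<pi>) - fact k * partials (?h \<pi> # ?t \<pi>) f x))"
    by (intro lower_op_mult lower_op_sum c smooth_const)
  then show ?case
  proof (rule lower_op_cong)
    fix f :: "real^'a \<Rightarrow> real" and x assume f: "smooth f"
    have "partials (?h \<pi> # ?t \<pi>) f x = partials I f x" if "\<pi> \<in> ?\<Pi>" for \<pi>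
      unfolding ne[symmetric] using that Suc.prems by (intro fun_cong[OF partials_perm[OF f]]) simp
    then have "(\<Sum>\<pi>\<in>?\<Pi>. fact k * partials (?h \<pi> # ?t \<pi>) f x) = real (card ?\<Pi>) * (fact k * partials I f x)" by simp
    also have "card ?\<Pi> = fact (Suc k)" by (rule card_permutations) auto
    finally show "sym_deriv_pow b \<Gamma> (Suc k) f x I - fact (Suc k) * partials I f x =
       (1 / fact k) * (\<Sum>\<pi>\<in>?\<Pi>. cov_deriv b \<Gamma> (?h \<pi>) (?D f) x (?t \<pi>) - fact k * partials (?h \<pi> # ?t \<pi>) f x)"
      unfolding sum_subtractf sym_deriv_pow.simps sym_deriv_def sum_sym_prod_dx[OF Suc.prems]
      by (simp add: diff_divide_distrib algebra_simps)
  qed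
qed

lemma lower_op_insertion:
  assumes \<Gamma>: "\<And>k i j. smooth (\<lambda>x. \<Gamma> x k i j)" and a: "\<And>I. smooth (\<lambda>x. a x I)"
  shows "lower_op k (\<lambda>f x. insertion k (a x) (sym_deriv_pow b \<Gamma> k f x) - contract k (a x) f x)"
proof -
  have "lower_op k (\<lambda>f x. (1 / fact k) * (\<Sum>I | length I = k. a x I * (sym_deriv_pow b \<Gamma> k f x I - fact k * partials I f x)))"
    by (intro lower_op_mult lower_op_sum smooth_const a lower_op_sym_deriv_pow \<Gamma>) auto
  then show ?thesis
    by (rule lower_op_cong)
      (simp add: insertion_def contract_def right_diff_distrib sum_subtractf diff_divide_distrib sum_divide_distrib)
qed

lemma smooth_sym_deriv_pow:
  assumes \<Gamma>: "\<And>k i j. smooth (\<lambda>x. \<Gamma> x k i j)" and f: "smooth f" and I: "length I = k"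
  shows "smooth (\<lambda>x. sym_deriv_pow b \<Gamma> k f x I)"
proof -
  have "smooth (\<lambda>x. (sym_deriv_pow b \<Gamma> k f x I - fact k * partials I f x) + fact k * partials I f x)"
    using smooth_lower_op[OF lower_op_sym_deriv_pow[OF \<Gamma> I] f]
    by (intro smooth_add smooth_mult smooth_partials f smooth_const)
  then show ?thesis by simp
qed

lemma lower_op_proj_quant:
  assumes a: "smooth_array a"
  shows "lower_op k (\<lambda>f x. proj_quant b c k a f x - contract k (a x) f x)"
proof -
  define q where "q = quant_coef (b * (real CARD('a) + 1)) (2 * real k + real CARD('a) - c * (real CARD('a) + 1)) (real k)"
  have "lower_op k (\<lambda>f x. \<Sum>l\<in>{1..k}. \<Sum>I | length I = k - l. (q l * (div_array ^^ l) a x I) * partials I f x)"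
    by (intro lower_op_sum lower_op_partials smooth_mult smooth_const smooth_arrayD(1)[OF smooth_array_div_pow[OF a]]) auto
  then show ?thesis
  proof (rule lower_op_cong)
    fix f :: "real^'a \<Rightarrow> real" and x
    have "{..k} - {0} = {1..k}" by auto
    then have "(\<Sum>l\<le>k. q l * contract (k - l) ((div_array ^^ l) a x) f x) =
        q 0 * contract k (a x) f x + (\<Sum>l\<in>{1..k}. q l * contract (k - l) ((div_array ^^ l) a x) f x)"
      using sum.remove[of "{..k}" 0 "\<lambda>l. q l * contract (k - l) ((div_array ^^ l) a x) f x"] by simp
    moreover have "q 0 = 1" by (simp add: q_def)
    ultimately show "proj_quant b c k a f x - contract k (a x) f x =
        (\<Sum>l\<in>{1..k}. \<Sum>I | length I = k - l. (q l * (div_array ^^ l) a x I) * partials I f x)"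
      unfolding proj_quant_def q_def[symmetric] by (simp add: contract_def sum_distrib_left mult.assoc)
  qed
qed

definition tpow_except :: "real^'m^'n \<Rightarrow> nat \<Rightarrow> 'n list \<Rightarrow> 'm list \<Rightarrow> real" where
  "tpow_except M r L I = (\<Prod>s\<in>{..<length I} - {r}. M $ (L ! s) $ (I ! s))"

lemma tpow_slot:
  assumes "r < length I" "length L = length I"
  shows "tpow M L I = M $ (L ! r) $ (I ! r) * tpow_except M r L I"
  using assms prod_eq_tpow[of L I M] prod.remove[of "{..<length I}" r "\<lambda>s. M $ (L ! s) $ (I ! s)"]
  by (simp add: tpow_except_def)

lemma tpow_except_update:
  "tpow_except M r L (I[r := i]) = tpow_except M r L I"
  "tpow_except M r (L[r := i]) I = tpow_except M r L I"
  unfolding tpow_except_def by (auto intro!: prod.cong)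

lemma tpow_permute:
  assumes "\<pi> permutes {..<n}" "length L = n" "length I = n"
  shows "tpow M (permute_list \<pi> L) (permute_list \<pi> I) = tpow M L I"
proof -
  have "tpow M (permute_list \<pi> L) (permute_list \<pi> I) = (\<Prod>r<n. M $ (L ! \<pi> r) $ (I ! \<pi> r))"
    using assms by (subst prod_eq_tpow[symmetric]) (auto simp: permute_list_nth)
  also have "\<dots> = (\<Prod>r<n. M $ (L ! r) $ (I ! r))"
    using prod.permute[OF assms(1), of "\<lambda>r. M $ (L ! r) $ (I ! r)"] by (simp add: o_def)
  finally show ?thesis using assms prod_eq_tpow[of L I M] by simp
qed

lemma sum_permute_list:
  assumes "\<pi> permutes {..<n}"
  shows "(\<Sum>L :: 'm::finite list | length L = n. g (permute_list \<pi> L)) = (\<Sum>L | length L = n. g L)"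
proof (rule sum.reindex_bij_witness[of _ "permute_list (inv \<pi>)" "permute_list \<pi>"])
  have i: "inv \<pi> permutes {..<n}" using permutes_inv[OF assms] .
  have "permute_list \<pi> (permute_list (inv \<pi>) L) = L" "permute_list (inv \<pi>) (permute_list \<pi> L) = L"
    if "length L = n" for L :: "'m list"
    using permute_list_compose[of \<pi> L "inv \<pi>"] permute_list_compose[of "inv \<pi>" L \<pi>] assms i that
      permutes_inv_o[OF assms] by simp_all
  then show "permute_list (inv \<pi>) (permute_list \<pi> L) = L" if "L \<in> {L. length L = n}" for L :: "'m list" using that by simp
  show "permute_list \<pi> (permute_list (inv \<pi>) L) = L" if "L \<in> {L. length L = n}" for L :: "'m list"
    using \<open>\<And>L. length L = n \<Longrightarrow> permute_list \<pi> (permute_list (inv \<pi>) L) = L\<close> that by simp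
qed auto

context projective_change begin

lemma cov_deriv_covariant:
  fixes G :: "real^'m \<Rightarrow> 'm list \<Rightarrow> real"
  assumes law: "\<And>a i j. (\<Sum>k\<in>UNIV. H x $ a $ k * \<Gamma> x k i j) =
      - (H x $ a $ i * \<beta> x j + H x $ a $ j * \<beta> x i)
      + (\<Sum>p\<in>UNIV. \<Sum>q\<in>UNIV. \<Gamma>' (h x) a p q * H x $ p $ i * H x $ q $ j)"
    and x: "x \<in> S" and G: "\<And>J. length J = k \<Longrightarrow> (\<lambda>y. G y J) differentiable (at (h x))"
    and \<gamma>: "\<And>y J. y \<in> S \<Longrightarrow> length J = k \<Longrightarrow> \<gamma> y J = pull_cov b G y J"
    and I: "length I = k"
  shows "cov_deriv b \<Gamma> j \<gamma> x I = (\<Sum>a\<in>UNIV. H x $ a $ j * pull_cov b (\<lambda>y. cov_deriv b \<Gamma>' a G y) x I)"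
proof -
  let ?m = "real CARD('m)" and ?K = "matrix_inv (H x)" and ?P = "pull_cov b G x"
  define Q where "Q a r = pull_cov b (\<lambda>y L. \<Sum>l\<in>UNIV. \<Gamma>' y l a (L ! r) * G y (L[r := l])) x I" for a r
  have G': "\<And>J. length J = length I \<Longrightarrow> (\<lambda>y. G y J) differentiable (at (h x))" using G I by simp
  have P1: "partial j (\<lambda>y. \<gamma> y I) x = partial j (\<lambda>y. pull_cov b G y I) x"
    by (rule partial_cong_open(1)[OF open_S x, symmetric]) (auto simp: \<gamma> I intro: partial_pull_cov(1)[OF x G'])
  have slot: "(\<Sum>l\<in>UNIV. \<Gamma> x l j (I ! r) * \<gamma> x (I[r := l])) =
      - (\<beta> x (I ! r) * ?P (I[r := j]) + \<beta> x j * ?P I) + (\<Sum>a\<in>UNIV. H x $ a $ j * Q a r)" if r: "r < k" for r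
  proof -
    let ?T = "\<lambda>L. tpow_except (H x) r L I"
    have t: "tpow (H x) L (I[r := l]) = H x $ (L ! r) $ l * ?T L" if "length L = k" for L l
      using tpow_slot[of r "I[r := l]" L "H x"] that r I by (simp add: tpow_except_update)
    have t': "tpow (H x) L I = H x $ (L ! r) $ (I ! r) * ?T L" if "length L = k" for L
      using tpow_slot[of r I L "H x"] that r I by simp
    have "(\<Sum>l\<in>UNIV. \<Gamma> x l j (I ! r) * \<gamma> x (I[r := l])) =
        weight b x * (\<Sum>l\<in>UNIV. \<Sum>L | length L = k. \<Gamma> x l j (I ! r) * (H x $ (L ! r) $ l * ?T L * G (h x) L))"
      using x I by (simp add: \<gamma> pull_cov_def t sum_distrib_left mult.left_commute)
    also have "(\<Sum>l\<in>UNIV. \<Sum>L | length L = k. \<Gamma> x l j (I ! r) * (H x $ (L ! r) $ l * ?T L * G (h x) L)) =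
        (\<Sum>L | length L = k. (\<Sum>l\<in>UNIV. H x $ (L ! r) $ l * \<Gamma> x l j (I ! r)) * (?T L * G (h x) L))"
      unfolding sum_distrib_right by (subst sum.swap, intro sum.cong refl) (simp only: mult_ac)
    also have "\<dots> = (\<Sum>L | length L = k. - (\<beta> x (I ! r) * (H x $ (L ! r) $ j * ?T L * G (h x) L) +
          \<beta> x j * (H x $ (L ! r) $ (I ! r) * ?T L * G (h x) L))
        + (\<Sum>p\<in>UNIV. \<Sum>q\<in>UNIV. \<Gamma>' (h x) (L ! r) p q * H x $ p $ j * H x $ q $ (I ! r)) * (?T L * G (h x) L))"
    proof -
      have "(- (u * p + v * q) + Z) * (T * g) = - (p * (u * T * g) + q * (v * T * g)) + Z * (T * g)" for u p v q Z T g :: real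
        by (simp add: algebra_simps)
      then show ?thesis unfolding law by (intro sum.cong refl)
    qed
    also have "\<dots> = - (\<beta> x (I ! r) * (\<Sum>L | length L = k. H x $ (L ! r) $ j * ?T L * G (h x) L) +
          \<beta> x j * (\<Sum>L | length L = k. H x $ (L ! r) $ (I ! r) * ?T L * G (h x) L))
        + (\<Sum>L | length L = k. (\<Sum>p\<in>UNIV. \<Sum>q\<in>UNIV. \<Gamma>' (h x) (L ! r) p q * H x $ p $ j * H x $ q $ (I ! r)) * (?T L * G (h x) L))"
      by (simp only: sum.distrib sum_negf sum_distrib_left)
    also have "(\<Sum>L | length L = k. (\<Sum>p\<in>UNIV. \<Sum>q\<in>UNIV. \<Gamma>' (h x) (L ! r) p q * H x $ p $ j * H x $ q $ (I ! r)) * (?T L * G (h x) L)) =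
        (\<Sum>p\<in>UNIV. H x $ p $ j * (\<Sum>q\<in>UNIV. \<Sum>L | length L = k. \<Gamma>' (h x) (L ! r) p q * H x $ q $ (I ! r) * ?T L * G (h x) L))"
    proof -
      have "(\<Sum>L | length L = k. (\<Sum>p\<in>UNIV. \<Sum>q\<in>UNIV. \<Gamma>' (h x) (L ! r) p q * H x $ p $ j * H x $ q $ (I ! r)) * (?T L * G (h x) L)) =
         (\<Sum>L | length L = k. \<Sum>p\<in>UNIV. \<Sum>q\<in>UNIV. H x $ p $ j * (\<Gamma>' (h x) (L ! r) p q * H x $ q $ (I ! r) * ?T L * G (h x) L))"
        unfolding sum_distrib_right by (intro sum.cong refl) (simp only: mult_ac)
      also have "\<dots> = (\<Sum>p\<in>UNIV. \<Sum>q\<in>UNIV. \<Sum>L | length L = k. H x $ p $ j * (\<Gamma>' (h x) (L ! r) p q * H x $ q $ (I ! r) * ?T L * G (h x) L))"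
        by (subst sum.swap, rule sum.cong[OF refl], rule sum.swap)
      finally show ?thesis unfolding sum_distrib_left .
    qed
    finally have S0: "(\<Sum>l\<in>UNIV. \<Gamma> x l j (I ! r) * \<gamma> x (I[r := l])) = weight b x * (
        - (\<beta> x (I ! r) * (\<Sum>L | length L = k. H x $ (L ! r) $ j * ?T L * G (h x) L) +
          \<beta> x j * (\<Sum>L | length L = k. H x $ (L ! r) $ (I ! r) * ?T L * G (h x) L))
        + (\<Sum>p\<in>UNIV. H x $ p $ j * (\<Sum>q\<in>UNIV. \<Sum>L | length L = k. \<Gamma>' (h x) (L ! r) p q * H x $ q $ (I ! r) * ?T L * G (h x) L)))" .
    have Z: "(\<Sum>q\<in>UNIV. \<Sum>L | length L = k. \<Gamma>' (h x) (L ! r) p q * H x $ q $ (I ! r) * ?T L * G (h x) L) =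
        (\<Sum>L | length L = k. tpow (H x) L I * (\<Sum>l\<in>UNIV. \<Gamma>' (h x) l p (L ! r) * G (h x) (L[r := l])))" for p
    proof -
      have "(\<Sum>q\<in>UNIV. \<Sum>L | length L = k. \<Gamma>' (h x) (L ! r) p q * H x $ q $ (I ! r) * ?T L * G (h x) L) =
         (\<Sum>q\<in>UNIV. \<Sum>L | length L = k. \<Gamma>' (h x) q p (L ! r) * H x $ (L ! r) $ (I ! r) * ?T L * G (h x) (L[r := q]))"
        by (subst sum_swap_slot[OF r], intro sum.cong refl) (use r in \<open>simp add: tpow_except_update\<close>)
      also have "\<dots> = (\<Sum>L | length L = k. \<Sum>q\<in>UNIV. tpow (H x) L I * (\<Gamma>' (h x) q p (L ! r) * G (h x) (L[r := q])))"
        by (subst sum.swap, intro sum.cong refl) (simp add: t')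
      finally show ?thesis unfolding sum_distrib_left .
    qed
    have S: "(\<Sum>l\<in>UNIV. \<Gamma> x l j (I ! r) * \<gamma> x (I[r := l])) = weight b x * (
        - (\<beta> x (I ! r) * (\<Sum>L | length L = k. H x $ (L ! r) $ j * ?T L * G (h x) L) +
          \<beta> x j * (\<Sum>L | length L = k. H x $ (L ! r) $ (I ! r) * ?T L * G (h x) L))
        + (\<Sum>p\<in>UNIV. H x $ p $ j * (\<Sum>L | length L = k. tpow (H x) L I * (\<Sum>l\<in>UNIV. \<Gamma>' (h x) l p (L ! r) * G (h x) (L[r := l])))))"
      unfolding S0 Z ..
    have e1: "?P (I[r := j]) = weight b x * (\<Sum>L | length L = k. H x $ (L ! r) $ j * ?T L * G (h x) L)"
      unfolding pull_cov_def using I by (simp add: t)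
    have e2: "?P I = weight b x * (\<Sum>L | length L = k. H x $ (L ! r) $ (I ! r) * ?T L * G (h x) L)"
      unfolding pull_cov_def using I by (simp add: t')
    have e3: "(\<Sum>a\<in>UNIV. H x $ a $ j * Q a r) = weight b x *
        (\<Sum>p\<in>UNIV. H x $ p $ j * (\<Sum>L | length L = k. tpow (H x) L I * (\<Sum>l\<in>UNIV. \<Gamma>' (h x) l p (L ! r) * G (h x) (L[r := l]))))"
      unfolding Q_def pull_cov_def I by (simp only: sum_distrib_left[of "weight b x" _ UNIV] mult.left_commute)
    have "w * (- (u * X + v * Y) + Z) = - (u * (w * X) + v * (w * Y)) + w * Z" for w u v X Y Z :: real
      by (simp add: algebra_simps)
    then show ?thesis unfolding S e1 e2 e3 .
  qed
  have trace: "(\<Sum>i\<in>UNIV. \<Gamma> x i j i) = - ((?m + 1) * \<beta> x j) + (\<Sum>p\<in>UNIV. H x $ p $ j * (\<Sum>q\<in>UNIV. \<Gamma>' (h x) q p q))"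
  proof -
    have "(\<Sum>i\<in>UNIV. \<Gamma> x i j i) = (\<Sum>i\<in>UNIV. \<Sum>k\<in>UNIV. (if k = i then 1 else 0) * \<Gamma> x k j i)"
      unfolding sum_kronecker ..
    also have "\<dots> = (\<Sum>i\<in>UNIV. \<Sum>k\<in>UNIV. \<Sum>a\<in>UNIV. ?K $ i $ a * (H x $ a $ k * \<Gamma> x k j i))"
    proof (intro sum.cong refl)
      fix i k
      have "(if k = i then 1 else 0) * \<Gamma> x k j i = (if i = k then 1 else 0) * \<Gamma> x k j i" by simp
      then show "(if k = i then 1 else 0) * \<Gamma> x k j i = (\<Sum>a\<in>UNIV. ?K $ i $ a * (H x $ a $ k * \<Gamma> x k j i))"
        unfolding H_inverse_component(1)[OF x, symmetric] sum_distrib_right by (simp only: mult.assoc)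
    qed
    also have "\<dots> = (\<Sum>i\<in>UNIV. \<Sum>a\<in>UNIV. ?K $ i $ a * (\<Sum>k\<in>UNIV. H x $ a $ k * \<Gamma> x k j i))"
      unfolding sum_distrib_left by (rule sum.cong[OF refl], rule sum.swap)
    also have "\<dots> = (\<Sum>i\<in>UNIV. \<Sum>a\<in>UNIV. - (?K $ i $ a * (H x $ a $ j * \<beta> x i)) - ?K $ i $ a * (H x $ a $ i * \<beta> x j)
        + ?K $ i $ a * (\<Sum>p\<in>UNIV. \<Sum>q\<in>UNIV. \<Gamma>' (h x) a p q * H x $ p $ j * H x $ q $ i))"
    proof -
      have "K * (- (u * p + v * q) + Z) = - (K * (u * p)) - K * (v * q) + K * Z" for K u p v q Z :: real
        by (simp add: algebra_simps)
      moreover have "(\<Sum>k\<in>UNIV. H x $ a $ k * \<Gamma> x k j i) = - (H x $ a $ j * \<beta> x i + H x $ a $ i * \<beta> x j)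
          + (\<Sum>p\<in>UNIV. \<Sum>q\<in>UNIV. \<Gamma>' (h x) a p q * H x $ p $ j * H x $ q $ i)" for a i
        by (rule law)
      ultimately show ?thesis by (simp only:)
    qed
    also have "\<dots> = - \<beta> x j - ?m * \<beta> x j +
        (\<Sum>i\<in>UNIV. \<Sum>a\<in>UNIV. ?K $ i $ a * (\<Sum>p\<in>UNIV. \<Sum>q\<in>UNIV. \<Gamma>' (h x) a p q * H x $ p $ j * H x $ q $ i))"
      by (simp only: sum.distrib sum_subtractf sum_negf sum_H_inverse[OF x])
    also have "(\<Sum>i\<in>UNIV. \<Sum>a\<in>UNIV. ?K $ i $ a * (\<Sum>p\<in>UNIV. \<Sum>q\<in>UNIV. \<Gamma>' (h x) a p q * H x $ p $ j * H x $ q $ i)) =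
        (\<Sum>p\<in>UNIV. \<Sum>q\<in>UNIV. \<Sum>a\<in>UNIV. \<Sum>i\<in>UNIV. ?K $ i $ a * (\<Gamma>' (h x) a p q * H x $ p $ j * H x $ q $ i))"
      unfolding sum_distrib_left by (rule sum_swap4)
    also have "\<dots> = (\<Sum>p\<in>UNIV. \<Sum>q\<in>UNIV. \<Sum>a\<in>UNIV. (\<Sum>i\<in>UNIV. H x $ q $ i * ?K $ i $ a) * (\<Gamma>' (h x) a p q * H x $ p $ j))"
      unfolding sum_distrib_right by (intro sum.cong refl) (simp only: mult_ac)
    also have "\<dots> = (\<Sum>p\<in>UNIV. \<Sum>q\<in>UNIV. \<Gamma>' (h x) q p q * H x $ p $ j)"
    proof (intro sum.cong refl)
      fix p q
      have "(\<Sum>a\<in>UNIV. (if q = a then 1 else 0) * (\<Gamma>' (h x) a p q * H x $ p $ j)) =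
          (\<Sum>a\<in>UNIV. (if a = q then 1 else 0) * (\<Gamma>' (h x) a p q * H x $ p $ j))"
        by (intro sum.cong refl) simp
      then show "(\<Sum>a\<in>UNIV. (\<Sum>i\<in>UNIV. H x $ q $ i * ?K $ i $ a) * (\<Gamma>' (h x) a p q * H x $ p $ j)) = \<Gamma>' (h x) q p q * H x $ p $ j"
        unfolding H_inverse_component(2)[OF x] sum_kronecker .
    qed
    finally show ?thesis by (simp add: sum_distrib_left algebra_simps)
  qed
  have rhs: "pull_cov b (\<lambda>y. cov_deriv b \<Gamma>' a G y) x I = pull_cov b (\<lambda>y J. partial a (\<lambda>z. G z J) y) x I
     - (\<Sum>r<k. Q a r) - b * (\<Sum>q\<in>UNIV. \<Gamma>' (h x) q a q) * ?P I" for a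
  proof -
    have "(\<Sum>r<k. Q a r) = weight b x * (\<Sum>L | length L = k. tpow (H x) L I *
        (\<Sum>r<k. \<Sum>l\<in>UNIV. \<Gamma>' (h x) l a (L ! r) * G (h x) (L[r := l])))"
      unfolding Q_def pull_cov_def I sum_distrib_left[of "weight b x", symmetric] sum_distrib_left[of "tpow _ _ _" _ "{..<k}"]
      by (subst sum.swap) (rule refl)
    moreover have "(\<Sum>L | length L = k. tpow (H x) L I * (b * (\<Sum>q\<in>UNIV. \<Gamma>' (h x) q a q) * G (h x) L)) =
        b * (\<Sum>q\<in>UNIV. \<Gamma>' (h x) q a q) * (\<Sum>L | length L = k. tpow (H x) L I * G (h x) L)"
      by (simp only: sum_distrib_left[of "b * _"] mult.left_commute)
    moreover have "pull_cov b (\<lambda>y. cov_deriv b \<Gamma>' a G y) x I = weight b x * (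
        (\<Sum>L | length L = k. tpow (H x) L I * partial a (\<lambda>z. G z L) (h x))
        - (\<Sum>L | length L = k. tpow (H x) L I * (\<Sum>r<k. \<Sum>l\<in>UNIV. \<Gamma>' (h x) l a (L ! r) * G (h x) (L[r := l])))
        - (\<Sum>L | length L = k. tpow (H x) L I * (b * (\<Sum>q\<in>UNIV. \<Gamma>' (h x) q a q) * G (h x) L)))"
      unfolding pull_cov_def cov_deriv_def I sum_subtractf[symmetric] right_diff_distrib[symmetric]
      by (intro arg_cong[where f = "(*) _"] sum.cong refl) simp
    ultimately show ?thesis
      unfolding pull_cov_def I by (simp add: right_diff_distrib)
  qed
  have "cov_deriv b \<Gamma> j \<gamma> x I = (\<Sum>a\<in>UNIV. H x $ a $ j * pull_cov b (\<lambda>y J. partial a (\<lambda>z. G z J) y) x I)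
     - (real k + b * (?m + 1)) * \<beta> x j * ?P I
     - (\<Sum>r<k. \<beta> x (I ! r) * ?P (I[r := j]))
     - (\<Sum>r<k. - (\<beta> x (I ! r) * ?P (I[r := j]) + \<beta> x j * ?P I) + (\<Sum>a\<in>UNIV. H x $ a $ j * Q a r))
     - b * (- ((?m + 1) * \<beta> x j) + (\<Sum>p\<in>UNIV. H x $ p $ j * (\<Sum>q\<in>UNIV. \<Gamma>' (h x) q p q))) * ?P I"
    unfolding cov_deriv_def P1 trace I \<gamma>[OF x I]
    using partial_pull_cov(2)[where G = G and I = I and b = b and j = j, OF x G'] by (simp add: slot I)
  also have "\<dots> = (\<Sum>a\<in>UNIV. H x $ a $ j * pull_cov b (\<lambda>y J. partial a (\<lambda>z. G z J) y) x I)
     - (\<Sum>r<k. \<Sum>a\<in>UNIV. H x $ a $ j * Q a r) - b * (\<Sum>p\<in>UNIV. H x $ p $ j * (\<Sum>q\<in>UNIV. \<Gamma>' (h x) q p q)) * ?P I"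
    by (simp only: sum.distrib sum_negf sum_constant card_lessThan) (simp add: algebra_simps)
  also have "(\<Sum>r<k. \<Sum>a\<in>UNIV. H x $ a $ j * Q a r) = (\<Sum>a\<in>UNIV. H x $ a $ j * (\<Sum>r<k. Q a r))"
    unfolding sum_distrib_left by (rule sum.swap)
  finally show ?thesis
    unfolding rhs by (simp add: right_diff_distrib sum_subtractf sum_distrib_left sum_distrib_right mult_ac)
qed

lemma sym_deriv_pow_covariant:
  assumes law: "\<And>x a i j. x \<in> S \<Longrightarrow> (\<Sum>k\<in>UNIV. H x $ a $ k * \<Gamma> x k i j) =
      - (H x $ a $ i * \<beta> x j + H x $ a $ j * \<beta> x i)
      + (\<Sum>p\<in>UNIV. \<Sum>q\<in>UNIV. \<Gamma>' (h x) a p q * H x $ p $ i * H x $ q $ j)"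
    and \<Gamma>': "\<And>k i j. smooth (\<lambda>x. \<Gamma>' x k i j)"
    and f: "smooth f" and eq: "\<And>y. y \<in> S \<Longrightarrow> F y = weight b y * f (h y)"
  shows "x \<in> S \<Longrightarrow> length I = k \<Longrightarrow> sym_deriv_pow b \<Gamma> k F x I = pull_cov b (sym_deriv_pow b \<Gamma>' k f) x I"
proof (induction k arbitrary: x I)
  case 0
  then show ?case by (simp add: pull_cov_def eq)
next
  case (Suc k)
  let ?\<Pi> = "{\<pi>. \<pi> permutes {..<Suc k}}"
  let ?G = "sym_deriv_pow b \<Gamma>' k f"
  define C where "C L = cov_deriv b \<Gamma>' (hd L) ?G (h x) (tl L)" for L
  have dG: "(\<lambda>y. ?G y J) differentiable (at (h x))" if "length J = k" for J
    using smooth_differentiable[OF smooth_sym_deriv_pow[OF \<Gamma>' f that]] .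
  have c: "cov_deriv b \<Gamma> j (sym_deriv_pow b \<Gamma> k F) x J = weight b x * (\<Sum>L | length L = Suc k. tpow (H x) L (j # J) * C L)"
    if "length J = k" for j J
    using cov_deriv_covariant[where \<Gamma> = \<Gamma> and \<Gamma>' = \<Gamma>' and G = ?G and \<gamma> = "sym_deriv_pow b \<Gamma> k F",
        OF law[OF Suc.prems(1)] Suc.prems(1) dG Suc.IH that, of j] that
    by (simp add: pull_cov_def sum_length_Suc C_def sum_distrib_left mult_ac)
  have p: "hd (permute_list \<pi> I) # tl (permute_list \<pi> I) = permute_list \<pi> I" "length (tl (permute_list \<pi> I)) = k" for \<pi>
    using Suc.prems(2) length_permute_list[of \<pi> I] by (cases "permute_list \<pi> I"; simp)+
  have "sym_deriv_pow b \<Gamma> (Suc k) F x I =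
      (\<Sum>\<pi>\<in>?\<Pi>. weight b x * (\<Sum>L | length L = Suc k. tpow (H x) L (permute_list \<pi> I) * C L)) / fact k"
    unfolding sym_deriv_pow.simps sym_deriv_def sum_sym_prod_dx[OF Suc.prems(2)] c[OF p(2)] p(1) ..
  also have "\<dots> = (\<Sum>\<pi>\<in>?\<Pi>. weight b x * (\<Sum>L | length L = Suc k. tpow (H x) L I * C (permute_list \<pi> L))) / fact k"
  proof (rule arg_cong[where f = "\<lambda>u. u / _"], rule sum.cong[OF refl], rule arg_cong[where f = "(*) _"])
    fix \<pi> assume "\<pi> \<in> ?\<Pi>"
    then have \<pi>: "\<pi> permutes {..<Suc k}" by simp
    have "(\<Sum>L | length L = Suc k. tpow (H x) L (permute_list \<pi> I) * C L) =
       (\<Sum>L | length L = Suc k. tpow (H x) (permute_list \<pi> L) (permute_list \<pi> I) * C (permute_list \<pi> L))"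
      by (rule sum_permute_list[OF \<pi>, symmetric])
    also have "\<dots> = (\<Sum>L | length L = Suc k. tpow (H x) L I * C (permute_list \<pi> L))"
      by (intro sum.cong refl) (simp add: tpow_permute[OF \<pi> _ Suc.prems(2)])
    finally show "(\<Sum>L | length L = Suc k. tpow (H x) L (permute_list \<pi> I) * C L) = \<dots>" .
  qed
  also have "\<dots> = weight b x * (\<Sum>L | length L = Suc k. tpow (H x) L I * ((\<Sum>\<pi>\<in>?\<Pi>. C (permute_list \<pi> L)) / fact k))"
    unfolding sum_distrib_left[of "weight b x", symmetric]
    by (subst sum.swap) (simp add: sum_distrib_left sum_divide_distrib)
  also have "\<dots> = pull_cov b (sym_deriv_pow b \<Gamma>' (Suc k) f) x I"
    unfolding pull_cov_def Suc.prems(2) C_def sym_deriv_pow.simps sym_deriv_def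
    by (intro arg_cong[where f = "(*) _"] sum.cong refl) (subst sum_sym_prod_dx, auto)
  finally show ?case .
qed

lemma insertion_covariant:
  assumes law: "\<And>x a i j. x \<in> S \<Longrightarrow> (\<Sum>k\<in>UNIV. H x $ a $ k * \<Gamma> x k i j) =
      - (H x $ a $ i * \<beta> x j + H x $ a $ j * \<beta> x i)
      + (\<Sum>p\<in>UNIV. \<Sum>q\<in>UNIV. \<Gamma>' (h x) a p q * H x $ p $ i * H x $ q $ j)"
    and \<Gamma>': "\<And>k i j. smooth (\<lambda>x. \<Gamma>' x k i j)"
    and f: "smooth f" and eq: "\<And>y. y \<in> S \<Longrightarrow> F y = weight b y * f (h y)"
    and rel: "push_related c k a A" and x: "x \<in> S"
  shows "insertion k (a x) (sym_deriv_pow b \<Gamma> k F x) = weight (b + c) x * insertion k (A (h x)) (sym_deriv_pow b \<Gamma>' k f (h x))"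
proof -
  let ?G = "sym_deriv_pow b \<Gamma>' k f (h x)"
  have "(\<Sum>I | length I = k. a x I * sym_deriv_pow b \<Gamma> k F x I) =
     (\<Sum>I | length I = k. \<Sum>L | length L = k. weight b x * (a x I * (tpow (H x) L I * ?G L)))"
    by (intro sum.cong refl)
      (simp add: sym_deriv_pow_covariant[OF law \<Gamma>' f eq x] pull_cov_def sum_distrib_left mult_ac)
  also have "\<dots> = (\<Sum>L | length L = k. weight b x * ((\<Sum>I | length I = k. tpow (H x) L I * a x I) * ?G L))"
    by (subst sum.swap) (simp add: sum_distrib_left sum_distrib_right mult_ac)
  also have "\<dots> = (\<Sum>L | length L = k. weight (b + c) x * (A (h x) L * ?G L))"
  proof (intro sum.cong refl)
    fix L assume "L \<in> {L :: 'm list. length L = k}"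
    then have "A (h x) L = weight (- c) x * (\<Sum>I | length I = k. tpow (H x) L I * a x I)"
      using rel x by (simp add: push_related_def)
    moreover have "weight (b + c) x * weight (- c) x = weight b x" using weight_mult[OF x] by simp
    ultimately show "weight b x * ((\<Sum>I | length I = k. tpow (H x) L I * a x I) * ?G L) = weight (b + c) x * (A (h x) L * ?G L)"
      by (simp only: mult.assoc[symmetric])
  qed
  finally show ?thesis by (simp add: insertion_def sum_distrib_left)
qed

lemma jacobian_eq:
  assumes "x \<in> S"
  shows "jacobian h (at x) = H x"
proof -
  have "frechet_derivative h (at x) = (*v) (H x)"
    using frechet_derivative_at[OF h_derivative[OF assms]] by simp
  then show ?thesis by (simp add: jacobian_def)
qed

end

section \<open>Coefficients are determined by the operator\<close>

lemma contract_linear_factor: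
  fixes i :: "'m::finite"
  assumes "smooth g" "symmetric_array a"
  shows "contract n a (\<lambda>x. (x $ i - z) * g x) x =
    (x $ i - z) * contract n a g x + real n * contract (n - 1) (\<lambda>J. a (i # J)) g x"
  using assms(2)
proof (induction n arbitrary: a x)
  case 0 then show ?case by simp
next
  case (Suc n)
  let ?l = "\<lambda>x :: real^'m. x $ i - z"
  let ?c = "\<lambda>j n x. contract n (\<lambda>I. a (j # I)) g x"
  have sl: "smooth ?l" by (intro smooth_diff smooth_coord smooth_const)
  have lg: "smooth (\<lambda>x. ?l x * g x)" by (intro smooth_mult sl assms(1))
  have pl: "partial j ?l x = (if i = j then 1 else 0)" for j
    by (subst partial_diff) (auto simp: partial_coord)
  have eq: "(\<lambda>y. contract n (\<lambda>I. a (j # I)) (\<lambda>x. ?l x * g x) y) =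
      (\<lambda>y. ?l y * ?c j n y + real n * contract (n - 1) (\<lambda>J. a (j # i # J)) g y)" for j
    using Suc.IH[OF symmetric_array_slot[OF Suc.prems]] by blast
  have sc: "smooth (contract k u g)" for k u
    using smooth_contract[OF assms(1), of "\<lambda>x. u" k] by simp
  have "contract (Suc n) a (\<lambda>x. ?l x * g x) x = (\<Sum>j\<in>UNIV. partial j (contract n (\<lambda>I. a (j # I)) (\<lambda>x. ?l x * g x)) x)"
    by (rule sum_partial_contract[OF lg, symmetric])
  also have "\<dots> = (\<Sum>j\<in>UNIV. (if i = j then 1 else 0) * ?c j n x + ?l x * partial j (?c j n) x
      + real n * partial j (contract (n - 1) (\<lambda>J. a (j # i # J)) g) x)"
    unfolding eq
    by (intro sum.cong refl, subst partial_add)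
      (auto simp: partial_mult pl smooth_differentiable[OF sc] smooth_differentiable[OF sl] partial_cmult differentiable_mult_real)
  also have "\<dots> = ?c i n x + ?l x * contract (Suc n) a g x
      + real n * (\<Sum>j\<in>UNIV. partial j (contract (n - 1) (\<lambda>J. a (j # i # J)) g) x)"
  proof -
    have "(\<Sum>j\<in>UNIV. (if i = j then 1 else 0) * ?c j n x) = (\<Sum>j\<in>UNIV. (if j = i then 1 else 0) * ?c j n x)"
      by (intro sum.cong refl) simp
    then show ?thesis
      by (simp only: sum.distrib sum_distrib_left[symmetric] sum_partial_contract[OF assms(1)] sum_kronecker)
  qed
  also have "real n * (\<Sum>j\<in>UNIV. partial j (contract (n - 1) (\<lambda>J. a (j # i # J)) g) x) = real n * ?c i n x"
  proof (cases n)
    case (Suc n')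
    have "(\<lambda>J. a (j # i # J)) = (\<lambda>J. a (i # j # J))" for j
      by (rule ext, rule symmetric_arrayD[OF Suc.prems]) simp
    then have "(\<Sum>j\<in>UNIV. partial j (contract (n - 1) (\<lambda>J. a (j # i # J)) g) x) =
       (\<Sum>j\<in>UNIV. partial j (contract n' (\<lambda>J. a (i # j # J)) g) x)"
      using Suc by simp
    also have "\<dots> = ?c i n x"
      using sum_partial_contract[OF assms(1), of n' "\<lambda>J. a (i # J)" x] Suc by simp
    finally show ?thesis by simp
  qed simp
  finally show ?case by (simp add: algebra_simps)
qed

definition monomial_at :: "real^'m::finite \<Rightarrow> 'm list \<Rightarrow> real^'m \<Rightarrow> real" where
  "monomial_at z I x = prod_list (map (\<lambda>i. x $ i - z $ i) I)"

lemma smooth_monomial_at: "smooth (monomial_at z I)"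
proof (induction I)
  case Nil then show ?case by (simp add: monomial_at_def[abs_def])
next
  case (Cons i I)
  then have "smooth (\<lambda>x. (x $ i - z $ i) * monomial_at z I x)"
    by (intro smooth_mult smooth_diff smooth_coord smooth_const)
  then show ?case by (simp add: monomial_at_def[abs_def])
qed

lemma contract_monomial:
  assumes "smooth u" "symmetric_array a" "n \<le> length I"
  shows "contract n a (\<lambda>x. monomial_at z I x * u x) z = (if n = length I then fact n * a I * u z else 0)"
  using assms(2,3)
proof (induction I arbitrary: n a)
  case Nil then show ?case by (simp add: monomial_at_def)
next
  case (Cons i I)
  have s: "smooth (\<lambda>x. monomial_at z I x * u x)" by (intro smooth_mult smooth_monomial_at assms(1))
  have "contract n a (\<lambda>x. monomial_at z (i # I) x * u x) z = real n * contract (n - 1) (\<lambda>J. a (i # J)) (\<lambda>x. monomial_at z I x * u x) z"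
    using contract_linear_factor[OF s Cons.prems(1), of n i "z $ i" z] by (simp add: monomial_at_def mult.assoc)
  then show ?case
    using Cons.IH[OF symmetric_array_slot[OF Cons.prems(1)], of "n - 1" i] Cons.prems(2) by (cases n) auto
qed

section \<open>Orderings on an atlas with projective changes of coordinates\<close>

lemma symmetric_array_tpow:
  assumes a: "symmetric_array a"
  shows "symmetric_array (\<lambda>I :: 'm::finite list. \<Sum>J | length J = length I. tpow (K :: real^'m^'m) I J * a J)"
  unfolding symmetric_array_def
proof (intro allI impI)
  fix I I' :: "'m list" assume "mset I = mset I'"
  then obtain \<pi> where \<pi>: "\<pi> permutes {..<length I'}" "permute_list \<pi> I' = I"
    using mset_eq_permutation by blast
  have l: "length I = length I'" using \<pi>(2) by auto
  have "(\<Sum>J | length J = length I. tpow K I J * a J) =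
      (\<Sum>J | length J = length I'. tpow K (permute_list \<pi> I') (permute_list \<pi> J) * a (permute_list \<pi> J))"
    unfolding \<pi>(2) l by (rule sum_permute_list[OF \<pi>(1), symmetric])
  also have "\<dots> = (\<Sum>J | length J = length I'. tpow K I' J * a J)"
    using \<pi>(1) by (intro sum.cong refl arg_cong2[where f = "(*)"] symmetric_arrayD[OF a]) (auto simp: tpow_permute)
  finally show "(\<Sum>J | length J = length I. tpow K I J * a J) = (\<Sum>J | length J = length I'. tpow K I' J * a J)" .
qed

lemma densitiesD:
  assumes "\<psi> \<in> densities M b"
  shows "\<kappa> \<notin> M \<or> x \<notin> image_of \<kappa> \<Longrightarrow> \<psi> \<kappa> x = 0" "\<kappa> \<in> M \<Longrightarrow> smooth_on (image_of \<kappa>) (\<psi> \<kappa>)"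
    "\<kappa> \<in> M \<Longrightarrow> \<kappa>' \<in> M \<Longrightarrow> x \<in> overlap \<kappa> \<kappa>' \<Longrightarrow> \<psi> \<kappa> x = pull_density b (in_coords id \<kappa> \<kappa>') (\<psi> \<kappa>') x"
  using assms unfolding densities_def by blast+

lemma symbolsD:
  assumes "A \<in> symbols M c"
  shows "\<kappa> \<notin> M \<or> x \<notin> image_of \<kappa> \<Longrightarrow> A \<kappa> x I = 0" "\<exists>n. \<forall>\<kappa> x I. length I > n \<longrightarrow> A \<kappa> x I = 0"
    "mset I = mset J \<Longrightarrow> A \<kappa> x I = A \<kappa> x J" "\<kappa> \<in> M \<Longrightarrow> smooth_on (image_of \<kappa>) (\<lambda>x. A \<kappa> x I)"
    "\<kappa> \<in> M \<Longrightarrow> \<kappa>' \<in> M \<Longrightarrow> x \<in> overlap \<kappa> \<kappa>' \<Longrightarrow> A \<kappa> x I = pull_symbol c (in_coords id \<kappa> \<kappa>') (A \<kappa>') x I"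
proof -
  note A = assms[unfolded symbols_def mem_Collect_eq]
  show "\<kappa> \<notin> M \<or> x \<notin> image_of \<kappa> \<Longrightarrow> A \<kappa> x I = 0" using A by blast
  show "\<exists>n. \<forall>\<kappa> x I. length I > n \<longrightarrow> A \<kappa> x I = 0" using A by blast
  show "mset I = mset J \<Longrightarrow> A \<kappa> x I = A \<kappa> x J" using A by blast
  show "\<kappa> \<in> M \<Longrightarrow> smooth_on (image_of \<kappa>) (\<lambda>x. A \<kappa> x I)" using A by blast
  show "\<kappa> \<in> M \<Longrightarrow> \<kappa>' \<in> M \<Longrightarrow> x \<in> overlap \<kappa> \<kappa>' \<Longrightarrow> A \<kappa> x I = pull_symbol c (in_coords id \<kappa> \<kappa>') (A \<kappa>') x I"
    using A by blast
qed

lemma pull_symbol_linear: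
  "pull_symbol c h (\<lambda>x I. s * a x I + t * a' x I) x I = s * pull_symbol c h a x I + t * pull_symbol c h a' x I"
  unfolding pull_symbol_def by (simp add: sum.distrib sum_distrib_left algebra_simps)

lemma symbols_linear:
  assumes A: "A \<in> symbols M c" and B: "B \<in> symbols M c" and "\<And>\<kappa>. \<kappa> \<in> M \<Longrightarrow> image_of \<kappa> = UNIV"
  shows "(\<lambda>\<kappa> x I. s * A \<kappa> x I + t * B \<kappa> x I) \<in> symbols M c"
  unfolding symbols_def mem_Collect_eq
proof (intro conjI allI impI ballI)
  fix \<kappa> x and I :: "'b list"
  assume "\<kappa> \<notin> M \<or> x \<notin> image_of \<kappa>"
  then show "s * A \<kappa> x I + t * B \<kappa> x I = 0" using symbolsD(1)[OF A] symbolsD(1)[OF B] by simp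
next
  obtain n n' where "\<forall>\<kappa> x I. length I > n \<longrightarrow> A \<kappa> x I = 0" "\<forall>\<kappa> x I. length I > n' \<longrightarrow> B \<kappa> x I = 0"
    using symbolsD(2)[OF A] symbolsD(2)[OF B] by blast
  then show "\<exists>n. \<forall>\<kappa> x I. n < length I \<longrightarrow> s * A \<kappa> x I + t * B \<kappa> x I = 0"
    by (intro exI[of _ "max n n'"]) auto
next
  fix \<kappa> x and I J :: "'b list" assume "mset I = mset J"
  then show "s * A \<kappa> x I + t * B \<kappa> x I = s * A \<kappa> x J + t * B \<kappa> x J"
    using symbolsD(3)[OF A] symbolsD(3)[OF B] by metis
next
  fix \<kappa> and I :: "'b list" assume \<kappa>: "\<kappa> \<in> M"
  note d = symbolsD(4)[OF A \<kappa>] symbolsD(4)[OF B \<kappa>]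
  then show "smooth_on (image_of \<kappa>) (\<lambda>x. s * A \<kappa> x I + t * B \<kappa> x I)"
    using assms(3)[OF \<kappa>] by (auto intro!: smooth_add smooth_mult)
next
  fix \<kappa> \<kappa>' x and I :: "'b list" assume "\<kappa> \<in> M" "\<kappa>' \<in> M" "x \<in> overlap \<kappa> \<kappa>'"
  then show "s * A \<kappa> x I + t * B \<kappa> x I = pull_symbol c (in_coords id \<kappa> \<kappa>') (\<lambda>x I. s * A \<kappa>' x I + t * B \<kappa>' x I) x I"
    using symbolsD(5)[OF A] symbolsD(5)[OF B] by (simp add: pull_symbol_linear)
qed

lemma sum_mult_left_commute:
  "(\<Sum>I\<in>A. t I * (w * g I)) = (w :: real) * (\<Sum>I\<in>A. t I * g I)"
  by (simp add: sum_distrib_left mult.left_commute)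

locale projective_atlas =
  fixes M :: "('p, 'm::finite) atlas"
  assumes image: "\<kappa> \<in> M \<Longrightarrow> image_of \<kappa> = UNIV"
    and transition: "\<kappa> \<in> M \<Longrightarrow> \<kappa>' \<in> M \<Longrightarrow>
      \<exists>H \<beta>. projective_change (overlap \<kappa> \<kappa>') (in_coords id \<kappa> \<kappa>') H \<beta>"
    and test_density: "\<kappa> \<in> M \<Longrightarrow>
      \<exists>\<psi>\<in>densities M b. \<exists>u. smooth u \<and> u z \<noteq> 0 \<and> \<psi> \<kappa> = (\<lambda>x. monomial_at z I x * u x)"
    and connection_exists: "torsion_free_connections M \<noteq> {}"
begin

lemma density_smooth: "\<psi> \<in> densities M b \<Longrightarrow> \<kappa> \<in> M \<Longrightarrow> smooth (\<psi> \<kappa>)"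
  using densitiesD(2) image by metis

lemma symbol_smooth_array:
  assumes "A \<in> symbols M c" "\<kappa> \<in> M" shows "smooth_array (A \<kappa>)"
  unfolding smooth_array_def symmetric_array_def
  using symbolsD(3,4)[OF assms(1)] assms(2) image[OF assms(2)] by metis

lemma pull_density_transition:
  assumes "projective_change S h H \<beta>" "x \<in> S"
  shows "pull_density b h f x = projective_change.weight H b x * f (h x)"
proof -
  interpret projective_change S h H \<beta> by fact
  show ?thesis unfolding pull_density_def weight_def projective_change.jacobian_eq[OF assms] ..
qed

lemma pull_symbol_transition:
  assumes "projective_change S h H \<beta>" "x \<in> S"
  shows "pull_symbol c h a x I = projective_change.weight H c x *
    (\<Sum>J | length J = length I. tpow (matrix_inv (H x)) I J * a (h x) J)"
proof -
  interpret projective_change S h H \<beta> by fact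
  show ?thesis unfolding pull_symbol_def weight_def projective_change.jacobian_eq[OF assms]
    by (intro arg_cong[where f = "(*) _"] sum.cong refl arg_cong2[where f = "(*)"] prod_eq_tpow) auto
qed

lemma symbol_push_related:
  assumes pc: "projective_change (overlap \<kappa> \<kappa>') (in_coords id \<kappa> \<kappa>') H \<beta>"
    and A: "A \<in> symbols M c" and \<kappa>: "\<kappa> \<in> M" "\<kappa>' \<in> M"
  shows "projective_change.push_related (overlap \<kappa> \<kappa>') (in_coords id \<kappa> \<kappa>') H c k (A \<kappa>) (A \<kappa>')"
proof -
  interpret projective_change "overlap \<kappa> \<kappa>'" "in_coords id \<kappa> \<kappa>'" H \<beta> by fact
  show ?thesis
    unfolding push_related_def
  proof (intro ballI allI impI)
    fix x and J :: "'m list" assume x: "x \<in> overlap \<kappa> \<kappa>'" and J: "length J = k"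
    let ?h = "in_coords id \<kappa> \<kappa>'"
    have "(\<Sum>I | length I = k. tpow (H x) J I * A \<kappa> x I) =
       (\<Sum>I | length I = k. tpow (H x) J I * (weight c x * (\<Sum>L | length L = k. tpow (matrix_inv (H x)) I L * A \<kappa>' (?h x) L)))"
      by (intro sum.cong refl) (simp add: symbolsD(5)[OF A \<kappa> x] pull_symbol_transition[OF pc x])
    also have "\<dots> = weight c x * (\<Sum>I | length I = k. tpow (H x) J I * (\<Sum>L | length L = k. tpow (matrix_inv (H x)) I L * A \<kappa>' (?h x) L))"
      by (rule sum_mult_left_commute)
    also have "\<dots> = weight c x * A \<kappa>' (?h x) J"
      unfolding tpow_inverse[OF H_inverse(1)[OF x] J] ..
    finally show "A \<kappa>' (?h x) J = weight (- c) x * (\<Sum>I | length I = k. tpow (H x) J I * A \<kappa> x I)"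
      using weight_mult[OF x, of "- c" c] weight_0[OF x] by (simp add: mult.assoc[symmetric])
  qed
qed

lemma coefficients_zero:
  assumes \<kappa>: "\<kappa> \<in> M" and a: "symmetric_array a"
    and z: "\<And>\<psi>. \<psi> \<in> densities M b \<Longrightarrow> (\<Sum>k<n. contract k a (\<psi> \<kappa>) z) = 0"
    and I: "length I < n"
  shows "a I = 0"
  using z I
proof (induction n arbitrary: I)
  case 0 then show ?case by simp
next
  case (Suc n)
  have top: "a J = 0" if J: "length J = n" for J
  proof -
    obtain \<psi> u where \<psi>: "\<psi> \<in> densities M b" "smooth u" "u z \<noteq> 0" "\<psi> \<kappa> = (\<lambda>x. monomial_at z J x * u x)"
      using test_density[OF \<kappa>] by blast
    have "(\<Sum>k<Suc n. contract k a (\<psi> \<kappa>) z) = (\<Sum>k<Suc n. if k = n then fact n * a J * u z else 0)"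
      unfolding \<psi>(4) using J by (intro sum.cong refl) (auto simp: contract_monomial[OF \<psi>(2) a])
    then have "fact n * a J * u z = 0" using Suc.prems(1)[OF \<psi>(1)] by simp
    then show ?thesis using \<psi>(3) by simp
  qed
  show ?case
  proof (cases "length I = n")
    case False
    have "(\<Sum>k<n. contract k a (\<psi> \<kappa>) z) = 0" if "\<psi> \<in> densities M b" for \<psi>
      using Suc.prems(1)[OF that] top by (simp add: contract_def)
    then show ?thesis using Suc.IH[of I] Suc.prems(2) False by auto
  qed (rule top)
qed

lemma coefficients_unique:
  assumes \<kappa>: "\<kappa> \<in> M" and a: "symmetric_array a" "symmetric_array a'"
    and z: "\<And>\<psi>. \<psi> \<in> densities M b \<Longrightarrow> (\<Sum>k<n. contract k a (\<psi> \<kappa>) z) = (\<Sum>k<n. contract k a' (\<psi> \<kappa>) z)"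
    and I: "length I < n"
  shows "a I = a' I"
proof -
  have "symmetric_array (\<lambda>I. a I + (- 1) * a' I)"
  proof -
    have "a I + (- 1) * a' I = a J + (- 1) * a' J" if "mset I = mset J" for I J
      using symmetric_arrayD[OF a(1) that] symmetric_arrayD[OF a(2) that] by simp
    then show ?thesis unfolding symmetric_array_def by blast
  qed
  from coefficients_zero[where b = b and n = n and z = z and I = I, OF \<kappa> this] have "a I + (- 1) * a' I = 0"
    using z I by (simp only: contract_add contract_scale sum.distrib sum_distrib_left[symmetric])
  then show ?thesis by simp
qed

definition local_form :: "nat \<Rightarrow> real \<Rightarrow> ('p, 'm) operator \<Rightarrow> ('p, 'm) chart \<Rightarrow> (real^'m \<Rightarrow> 'm list \<Rightarrow> real) \<Rightarrow> bool"
where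
  "local_form n b D \<kappa> a \<longleftrightarrow> smooth_array a \<and>
     (\<forall>\<psi>\<in>densities M b. \<forall>x. D \<psi> \<kappa> x = (\<Sum>k<n. contract k (a x) (\<psi> \<kappa>) x))"

lemma diff_op_local_form:
  assumes "D \<in> diff_ops M b c"
  shows "\<exists>n. \<forall>\<kappa>\<in>M. \<exists>a. local_form n b D \<kappa> a"
proof -
  obtain k where k: "\<And>\<kappa>. \<kappa> \<in> M \<Longrightarrow> \<exists>a. (\<forall>I. smooth_on (image_of \<kappa>) (a I)) \<and>
        (\<forall>\<psi>\<in>densities M b. \<forall>x\<in>image_of \<kappa>. D \<psi> \<kappa> x = (\<Sum>I | length I \<le> k. a I x * partials I (\<psi> \<kappa>) x))"
    using assms unfolding diff_ops_def by blast
  have "\<exists>a. local_form (Suc k) b D \<kappa> a" if \<kappa>: "\<kappa> \<in> M" for \<kappa>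
  proof -
    obtain a where a: "\<And>I. smooth (a I)"
      "\<And>\<psi> x. \<psi> \<in> densities M b \<Longrightarrow> D \<psi> \<kappa> x = (\<Sum>I | length I \<le> k. a I x * partials I (\<psi> \<kappa>) x)"
      using k[OF \<kappa>] unfolding image[OF \<kappa>] by blast
    have "lower_op (Suc k) (\<lambda>f x. \<Sum>I | length I < Suc k. a I x * partials I f x)"
      by (intro lower_op_sum lower_op_partials a(1)) auto
    then obtain a' where a': "smooth_array a'"
      "\<And>f x. smooth f \<Longrightarrow> (\<Sum>I | length I < Suc k. a I x * partials I f x) = (\<Sum>k<Suc k. contract k (a' x) f x)"
      by (rule lower_op_smooth_array) blast
    have "local_form (Suc k) b D \<kappa> a'"
      unfolding local_form_def using a' a(2) density_smooth[OF _ \<kappa>] by (simp add: less_Suc_eq_le del: sum.lessThan_Suc)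
    then show ?thesis by blast
  qed
  then show ?thesis by blast
qed

lemma local_form_mono:
  assumes "local_form n b D \<kappa> a" "n \<le> n'"
  shows "\<exists>a'. local_form n' b D \<kappa> a' \<and> (\<forall>x I. length I < n \<longrightarrow> a' x I = a x I) \<and> (\<forall>x I. n \<le> length I \<longrightarrow> a' x I = 0)"
proof -
  define a' where "a' x I = (if length I < n then a x I else 0)" for x I
  note a = conjunct1[OF assms(1)[unfolded local_form_def]]
  have "symmetric_array (a' x)" for x
  proof -
    have "a' x I = a' x J" if "mset I = mset J" for I J
      using symmetric_arrayD[OF smooth_arrayD(2)[OF a] that] mset_eq_length[OF that] by (simp add: a'_def)
    then show ?thesis unfolding symmetric_array_def by blast
  qed
  moreover have "smooth (\<lambda>x. a' x I)" for I
    using smooth_arrayD(1)[OF a] by (cases "length I < n") (auto simp: a'_def)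
  moreover have "(\<Sum>k<n. contract k (a x) (\<psi> \<kappa>) x) = (\<Sum>k<n'. contract k (a' x) (\<psi> \<kappa>) x)" for \<psi> :: "('p, 'm) density" and x
  proof -
    have "(\<Sum>k<n. contract k (a x) (\<psi> \<kappa>) x) = (\<Sum>k<n. contract k (a' x) (\<psi> \<kappa>) x)"
      by (intro sum.cong refl contract_cong) (auto simp: a'_def)
    also have "\<dots> = (\<Sum>k<n'. contract k (a' x) (\<psi> \<kappa>) x)"
      using assms(2) by (intro sum.mono_neutral_left) (auto simp: contract_def a'_def)
    finally show ?thesis .
  qed
  ultimately show ?thesis
    using assms(1) by (intro exI[of _ a']) (auto simp: local_form_def smooth_array_def a'_def)
qed

lemma diff_ops_diff:
  assumes D: "D \<in> diff_ops M b c" and E: "E \<in> diff_ops M b c"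
  shows "(\<lambda>\<psi> \<kappa> x. D \<psi> \<kappa> x - E \<psi> \<kappa> x) \<in> diff_ops M b c"
proof -
  have dd: "(\<lambda>\<kappa> x. \<phi> \<kappa> x - \<theta> \<kappa> x) \<in> densities M (b + c)" if "\<phi> \<in> densities M (b + c)" "\<theta> \<in> densities M (b + c)" for \<phi> \<theta>
    unfolding densities_def mem_Collect_eq
  proof (intro conjI allI impI ballI)
    fix \<kappa> x assume "\<kappa> \<notin> M \<or> x \<notin> image_of \<kappa>"
    then show "\<phi> \<kappa> x - \<theta> \<kappa> x = 0" using densitiesD(1)[OF that(1)] densitiesD(1)[OF that(2)] by simp
  next
    fix \<kappa> assume \<kappa>: "\<kappa> \<in> M"
    show "smooth_on (image_of \<kappa>) (\<lambda>x. \<phi> \<kappa> x - \<theta> \<kappa> x)"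
      unfolding image[OF \<kappa>] using density_smooth[OF that(1) \<kappa>] density_smooth[OF that(2) \<kappa>] by (rule smooth_diff)
  next
    fix \<kappa> \<kappa>' x assume *: "\<kappa> \<in> M" "\<kappa>' \<in> M" "x \<in> overlap \<kappa> \<kappa>'"
    show "\<phi> \<kappa> x - \<theta> \<kappa> x = pull_density (b + c) (in_coords id \<kappa> \<kappa>') (\<lambda>x. \<phi> \<kappa>' x - \<theta> \<kappa>' x) x"
      using densitiesD(3)[OF that(1) *] densitiesD(3)[OF that(2) *] by (simp add: pull_density_def right_diff_distrib)
  qed
  obtain n n' where n: "\<forall>\<kappa>\<in>M. \<exists>a. local_form n b D \<kappa> a" "\<forall>\<kappa>\<in>M. \<exists>a. local_form n' b E \<kappa> a"
    using diff_op_local_form[OF D] diff_op_local_form[OF E] by blast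
  have "\<exists>a. (\<forall>I. smooth_on (image_of \<kappa>) (a I)) \<and> (\<forall>\<psi>\<in>densities M b. \<forall>x\<in>image_of \<kappa>.
           D \<psi> \<kappa> x - E \<psi> \<kappa> x = (\<Sum>I | length I \<le> max n n'. a I x * partials I (\<psi> \<kappa>) x))" if \<kappa>: "\<kappa> \<in> M" for \<kappa>
  proof -
    obtain a a' where a: "local_form (Suc (max n n')) b D \<kappa> a" "local_form (Suc (max n n')) b E \<kappa> a'"
      using n \<kappa> local_form_mono[of n b D \<kappa> _ "Suc (max n n')"] local_form_mono[of n' b E \<kappa> _ "Suc (max n n')"]
      by (metis le_SucI max.cobounded1 max.cobounded2)
    have len: "{I :: 'm list. length I \<le> max n n'} = {I. length I < Suc (max n n')}" by auto
    show ?thesis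
    proof (intro exI[of _ "\<lambda>I x. a x I - a' x I"] conjI allI ballI)
      show "smooth_on (image_of \<kappa>) (\<lambda>x. a x I - a' x I)" for I
        unfolding image[OF \<kappa>] using a unfolding local_form_def by (intro smooth_diff smooth_arrayD(1)) auto
      fix \<psi> x assume \<psi>: "\<psi> \<in> densities M b"
      have "D \<psi> \<kappa> x - E \<psi> \<kappa> x = (\<Sum>k<Suc (max n n'). contract k (a x) (\<psi> \<kappa>) x) - (\<Sum>k<Suc (max n n'). contract k (a' x) (\<psi> \<kappa>) x)"
        using a \<psi> unfolding local_form_def by auto
      then show "D \<psi> \<kappa> x - E \<psi> \<kappa> x = (\<Sum>I | length I \<le> max n n'. (a x I - a' x I) * partials I (\<psi> \<kappa>) x)"
        unfolding len sum_length_less contract_def by (simp only: sum_subtractf left_diff_distrib)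
    qed
  qed
  then show ?thesis
    unfolding diff_ops_def mem_Collect_eq
  proof (intro conjI allI impI ballI exI[of _ "max n n'"])
    show "(\<lambda>\<kappa> x. D \<psi> \<kappa> x - E \<psi> \<kappa> x) = (\<lambda>\<kappa> x. 0)" if "\<psi> \<notin> densities M b" for \<psi>
      using D E that unfolding diff_ops_def by simp
    show "(\<lambda>\<kappa> x. D \<psi> \<kappa> x - E \<psi> \<kappa> x) \<in> densities M (b + c)" if "\<psi> \<in> densities M b" for \<psi>
      using D E that unfolding diff_ops_def by (intro dd) blast+
  qed
qed

text \<open>The components of highest degree transform as a symbol: comparing the two local expressions
  of an operator, the chain rule only changes the coefficients of lower order.\<close>

lemma leading_coefficients_symbol:
  assumes D: "D \<in> diff_ops M b c" and a: "\<And>\<kappa>. \<kappa> \<in> M \<Longrightarrow> local_form (Suc n) b D \<kappa> (a \<kappa>)"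
  defines "\<sigma> \<equiv> \<lambda>\<kappa> x I. if \<kappa> \<in> M \<and> length I = n then a \<kappa> x I else 0"
  shows "\<sigma> \<in> symbols M c"
  unfolding symbols_def mem_Collect_eq
proof (intro conjI allI impI ballI)
  have sa: "smooth_array (a \<kappa>)" if "\<kappa> \<in> M" for \<kappa> using a[OF that] unfolding local_form_def by blast
  show "\<sigma> \<kappa> x I = 0" if "\<kappa> \<notin> M \<or> x \<notin> image_of \<kappa>" for \<kappa> x I
    using that image by (auto simp: \<sigma>_def)
  show "\<exists>n. \<forall>\<kappa> x I. n < length I \<longrightarrow> \<sigma> \<kappa> x I = 0" by (intro exI[of _ n]) (auto simp: \<sigma>_def)
  show "\<sigma> \<kappa> x I = \<sigma> \<kappa> x J" if "mset I = mset J" for \<kappa> x I J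
    using symmetric_arrayD[OF smooth_arrayD(2)[OF sa] that, of \<kappa> x] mset_eq_length[OF that] by (auto simp: \<sigma>_def)
  show "smooth_on (image_of \<kappa>) (\<lambda>x. \<sigma> \<kappa> x I)" if "\<kappa> \<in> M" for \<kappa> I
    unfolding image[OF that] \<sigma>_def using that smooth_arrayD(1)[OF sa[OF that]] by (cases "length I = n") auto
  fix \<kappa> \<kappa>' x and I :: "'m list"
  assume \<kappa>: "\<kappa> \<in> M" "\<kappa>' \<in> M" and x: "x \<in> overlap \<kappa> \<kappa>'"
  let ?h = "in_coords id \<kappa> \<kappa>'"
  obtain H \<beta> where pc: "projective_change (overlap \<kappa> \<kappa>') ?h H \<beta>" using transition[OF \<kappa>] by blast
  interpret P: projective_change "overlap \<kappa> \<kappa>'" ?h H \<beta> by fact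
  let ?\<nu> = "b * (real CARD('m) + 1)"
  show "\<sigma> \<kappa> x I = pull_symbol c ?h (\<sigma> \<kappa>') x I"
  proof (cases "length I = n")
    case False
    then show ?thesis by (simp add: pull_symbol_def \<sigma>_def)
  next
    case True
    define e where "e I = P.weight c x * (\<Sum>J | length J = length I. tpow (matrix_inv (H x)) I J * a \<kappa>' (?h x) J)" for I
    have sym: "symmetric_array e"
    proof -
      have "e I = e J" if "mset I = mset J" for I J
        using symmetric_arrayD[OF symmetric_array_tpow[OF smooth_arrayD(2)[OF sa[OF \<kappa>(2)]]] that, of "matrix_inv (H x)" "?h x"]
        by (simp add: e_def)
      then show ?thesis unfolding symmetric_array_def by blast
    qed
    define d where "d I = (\<Sum>l\<le>n - length I. coef ?\<nu> (real (length I + l)) l * (ctr (\<beta> x) ^^ l) e I)" for I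
    have symd: "symmetric_array d"
    proof -
      have "d I = d J" if "mset I = mset J" for I J
        using symmetric_arrayD[OF symmetric_array_ctr_pow[OF sym] that] mset_eq_length[OF that] by (simp add: d_def)
      then show ?thesis unfolding symmetric_array_def by blast
    qed
    have main: "(\<Sum>k<Suc n. contract k (a \<kappa> x) (\<psi> \<kappa>) x) = (\<Sum>k<Suc n. contract k d (\<psi> \<kappa>) x)" if \<psi>: "\<psi> \<in> densities M b" for \<psi>
    proof -
      have D\<psi>: "D \<psi> \<in> densities M (b + c)" using D \<psi> unfolding diff_ops_def by blast
      have eq: "\<psi> \<kappa> y = P.weight b y * \<psi> \<kappa>' (?h y)" if "y \<in> overlap \<kappa> \<kappa>'" for y
        using densitiesD(3)[OF \<psi> \<kappa> that] pull_density_transition[OF pc that] by simp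
      have K: "P.weight (b + c) x * contract k (a \<kappa>' (?h x)) (\<psi> \<kappa>') (?h x) =
          (\<Sum>l\<le>k. coef ?\<nu> k l * contract (k - l) ((ctr (\<beta> x) ^^ l) e) (\<psi> \<kappa>) x)" for k
      proof -
        have "(\<Sum>I | length I = k. e I * P.pull_cov b (\<lambda>y J. partials J (\<psi> \<kappa>') y) x I) =
          (\<Sum>I | length I = k. \<Sum>L | length L = k. P.weight b x * (e I * tpow (H x) L I * partials L (\<psi> \<kappa>') (?h x)))"
          unfolding P.pull_cov_def by (intro sum.cong refl) (simp add: sum_distrib_left mult_ac)
        also have "\<dots> = (\<Sum>L | length L = k. P.weight b x * ((\<Sum>I | length I = k. tpow (H x) L I * e I) * partials L (\<psi> \<kappa>') (?h x)))"
          by (subst sum.swap) (simp add: sum_distrib_left sum_distrib_right mult_ac)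
        also have "\<dots> = (\<Sum>L | length L = k. P.weight (b + c) x * (a \<kappa>' (?h x) L * partials L (\<psi> \<kappa>') (?h x)))"
        proof (intro sum.cong refl)
          fix L assume "L \<in> {L :: 'm list. length L = k}"
          then have L: "length L = k" by simp
          have "(\<Sum>I | length I = k. tpow (H x) L I * e I) = P.weight c x *
              (\<Sum>I | length I = k. tpow (H x) L I * (\<Sum>J | length J = k. tpow (matrix_inv (H x)) I J * a \<kappa>' (?h x) J))"
            by (subst sum_mult_left_commute[symmetric], intro sum.cong refl) (simp add: e_def)
          also have "\<dots> = P.weight c x * a \<kappa>' (?h x) L"
            unfolding tpow_inverse[OF P.H_inverse(1)[OF x] L] ..
          finally show "P.weight b x * ((\<Sum>I | length I = k. tpow (H x) L I * e I) * partials L (\<psi> \<kappa>') (?h x)) =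
              P.weight (b + c) x * (a \<kappa>' (?h x) L * partials L (\<psi> \<kappa>') (?h x))"
            by (simp add: P.weight_mult[OF x, symmetric] mult.assoc)
        qed
        also have "\<dots> = P.weight (b + c) x * contract k (a \<kappa>' (?h x)) (\<psi> \<kappa>') (?h x)"
          by (simp add: contract_def sum_distrib_left)
        finally show ?thesis
          using P.contract_pull_cov[OF density_smooth[OF \<psi> \<kappa>(2)] density_smooth[OF \<psi> \<kappa>(1)] eq x sym] by simp
      qed
      have "(\<Sum>k<Suc n. contract k (a \<kappa> x) (\<psi> \<kappa>) x) = D \<psi> \<kappa> x"
        using a[OF \<kappa>(1)] \<psi> unfolding local_form_def by simp
      also have "\<dots> = P.weight (b + c) x * D \<psi> \<kappa>' (?h x)"
        using densitiesD(3)[OF D\<psi> \<kappa> x] pull_density_transition[OF pc x] by simp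
      also have "D \<psi> \<kappa>' (?h x) = (\<Sum>k<Suc n. contract k (a \<kappa>' (?h x)) (\<psi> \<kappa>') (?h x))"
        using a[OF \<kappa>(2)] \<psi> unfolding local_form_def by blast
      also have "P.weight (b + c) x * \<dots> = (\<Sum>k\<le>n. \<Sum>l\<le>k. coef ?\<nu> k l * contract (k - l) ((ctr (\<beta> x) ^^ l) e) (\<psi> \<kappa>) x)"
        unfolding sum_distrib_left K lessThan_Suc_atMost ..
      also have "\<dots> = (\<Sum>k\<le>n. \<Sum>l\<le>n - k. coef ?\<nu> (real (k + l)) l * contract k ((ctr (\<beta> x) ^^ l) e) (\<psi> \<kappa>) x)"
        by (simp add: sum.Sigma, rule sum.reindex_bij_witness[of _ "\<lambda>(k, l). (k + l, l)" "\<lambda>(k, l). (k - l, l)"]) auto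
      also have "\<dots> = (\<Sum>k\<le>n. contract k d (\<psi> \<kappa>) x)"
      proof (rule sum.cong[OF refl])
        fix k
        have "contract k d (\<psi> \<kappa>) x = contract k (\<lambda>I. \<Sum>l\<le>n - k. coef ?\<nu> (real (k + l)) l * (ctr (\<beta> x) ^^ l) e I) (\<psi> \<kappa>) x"
          by (rule contract_cong) (simp add: d_def)
        then show "(\<Sum>l\<le>n - k. coef ?\<nu> (real (k + l)) l * contract k ((ctr (\<beta> x) ^^ l) e) (\<psi> \<kappa>) x) = contract k d (\<psi> \<kappa>) x"
          by (simp add: contract_sum contract_scale)
      qed
      finally show ?thesis unfolding lessThan_Suc_atMost .
    qed
    have "a \<kappa> x I = d I"
      by (rule coefficients_unique[where z = x and b = b and n = "Suc n",
            OF \<kappa>(1) smooth_arrayD(2)[OF sa[OF \<kappa>(1)]] symd]) (rule main, assumption, simp add: True)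
    then have "a \<kappa> x I = e I" using True by (simp add: d_def)
    then show ?thesis
      using True \<kappa> by (simp add: pull_symbol_transition[OF pc x] e_def \<sigma>_def)
  qed
qed

end

definition local_ordering_op ::
  "('p, 'm::finite) atlas \<Rightarrow> real \<Rightarrow>
   (('p, 'm) chart \<Rightarrow> nat \<Rightarrow> (real^'m \<Rightarrow> 'm list \<Rightarrow> real) \<Rightarrow> (real^'m \<Rightarrow> real) \<Rightarrow> real^'m \<Rightarrow> real) \<Rightarrow>
   ('p, 'm) symbol \<Rightarrow> ('p, 'm) operator"
where
  "local_ordering_op M b R A = (\<lambda>\<psi> \<kappa> x.
     if \<psi> \<in> densities M b \<and> \<kappa> \<in> M \<and> x \<in> image_of \<kappa>
     then \<Sum>k\<le>symbol_degree A. R \<kappa> k (A \<kappa>) (\<psi> \<kappa>) x else 0)"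

lemma symbol_degree_greatest:
  assumes "A \<in> symbols M c" "A \<noteq> (\<lambda>\<kappa> x I. 0)"
  shows "component (symbol_degree A) A \<noteq> (\<lambda>\<kappa> x I. 0)"
    and "length I > symbol_degree A \<Longrightarrow> A \<kappa> x I = 0"
proof -
  obtain n where n: "\<And>\<kappa> x I. length I > n \<Longrightarrow> A \<kappa> x I = 0" using symbolsD(2)[OF assms(1)] by blast
  have bound: "k \<le> n" if "component k A \<noteq> (\<lambda>\<kappa> x I. 0)" for k
  proof (rule ccontr)
    assume "\<not> k \<le> n"
    then have "component k A \<kappa> x I = 0" for \<kappa> x I
      using n[of I \<kappa> x] by (cases "length I = k") (simp_all add: component_def)
    then have "component k A = (\<lambda>\<kappa> x I. 0)" by (intro ext)
    with that show False by contradiction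
  qed
  obtain \<kappa>0 x0 I0 where "A \<kappa>0 x0 I0 \<noteq> 0" using assms(2) by (auto simp: fun_eq_iff)
  then have "component (length I0) A \<kappa>0 x0 I0 \<noteq> 0" by (simp add: component_def)
  then have "component (length I0) A \<noteq> (\<lambda>\<kappa> x I. 0)" by (intro notI) simp
  then show "component (symbol_degree A) A \<noteq> (\<lambda>\<kappa> x I. 0)"
    unfolding symbol_degree_def using GreatestI_nat[where P = "\<lambda>k. component k A \<noteq> (\<lambda>\<kappa> x I. 0)"] bound by blast
  show "A \<kappa> x I = 0" if "length I > symbol_degree A"
  proof (rule ccontr)
    assume "A \<kappa> x I \<noteq> 0"
    then have "component (length I) A \<kappa> x I \<noteq> 0" by (simp add: component_def)
    then have "component (length I) A \<noteq> (\<lambda>\<kappa> x I. 0)" by (intro notI) simp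
    then have "length I \<le> symbol_degree A"
      unfolding symbol_degree_def using Greatest_le_nat[where P = "\<lambda>k. component k A \<noteq> (\<lambda>\<kappa> x I. 0)"] bound by blast
    with that show False by linarith
  qed
qed

locale local_ordering = projective_atlas M for M :: "('p, 'm::finite) atlas" +
  fixes b c :: real
    and R :: "('p, 'm) chart \<Rightarrow> nat \<Rightarrow> (real^'m \<Rightarrow> 'm list \<Rightarrow> real) \<Rightarrow> (real^'m \<Rightarrow> real) \<Rightarrow> real^'m \<Rightarrow> real"
  assumes R_linear: "\<kappa> \<in> M \<Longrightarrow> smooth_array a \<Longrightarrow> smooth_array a' \<Longrightarrow> smooth f \<Longrightarrow>
      R \<kappa> k (\<lambda>x I. s * a x I + t * a' x I) f x = s * R \<kappa> k a f x + t * R \<kappa> k a' f x"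
    and R_leading: "\<kappa> \<in> M \<Longrightarrow> smooth_array a \<Longrightarrow> lower_op k (\<lambda>f x. R \<kappa> k a f x - contract k (a x) f x)"
    and R_cong: "\<kappa> \<in> M \<Longrightarrow> (\<And>y I. length I = k \<Longrightarrow> a y I = a' y I) \<Longrightarrow> R \<kappa> k a f x = R \<kappa> k a' f x"
    and R_covariant: "\<kappa> \<in> M \<Longrightarrow> \<kappa>' \<in> M \<Longrightarrow> A \<in> symbols M c \<Longrightarrow> \<psi> \<in> densities M b \<Longrightarrow> x \<in> overlap \<kappa> \<kappa>' \<Longrightarrow>
      R \<kappa> k (A \<kappa>) (\<psi> \<kappa>) x = pull_density (b + c) (in_coords id \<kappa> \<kappa>') (R \<kappa>' k (A \<kappa>') (\<psi> \<kappa>')) x"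
begin

abbreviation "quantize \<equiv> local_ordering_op M b R"

lemma zero_smooth_array: "smooth_array (\<lambda>x I. 0)"
  by (simp add: smooth_array_def symmetric_array_def)

lemma R_zero:
  assumes "\<kappa> \<in> M" "smooth f" "\<And>y I. length I = k \<Longrightarrow> a y I = 0"
  shows "R \<kappa> k a f x = 0"
proof -
  have "R \<kappa> k a f x = R \<kappa> k (\<lambda>x I. 0 * 0 + 0 * 0) f x"
    using assms(1,3) by (intro R_cong) auto
  also have "\<dots> = 0"
    using R_linear[OF assms(1) zero_smooth_array zero_smooth_array assms(2), of k 0 0 x] by simp
  finally show ?thesis .
qed

lemma symbol_combine:
  "A \<in> symbols M c \<Longrightarrow> B \<in> symbols M c \<Longrightarrow> (\<lambda>\<kappa> x I. s * A \<kappa> x I + t * B \<kappa> x I) \<in> symbols M c"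
  using symbols_linear image by blast

lemma zero_symbol: "(\<lambda>\<kappa> x I. 0) \<in> symbols M c"
  unfolding symbols_def using image by (auto simp: pull_symbol_def)

lemma ordering_eq:
  assumes A: "A \<in> symbols M c" and n: "\<And>\<kappa> x I. length I > n \<Longrightarrow> A \<kappa> x I = 0"
    and \<psi>: "\<psi> \<in> densities M b" and \<kappa>: "\<kappa> \<in> M"
  shows "quantize A \<psi> \<kappa> x = (\<Sum>k\<le>n. R \<kappa> k (A \<kappa>) (\<psi> \<kappa>) x)"
proof -
  have z: "R \<kappa> k (A \<kappa>) (\<psi> \<kappa>) x = 0" if "\<And>y I. length I = k \<Longrightarrow> A \<kappa> y I = 0" for k
    using R_zero[OF \<kappa> density_smooth[OF \<psi> \<kappa>]] that by blast
  have e: "quantize A \<psi> \<kappa> x = (\<Sum>k\<le>symbol_degree A. R \<kappa> k (A \<kappa>) (\<psi> \<kappa>) x)"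
    using \<psi> \<kappa> image[OF \<kappa>] by (simp add: local_ordering_op_def)
  have m: "(\<Sum>k\<le>n. R \<kappa> k (A \<kappa>) (\<psi> \<kappa>) x) = (\<Sum>k\<le>max n n'. R \<kappa> k (A \<kappa>) (\<psi> \<kappa>) x)"
    if "\<And>y I. length I > n \<Longrightarrow> A \<kappa> y I = 0" for n n'
    by (rule sum.mono_neutral_left) (auto intro!: z that)
  show ?thesis
  proof (cases "A = (\<lambda>\<kappa> x I. 0)")
    case True
    then show ?thesis unfolding e using z by simp
  next
    case False
    show ?thesis
      unfolding e using m[of "symbol_degree A" n] m[of n "symbol_degree A"] symbol_degree_greatest(2)[OF A False] n
      by (simp add: max.commute)
  qed
qed

lemma ordering_linear:
  assumes A: "A \<in> symbols M c" and B: "B \<in> symbols M c"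
  shows "quantize (\<lambda>\<kappa> x I. s * A \<kappa> x I + t * B \<kappa> x I) = (\<lambda>\<psi> \<kappa> x. s * quantize A \<psi> \<kappa> x + t * quantize B \<psi> \<kappa> x)"
proof (intro ext)
  fix \<psi> \<kappa> x
  obtain n1 n2 where n: "\<And>\<kappa> x I. length I > n1 \<Longrightarrow> A \<kappa> x I = 0" "\<And>\<kappa> x I. length I > n2 \<Longrightarrow> B \<kappa> x I = 0"
    using symbolsD(2)[OF A] symbolsD(2)[OF B] by blast
  show "quantize (\<lambda>\<kappa> x I. s * A \<kappa> x I + t * B \<kappa> x I) \<psi> \<kappa> x = s * quantize A \<psi> \<kappa> x + t * quantize B \<psi> \<kappa> x"
  proof (cases "\<psi> \<in> densities M b \<and> \<kappa> \<in> M")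
    case True
    then have \<psi>: "\<psi> \<in> densities M b" and \<kappa>: "\<kappa> \<in> M" by auto
    note r = R_linear[OF \<kappa> symbol_smooth_array[OF A \<kappa>] symbol_smooth_array[OF B \<kappa>] density_smooth[OF \<psi> \<kappa>]]
    show ?thesis
      using ordering_eq[OF A _ \<psi> \<kappa>, of "max n1 n2" x] ordering_eq[OF B _ \<psi> \<kappa>, of "max n1 n2" x]
        ordering_eq[OF symbol_combine[OF A B, of s t] _ \<psi> \<kappa>, of "max n1 n2" x] n
      by (simp add: r sum.distrib sum_distrib_left)
  qed (auto simp: local_ordering_op_def)
qed

lemma ordering_leading:
  assumes A: "A \<in> symbols M c" and n: "\<And>\<kappa> x I. length I > n \<Longrightarrow> A \<kappa> x I = 0" and \<kappa>: "\<kappa> \<in> M"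
  shows "\<exists>a. local_form (Suc n) b (quantize A) \<kappa> a \<and> (\<forall>x I. length I = n \<longrightarrow> a x I = A \<kappa> x I)"
proof -
  note sA = symbol_smooth_array[OF A \<kappa>]
  have "lower_op n (\<lambda>f x. (\<Sum>k<n. (R \<kappa> k (A \<kappa>) f x - contract k (A \<kappa> x) f x) + contract k (A \<kappa> x) f x)
      + (R \<kappa> n (A \<kappa>) f x - contract n (A \<kappa> x) f x))"
  proof (intro lower_op_add lower_op_sum R_leading \<kappa> sA)
    fix k assume "k \<in> {..<n}"
    then have k: "k < n" by simp
    show "lower_op n (\<lambda>f x. R \<kappa> k (A \<kappa>) f x - contract k (A \<kappa> x) f x)"
      using lower_op_mono[OF R_leading[OF \<kappa> sA]] k by simp
    show "lower_op n (\<lambda>f x. contract k (A \<kappa> x) f x)"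
      unfolding contract_def by (intro lower_op_sum lower_op_partials smooth_arrayD(1)[OF sA]) (use k in auto)
  qed
  then obtain e where e: "smooth_array e" "\<And>f x. smooth f \<Longrightarrow>
      (\<Sum>k<n. (R \<kappa> k (A \<kappa>) f x - contract k (A \<kappa> x) f x) + contract k (A \<kappa> x) f x)
      + (R \<kappa> n (A \<kappa>) f x - contract n (A \<kappa> x) f x) = (\<Sum>k<n. contract k (e x) f x)"
    by (rule lower_op_smooth_array) blast
  define a where "a x I = (if length I < n then e x I else if length I = n then A \<kappa> x I else 0)" for x I
  have "smooth_array a"
  proof -
    have "smooth (\<lambda>x. a x I)" for I
      unfolding a_def using smooth_arrayD(1)[OF e(1)] smooth_arrayD(1)[OF sA]
      by (cases "length I < n"; cases "length I = n") auto
    moreover have "a x I = a x J" if "mset I = mset J" for x I J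
      using symmetric_arrayD[OF smooth_arrayD(2)[OF e(1)] that] symmetric_arrayD[OF smooth_arrayD(2)[OF sA] that]
        mset_eq_length[OF that] by (simp add: a_def)
    ultimately show ?thesis unfolding smooth_array_def symmetric_array_def by blast
  qed
  moreover have "quantize A \<psi> \<kappa> x = (\<Sum>k<Suc n. contract k (a x) (\<psi> \<kappa>) x)" if \<psi>: "\<psi> \<in> densities M b" for \<psi> x
  proof -
    have "(\<Sum>k<n. contract k (a x) (\<psi> \<kappa>) x) = (\<Sum>k<n. contract k (e x) (\<psi> \<kappa>) x)"
      by (intro sum.cong refl contract_cong) (auto simp: a_def)
    moreover have "contract n (a x) (\<psi> \<kappa>) x = contract n (A \<kappa> x) (\<psi> \<kappa>) x"
      by (rule contract_cong) (simp add: a_def)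
    moreover have "quantize A \<psi> \<kappa> x = (\<Sum>k<n. R \<kappa> k (A \<kappa>) (\<psi> \<kappa>) x) + R \<kappa> n (A \<kappa>) (\<psi> \<kappa>) x"
      using ordering_eq[OF A n \<psi> \<kappa>, where x = x] by (simp add: lessThan_Suc_atMost[symmetric])
    ultimately show ?thesis using e(2)[OF density_smooth[OF \<psi> \<kappa>], of x] by simp
  qed
  ultimately show ?thesis unfolding local_form_def by (intro exI[of _ a]) (auto simp: a_def)
qed

lemma ordering_diff_op:
  assumes A: "A \<in> symbols M c"
  shows "quantize A \<in> diff_ops M b c"
proof -
  obtain n where n: "\<And>\<kappa> x I. length I > n \<Longrightarrow> A \<kappa> x I = 0" using symbolsD(2)[OF A] by blast
  show ?thesis
    unfolding diff_ops_def mem_Collect_eq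
  proof (intro conjI allI impI ballI exI[of _ n])
    show "quantize A \<psi> = (\<lambda>\<kappa> x. 0)" if "\<psi> \<notin> densities M b" for \<psi>
      using that by (simp add: local_ordering_op_def)
    show "\<exists>a. (\<forall>I. smooth_on (image_of \<kappa>) (a I)) \<and> (\<forall>\<psi>\<in>densities M b. \<forall>x\<in>image_of \<kappa>.
        quantize A \<psi> \<kappa> x = (\<Sum>I | length I \<le> n. a I x * partials I (\<psi> \<kappa>) x))" if \<kappa>: "\<kappa> \<in> M" for \<kappa>
    proof -
      obtain a where a: "smooth_array a" "\<forall>\<psi>\<in>densities M b. \<forall>x. quantize A \<psi> \<kappa> x = (\<Sum>k<Suc n. contract k (a x) (\<psi> \<kappa>) x)"
        using ordering_leading[OF A n \<kappa>] unfolding local_form_def by blast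
      have len: "{I :: 'm list. length I \<le> n} = {I. length I < Suc n}" by auto
      show ?thesis
        unfolding len sum_length_less image[OF \<kappa>] using a smooth_arrayD(1)[OF a(1)]
        by (intro exI[of _ "\<lambda>I x. a x I"]) (simp add: contract_def)
    qed
    fix \<psi> assume \<psi>: "\<psi> \<in> densities M b"
    show "quantize A \<psi> \<in> densities M (b + c)"
      unfolding densities_def mem_Collect_eq
    proof (intro conjI allI impI ballI)
      show "quantize A \<psi> \<kappa> x = 0" if "\<kappa> \<notin> M \<or> x \<notin> image_of \<kappa>" for \<kappa> x
        using that by (auto simp: local_ordering_op_def)
      show "smooth_on (image_of \<kappa>) (quantize A \<psi> \<kappa>)" if \<kappa>: "\<kappa> \<in> M" for \<kappa>
      proof -
        obtain a where a: "smooth_array a" "\<forall>\<psi>\<in>densities M b. \<forall>x. quantize A \<psi> \<kappa> x = (\<Sum>k<Suc n. contract k (a x) (\<psi> \<kappa>) x)"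
          using ordering_leading[OF A n \<kappa>] unfolding local_form_def by blast
        have "quantize A \<psi> \<kappa> = (\<lambda>x. \<Sum>k<Suc n. contract k (a x) (\<psi> \<kappa>) x)" using a(2) \<psi> by blast
        then show ?thesis
          unfolding image[OF \<kappa>]
          by (simp only:) (intro smooth_sum smooth_contract density_smooth[OF \<psi> \<kappa>] smooth_arrayD(1)[OF a(1)])
      qed
      fix \<kappa> \<kappa>' x assume \<kappa>: "\<kappa> \<in> M" "\<kappa>' \<in> M" and x: "x \<in> overlap \<kappa> \<kappa>'"
      show "quantize A \<psi> \<kappa> x = pull_density (b + c) (in_coords id \<kappa> \<kappa>') (quantize A \<psi> \<kappa>') x"
        using R_covariant[OF \<kappa> A \<psi> x]
        by (simp add: pull_density_def ordering_eq[OF A n \<psi> \<kappa>(1)] ordering_eq[OF A n \<psi> \<kappa>(2)] sum_distrib_left)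
    qed
  qed
qed

lemma diff_op_is_ordering:
  assumes "D \<in> diff_ops M b c" "\<And>\<kappa>. \<kappa> \<in> M \<Longrightarrow> \<exists>a. local_form n b D \<kappa> a"
  shows "\<exists>A\<in>symbols M c. quantize A = D"
  using assms
proof (induction n arbitrary: D)
  case 0
  have "D \<psi> \<kappa> x = 0" for \<psi> \<kappa> x
  proof (cases "\<psi> \<in> densities M b")
    case True
    then have "D \<psi> \<in> densities M (b + c)" using 0 unfolding diff_ops_def by blast
    then show ?thesis
      using densitiesD(1) 0(2)[of \<kappa>] True by (cases "\<kappa> \<in> M") (fastforce simp: local_form_def)+
  next
    case False
    then show ?thesis using 0 unfolding diff_ops_def by simp
  qed
  moreover have "quantize (\<lambda>\<kappa> x I. 0) = (\<lambda>\<psi> \<kappa> x. 0)"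
    using ordering_linear[OF zero_symbol zero_symbol, of 0 0] by simp
  ultimately show ?case using zero_symbol by (intro bexI[of _ "\<lambda>\<kappa> x I. 0"]) auto
next
  case (Suc n)
  obtain a where a: "\<And>\<kappa>. \<kappa> \<in> M \<Longrightarrow> local_form (Suc n) b D \<kappa> (a \<kappa>)" using Suc.prems(2) by metis
  define \<sigma> where "\<sigma> = (\<lambda>\<kappa> x I. if \<kappa> \<in> M \<and> length I = n then a \<kappa> x I else 0)"
  have \<sigma>: "\<sigma> \<in> symbols M c" unfolding \<sigma>_def by (rule leading_coefficients_symbol[OF Suc.prems(1) a])
  have n: "\<sigma> \<kappa> x I = 0" if "length I > n" for \<kappa> x I using that by (simp add: \<sigma>_def)
  define E where "E = (\<lambda>\<psi> \<kappa> x. D \<psi> \<kappa> x - quantize \<sigma> \<psi> \<kappa> x)"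
  have E: "E \<in> diff_ops M b c" unfolding E_def by (rule diff_ops_diff[OF Suc.prems(1) ordering_diff_op[OF \<sigma>]])
  have "\<exists>a. local_form n b E \<kappa> a" if \<kappa>: "\<kappa> \<in> M" for \<kappa>
  proof -
    obtain e where e: "local_form (Suc n) b (quantize \<sigma>) \<kappa> e" "\<And>x I. length I = n \<Longrightarrow> e x I = \<sigma> \<kappa> x I"
      using ordering_leading[OF \<sigma> n \<kappa>] by blast
    note sa = conjunct1[OF a[OF \<kappa>, unfolded local_form_def]] and se = conjunct1[OF e(1)[unfolded local_form_def]]
    have "smooth_array (\<lambda>x I. a \<kappa> x I + (- 1) * e x I)"
    proof -
      have "a \<kappa> x I + (- 1) * e x I = a \<kappa> x J + (- 1) * e x J" if "mset I = mset J" for x I J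
        using symmetric_arrayD[OF smooth_arrayD(2)[OF sa] that] symmetric_arrayD[OF smooth_arrayD(2)[OF se] that] by simp
      moreover have "smooth (\<lambda>x. a \<kappa> x I + (- 1) * e x I)" for I
        by (intro smooth_add smooth_mult smooth_const smooth_arrayD(1) sa se)
      ultimately show ?thesis unfolding smooth_array_def symmetric_array_def by blast
    qed
    moreover have "E \<psi> \<kappa> x = (\<Sum>k<n. contract k (\<lambda>I. a \<kappa> x I + (- 1) * e x I) (\<psi> \<kappa>) x)" if \<psi>: "\<psi> \<in> densities M b" for \<psi> x
    proof -
      have "contract n (a \<kappa> x) (\<psi> \<kappa>) x = contract n (e x) (\<psi> \<kappa>) x"
        using \<kappa> by (intro contract_cong) (simp add: e(2) \<sigma>_def)
      moreover have "E \<psi> \<kappa> x = (\<Sum>k<Suc n. contract k (a \<kappa> x) (\<psi> \<kappa>) x) - (\<Sum>k<Suc n. contract k (e x) (\<psi> \<kappa>) x)"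
        using a[OF \<kappa>] e(1) \<psi> unfolding local_form_def E_def by metis
      ultimately show ?thesis
        unfolding contract_add contract_scale by (simp add: sum_subtractf)
    qed
    ultimately show ?thesis unfolding local_form_def by blast
  qed
  from Suc.IH[OF E this] obtain A where A: "A \<in> symbols M c" "quantize A = E" by blast
  have "quantize (\<lambda>\<kappa> x I. 1 * A \<kappa> x I + 1 * \<sigma> \<kappa> x I) = D"
    unfolding ordering_linear[OF A(1) \<sigma>] A(2) by (simp add: E_def)
  then show ?case using symbol_combine[OF A(1) \<sigma>, of 1 1] by blast
qed

lemma ordering_leading_unique:
  assumes A: "A \<in> symbols M c" "\<And>\<kappa> x I. length I > n \<Longrightarrow> A \<kappa> x I = 0"
    and a: "local_form (Suc n) b (quantize A) \<kappa> a" and \<kappa>: "\<kappa> \<in> M" and I: "length I = n"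
  shows "A \<kappa> x I = a x I"
proof -
  obtain e where e: "local_form (Suc n) b (quantize A) \<kappa> e" "\<And>x I. length I = n \<Longrightarrow> e x I = A \<kappa> x I"
    using ordering_leading[OF A \<kappa>] by blast
  have "(\<Sum>k<Suc n. contract k (e x) (\<psi> \<kappa>) x) = (\<Sum>k<Suc n. contract k (a x) (\<psi> \<kappa>) x)" if "\<psi> \<in> densities M b" for \<psi>
    using a e(1) that unfolding local_form_def by metis
  moreover have "symmetric_array (e x)" "symmetric_array (a x)"
    using a e(1) smooth_arrayD(2) unfolding local_form_def by blast+
  ultimately have "e x I = a x I"
    using coefficients_unique[where z = x and a = "e x" and a' = "a x" and n = "Suc n" and b = b and \<kappa> = \<kappa> and I = I] \<kappa> I
    by blast
  then show ?thesis using e(2)[OF I] by simp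
qed

lemma ordering_zero_iff:
  assumes A: "A \<in> symbols M c" and z: "quantize A = zero_operator"
  shows "A = (\<lambda>\<kappa> x I. 0)"
proof (rule ccontr)
  assume ne: "A \<noteq> (\<lambda>\<kappa> x I. 0)"
  note deg = symbol_degree_greatest[OF A ne]
  have "A \<kappa> x I = 0" if I: "length I = symbol_degree A" for \<kappa> x I
  proof (cases "\<kappa> \<in> M")
    case True
    have "local_form (Suc (symbol_degree A)) b (quantize A) \<kappa> (\<lambda>x I. 0)"
      unfolding z local_form_def using zero_smooth_array by (simp add: zero_operator_def contract_def)
    from ordering_leading_unique[OF A deg(2) this True I] show ?thesis by simp
  qed (simp add: symbolsD(1)[OF A])
  then have "component (symbol_degree A) A = (\<lambda>\<kappa> x I. 0)" by (auto simp: component_def fun_eq_iff)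
  with deg(1) show False by simp
qed

lemma ordering_bij: "bij_betw quantize (symbols M c) (diff_ops M b c)"
  unfolding bij_betw_def
proof
  show "inj_on quantize (symbols M c)"
  proof (rule inj_onI)
    fix A B assume A: "A \<in> symbols M c" and B: "B \<in> symbols M c" and eq: "quantize A = quantize B"
    have "quantize (\<lambda>\<kappa> x I. 1 * A \<kappa> x I + (- 1) * B \<kappa> x I) = zero_operator"
      unfolding ordering_linear[OF A B] eq by (simp add: zero_operator_def)
    from ordering_zero_iff[OF symbol_combine[OF A B] this] show "A = B" by (simp add: fun_eq_iff)
  qed
  show "quantize ` symbols M c = diff_ops M b c"
    using ordering_diff_op diff_op_is_ordering diff_op_local_form by (auto simp: image_iff) metis
qed

end

lemma top_component_eq:
  assumes L: "local_ordering M b c R" and L': "local_ordering M b c R'"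
    and A: "A \<in> symbols M c" "A \<noteq> (\<lambda>\<kappa> x I. 0)" and B: "B \<in> symbols M c" "B \<noteq> (\<lambda>\<kappa> x I. 0)"
    and eq: "local_ordering_op M b R A = local_ordering_op M b R' B"
  shows "top_component A = top_component B"
proof -
  have le: "symbol_degree B \<le> symbol_degree A \<and>
      (symbol_degree B = symbol_degree A \<longrightarrow> (\<forall>\<kappa> x I. length I = symbol_degree A \<longrightarrow> A \<kappa> x I = B \<kappa> x I))"
    if L: "local_ordering M b c R" and L': "local_ordering M b c R'"
      and A: "A \<in> symbols M c" "A \<noteq> (\<lambda>\<kappa> x I. 0)" and B: "B \<in> symbols M c" "B \<noteq> (\<lambda>\<kappa> x I. 0)"
      and eq: "local_ordering_op M b R A = local_ordering_op M b R' B" for R R' A B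
  proof -
    interpret X: local_ordering M b c R by fact
    interpret Y: local_ordering M b c R' by fact
    note dA = symbol_degree_greatest[OF A] and dB = symbol_degree_greatest[OF B]
    have "symbol_degree B \<le> symbol_degree A"
    proof (rule ccontr)
      assume "\<not> symbol_degree B \<le> symbol_degree A"
      then have lt: "symbol_degree A < symbol_degree B" by simp
      have "B \<kappa> x I = 0" if I: "length I = symbol_degree B" for \<kappa> x I
      proof (cases "\<kappa> \<in> M")
        case True
        obtain a where a: "X.local_form (Suc (symbol_degree A)) b (local_ordering_op M b R A) \<kappa> a"
          using X.ordering_leading[OF A(1) dA(2) True] by blast
        obtain a' where a': "X.local_form (Suc (symbol_degree B)) b (local_ordering_op M b R A) \<kappa> a'"
          "\<And>x I. Suc (symbol_degree A) \<le> length I \<Longrightarrow> a' x I = 0"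
          using X.local_form_mono[OF a, of "Suc (symbol_degree B)"] lt by auto
        from Y.ordering_leading_unique[OF B(1) dB(2) a'(1)[unfolded eq] True I] a'(2) lt I show ?thesis by simp
      qed (simp add: symbolsD(1)[OF B(1)])
      then have "component (symbol_degree B) B = (\<lambda>\<kappa> x I. 0)" by (auto simp: component_def fun_eq_iff)
      with dB(1) show False by simp
    qed
    moreover have "A \<kappa> x I = B \<kappa> x I" if d: "symbol_degree B = symbol_degree A" and I: "length I = symbol_degree A" for \<kappa> x I
    proof (cases "\<kappa> \<in> M")
      case True
      obtain a where a: "X.local_form (Suc (symbol_degree A)) b (local_ordering_op M b R A) \<kappa> a"
          "\<And>x I. length I = symbol_degree A \<Longrightarrow> a x I = A \<kappa> x I"
        using X.ordering_leading[OF A(1) dA(2) True] by blast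
      from Y.ordering_leading_unique[where \<kappa> = \<kappa> and I = I and x = x, OF B(1) dB(2) _ True] a I
      show ?thesis unfolding d eq by simp
    qed (simp add: symbolsD(1)[OF A(1)] symbolsD(1)[OF B(1)])
    ultimately show ?thesis by blast
  qed
  from le[OF L L' A B eq] le[OF L' L B A eq[symmetric]]
  show ?thesis unfolding top_component_def by (auto simp: component_def fun_eq_iff)
qed

theorem local_ordering_prescription:
  assumes L: "local_ordering M b c R"
    and std: "\<And>\<Gamma>. \<Gamma> \<in> torsion_free_connections M \<Longrightarrow>
      local_ordering M b c (\<lambda>\<kappa> k a f x. insertion k (a x) (sym_deriv_pow b (\<Gamma> \<kappa>) k f x))"
  shows "ordering_prescription M b c (local_ordering_op M b R)"
proof -
  interpret X: local_ordering M b c R by fact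
  show ?thesis
    unfolding ordering_prescription_def
  proof (intro conjI ballI allI impI)
    show "bij_betw X.quantize (symbols M c) (diff_ops M b c)" by (rule X.ordering_bij)
    show "torsion_free_connections M \<noteq> {}" by (rule X.connection_exists)
    show "X.quantize (\<lambda>\<kappa> x I. s * A \<kappa> x I + t * B \<kappa> x I) = (\<lambda>\<psi> \<kappa> x. s * X.quantize A \<psi> \<kappa> x + t * X.quantize B \<psi> \<kappa> x)"
      if "A \<in> symbols M c" "B \<in> symbols M c" for A B s t using X.ordering_linear[OF that] .
    fix \<Gamma> D assume \<Gamma>: "\<Gamma> \<in> torsion_free_connections M" and D: "D \<in> diff_ops M b c" "D \<noteq> zero_operator"
    let ?R = "\<lambda>\<kappa> k a f x. insertion k (a x) (sym_deriv_pow b (\<Gamma> \<kappa>) k f x)"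
    interpret Y: local_ordering M b c ?R by (rule std[OF \<Gamma>])
    have s: "std_ordering M b \<Gamma> = local_ordering_op M b ?R"
      by (intro ext) (simp add: std_ordering_def local_ordering_op_def)
    define A where "A = inv_into (symbols M c) X.quantize D"
    define B where "B = inv_into (symbols M c) (std_ordering M b \<Gamma>) D"
    have A: "A \<in> symbols M c" "X.quantize A = D"
      unfolding A_def using bij_betw_inv_into_right[OF X.ordering_bij D(1)] inv_into_into[of D X.quantize "symbols M c"]
        X.ordering_bij D(1) by (auto simp: bij_betw_def)
    have B: "B \<in> symbols M c" "Y.quantize B = D"
      unfolding B_def s using bij_betw_inv_into_right[OF Y.ordering_bij D(1)] inv_into_into[of D Y.quantize "symbols M c"]
        Y.ordering_bij D(1) by (auto simp: bij_betw_def)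
    have "A \<noteq> (\<lambda>\<kappa> x I. 0)"
      using A D(2) X.ordering_linear[OF X.zero_symbol X.zero_symbol, of 0 0] by (auto simp: zero_operator_def)
    moreover have "B \<noteq> (\<lambda>\<kappa> x I. 0)"
      using B D(2) Y.ordering_linear[OF Y.zero_symbol Y.zero_symbol, of 0 0] by (auto simp: zero_operator_def)
    ultimately show "top_component (inv_into (symbols M c) X.quantize D) = principal_symbol M b c \<Gamma> D"
      unfolding principal_symbol_def A_def[symmetric] B_def[symmetric]
      using top_component_eq[OF L std[OF \<Gamma>] A(1) _ B(1)] A(2) B(2) by simp
  qed
qed

lemma div_array_pow_cong:
  assumes "\<And>y I. length I = k \<Longrightarrow> a y I = a' y I"
  shows "l \<le> k \<Longrightarrow> length I = k - l \<Longrightarrow> (div_array ^^ l) a x I = (div_array ^^ l) a' x I"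
proof (induction l arbitrary: I x)
  case 0 then show ?case using assms by simp
next
  case (Suc l)
  have "(\<lambda>y. (div_array ^^ l) a y (i # I)) = (\<lambda>y. (div_array ^^ l) a' y (i # I))" for i
    using Suc by (intro ext Suc.IH) auto
  then show ?case by (simp add: div_array_def[of "(div_array ^^ l) _"])
qed

lemma div_array_pow_linear:
  assumes "smooth_array a" "smooth_array a'"
  shows "(div_array ^^ l) (\<lambda>x I. s * a x I + t * a' x I) = (\<lambda>x I. s * (div_array ^^ l) a x I + t * (div_array ^^ l) a' x I)"
proof (induction l)
  case (Suc l)
  have "partial i (\<lambda>y. s * (div_array ^^ l) a y I + t * (div_array ^^ l) a' y I) x =
      s * partial i (\<lambda>y. (div_array ^^ l) a y I) x + t * partial i (\<lambda>y. (div_array ^^ l) a' y I) x" for i I x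
    using smooth_arrayD(1)[OF smooth_array_div_pow[OF assms(1)]] smooth_arrayD(1)[OF smooth_array_div_pow[OF assms(2)]]
    by (simp add: partial_add partial_cmult smooth_differentiable differentiable_mult_real)
  then show ?case
    unfolding funpow.simps o_def Suc
    by (simp add: div_array_def[abs_def] sum.distrib sum_distrib_left)
qed simp

lemma proj_quant_linear:
  assumes "smooth_array a" "smooth_array a'"
  shows "proj_quant b c k (\<lambda>x I. s * a x I + t * a' x I) f x = s * proj_quant b c k a f x + t * proj_quant b c k a' f x"
  unfolding proj_quant_def div_array_pow_linear[OF assms] contract_add contract_scale
  by (simp add: sum.distrib sum_distrib_left algebra_simps)

lemma proj_quant_cong:
  assumes "\<And>y I. length I = k \<Longrightarrow> a y I = a' y I"
  shows "proj_quant b c k a f x = proj_quant b c k a' f x"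
  unfolding proj_quant_def
  by (intro sum.cong refl arg_cong2[where f = "(*)"] contract_cong div_array_pow_cong[OF assms]) auto

context projective_change begin

lemma second_partials:
  assumes "x \<in> S"
  shows "partials [i, j] (\<lambda>z. h z $ a) x = - (H x $ a $ i * \<beta> x j + H x $ a $ j * \<beta> x i)"
proof -
  have p: "partial j (\<lambda>z. h z $ a) z = H z $ a $ j" if "z \<in> S" for z
    using partial_chain(1)[OF h_derivative[OF that], of "\<lambda>y. y $ a" j]
    by (simp add: partial_coord if_distrib[of "(*) _"] sum.delta cong: if_cong)
  have "partials [i, j] (\<lambda>z. h z $ a) x = partial i (\<lambda>z. H z $ a $ j) x"
    unfolding partials_Cons partials_Nil
    by (rule partial_cong_open(1)[OF open_S assms _ H_differentiable[OF assms], symmetric]) (simp add: p)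
  then show ?thesis by (simp add: H_partial[OF assms])
qed

end

context projective_atlas begin

lemma proj_quant_local_ordering:
  assumes nz: "\<And>k j. j < k \<Longrightarrow> 2 * real k + real CARD('m) - c * (real CARD('m) + 1) - 1 - real j \<noteq> 0"
  shows "local_ordering M b c (\<lambda>\<kappa>. proj_quant b c)"
proof unfold_locales
  fix \<kappa> \<kappa>' A \<psi> x k
  assume \<kappa>: "\<kappa> \<in> M" "\<kappa>' \<in> M" and A: "A \<in> symbols M c" and \<psi>: "\<psi> \<in> densities M b" and x: "x \<in> overlap \<kappa> \<kappa>'"
  let ?h = "in_coords id \<kappa> \<kappa>'"
  obtain H \<beta> where pc: "projective_change (overlap \<kappa> \<kappa>') ?h H \<beta>" using transition[OF \<kappa>] by blast
  interpret P: projective_change "overlap \<kappa> \<kappa>'" ?h H \<beta> by fact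
  have eq: "\<psi> \<kappa> y = P.weight b y * \<psi> \<kappa>' (?h y)" if "y \<in> overlap \<kappa> \<kappa>'" for y
    using densitiesD(3)[OF \<psi> \<kappa> that] pull_density_transition[OF pc that] by simp
  show "proj_quant b c k (A \<kappa>) (\<psi> \<kappa>) x = pull_density (b + c) ?h (proj_quant b c k (A \<kappa>') (\<psi> \<kappa>')) x"
    unfolding pull_density_transition[OF pc x]
    by (rule P.proj_quant_covariant[OF symbol_smooth_array[OF A \<kappa>(1)] symbol_smooth_array[OF A \<kappa>(2)]
          symbol_push_related[OF pc A \<kappa>] density_smooth[OF \<psi> \<kappa>(2)] density_smooth[OF \<psi> \<kappa>(1)] eq nz x])
qed (auto intro: proj_quant_linear lower_op_proj_quant proj_quant_cong)

lemma std_local_ordering: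
  assumes \<Gamma>: "\<Gamma> \<in> torsion_free_connections M"
  shows "local_ordering M b c (\<lambda>\<kappa> k a f x. insertion k (a x) (sym_deriv_pow b (\<Gamma> \<kappa>) k f x))"
proof -
  have sm: "smooth (\<lambda>x. \<Gamma> \<kappa> x k i j)" if "\<kappa> \<in> M" for \<kappa> k i j
    using \<Gamma> that image[OF that] unfolding torsion_free_connections_def by auto
  show ?thesis
  proof unfold_locales
    fix \<kappa> \<kappa>' A \<psi> x k
    assume \<kappa>: "\<kappa> \<in> M" "\<kappa>' \<in> M" and A: "A \<in> symbols M c" and \<psi>: "\<psi> \<in> densities M b" and x: "x \<in> overlap \<kappa> \<kappa>'"
    let ?h = "in_coords id \<kappa> \<kappa>'"
    obtain H \<beta> where pc: "projective_change (overlap \<kappa> \<kappa>') ?h H \<beta>" using transition[OF \<kappa>] by blast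
    interpret P: projective_change "overlap \<kappa> \<kappa>'" ?h H \<beta> by fact
    have eq: "\<psi> \<kappa> y = P.weight b y * \<psi> \<kappa>' (?h y)" if "y \<in> overlap \<kappa> \<kappa>'" for y
      using densitiesD(3)[OF \<psi> \<kappa> that] pull_density_transition[OF pc that] by simp
    have law: "(\<Sum>k\<in>UNIV. H y $ a $ k * \<Gamma> \<kappa> y k i j) = - (H y $ a $ i * \<beta> y j + H y $ a $ j * \<beta> y i)
      + (\<Sum>p\<in>UNIV. \<Sum>q\<in>UNIV. \<Gamma> \<kappa>' (?h y) a p q * H y $ p $ i * H y $ q $ j)" if y: "y \<in> overlap \<kappa> \<kappa>'" for y a i j
    proof -
      have "partials [i, j] (\<lambda>z. ?h z $ a) y = - (H y $ a $ i * \<beta> y j + H y $ a $ j * \<beta> y i)"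
        by (rule P.second_partials[OF y])
      moreover have "(\<Sum>k\<in>UNIV. jacobian ?h (at y) $ a $ k * \<Gamma> \<kappa> y k i j) = partials [i, j] (\<lambda>z. ?h z $ a) y +
         (\<Sum>p\<in>UNIV. \<Sum>q\<in>UNIV. \<Gamma> \<kappa>' (?h y) a p q * jacobian ?h (at y) $ p $ i * jacobian ?h (at y) $ q $ j)"
        using \<Gamma> \<kappa> y unfolding torsion_free_connections_def mem_Collect_eq Let_def by blast
      ultimately show ?thesis unfolding projective_change.jacobian_eq[OF pc y] by (simp only:)
    qed
    show "insertion k (A \<kappa> x) (sym_deriv_pow b (\<Gamma> \<kappa>) k (\<psi> \<kappa>) x) =
      pull_density (b + c) ?h (\<lambda>x. insertion k (A \<kappa>' x) (sym_deriv_pow b (\<Gamma> \<kappa>') k (\<psi> \<kappa>') x)) x"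
      unfolding pull_density_transition[OF pc x]
      by (rule P.insertion_covariant[OF law sm[OF \<kappa>(2)] density_smooth[OF \<psi> \<kappa>(2)] eq symbol_push_related[OF pc A \<kappa>] x])
  next
    show "lower_op k (\<lambda>f x. insertion k (a x) (sym_deriv_pow b (\<Gamma> \<kappa>) k f x) - contract k (a x) f x)"
      if "\<kappa> \<in> M" "smooth_array a" for \<kappa> k a
      by (intro lower_op_insertion sm that(1) smooth_arrayD(1)[OF that(2)])
  qed (auto simp: insertion_def sum.distrib sum_distrib_left add_divide_distrib algebra_simps)
qed

lemma std_prescription:
  assumes "local_ordering M b c R"
  shows "ordering_prescription M b c (local_ordering_op M b R)"
  using local_ordering_prescription[OF assms std_local_ordering] .

end

lemma nonresonant:
  assumes "c \<notin> {(real j + m) / (m + 1) | j :: nat. True}" "m > 0" "j < k"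
  shows "2 * real k + m - c * (m + 1) - 1 - real j \<noteq> 0"
proof
  assume "2 * real k + m - c * (m + 1) - 1 - real j = 0"
  then have "c * (m + 1) = real (2 * k - 1 - j) + m" using assms(3) by (simp add: of_nat_diff)
  then have "c = (real (2 * k - 1 - j) + m) / (m + 1)" using assms(2) by (simp add: field_simps)
  with assms(1) show False by blast
qed

section \<open>The sphere\<close>

definition sphere_chart ::
  "((real^'m::finite) \<times> real \<Rightarrow> (real^'m) \<times> real) \<Rightarrow> ((real^'m) \<times> real, 'm) chart" where
  "sphere_chart g = ({p \<in> sphere 0 1. snd (g p) > 0}, \<lambda>p. fst (g p) /\<^sub>R snd (g p))"

lemma sphere_atlas_eq: "sphere_atlas = {sphere_chart g | g. linear g \<and> bij g}"
  by (simp add: sphere_atlas_def sphere_chart_def)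

definition fractional_linear ::
  "((real^'m::finite) \<times> real \<Rightarrow> (real^'m) \<times> real) \<Rightarrow> real^'m \<Rightarrow> real^'m" where
  "fractional_linear G x = fst (G (x, 1)) /\<^sub>R snd (G (x, 1))"

lemma fractional_linear_scale:
  assumes "linear G" "r \<noteq> 0"
  shows "fst (G (r *\<^sub>R p)) /\<^sub>R snd (G (r *\<^sub>R p)) = fst (G p) /\<^sub>R snd (G p)"
proof -
  have "inverse (r * s) * r = inverse s" for s using assms(2) by (simp add: inverse_mult_distrib mult.commute)
  then show ?thesis
    by (simp only: linear_scale[OF assms(1)] fst_scaleR snd_scaleR scaleR_scaleR real_scaleR_def)
qed

lemma linear_vec_sum:
  fixes L :: "real^'m::finite \<Rightarrow> real"
  assumes "linear L"
  shows "L v = (\<Sum>i\<in>UNIV. v $ i * L (axis i 1))"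
proof -
  have "L v = L (\<Sum>i\<in>UNIV. v $ i *\<^sub>R axis i 1)" using sum_axis[of v] by simp
  then show ?thesis by (simp only: linear_sum[OF assms] linear_scale[OF assms] real_scaleR_def)
qed

lemma linear_at_1:
  fixes L :: "(real^'m::finite) \<times> real \<Rightarrow> real"
  assumes "linear L"
  shows "L (x, 1) = (\<Sum>i\<in>UNIV. x $ i * L (axis i 1, 0)) + L (0, 1)"
proof -
  have "linear (\<lambda>v. L (v, 0))"
    using linear_add[OF assms, of "(_, 0)" "(_, 0)"] linear_scale[OF assms, of _ "(_, 0)"] by (intro linearI) auto
  from linear_vec_sum[OF this, of x] show ?thesis
    using linear_add[OF assms, of "(x, 0)" "(0, 1)"] by simp
qed

lemma smooth_linear_at_1:
  fixes L :: "(real^'m::finite) \<times> real \<Rightarrow> real"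
  assumes "linear L"
  shows "smooth (\<lambda>x. L (x, 1))"
proof -
  have "smooth (\<lambda>x. (\<Sum>i\<in>UNIV. x $ i * L (axis i 1, 0)) + L (0, 1))"
    by (intro smooth_add smooth_sum smooth_mult smooth_coord smooth_const)
  then show ?thesis by (rule ssubst[OF ext[OF linear_at_1[OF assms]]])
qed

lemma partial_linear_at_1:
  fixes L :: "(real^'m::finite) \<times> real \<Rightarrow> real"
  assumes "linear L"
  shows "partial j (\<lambda>x. L (x, 1)) x = L (axis j 1, 0)"
proof -
  have s: "smooth (\<lambda>x. x $ i * L (axis i 1, 0))" for i by (intro smooth_mult smooth_coord smooth_const)
  have "partial j (\<lambda>x. (\<Sum>i\<in>UNIV. x $ i * L (axis i 1, 0)) + L (0, 1)) x =
      (\<Sum>i\<in>UNIV. (if i = j then 1 else 0) * L (axis i 1, 0))"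
    by (subst partial_add) (auto simp: partial_sum partial_mult partial_coord smooth_differentiable[OF s]
        smooth_differentiable[OF smooth_sum[OF s]])
  also have "\<dots> = L (axis j 1, 0)" by (rule sum_kronecker)
  finally show ?thesis by (rule ssubst[OF ext[OF linear_at_1[OF assms]]])
qed

lemma linear_fst_comp: "linear G \<Longrightarrow> linear (\<lambda>p. fst (G p) $ a)"
  by (rule linearI) (simp_all add: linear_add linear_scale)

lemma linear_snd_comp: "linear G \<Longrightarrow> linear (\<lambda>p. snd (G p) :: real)"
  by (rule linearI) (simp_all add: linear_add linear_scale)

definition fl_denom :: "((real^'m::finite) \<times> real \<Rightarrow> (real^'m) \<times> real) \<Rightarrow> real^'m \<Rightarrow> real" where
  "fl_denom G x = snd (G (x, 1))"

definition fl_jacobian ::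
  "((real^'m::finite) \<times> real \<Rightarrow> (real^'m) \<times> real) \<Rightarrow> real^'m \<Rightarrow> real^'m^'m" where
  "fl_jacobian G x = (\<chi> a i. (fst (G (axis i 1, 0)) $ a - fractional_linear G x $ a * snd (G (axis i 1, 0))) * (1 / fl_denom G x))"

definition fl_form :: "((real^'m::finite) \<times> real \<Rightarrow> (real^'m) \<times> real) \<Rightarrow> real^'m \<Rightarrow> 'm \<Rightarrow> real" where
  "fl_form G x i = snd (G (axis i 1, 0)) * (1 / fl_denom G x)"

lemma projective_change_fractional_linear:
  fixes G :: "(real^'m::finite) \<times> real \<Rightarrow> (real^'m) \<times> real"
  assumes G: "linear G" "bij G"
  shows "projective_change {x. fl_denom G x > 0} (fractional_linear G) (fl_jacobian G) (fl_form G)"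
proof -
  let ?s = "fl_denom G" and ?h = "fractional_linear G"
  have ss: "smooth ?s" unfolding fl_denom_def[abs_def] by (rule smooth_linear_at_1[OF linear_snd_comp[OF G(1)]])
  have ps: "partial j ?s x = snd (G (axis j 1, 0))" for j x
    unfolding fl_denom_def[abs_def] by (rule partial_linear_at_1[OF linear_snd_comp[OF G(1)]])
  have su: "smooth (\<lambda>x. fst (G (x, 1)) $ a)" for a by (rule smooth_linear_at_1[OF linear_fst_comp[OF G(1)]])
  have pu: "partial j (\<lambda>x. fst (G (x, 1)) $ a) x = fst (G (axis j 1, 0)) $ a" for j x a
    by (rule partial_linear_at_1[OF linear_fst_comp[OF G(1)]])
  have "continuous_on UNIV ?s"
    using smooth_differentiable[OF ss] differentiable_imp_continuous_within continuous_on_eq_continuous_within by blast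
  then have op: "open {x. ?s x > 0}" by (intro open_Collect_less continuous_intros)
  have main: "(?h has_derivative (*v) (fl_jacobian G x)) (at x) \<and> invertible (fl_jacobian G x) \<and>
      (\<forall>a i. (\<lambda>y. fl_jacobian G y $ a $ i) differentiable (at x)) \<and>
      (\<forall>a i j. partial j (\<lambda>y. fl_jacobian G y $ a $ i) x =
         - (fl_jacobian G x $ a $ i * fl_form G x j + fl_jacobian G x $ a $ j * fl_form G x i)) \<and>
      (\<forall>i. (\<lambda>y. fl_form G y i) differentiable (at x)) \<and>
      (\<forall>i j. partial j (\<lambda>y. fl_form G y i) x = - (fl_form G x i * fl_form G x j))" if x: "?s x > 0" for x
  proof -
  have inv: "(\<lambda>y. 1 / ?s y) differentiable (at x)" "partial j (\<lambda>y. 1 / ?s y) x = - snd (G (axis j 1, 0)) / (?s x)\<^sup>2" for j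
  proof -
    have "((\<lambda>t. 1 / t) has_real_derivative - 1 / (?s x)\<^sup>2) (at (?s x))"
      using x by (auto intro!: derivative_eq_intros simp: power2_eq_square)
    from partial_real_comp[OF this smooth_differentiable[OF ss]]
    show "(\<lambda>y. 1 / ?s y) differentiable (at x)" "partial j (\<lambda>y. 1 / ?s y) x = - snd (G (axis j 1, 0)) / (?s x)\<^sup>2" by (auto simp: ps)
  qed
  have h: "?h y $ a = fst (G (y, 1)) $ a * (1 / ?s y)" for y a
    by (simp add: fractional_linear_def fl_denom_def divide_inverse)
  have dh: "(\<lambda>y. ?h y $ a) differentiable (at x)" "partial j (\<lambda>y. ?h y $ a) x = fl_jacobian G x $ a $ j" for a j
  proof -
    show "(\<lambda>y. ?h y $ a) differentiable (at x)"
      unfolding h using smooth_differentiable[OF su] inv(1) by (rule differentiable_mult_real)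
    show "partial j (\<lambda>y. ?h y $ a) x = fl_jacobian G x $ a $ j"
    proof -
      have "partial j (\<lambda>y. ?h y $ a) x = fst (G (axis j 1, 0)) $ a * (1 / ?s x)
          + fst (G (x, 1)) $ a * (- snd (G (axis j 1, 0)) / (?s x)\<^sup>2)"
        by (simp only: h partial_mult[OF smooth_differentiable[OF su] inv(1)] pu inv(2))
      also have "\<dots> = (fst (G (axis j 1, 0)) $ a - (fst (G (x, 1)) $ a * (1 / ?s x)) * snd (G (axis j 1, 0))) * (1 / ?s x)"
        by (simp add: power2_eq_square diff_divide_distrib)
      also have "\<dots> = fl_jacobian G x $ a $ j"
        by (simp only: h[symmetric] fl_jacobian_def vec_lambda_beta)
      finally show ?thesis .
    qed
  qed
  have m1: "(?h has_derivative (*v) (fl_jacobian G x)) (at x)"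
  proof -
    have "frechet_derivative (\<lambda>y. ?h y $ a) (at x) = (\<lambda>v. (fl_jacobian G x *v v) $ a)" for a
      using frechet_eq_sum_partial[OF dh(1), of a]
      by (simp add: dh(2) matrix_vector_mult_def fun_eq_iff mult.commute)
    then have "((\<lambda>y. ?h y $ a) has_derivative (\<lambda>v. (fl_jacobian G x *v v) $ a)) (at x)" for a
      using frechet_works[OF dh(1), of a] by simp
    then show ?thesis
      by (subst has_derivative_componentwise_within) (auto simp: Basis_vec_def inner_axis)
  qed
  have m2: "(\<lambda>y. fl_form G y i) differentiable (at x)" for i
    unfolding fl_form_def using inv(1) by (intro differentiable_mult_real) auto
  have m3: "partial j (\<lambda>y. fl_form G y i) x = - (fl_form G x i * fl_form G x j)" for i j
    unfolding fl_form_def partial_cmult[OF inv(1)] inv(2) by (simp add: power2_eq_square)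
  have m4: "(\<lambda>y. fl_jacobian G y $ a $ i) differentiable (at x)" for a i
  proof -
    have "(\<lambda>y. (fst (G (axis i 1, 0)) $ a - ?h y $ a * snd (G (axis i 1, 0))) * (1 / ?s y)) differentiable (at x)"
      using dh(1) inv(1) by (intro differentiable_mult_real differentiable_diff differentiable_const)
    then show ?thesis by (simp add: fl_jacobian_def)
  qed
  have m5: "partial j (\<lambda>y. fl_jacobian G y $ a $ i) x = - (fl_jacobian G x $ a $ i * fl_form G x j + fl_jacobian G x $ a $ j * fl_form G x i)" for a i j
  proof -
    have d: "(\<lambda>y. fst (G (axis i 1, 0)) $ a - ?h y $ a * snd (G (axis i 1, 0))) differentiable (at x)"
      using dh(1) by (auto intro!: differentiable_mult_real differentiable_diff)
    have p: "partial j (\<lambda>y. fst (G (axis i 1, 0)) $ a - ?h y $ a * snd (G (axis i 1, 0))) x = - (fl_jacobian G x $ a $ j * snd (G (axis i 1, 0)))"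
      using dh by (simp add: partial_diff partial_mult differentiable_mult_real)
    have "partial j (\<lambda>y. fl_jacobian G y $ a $ i) x =
       partial j (\<lambda>y. (fst (G (axis i 1, 0)) $ a - ?h y $ a * snd (G (axis i 1, 0))) * (1 / ?s y)) x"
      by (simp add: fl_jacobian_def)
    also have "\<dots> = - (fl_jacobian G x $ a $ j * snd (G (axis i 1, 0))) * (1 / ?s x)
        + (fst (G (axis i 1, 0)) $ a - ?h x $ a * snd (G (axis i 1, 0))) * (- snd (G (axis j 1, 0)) / (?s x)\<^sup>2)"
      unfolding partial_mult[OF d inv(1)] p inv(2) ..
    also have "\<dots> = - (fl_jacobian G x $ a $ i * fl_form G x j + fl_jacobian G x $ a $ j * fl_form G x i)"
      unfolding fl_form_def by (simp add: fl_jacobian_def[of G x] power2_eq_square)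
    finally show ?thesis .
  qed
  have m6: "invertible (fl_jacobian G x)"
  proof -
    have "v = 0" if v: "fl_jacobian G x *v v = 0" for v
    proof -
      have G0: "G (u + w, 0) = G (u, 0) + G (w, 0)" "G (r *\<^sub>R u, 0) = r *\<^sub>R G (u, 0)" for u w r
        using linear_add[OF G(1), of "(u, 0)" "(w, 0)"] linear_scale[OF G(1), of r "(u, 0)"] by simp_all
      have "linear (\<lambda>v. fst (G (v, 0)) $ a)" "linear (\<lambda>v. snd (G (v, 0)))" for a
        by (rule linearI; simp add: G0)+
      note f = linear_vec_sum[OF this(1), of v] and s = linear_vec_sum[OF this(2), of v]
      have "(fst (G (v, 0)) $ a - ?h x $ a * snd (G (v, 0))) * (1 / ?s x) = (fl_jacobian G x *v v) $ a" for a
      proof -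
        have "(u * F - r * (u * Z)) * d = (F - r * Z) * d * u" for u F r Z d :: real by (simp add: algebra_simps)
        then show ?thesis
          unfolding f s fl_jacobian_def matrix_vector_mult_def vec_lambda_beta
            sum_distrib_left sum_subtractf[symmetric] sum_distrib_right by (intro sum.cong refl)
      qed
      then have F: "fst (G (v, 0)) = snd (G (v, 0)) *\<^sub>R ?h x"
        using v x by (simp add: vec_eq_iff mult.commute)
      define t where "t = snd (G (v, 0)) / ?s x"
      have "G (t *\<^sub>R (x, 1)) = G (v, 0)"
        unfolding linear_scale[OF G(1)] using x F
        by (intro prod_eqI) (auto simp: t_def fractional_linear_def fl_denom_def divide_inverse)
      then have "t *\<^sub>R (x, 1) = (v, 0 :: real)" by (rule injD[OF bij_is_inj[OF G(2)]])
      then show "v = 0" by auto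
    qed
    then show ?thesis
      using matrix_left_invertible_ker[of "fl_jacobian G x"] invertible_left_inverse by blast
  qed
  show ?thesis using m1 m2 m3 m4 m5 m6 by blast
  qed
  show ?thesis
    by unfold_locales (use op main in \<open>simp_all\<close>)
qed

lemma linear_inv_bij:
  fixes g :: "'a::real_vector \<Rightarrow> 'b::real_vector"
  assumes "linear g" "bij g"
  shows "linear (inv g)"
proof (rule linearI)
  note i = inv_f_f[OF bij_is_inj[OF assms(2)]] and s = surj_f_inv_f[OF bij_is_surj[OF assms(2)]]
  show "inv g (u + v) = inv g u + inv g v" for u v
    using i[of "inv g u + inv g v"] by (simp add: linear_add[OF assms(1)] s)
  show "inv g (r *\<^sub>R u) = r *\<^sub>R inv g u" for r u
    using i[of "r *\<^sub>R inv g u"] by (simp add: linear_scale[OF assms(1)] s)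
qed

definition sphere_scale :: "((real^'m::finite) \<times> real \<Rightarrow> (real^'m) \<times> real) \<Rightarrow> real^'m \<Rightarrow> real" where
  "sphere_scale g x = inverse (norm (inv g (x, 1)))"

locale linear_iso =
  fixes g :: "(real^'m::finite) \<times> real \<Rightarrow> (real^'m) \<times> real"
  assumes linear_g: "linear g" and bij_g: "bij g"
begin

lemmas g_inv = surj_f_inv_f[OF bij_is_surj[OF bij_g]]
lemmas inv_g = inv_f_f[OF bij_is_inj[OF bij_g]]
lemmas linear_inv_g = linear_inv_bij[OF linear_g bij_g]

lemma inv_nonzero: "inv g (x, 1) \<noteq> 0"
proof
  assume "inv g (x, 1) = 0"
  then have "g (inv g (x, 1)) = 0" using linear_0[OF linear_g] by simp
  then show False unfolding g_inv by (simp add: prod_eq_iff)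
qed

lemma sphere_scale_pos: "sphere_scale g x > 0"
  using inv_nonzero by (simp add: sphere_scale_def)

lemma chart_inj: "inj_on (snd (sphere_chart g)) (fst (sphere_chart g))"
proof (rule inj_onI)
  fix p q assume pq: "p \<in> fst (sphere_chart g)" "q \<in> fst (sphere_chart g)"
    and eq: "snd (sphere_chart g) p = snd (sphere_chart g) q"
  let ?s = "inverse (snd (g p))" and ?t = "inverse (snd (g q))"
  have p: "norm p = 1" "snd (g p) > 0" and q: "norm q = 1" "snd (g q) > 0"
    using pq by (auto simp: sphere_chart_def)
  have "?s *\<^sub>R g p = ?t *\<^sub>R g q"
    using eq p q by (simp add: sphere_chart_def prod_eq_iff)
  then have "g (?s *\<^sub>R p) = g (?t *\<^sub>R q)" by (simp only: linear_scale[OF linear_g])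
  then have st: "?s *\<^sub>R p = ?t *\<^sub>R q" by (rule injD[OF bij_is_inj[OF bij_g]])
  then have "norm (?s *\<^sub>R p) = norm (?t *\<^sub>R q)" by simp
  then have "?s = ?t" using p q by simp
  then show "p = q" using st p by simp
qed

lemma point_chart: "point (sphere_chart g) x = sphere_scale g x *\<^sub>R inv g (x, 1)"
  and point_in_chart: "point (sphere_chart g) x \<in> fst (sphere_chart g)"
  and chart_point: "snd (sphere_chart g) (point (sphere_chart g) x) = x"
proof -
  let ?p = "sphere_scale g x *\<^sub>R inv g (x, 1)"
  have gp: "g ?p = sphere_scale g x *\<^sub>R (x, 1)" by (simp only: linear_scale[OF linear_g] g_inv)
  have U: "?p \<in> fst (sphere_chart g)"
    using sphere_scale_pos[of x] inv_nonzero[of x] unfolding sphere_chart_def by (simp add: gp) (simp add: sphere_scale_def)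
  have \<phi>: "snd (sphere_chart g) ?p = x"
    using sphere_scale_pos[of x] unfolding sphere_chart_def by (simp add: gp)
  show "point (sphere_chart g) x = ?p"
    unfolding point_def using inv_into_f_f[OF chart_inj U] \<phi> by simp
  then show "point (sphere_chart g) x \<in> fst (sphere_chart g)" "snd (sphere_chart g) (point (sphere_chart g) x) = x"
    using U \<phi> by simp_all
qed

lemma g_point: "g (point (sphere_chart g) x) = sphere_scale g x *\<^sub>R (x, 1)"
  unfolding point_chart by (simp only: linear_scale[OF linear_g] g_inv)

lemma point_of_chart: "p \<in> fst (sphere_chart g) \<Longrightarrow> point (sphere_chart g) (snd (sphere_chart g) p) = p"
  unfolding point_def by (rule inv_into_f_f[OF chart_inj])

lemma image_chart: "image_of (sphere_chart g) = UNIV"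
  unfolding image_of_def using point_in_chart chart_point by (metis UNIV_eq_I image_eqI)

lemma mem_overlap: "x \<in> overlap (sphere_chart g) \<kappa>' \<longleftrightarrow> point (sphere_chart g) x \<in> fst \<kappa>'"
proof
  assume "x \<in> overlap (sphere_chart g) \<kappa>'"
  then obtain p where "p \<in> fst (sphere_chart g)" "p \<in> fst \<kappa>'" "x = snd (sphere_chart g) p"
    unfolding overlap_def by blast
  then show "point (sphere_chart g) x \<in> fst \<kappa>'" using point_of_chart by simp
next
  assume "point (sphere_chart g) x \<in> fst \<kappa>'"
  then show "x \<in> overlap (sphere_chart g) \<kappa>'"
    unfolding overlap_def using point_in_chart[of x] chart_point[of x] by (metis IntI image_eqI)
qed

lemma norm_point: "norm (point (sphere_chart g) x) = 1"
  using point_in_chart[of x] by (simp add: sphere_chart_def)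

lemma chart_in_atlas: "sphere_chart g \<in> sphere_atlas"
  unfolding sphere_atlas_eq using linear_g bij_g by blast

lemma overlap_fl:
  assumes "linear_iso g'"
  shows "overlap (sphere_chart g) (sphere_chart g') = {x. fl_denom (g' \<circ> inv g) x > 0}"
proof -
  interpret g': linear_iso g' by fact
  have "x \<in> overlap (sphere_chart g) (sphere_chart g') \<longleftrightarrow> fl_denom (g' \<circ> inv g) x > 0" for x
  proof -
    have "x \<in> overlap (sphere_chart g) (sphere_chart g') \<longleftrightarrow> snd (g' (point (sphere_chart g) x)) > 0"
      unfolding mem_overlap sphere_chart_def[of g'] using norm_point[of x] by simp
    also have "snd (g' (point (sphere_chart g) x)) = sphere_scale g x * fl_denom (g' \<circ> inv g) x"
      unfolding point_chart linear_scale[OF g'.linear_g] fl_denom_def by simp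
    finally show ?thesis using sphere_scale_pos[of x] by (simp add: zero_less_mult_iff)
  qed
  then show ?thesis by blast
qed

lemma in_coords_fl:
  assumes "linear_iso g'"
  shows "in_coords id (sphere_chart g) (sphere_chart g') = fractional_linear (g' \<circ> inv g)"
proof
  fix x
  interpret g': linear_iso g' by fact
  have "sphere_scale g x \<noteq> 0" using sphere_scale_pos[of x] by simp
  from fractional_linear_scale[OF g'.linear_g this]
  show "in_coords id (sphere_chart g) (sphere_chart g') x = fractional_linear (g' \<circ> inv g) x"
    unfolding in_coords_def sphere_chart_def[of g'] fractional_linear_def point_chart by simp
qed

lemma transition_iso:
  assumes "linear_iso g'"
  shows "linear (g' \<circ> inv g)" "bij (g' \<circ> inv g)"
  using assms linear_inv_g bij_imp_bij_inv[OF bij_g] unfolding linear_iso_def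
  by (auto intro: linear_compose bij_comp)

lemma transition_change:
  assumes "linear_iso g'"
  shows "projective_change (overlap (sphere_chart g) (sphere_chart g')) (in_coords id (sphere_chart g) (sphere_chart g'))
    (fl_jacobian (g' \<circ> inv g)) (fl_form (g' \<circ> inv g))"
  unfolding overlap_fl[OF assms] in_coords_fl[OF assms]
  by (rule projective_change_fractional_linear[OF transition_iso[OF assms]])

lemma point_transition:
  assumes "linear_iso g'" "x \<in> overlap (sphere_chart g) (sphere_chart g')"
  shows "point (sphere_chart g') (in_coords id (sphere_chart g) (sphere_chart g') x) = point (sphere_chart g) x"
proof -
  interpret g': linear_iso g' by fact
  show ?thesis unfolding in_coords_def using g'.point_of_chart assms(2)[unfolded mem_overlap] by simp
qed

definition quad :: "real^'m \<Rightarrow> real" where "quad x = (\<Sum>e\<in>Basis. (inv g (x, 1) \<bullet> e)\<^sup>2)"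

lemma quad_eq: "quad x = (norm (inv g (x, 1)))\<^sup>2"
  unfolding quad_def power2_norm_eq_inner by (subst euclidean_inner) (simp add: power2_eq_square)

lemma quad_pos: "quad x > 0"
  unfolding quad_eq using inv_nonzero by simp

lemma smooth_quad: "smooth quad"
proof -
  have "linear (\<lambda>p. inv g p \<bullet> e)" for e
    by (rule linearI) (simp_all add: linear_add[OF linear_inv_g] linear_scale[OF linear_inv_g] inner_add_left)
  from smooth_linear_at_1[OF this] show ?thesis
    unfolding quad_def[abs_def] power2_eq_square by (intro smooth_sum smooth_mult)
qed

lemma smooth_linear_point:
  assumes L: "linear L"
  shows "smooth (\<lambda>x. L (point (sphere_chart g) x) :: real)"
proof -
  have "linear (\<lambda>p. L (inv g p))"
    using linear_compose[OF linear_inv_g L] by (simp add: o_def)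
  then have "smooth (\<lambda>x. quad x powr (- (1/2)) * L (inv g (x, 1)))"
    by (intro smooth_mult smooth_powr smooth_quad quad_pos smooth_linear_at_1)
  moreover have "L (point (sphere_chart g) x) = quad x powr (- (1/2)) * L (inv g (x, 1))" for x
  proof -
    have "quad x powr (- (1/2)) = sphere_scale g x"
      unfolding powr_minus powr_half_sqrt[OF less_imp_le[OF quad_pos]] quad_eq sphere_scale_def by simp
    then show ?thesis unfolding point_chart linear_scale[OF L] by simp
  qed
  ultimately show ?thesis by simp
qed

end

lemma sphere_atlasE:
  assumes "\<kappa> \<in> sphere_atlas"
  obtains g where "linear_iso g" "\<kappa> = sphere_chart g"
  using assms unfolding sphere_atlas_eq linear_iso_def by blast

definition gram :: "((real^'m::finite) \<times> real, 'm) chart \<Rightarrow> real^'m \<Rightarrow> real^'m^'m" where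
  "gram \<kappa> x = (\<chi> i j. \<Sum>e\<in>Basis. partial i (\<lambda>y. point \<kappa> y \<bullet> e) x * partial j (\<lambda>y. point \<kappa> y \<bullet> e) x)"

context linear_iso begin

lemma linear_inner: "linear (\<lambda>p. p \<bullet> e)"
  by (rule linearI) (simp_all add: inner_add_left)

lemmas smooth_point_component = smooth_linear_point[OF linear_inner]

lemma smooth_det_gram: "smooth (\<lambda>x. det (gram (sphere_chart g) x))"
  unfolding det_def gram_def vec_lambda_beta
  by (intro smooth_sum smooth_mult smooth_prod smooth_const smooth_partial smooth_point_component)

lemma det_gram_nonzero: "det (gram (sphere_chart g) x) \<noteq> 0"
proof -
  let ?n = "point (sphere_chart g)"
  have "v = 0" if v: "gram (sphere_chart g) x *v v = 0" for v
  proof -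
    define w where "w e = (\<Sum>i\<in>UNIV. v $ i * partial i (\<lambda>y. ?n y \<bullet> e) x)" for e
    have "(\<Sum>e\<in>Basis. w e * w e) = (\<Sum>e\<in>Basis. \<Sum>i\<in>UNIV. \<Sum>j\<in>UNIV. v $ i * (partial i (\<lambda>y. ?n y \<bullet> e) x * partial j (\<lambda>y. ?n y \<bullet> e) x * v $ j))"
      unfolding w_def sum_product by (intro sum.cong refl) simp
    also have "\<dots> = (\<Sum>i\<in>UNIV. \<Sum>j\<in>UNIV. \<Sum>e\<in>Basis. v $ i * (partial i (\<lambda>y. ?n y \<bullet> e) x * partial j (\<lambda>y. ?n y \<bullet> e) x * v $ j))"
      by (subst sum.swap, rule sum.cong[OF refl], rule sum.swap)
    also have "\<dots> = v \<bullet> (gram (sphere_chart g) x *v v)"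
      unfolding inner_vec_def matrix_vector_mult_def gram_def
      by (simp add: sum_distrib_left sum_distrib_right)
    finally have "(\<Sum>e\<in>Basis. w e * w e) = 0" using v by simp
    then have "w e * w e = 0" if "e \<in> Basis" for e
      by (rule sum_nonneg_eq_0_iff[THEN iffD1, rule_format, rotated 2]) (use that in auto)
    then have w0: "w e = 0" if "e \<in> Basis" for e using that by simp
    have L0: "(\<Sum>i\<in>UNIV. v $ i * partial i (\<lambda>y. L (?n y)) x) = 0" if L: "linear L" for L :: "_ \<Rightarrow> real"
    proof -
      have "L p = (\<Sum>e\<in>Basis. L e * (p \<bullet> e))" for p
      proof -
        have "L p = L (\<Sum>e\<in>Basis. (p \<bullet> e) *\<^sub>R e)" unfolding euclidean_representation ..
        then show ?thesis by (simp only: linear_sum[OF L] linear_scale[OF L] real_scaleR_def mult.commute)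
      qed
      then have eq: "(\<lambda>y. L (?n y)) = (\<lambda>y. \<Sum>e\<in>Basis. L e * (?n y \<bullet> e))" by (intro ext)
      have "partial i (\<lambda>y. L (?n y)) x = (\<Sum>e\<in>Basis. L e * partial i (\<lambda>y. ?n y \<bullet> e) x)" for i
        unfolding eq using smooth_differentiable[OF smooth_point_component]
        by (simp add: partial_sum partial_cmult differentiable_mult_real)
      then have "(\<Sum>i\<in>UNIV. v $ i * partial i (\<lambda>y. L (?n y)) x) = (\<Sum>i\<in>UNIV. \<Sum>e\<in>Basis. L e * (v $ i * partial i (\<lambda>y. ?n y \<bullet> e) x))"
        by (simp add: sum_distrib_left mult.left_commute)
      also have "\<dots> = (\<Sum>e\<in>Basis. L e * w e)"
        unfolding w_def sum_distrib_left by (rule sum.swap)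
      finally show ?thesis using w0 by simp
    qed
    let ?r = "\<lambda>y. snd (g (?n y))"
    have r: "?r y = sphere_scale g y" "fst (g (?n y)) $ a = y $ a * ?r y" for y a
      by (simp_all add: g_point)
    have sr: "smooth ?r" by (rule smooth_linear_point[OF linear_snd_comp[OF linear_g]])
    have "v $ a = 0" for a
    proof -
      have "partial i (\<lambda>y. fst (g (?n y)) $ a) x = (if a = i then 1 else 0) * ?r x + x $ a * partial i ?r x" for i
        unfolding r(2) by (subst partial_mult) (auto simp: partial_coord smooth_differentiable[OF sr])
      then have "(\<Sum>i\<in>UNIV. v $ i * partial i (\<lambda>y. fst (g (?n y)) $ a) x) =
          (\<Sum>i\<in>UNIV. v $ i * ((if a = i then 1 else 0) * ?r x + x $ a * partial i ?r x))" by simp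
      also have "\<dots> = (\<Sum>i\<in>UNIV. (if i = a then 1 else 0) * (v $ i * ?r x)) + x $ a * (\<Sum>i\<in>UNIV. v $ i * partial i ?r x)"
        unfolding sum_distrib_left sum.distrib[symmetric] by (intro sum.cong refl) (auto simp: algebra_simps)
      finally have S: "(\<Sum>i\<in>UNIV. v $ i * partial i (\<lambda>y. fst (g (?n y)) $ a) x) =
          (\<Sum>i\<in>UNIV. (if i = a then 1 else 0) * (v $ i * ?r x)) + x $ a * (\<Sum>i\<in>UNIV. v $ i * partial i ?r x)" .
      have "v $ a * ?r x = 0"
        using S unfolding L0[OF linear_fst_comp[OF linear_g]] L0[OF linear_snd_comp[OF linear_g]] sum_kronecker by simp
      then show ?thesis using sphere_scale_pos[of x] r(1)[of x] by simp
    qed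
    then show "v = 0" by (simp add: vec_eq_iff)
  qed
  then show ?thesis
    using matrix_left_invertible_ker[of "gram (sphere_chart g) x"] invertible_left_inverse invertible_det_nz by blast
qed

lemma det_gram_transition:
  assumes "linear_iso g'" and x: "x \<in> overlap (sphere_chart g) (sphere_chart g')"
  shows "det (gram (sphere_chart g) x) = (det (fl_jacobian (g' \<circ> inv g) x))\<^sup>2 *
    det (gram (sphere_chart g') (in_coords id (sphere_chart g) (sphere_chart g') x))"
proof -
  interpret g': linear_iso g' by fact
  interpret P: projective_change "overlap (sphere_chart g) (sphere_chart g')" "in_coords id (sphere_chart g) (sphere_chart g')"
    "fl_jacobian (g' \<circ> inv g)" "fl_form (g' \<circ> inv g)" by (rule transition_change[OF assms(1)])
  let ?h = "in_coords id (sphere_chart g) (sphere_chart g')" and ?H = "fl_jacobian (g' \<circ> inv g) x"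
  let ?q = "\<lambda>e a. partial a (\<lambda>y. point (sphere_chart g') y \<bullet> e) (?h x)"
  have p: "partial i (\<lambda>y. point (sphere_chart g) y \<bullet> e) x = (\<Sum>a\<in>UNIV. ?H $ a $ i * ?q e a)" for i e
  proof -
    have "partial i (\<lambda>y. point (sphere_chart g) y \<bullet> e) x = partial i (\<lambda>y. point (sphere_chart g') (?h y) \<bullet> e) x"
      by (rule partial_cong_open(1)[OF P.open_S x])
        (simp_all add: point_transition[OF assms(1)] smooth_differentiable[OF smooth_point_component])
    also have "\<dots> = (\<Sum>a\<in>UNIV. ?H $ a $ i * ?q e a)"
      by (rule partial_chain(1)[OF P.h_derivative[OF x] smooth_differentiable[OF g'.smooth_point_component]])
    finally show ?thesis .
  qed
  have "gram (sphere_chart g) x $ i $ j = (transpose ?H ** (gram (sphere_chart g') (?h x) ** ?H)) $ i $ j" for i j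
  proof -
    have "gram (sphere_chart g) x $ i $ j = (\<Sum>e\<in>Basis. \<Sum>a\<in>UNIV. \<Sum>b\<in>UNIV. ?H $ a $ i * (?q e a * ?q e b * ?H $ b $ j))"
      unfolding gram_def vec_lambda_beta p sum_product by (intro sum.cong refl) simp
    also have "\<dots> = (\<Sum>a\<in>UNIV. \<Sum>b\<in>UNIV. \<Sum>e\<in>Basis. ?H $ a $ i * (?q e a * ?q e b * ?H $ b $ j))"
      by (subst sum.swap, rule sum.cong[OF refl], rule sum.swap)
    also have "\<dots> = (transpose ?H ** (gram (sphere_chart g') (?h x) ** ?H)) $ i $ j"
      unfolding matrix_matrix_mult_def gram_def transpose_def vec_lambda_beta sum_distrib_left sum_distrib_right ..
    finally show ?thesis .
  qed
  then have "gram (sphere_chart g) x = transpose ?H ** (gram (sphere_chart g') (?h x) ** ?H)" by (simp add: vec_eq_iff)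
  then show ?thesis by (simp add: det_mul det_transpose power2_eq_square)
qed

end

definition sphere_density ::
  "real \<Rightarrow> ((real^'m::finite) \<times> real \<Rightarrow> real) \<Rightarrow> ((real^'m) \<times> real, 'm) density" where
  "sphere_density b F \<kappa> x = (if \<kappa> \<in> sphere_atlas then (det (gram \<kappa> x))\<^sup>2 powr (b / 4) * F (point \<kappa> x) else 0)"

lemma smooth_volume:
  assumes "linear_iso g"
  shows "smooth (\<lambda>x. (det (gram (sphere_chart g) x))\<^sup>2 powr r)"
proof -
  interpret linear_iso g by fact
  show ?thesis
    using smooth_mult[OF smooth_det_gram smooth_det_gram] det_gram_nonzero
    by (intro smooth_powr) (simp_all only: power2_eq_square[symmetric] zero_less_power2 not_False_eq_True)
qed

lemma sphere_density_mem:
  assumes F: "\<And>g. linear_iso g \<Longrightarrow> smooth (\<lambda>x. F (point (sphere_chart g) x))"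
  shows "sphere_density b F \<in> densities sphere_atlas b"
  unfolding densities_def mem_Collect_eq
proof (intro conjI allI impI ballI)
  fix \<kappa> :: "((real^'a) \<times> real, 'a) chart" and x
  assume *: "\<kappa> \<notin> sphere_atlas \<or> x \<notin> image_of \<kappa>"
  have "image_of \<kappa> = UNIV" if "\<kappa> \<in> sphere_atlas"
    using that by (rule sphere_atlasE) (simp add: linear_iso.image_chart)
  with * show "sphere_density b F \<kappa> x = 0" by (auto simp: sphere_density_def)
next
  fix \<kappa> :: "((real^'a) \<times> real, 'a) chart" assume "\<kappa> \<in> sphere_atlas"
  then obtain g where g: "linear_iso g" "\<kappa> = sphere_chart g" by (rule sphere_atlasE)
  have "sphere_density b F \<kappa> = (\<lambda>x. (det (gram (sphere_chart g) x))\<^sup>2 powr (b / 4) * F (point (sphere_chart g) x))"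
    unfolding sphere_density_def[abs_def] g(2) using linear_iso.chart_in_atlas[OF g(1)] by simp
  then show "smooth_on (image_of \<kappa>) (sphere_density b F \<kappa>)"
    unfolding g(2) linear_iso.image_chart[OF g(1)] using smooth_mult[OF smooth_volume[OF g(1)] F[OF g(1)]] by simp
next
  fix \<kappa> \<kappa>' :: "((real^'a) \<times> real, 'a) chart" and x
  assume "\<kappa> \<in> sphere_atlas" "\<kappa>' \<in> sphere_atlas" and x: "x \<in> overlap \<kappa> \<kappa>'"
  obtain g where g: "linear_iso g" "\<kappa> = sphere_chart g" using \<open>\<kappa> \<in> sphere_atlas\<close> by (rule sphere_atlasE)
  obtain g' where g': "linear_iso g'" "\<kappa>' = sphere_chart g'" using \<open>\<kappa>' \<in> sphere_atlas\<close> by (rule sphere_atlasE)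
  interpret g: linear_iso g by fact
  interpret g': linear_iso g' by fact
  interpret P: projective_change "overlap (sphere_chart g) (sphere_chart g')" "in_coords id (sphere_chart g) (sphere_chart g')"
    "fl_jacobian (g' \<circ> inv g)" "fl_form (g' \<circ> inv g)" by (rule g.transition_change[OF g'(1)])
  have x': "x \<in> overlap (sphere_chart g) (sphere_chart g')" using x g g' by simp
  let ?d = "det (fl_jacobian (g' \<circ> inv g) x)"
  have "?d \<noteq> 0" by (rule P.det_nonzero[OF x'])
  have "(?d\<^sup>2 * D)\<^sup>2 powr (b / 4) = \<bar>?d\<bar> powr b * D\<^sup>2 powr (b / 4)" for D
  proof -
    have "(?d\<^sup>2 * D)\<^sup>2 = \<bar>?d\<bar> powr 4 * D\<^sup>2"
      using \<open>?d \<noteq> 0\<close> powr_realpow[of "\<bar>?d\<bar>" 4] by (simp add: power_mult_distrib flip: power_mult)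
    then have "(?d\<^sup>2 * D)\<^sup>2 powr (b / 4) = (\<bar>?d\<bar> powr 4) powr (b / 4) * D\<^sup>2 powr (b / 4)"
      by (simp only: powr_mult powr_ge_zero zero_le_power2)
    also have "(\<bar>?d\<bar> powr 4) powr (b / 4) = \<bar>?d\<bar> powr b" by (simp only: powr_powr) simp
    finally show ?thesis .
  qed
  then show "sphere_density b F \<kappa> x = pull_density b (in_coords id \<kappa> \<kappa>') (sphere_density b F \<kappa>') x"
    unfolding g(2) g'(2) pull_density_def P.jacobian_eq[OF x'] sphere_density_def g.det_gram_transition[OF g'(1) x']
      g.point_transition[OF g'(1) x'] using g.chart_in_atlas g'.chart_in_atlas by simp
qed

lemma sphere_test_density:
  assumes "linear_iso g"
  shows "\<exists>\<psi>\<in>densities sphere_atlas b. \<exists>u. smooth u \<and> u z \<noteq> 0 \<and> \<psi> (sphere_chart g) = (\<lambda>x. monomial_at z I x * u x)"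
proof -
  interpret linear_iso g by fact
  define F where "F p = prod_list (map (\<lambda>i. fst (g p) $ i - z $ i * snd (g p)) I)" for p
  have "smooth (\<lambda>x. F (point (sphere_chart g') x))" if g': "linear_iso g'" for g'
    unfolding F_def
  proof (induction I)
    case (Cons i I)
    have "linear (\<lambda>p. fst (g p) $ i - z $ i * snd (g p))"
      by (rule linearI) (simp_all add: linear_add[OF linear_g] linear_scale[OF linear_g] algebra_simps)
    from smooth_mult[OF linear_iso.smooth_linear_point[OF g' this] Cons.IH] show ?case by simp
  qed simp
  then have mem: "sphere_density b F \<in> densities sphere_atlas b" by (rule sphere_density_mem)
  define r where "r x = snd (g (point (sphere_chart g) x))" for x
  have sr: "smooth r" unfolding r_def[abs_def] by (rule smooth_linear_point[OF linear_snd_comp[OF linear_g]])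
  have rp: "r x > 0" for x using sphere_scale_pos[of x] by (simp add: r_def g_point)
  define u where "u x = (det (gram (sphere_chart g) x))\<^sup>2 powr (b / 4) * (\<Prod>i<length I. r x)" for x
  have "smooth u" unfolding u_def[abs_def] by (intro smooth_mult smooth_volume assms smooth_prod sr)
  moreover have "u z \<noteq> 0" using rp[of z] det_gram_nonzero[of z] by (simp add: u_def)
  moreover have "F (point (sphere_chart g) x) = monomial_at z I x * (\<Prod>i<length I. r x)" for x
    unfolding F_def monomial_at_def r_def
    by (induction I) (simp_all add: g_point algebra_simps)
  then have "sphere_density b F (sphere_chart g) = (\<lambda>x. monomial_at z I x * u x)"
    using chart_in_atlas by (simp add: sphere_density_def[abs_def] u_def mult_ac)
  ultimately show ?thesis using mem by blast
qed

lemma sum_kronecker':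
  "(\<Sum>i\<in>UNIV. (if (j::'m::finite) = i then 1 else 0) * (X i :: real)) = X j"
  by (subst sum.remove[of _ j]) auto

text \<open>The Levi-Civita connection of the round metric: its geodesics are straight lines in the charts,
  so that only the one-form \<open>d (log N)\<close> with \<open>N x = norm (inv g (x, 1))\<close> enters.\<close>

definition sphere_form :: "((real^'m::finite) \<times> real, 'm) chart \<Rightarrow> real^'m \<Rightarrow> 'm \<Rightarrow> real" where
  "sphere_form \<kappa> x j = (let g = (SOME g. linear_iso g \<and> \<kappa> = sphere_chart g) in
     1 / 2 * (partial j (linear_iso.quad g) x * linear_iso.quad g x powr (- 1)))"

definition sphere_connection :: "((real^'m::finite) \<times> real, 'm) connection" where
  "sphere_connection \<kappa> x k i j =
     - ((if k = i then 1 else 0) * sphere_form \<kappa> x j + (if k = j then 1 else 0) * sphere_form \<kappa> x i)"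

lemma sphere_form_chart:
  assumes "\<kappa> \<in> sphere_atlas"
  obtains g where "linear_iso g" "\<kappa> = sphere_chart g"
    "\<And>x j. sphere_form \<kappa> x j = 1 / 2 * (partial j (linear_iso.quad g) x * linear_iso.quad g x powr (- 1))"
proof -
  have "\<exists>g. linear_iso g \<and> \<kappa> = sphere_chart g" using assms by (rule sphere_atlasE) blast
  then have "linear_iso (SOME g. linear_iso g \<and> \<kappa> = sphere_chart g) \<and>
      \<kappa> = sphere_chart (SOME g. linear_iso g \<and> \<kappa> = sphere_chart g)"
    by (rule someI_ex)
  then show ?thesis using that unfolding sphere_form_def Let_def by blast
qed

lemma (in linear_iso) quad_transition:
  assumes "linear_iso g'" and x: "x \<in> overlap (sphere_chart g) (sphere_chart g')"
  shows "quad x = (fl_denom (g' \<circ> inv g) x)\<^sup>2 * linear_iso.quad g' (in_coords id (sphere_chart g) (sphere_chart g') x)"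
proof -
  interpret g': linear_iso g' by fact
  let ?G = "g' \<circ> inv g"
  let ?s = "fl_denom ?G x" and ?h = "fractional_linear ?G x"
  have s: "?s > 0" using x unfolding overlap_fl[OF assms(1)] by simp
  have "g' (inv g (x, 1)) = ?s *\<^sub>R (?h, 1)"
    using s by (simp add: prod_eq_iff fractional_linear_def fl_denom_def)
  also have "\<dots> = g' (?s *\<^sub>R inv g' (?h, 1))" unfolding linear_scale[OF g'.linear_g] g'.g_inv ..
  finally have "inv g (x, 1) = ?s *\<^sub>R inv g' (?h, 1)" by (rule injD[OF bij_is_inj[OF g'.bij_g]])
  then show ?thesis unfolding quad_eq g'.quad_eq in_coords_fl[OF assms(1)] by (simp add: power_mult_distrib)
qed

lemma sphere_form_transition:
  assumes g: "linear_iso g" and g': "linear_iso g'" and x: "x \<in> overlap (sphere_chart g) (sphere_chart g')"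
  shows "1 / 2 * (partial j (linear_iso.quad g) x * linear_iso.quad g x powr (- 1)) =
    fl_form (g' \<circ> inv g) x j + (\<Sum>a\<in>UNIV. fl_jacobian (g' \<circ> inv g) x $ a $ j *
      (let y = in_coords id (sphere_chart g) (sphere_chart g') x in
        1 / 2 * (partial a (linear_iso.quad g') y * linear_iso.quad g' y powr (- 1))))"
proof -
  interpret g: linear_iso g by fact
  interpret g': linear_iso g' by fact
  let ?G = "g' \<circ> inv g" and ?h = "in_coords id (sphere_chart g) (sphere_chart g')"
  interpret P: projective_change "overlap (sphere_chart g) (sphere_chart g')" ?h "fl_jacobian ?G" "fl_form ?G"
    by (rule g.transition_change[OF g'])
  let ?s = "fl_denom ?G" and ?q = "g'.quad" and ?H = "fl_jacobian ?G x"
  note lin = linear_snd_comp[OF g.transition_iso(1)[OF g']]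
  have ss: "smooth ?s" unfolding fl_denom_def[abs_def] by (rule smooth_linear_at_1[OF lin])
  have ps: "partial j ?s x = snd (?G (axis j 1, 0))" unfolding fl_denom_def[abs_def] by (rule partial_linear_at_1[OF lin])
  have s: "?s x > 0" using x unfolding g.overlap_fl[OF g'] by simp
  note c = partial_chain[OF P.h_derivative[OF x] smooth_differentiable[OF g'.smooth_quad]]
  have "partial j g.quad x = partial j (\<lambda>y. (?s y * ?s y) * ?q (?h y)) x"
    by (rule partial_cong_open(1)[OF P.open_S x])
      (simp_all add: g.quad_transition[OF g'] power2_eq_square smooth_differentiable[OF g.smooth_quad])
  also have "\<dots> = (2 * ?s x * snd (?G (axis j 1, 0))) * ?q (?h x) + ?s x * ?s x * (\<Sum>a\<in>UNIV. ?H $ a $ j * partial a ?q (?h x))"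
    by (subst partial_mult) (simp_all add: c partial_mult ps smooth_differentiable[OF ss] smooth_differentiable[OF smooth_mult[OF ss ss]])
  finally have pq: "partial j g.quad x = \<dots>" .
  have p1: "g.quad x powr (- 1) = 1 / (?s x * ?s x * ?q (?h x))" "?q (?h x) powr (- 1) = 1 / ?q (?h x)"
    using g.quad_pos[of x] g'.quad_pos[of "?h x"] g.quad_transition[OF g' x]
    by (simp_all add: powr_minus_divide power2_eq_square)
  have "1 / 2 * ((2 * S * D * Q + S * S * Z) * (1 / (S * S * Q))) = D * (1 / S) + Z * (1 / 2 * (1 / Q))"
    if "S \<noteq> 0" "Q \<noteq> 0" for S D Q Z :: real
    using that by (simp add: field_simps)
  from this[of "?s x" "?q (?h x)" "snd (?G (axis j 1, 0))" "\<Sum>a\<in>UNIV. ?H $ a $ j * partial a ?q (?h x)"]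
  have "1 / 2 * (partial j g.quad x * g.quad x powr (- 1)) =
     fl_form ?G x j + (\<Sum>a\<in>UNIV. ?H $ a $ j * partial a ?q (?h x)) * (1 / 2 * (1 / ?q (?h x)))"
    unfolding pq p1 fl_form_def using s g'.quad_pos[of "?h x"] by simp
  also have "\<dots> = fl_form ?G x j + (\<Sum>a\<in>UNIV. ?H $ a $ j * (1 / 2 * (partial a ?q (?h x) * ?q (?h x) powr (- 1))))"
    unfolding p1(2) sum_distrib_right by (simp add: mult_ac)
  finally show ?thesis unfolding Let_def .
qed

lemma sphere_connection_torsion_free: "sphere_connection \<in> torsion_free_connections sphere_atlas"
  unfolding torsion_free_connections_def mem_Collect_eq Let_def
proof (intro conjI allI impI ballI)
  fix \<kappa> :: "((real^'a) \<times> real, 'a) chart" and k i j assume \<kappa>: "\<kappa> \<in> sphere_atlas"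
  obtain g where g: "linear_iso g" "\<kappa> = sphere_chart g"
    "\<And>x j. sphere_form \<kappa> x j = 1 / 2 * (partial j (linear_iso.quad g) x * linear_iso.quad g x powr (- 1))"
    by (rule sphere_form_chart[OF \<kappa>]) (rule that)
  interpret g: linear_iso g by fact
  have f: "smooth (\<lambda>x. sphere_form \<kappa> x j)" for j
    unfolding g(3) by (intro smooth_mult smooth_const smooth_partial g.smooth_quad smooth_powr g.quad_pos)
  have "smooth (\<lambda>x. - 1 * ((if k = i then 1 else 0) * sphere_form \<kappa> x j + (if k = j then 1 else 0) * sphere_form \<kappa> x i))"
    by (intro smooth_mult smooth_add smooth_const f)
  then show "smooth_on (image_of \<kappa>) (\<lambda>x. sphere_connection \<kappa> x k i j)"
    unfolding sphere_connection_def g(2) g.image_chart by simp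
next
  fix \<kappa> \<kappa>' :: "((real^'a) \<times> real, 'a) chart" and x a i j
  assume \<kappa>: "\<kappa> \<in> sphere_atlas" and \<kappa>': "\<kappa>' \<in> sphere_atlas" and x: "x \<in> overlap \<kappa> \<kappa>'"
  obtain g where g: "linear_iso g" "\<kappa> = sphere_chart g"
    "\<And>x j. sphere_form \<kappa> x j = 1 / 2 * (partial j (linear_iso.quad g) x * linear_iso.quad g x powr (- 1))"
    by (rule sphere_form_chart[OF \<kappa>]) (rule that)
  obtain g' where g': "linear_iso g'" "\<kappa>' = sphere_chart g'"
    "\<And>x j. sphere_form \<kappa>' x j = 1 / 2 * (partial j (linear_iso.quad g') x * linear_iso.quad g' x powr (- 1))"
    by (rule sphere_form_chart[OF \<kappa>']) (rule that)
  have x': "x \<in> overlap (sphere_chart g) (sphere_chart g')" using x g(2) g'(2) by simp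
  let ?h = "in_coords id \<kappa> \<kappa>'" and ?H = "fl_jacobian (g' \<circ> inv g) x" and ?\<beta> = "fl_form (g' \<circ> inv g) x"
  interpret P: projective_change "overlap \<kappa> \<kappa>'" ?h "fl_jacobian (g' \<circ> inv g)" "fl_form (g' \<circ> inv g)"
    unfolding g(2) g'(2) by (rule linear_iso.transition_change[OF g(1) g'(1)])
  let ?\<alpha> = "sphere_form \<kappa> x" and ?\<alpha>' = "sphere_form \<kappa>' (?h x)"
  have \<alpha>: "?\<alpha> j = ?\<beta> j + (\<Sum>a\<in>UNIV. ?H $ a $ j * ?\<alpha>' a)" for j
    unfolding g(3) g'(3) using sphere_form_transition[OF g(1) g'(1) x', of j] unfolding Let_def g(2) g'(2) .
  have l: "(\<Sum>k\<in>UNIV. ?H $ a $ k * sphere_connection \<kappa> x k i j) = - (?H $ a $ i * ?\<alpha> j + ?H $ a $ j * ?\<alpha> i)"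
  proof -
    have "(\<Sum>k\<in>UNIV. ?H $ a $ k * sphere_connection \<kappa> x k i j) =
      - ((\<Sum>k\<in>UNIV. (if k = i then 1 else 0) * (?H $ a $ k * ?\<alpha> j)) + (\<Sum>k\<in>UNIV. (if k = j then 1 else 0) * (?H $ a $ k * ?\<alpha> i)))"
      unfolding sum.distrib[symmetric] sum_negf[symmetric] sphere_connection_def
      by (intro sum.cong refl) (simp add: algebra_simps)
    then show ?thesis unfolding sum_kronecker .
  qed
  have r: "(\<Sum>p\<in>UNIV. \<Sum>q\<in>UNIV. sphere_connection \<kappa>' (?h x) a p q * ?H $ p $ i * ?H $ q $ j) =
      - (?H $ a $ i * (\<Sum>q\<in>UNIV. ?H $ q $ j * ?\<alpha>' q) + ?H $ a $ j * (\<Sum>p\<in>UNIV. ?H $ p $ i * ?\<alpha>' p))"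
  proof -
    have "(\<Sum>p\<in>UNIV. \<Sum>q\<in>UNIV. sphere_connection \<kappa>' (?h x) a p q * ?H $ p $ i * ?H $ q $ j) =
      - ((\<Sum>p\<in>UNIV. (if a = p then 1 else 0) * (\<Sum>q\<in>UNIV. ?H $ p $ i * (?H $ q $ j * ?\<alpha>' q)))
       + (\<Sum>p\<in>UNIV. \<Sum>q\<in>UNIV. (if a = q then 1 else 0) * (?H $ q $ j * (?H $ p $ i * ?\<alpha>' p))))"
      unfolding sum_distrib_left sum.distrib[symmetric] sum_negf[symmetric] sphere_connection_def
      by (intro sum.cong refl) (simp add: algebra_simps)
    then show ?thesis unfolding sum_kronecker' unfolding sum_distrib_left .
  qed
  show "(\<Sum>k\<in>UNIV. jacobian ?h (at x) $ a $ k * sphere_connection \<kappa> x k i j) = partials [i, j] (\<lambda>y. ?h y $ a) x +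
    (\<Sum>p\<in>UNIV. \<Sum>q\<in>UNIV. sphere_connection \<kappa>' (?h x) a p q * jacobian ?h (at x) $ p $ i * jacobian ?h (at x) $ q $ j)"
    unfolding P.jacobian_eq[OF x] l r P.second_partials[OF x] \<alpha> by (simp add: distrib_left)
next
  show "sphere_connection \<kappa> x k i j = sphere_connection \<kappa> x k j i" for \<kappa> x and k i j :: 'a
    by (simp add: sphere_connection_def)
qed

lemma sphere_projective_atlas: "projective_atlas sphere_atlas"
proof
  fix \<kappa> :: "((real^'a) \<times> real, 'a) chart" assume \<kappa>: "\<kappa> \<in> sphere_atlas"
  then obtain g where g: "linear_iso g" "\<kappa> = sphere_chart g" by (rule sphere_atlasE)
  show "image_of \<kappa> = UNIV" unfolding g(2) by (rule linear_iso.image_chart[OF g(1)])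
  show "\<exists>\<psi>\<in>densities sphere_atlas b. \<exists>u. smooth u \<and> u z \<noteq> 0 \<and> \<psi> \<kappa> = (\<lambda>x. monomial_at z I x * u x)" for b z I
    unfolding g(2) by (rule sphere_test_density[OF g(1)])
  fix \<kappa>' :: "((real^'a) \<times> real, 'a) chart" assume "\<kappa>' \<in> sphere_atlas"
  then obtain g' where g': "linear_iso g'" "\<kappa>' = sphere_chart g'" by (rule sphere_atlasE)
  show "\<exists>H \<beta>. projective_change (overlap \<kappa> \<kappa>') (in_coords id \<kappa> \<kappa>') H \<beta>"
    unfolding g(2) g'(2) using linear_iso.transition_change[OF g(1) g'(1)] by blast
next
  show "torsion_free_connections sphere_atlas \<noteq> {}" using sphere_connection_torsion_free by blast
qed

subsection \<open>Homographies permute the charts\<close>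

lemma linear_iso_comp_inv:
  assumes "linear_iso g" "linear_iso \<gamma>"
  shows "linear_iso (g \<circ> inv \<gamma>)"
  using linear_iso.transition_iso[OF assms(2) assms(1)] by (rule linear_iso.intro)

lemma point_homography:
  assumes g: "linear_iso g" and \<gamma>: "linear_iso \<gamma>"
  shows "point (sphere_chart (g \<circ> inv \<gamma>)) x = homography \<gamma> (point (sphere_chart g) x)"
proof -
  interpret g: linear_iso g by fact
  interpret \<gamma>: linear_iso \<gamma> by fact
  interpret k: linear_iso "g \<circ> inv \<gamma>" by (rule linear_iso_comp_inv[OF g \<gamma>])
  let ?w = "\<gamma> (inv g (x, 1))"
  have "(g \<circ> inv \<gamma>) ?w = (x, 1)" by (simp add: \<gamma>.inv_g g.g_inv)
  then have i: "inv (g \<circ> inv \<gamma>) (x, 1) = ?w" using k.inv_g[of ?w] by simp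
  have s: "sphere_scale g x > 0" by (rule g.sphere_scale_pos)
  show ?thesis
    unfolding k.point_chart g.point_chart homography_def linear_scale[OF \<gamma>.linear_g] sphere_scale_def[of "g \<circ> inv \<gamma>"] i
    using s by simp
qed

lemma chart_at_covers:
  assumes "\<kappa> \<in> M" "p \<in> fst \<kappa>"
  shows "chart_at M p \<in> M" "p \<in> fst (chart_at M p)"
  using someI[of "\<lambda>\<kappa>. \<kappa> \<in> M \<and> p \<in> fst \<kappa>" \<kappa>] assms unfolding chart_at_def by auto

lemma chart_at_homography:
  fixes x :: "real^'m::finite"
  assumes g: "linear_iso g" and \<gamma>: "linear_iso \<gamma>"
  defines "\<kappa>' \<equiv> chart_at sphere_atlas (homography \<gamma> (point (sphere_chart g) x))"
  shows "\<kappa>' \<in> sphere_atlas" "x \<in> overlap (sphere_chart (g \<circ> inv \<gamma>)) \<kappa>'"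
    "in_coords (homography \<gamma>) (sphere_chart g) \<kappa>' = in_coords id (sphere_chart (g \<circ> inv \<gamma>)) \<kappa>'"
proof -
  interpret k: linear_iso "g \<circ> inv \<gamma>" by (rule linear_iso_comp_inv[OF g \<gamma>])
  note p = point_homography[OF g \<gamma>]
  note c = chart_at_covers[OF k.chart_in_atlas k.point_in_chart[of x], unfolded p]
  show "\<kappa>' \<in> sphere_atlas" unfolding \<kappa>'_def by (rule c(1))
  show "x \<in> overlap (sphere_chart (g \<circ> inv \<gamma>)) \<kappa>'" unfolding k.mem_overlap p \<kappa>'_def by (rule c(2))
  show "in_coords (homography \<gamma>) (sphere_chart g) \<kappa>' = in_coords id (sphere_chart (g \<circ> inv \<gamma>)) \<kappa>'"
    unfolding in_coords_def p by simp
qed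

lemma pullback_density_chart:
  assumes g: "linear_iso g" and \<gamma>: "linear_iso \<gamma>" and \<psi>: "\<psi> \<in> densities sphere_atlas b"
  shows "pullback_density sphere_atlas b (homography \<gamma>) \<psi> (sphere_chart g) = \<psi> (sphere_chart (g \<circ> inv \<gamma>))"
proof
  fix x
  interpret g: linear_iso g by fact
  interpret k: linear_iso "g \<circ> inv \<gamma>" by (rule linear_iso_comp_inv[OF g \<gamma>])
  note c = chart_at_homography[OF g \<gamma>, of x]
  show "pullback_density sphere_atlas b (homography \<gamma>) \<psi> (sphere_chart g) x = \<psi> (sphere_chart (g \<circ> inv \<gamma>)) x"
    unfolding pullback_density_def Let_def c(3) densitiesD(3)[OF \<psi> k.chart_in_atlas c(1,2)]
    using g.chart_in_atlas g.image_chart by simp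
qed

lemma pullback_symbol_chart:
  assumes g: "linear_iso g" and \<gamma>: "linear_iso \<gamma>" and A: "A \<in> symbols sphere_atlas c"
  shows "pullback_symbol sphere_atlas c (homography \<gamma>) A (sphere_chart g) = A (sphere_chart (g \<circ> inv \<gamma>))"
proof (intro ext)
  fix x I
  interpret g: linear_iso g by fact
  interpret k: linear_iso "g \<circ> inv \<gamma>" by (rule linear_iso_comp_inv[OF g \<gamma>])
  note c = chart_at_homography[OF g \<gamma>, of x]
  show "pullback_symbol sphere_atlas c (homography \<gamma>) A (sphere_chart g) x I = A (sphere_chart (g \<circ> inv \<gamma>)) x I"
    unfolding pullback_symbol_def Let_def c(3) symbolsD(5)[OF A k.chart_in_atlas c(1,2)]
    using g.chart_in_atlas g.image_chart by simp
qed

lemma transition_homography: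
  assumes g: "linear_iso g" and g': "linear_iso g'" and \<gamma>: "linear_iso \<gamma>"
  shows "in_coords id (sphere_chart (g \<circ> inv \<gamma>)) (sphere_chart (g' \<circ> inv \<gamma>)) = in_coords id (sphere_chart g) (sphere_chart g')"
    and "overlap (sphere_chart (g \<circ> inv \<gamma>)) (sphere_chart (g' \<circ> inv \<gamma>)) = overlap (sphere_chart g) (sphere_chart g')"
proof -
  interpret \<gamma>: linear_iso \<gamma> by fact
  interpret g: linear_iso g by fact
  interpret k: linear_iso "g \<circ> inv \<gamma>" by (rule linear_iso_comp_inv[OF g \<gamma>])
  have "g' \<circ> inv \<gamma> \<circ> inv (g \<circ> inv \<gamma>) = g' \<circ> inv g"
  proof
    fix p
    have "(g \<circ> inv \<gamma>) (\<gamma> (inv g p)) = p" by (simp add: \<gamma>.inv_g g.g_inv)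
    then have "inv (g \<circ> inv \<gamma>) p = \<gamma> (inv g p)" using k.inv_g[of "\<gamma> (inv g p)"] by simp
    then show "(g' \<circ> inv \<gamma> \<circ> inv (g \<circ> inv \<gamma>)) p = (g' \<circ> inv g) p" by (simp add: \<gamma>.inv_g)
  qed
  then show "in_coords id (sphere_chart (g \<circ> inv \<gamma>)) (sphere_chart (g' \<circ> inv \<gamma>)) = in_coords id (sphere_chart g) (sphere_chart g')"
    "overlap (sphere_chart (g \<circ> inv \<gamma>)) (sphere_chart (g' \<circ> inv \<gamma>)) = overlap (sphere_chart g) (sphere_chart g')"
    unfolding k.in_coords_fl[OF linear_iso_comp_inv[OF g' \<gamma>]] g.in_coords_fl[OF g']
      k.overlap_fl[OF linear_iso_comp_inv[OF g' \<gamma>]] g.overlap_fl[OF g'] by simp_all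
qed

lemma pullback_density_mem:
  assumes \<gamma>: "linear_iso \<gamma>" and \<psi>: "\<psi> \<in> densities sphere_atlas b"
  shows "pullback_density sphere_atlas b (homography \<gamma>) \<psi> \<in> densities sphere_atlas b"
  unfolding densities_def mem_Collect_eq
proof (intro conjI allI impI ballI)
  fix \<kappa> :: "((real^'a) \<times> real, 'a) chart" and x
  show "pullback_density sphere_atlas b (homography \<gamma>) \<psi> \<kappa> x = 0" if "\<kappa> \<notin> sphere_atlas \<or> x \<notin> image_of \<kappa>"
    using that by (auto simp: pullback_density_def)
next
  fix \<kappa> :: "((real^'a) \<times> real, 'a) chart" assume "\<kappa> \<in> sphere_atlas"
  then obtain g where g: "linear_iso g" "\<kappa> = sphere_chart g" by (rule sphere_atlasE)
  interpret g: linear_iso g by (rule g)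
  interpret k: linear_iso "g \<circ> inv \<gamma>" by (rule linear_iso_comp_inv[OF g(1) \<gamma>])
  show "smooth_on (image_of \<kappa>) (pullback_density sphere_atlas b (homography \<gamma>) \<psi> \<kappa>)"
    unfolding g(2) pullback_density_chart[OF g(1) \<gamma> \<psi>] g.image_chart
    using densitiesD(2)[OF \<psi> k.chart_in_atlas] unfolding k.image_chart .
next
  fix \<kappa> \<kappa>' :: "((real^'a) \<times> real, 'a) chart" and x
  assume \<kappa>: "\<kappa> \<in> sphere_atlas" "\<kappa>' \<in> sphere_atlas" and x: "x \<in> overlap \<kappa> \<kappa>'"
  obtain g where g: "linear_iso g" "\<kappa> = sphere_chart g" using \<kappa>(1) by (rule sphere_atlasE)
  obtain g' where g': "linear_iso g'" "\<kappa>' = sphere_chart g'" using \<kappa>(2) by (rule sphere_atlasE)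
  note t = transition_homography[OF g(1) g'(1) \<gamma>]
  show "pullback_density sphere_atlas b (homography \<gamma>) \<psi> \<kappa> x =
      pull_density b (in_coords id \<kappa> \<kappa>') (pullback_density sphere_atlas b (homography \<gamma>) \<psi> \<kappa>') x"
    unfolding g(2) g'(2) pullback_density_chart[OF g(1) \<gamma> \<psi>] pullback_density_chart[OF g'(1) \<gamma> \<psi>] t(1)[symmetric]
    by (rule densitiesD(3)[OF \<psi>])
      (use x t(2) g(2) g'(2) linear_iso.chart_in_atlas[OF linear_iso_comp_inv[OF g(1) \<gamma>]]
         linear_iso.chart_in_atlas[OF linear_iso_comp_inv[OF g'(1) \<gamma>]] in auto)
qed

lemma pullback_symbol_mem:
  assumes \<gamma>: "linear_iso \<gamma>" and A: "A \<in> symbols sphere_atlas c"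
  shows "pullback_symbol sphere_atlas c (homography \<gamma>) A \<in> symbols sphere_atlas c"
    and "(\<And>\<kappa> x I. length I > n \<Longrightarrow> A \<kappa> x I = 0) \<Longrightarrow> length J > n \<Longrightarrow>
      pullback_symbol sphere_atlas c (homography \<gamma>) A \<kappa>0 x0 J = 0"
proof -
  let ?P = "pullback_symbol sphere_atlas c (homography \<gamma>) A"
  have val: "?P \<kappa> = (\<lambda>x I. 0) \<or> (\<exists>\<kappa>'. ?P \<kappa> = A \<kappa>')" for \<kappa>
  proof (cases "\<kappa> \<in> sphere_atlas")
    case True
    then obtain g where "linear_iso g" "\<kappa> = sphere_chart g" by (rule sphere_atlasE)
    then show ?thesis using pullback_symbol_chart[OF _ \<gamma> A] by blast
  qed (simp add: pullback_symbol_def)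
  show bound: "?P \<kappa>0 x0 J = 0" if "\<And>\<kappa> x I. length I > n \<Longrightarrow> A \<kappa> x I = 0" "length J > n" for n J \<kappa>0 x0
    using val[of \<kappa>0] that(1)[OF that(2)] by auto
  show "?P \<in> symbols sphere_atlas c"
    unfolding symbols_def mem_Collect_eq
  proof (intro conjI allI impI ballI)
    fix \<kappa> :: "((real^'a) \<times> real, 'a) chart" and x and I :: "'a list"
    show "?P \<kappa> x I = 0" if "\<kappa> \<notin> sphere_atlas \<or> x \<notin> image_of \<kappa>"
      using that by (auto simp: pullback_symbol_def)
    show "?P \<kappa> x I = ?P \<kappa> x J" if "mset I = mset J" for J
      using val[of \<kappa>] symbolsD(3)[OF A that] by auto
  next
    obtain n where "\<And>\<kappa> x I. length I > n \<Longrightarrow> A \<kappa> x I = 0" using symbolsD(2)[OF A] by blast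
    then show "\<exists>n. \<forall>\<kappa> x I. n < length I \<longrightarrow> ?P \<kappa> x I = 0" using bound[of n] by blast
  next
    fix \<kappa> :: "((real^'a) \<times> real, 'a) chart" and I assume "\<kappa> \<in> sphere_atlas"
    then obtain g where g: "linear_iso g" "\<kappa> = sphere_chart g" by (rule sphere_atlasE)
    interpret g: linear_iso g by (rule g)
    interpret k: linear_iso "g \<circ> inv \<gamma>" by (rule linear_iso_comp_inv[OF g(1) \<gamma>])
    show "smooth_on (image_of \<kappa>) (\<lambda>x. ?P \<kappa> x I)"
      unfolding g(2) pullback_symbol_chart[OF g(1) \<gamma> A] g.image_chart
      using symbolsD(4)[OF A k.chart_in_atlas] unfolding k.image_chart .
  next
    fix \<kappa> \<kappa>' :: "((real^'a) \<times> real, 'a) chart" and x I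
    assume \<kappa>: "\<kappa> \<in> sphere_atlas" "\<kappa>' \<in> sphere_atlas" and x: "x \<in> overlap \<kappa> \<kappa>'"
    obtain g where g: "linear_iso g" "\<kappa> = sphere_chart g" using \<kappa>(1) by (rule sphere_atlasE)
    obtain g' where g': "linear_iso g'" "\<kappa>' = sphere_chart g'" using \<kappa>(2) by (rule sphere_atlasE)
    note t = transition_homography[OF g(1) g'(1) \<gamma>]
    show "?P \<kappa> x I = pull_symbol c (in_coords id \<kappa> \<kappa>') (?P \<kappa>') x I"
      unfolding g(2) g'(2) pullback_symbol_chart[OF g(1) \<gamma> A] pullback_symbol_chart[OF g'(1) \<gamma> A] t(1)[symmetric]
      by (rule symbolsD(5)[OF A])
        (use x t(2) g(2) g'(2) linear_iso.chart_in_atlas[OF linear_iso_comp_inv[OF g(1) \<gamma>]]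
           linear_iso.chart_in_atlas[OF linear_iso_comp_inv[OF g'(1) \<gamma>]] in auto)
  qed
qed

theorem sphere_equivariant:
  fixes R :: "nat \<Rightarrow> (real^'m::finite \<Rightarrow> 'm list \<Rightarrow> real) \<Rightarrow> (real^'m \<Rightarrow> real) \<Rightarrow> real^'m \<Rightarrow> real"
  assumes L: "local_ordering sphere_atlas b c (\<lambda>\<kappa>. R)"
  shows "homography_equivariant b c (local_ordering_op sphere_atlas b (\<lambda>\<kappa>. R))"
  unfolding homography_equivariant_def
proof (intro allI impI ballI)
  fix \<gamma> :: "(real^'m) \<times> real \<Rightarrow> (real^'m) \<times> real" 
    and A :: "((real^'m) \<times> real, 'm) symbol" and \<psi> :: "((real^'m) \<times> real, 'm) density"
  assume "linear \<gamma> \<and> bij \<gamma>" and A: "A \<in> symbols sphere_atlas c" and \<psi>: "\<psi> \<in> densities sphere_atlas b"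
  then have \<gamma>: "linear_iso \<gamma>" by (simp add: linear_iso_def)
  interpret X: local_ordering sphere_atlas b c "\<lambda>\<kappa>. R" by (rule L)
  let ?pA = "pullback_symbol sphere_atlas c (homography \<gamma>) A"
  let ?p\<psi> = "pullback_density sphere_atlas b (homography \<gamma>) \<psi>"
  have A\<psi>: "X.quantize A \<psi> \<in> densities sphere_atlas (b + c)"
    using X.ordering_diff_op[OF A] \<psi> unfolding diff_ops_def by blast
  obtain n where n: "\<And>\<kappa> x I. length I > n \<Longrightarrow> A \<kappa> x I = 0" using symbolsD(2)[OF A] by blast
  show "pullback_density sphere_atlas (b + c) (homography \<gamma>) (X.quantize A \<psi>) = X.quantize ?pA ?p\<psi>"
  proof (intro ext)
    fix \<kappa> :: "((real^'m) \<times> real, 'm) chart" and x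
    show "pullback_density sphere_atlas (b + c) (homography \<gamma>) (X.quantize A \<psi>) \<kappa> x = X.quantize ?pA ?p\<psi> \<kappa> x"
    proof (cases "\<kappa> \<in> sphere_atlas")
      case False
      then show ?thesis by (simp add: pullback_density_def local_ordering_op_def)
    next
      case True
      then obtain g where g: "linear_iso g" "\<kappa> = sphere_chart g" by (rule sphere_atlasE)
      interpret k: linear_iso "g \<circ> inv \<gamma>" by (rule linear_iso_comp_inv[OF g(1) \<gamma>])
      have "X.quantize ?pA ?p\<psi> \<kappa> x = (\<Sum>k\<le>n. R k (?pA \<kappa>) (?p\<psi> \<kappa>) x)"
        by (rule X.ordering_eq[OF pullback_symbol_mem(1)[OF \<gamma> A] pullback_symbol_mem(2)[OF \<gamma> A n]
              pullback_density_mem[OF \<gamma> \<psi>] True])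
      also have "\<dots> = X.quantize A \<psi> (sphere_chart (g \<circ> inv \<gamma>)) x"
        unfolding g(2) pullback_symbol_chart[OF g(1) \<gamma> A] pullback_density_chart[OF g(1) \<gamma> \<psi>]
        by (rule X.ordering_eq[OF A n \<psi> k.chart_in_atlas, symmetric])
      finally show ?thesis unfolding g(2) pullback_density_chart[OF g(1) \<gamma> A\<psi>] by simp
    qed
  qed
qed

section \<open>Euclidean space\<close>

definition lie_function :: "real \<Rightarrow> (real^'m::finite \<Rightarrow> real^'m) \<Rightarrow> (real^'m \<Rightarrow> real) \<Rightarrow> real^'m \<Rightarrow> real" where
  "lie_function b X f x = (\<Sum>i\<in>UNIV. X x $ i * partial i f x) + b * divergence X x * f x"

definition slot_action :: "(real^'m::finite \<Rightarrow> real^'m) \<Rightarrow> real^'m \<Rightarrow> ('m list \<Rightarrow> real) \<Rightarrow> 'm list \<Rightarrow> real" where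
  "slot_action X x a I = (\<Sum>r<length I. \<Sum>l\<in>UNIV. partial l (\<lambda>y. X y $ (I ! r)) x * a (I[r := l]))"

definition lie_array ::
  "real \<Rightarrow> (real^'m::finite \<Rightarrow> real^'m) \<Rightarrow> (real^'m \<Rightarrow> 'm list \<Rightarrow> real) \<Rightarrow> real^'m \<Rightarrow> 'm list \<Rightarrow> real" where
  "lie_array c X A x I = (\<Sum>i\<in>UNIV. X x $ i * partial i (\<lambda>y. A y I) x) - slot_action X x (A x) I
     + c * divergence X x * A x I"

lemma slot_action_Cons:
  "slot_action X x a (i # I) = (\<Sum>l\<in>UNIV. partial l (\<lambda>y. X y $ i) x * a (l # I)) + slot_action X x (\<lambda>J. a (i # J)) I"
  unfolding slot_action_def by (simp add: sum.lessThan_Suc_shift del: sum.lessThan_Suc)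

lemma symmetric_slot_action:
  assumes a: "symmetric_array a"
  shows "symmetric_array (slot_action X x a)"
  unfolding symmetric_array_def
proof (intro allI impI)
  fix I J :: "'a list" assume "mset I = mset J"
  then obtain \<pi> where \<pi>: "\<pi> permutes {..<length J}" "permute_list \<pi> J = I" using mset_eq_permutation by blast
  let ?g = "\<lambda>r. \<Sum>l\<in>UNIV. partial l (\<lambda>y. X y $ (J ! r)) x * a (J[r := l])"
  have len: "length I = length J" using \<pi>(2) by auto
  have eq: "(\<Sum>l\<in>UNIV. partial l (\<lambda>y. X y $ (I ! r)) x * a (I[r := l])) = ?g (\<pi> r)" if r: "r < length J" for r
  proof -
    have n: "I ! r = J ! \<pi> r" using permute_list_nth[OF \<pi>(1) r] \<pi>(2) by simp
    have "\<pi> r < length J" using permutes_in_image[OF \<pi>(1), of r] r by simp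
    then have "mset (I[r := l]) = mset (J[\<pi> r := l])" for l
      using r len n \<open>mset I = mset J\<close> by (simp add: mset_update)
    then show ?thesis unfolding n by (intro sum.cong refl arg_cong2[where f = "(*)"] symmetric_arrayD[OF a])
  qed
  have "slot_action X x a I = (\<Sum>r<length J. ?g (\<pi> r))"
    unfolding slot_action_def len by (intro sum.cong refl eq) simp
  also have "\<dots> = (\<Sum>r<length J. ?g r)" using sum.permute[OF \<pi>(1), of ?g] by (simp add: o_def)
  finally show "slot_action X x a I = slot_action X x a J" unfolding slot_action_def .
qed

locale projective_field =
  fixes X :: "real^'m::finite \<Rightarrow> real^'m" and w :: "'m \<Rightarrow> real"
  assumes X_smooth: "smooth (\<lambda>x. X x $ a)"
    and X_second: "partial i (partial j (\<lambda>y. X y $ a)) x = (if a = i then 1 else 0) * w j + (if a = j then 1 else 0) * w i"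
begin

abbreviation "DX l a \<equiv> partial l (\<lambda>y. X y $ a)"

lemma DX_smooth: "smooth (DX l a)" by (rule smooth_partial[OF X_smooth])

lemma divergence_smooth: "smooth (divergence X)"
  unfolding divergence_def[abs_def] by (intro smooth_sum DX_smooth)

lemma partial_divergence: "partial j (divergence X) x = (real CARD('m) + 1) * w j"
proof -
  have "partial j (divergence X) x = (\<Sum>a\<in>UNIV. partial j (DX a a) x)"
    unfolding divergence_def[abs_def] by (rule partial_sum) (rule smooth_differentiable[OF DX_smooth])
  also have "\<dots> = (\<Sum>a\<in>UNIV. (if a = j then 1 else 0) * w a) + (\<Sum>a\<in>(UNIV :: 'm set). w j)"
    unfolding X_second sum.distrib by simp
  finally show ?thesis unfolding sum_kronecker by (simp add: algebra_simps)
qed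

lemma lie_function_smooth: "smooth f \<Longrightarrow> smooth (lie_function b X f)"
  unfolding lie_function_def[abs_def]
  by (intro smooth_add smooth_sum smooth_mult X_smooth smooth_partial smooth_const divergence_smooth)

lemma lie_array_smooth_array:
  assumes "smooth_array A" shows "smooth_array (lie_array c X A)"
proof -
  have "smooth (\<lambda>x. lie_array c X A x I)" for I
    unfolding lie_array_def slot_action_def
    by (intro smooth_add smooth_diff smooth_sum smooth_mult X_smooth smooth_partial smooth_const divergence_smooth
        smooth_arrayD(1)[OF assms])
  moreover have "lie_array c X A x I = lie_array c X A x J" if m: "mset I = mset J" for x I J
  proof -
    have "A y I = A y J" for y by (rule symmetric_arrayD[OF smooth_arrayD(2)[OF assms] m])
    moreover have "slot_action X x (A x) I = slot_action X x (A x) J"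
      by (rule symmetric_arrayD[OF symmetric_slot_action[OF smooth_arrayD(2)[OF assms]] m])
    ultimately show ?thesis unfolding lie_array_def by simp
  qed
  ultimately show ?thesis unfolding smooth_array_def symmetric_array_def by blast
qed

text \<open>The second derivatives of \<open>X\<close> contribute one copy of the contraction for each slot, twice.\<close>

lemma sum_second_derivative_slots:
  assumes a: "symmetric_array a" and I: "length I = k"
  shows "(\<Sum>j\<in>UNIV. \<Sum>r<k. \<Sum>l\<in>UNIV. partial j (DX l (I ! r)) x * a (j # I[r := l])) = 2 * real k * ctr w a I"
proof -
  have "(\<Sum>j\<in>UNIV. \<Sum>l\<in>UNIV. partial j (DX l (I ! r)) x * a (j # I[r := l])) = 2 * ctr w a I" if r: "r < k" for r
  proof -
    have "(\<Sum>j\<in>UNIV. \<Sum>l\<in>UNIV. partial j (DX l (I ! r)) x * a (j # I[r := l])) =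
        (\<Sum>j\<in>UNIV. (if I ! r = j then 1 else 0) * (\<Sum>l\<in>UNIV. w l * a (j # I[r := l])))
        + (\<Sum>j\<in>UNIV. \<Sum>l\<in>UNIV. (if I ! r = l then 1 else 0) * (w j * a (j # I[r := l])))"
      unfolding X_second sum_distrib_left sum.distrib[symmetric] by (intro sum.cong refl) (simp add: distrib_right)
    also have "\<dots> = (\<Sum>l\<in>UNIV. w l * a (I ! r # I[r := l])) + (\<Sum>j\<in>UNIV. w j * a (j # I))"
      unfolding sum_kronecker' by simp
    also have "(\<Sum>l\<in>UNIV. w l * a (I ! r # I[r := l])) = (\<Sum>l\<in>UNIV. w l * a (l # I))"
      using r I by (intro sum.cong refl arg_cong[where f = "(*) _"] symmetric_arrayD[OF a] mset_slot_swap) simp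
    finally show ?thesis by (simp add: ctr_def)
  qed
  then have "(\<Sum>r<k. \<Sum>j\<in>UNIV. \<Sum>l\<in>UNIV. partial j (DX l (I ! r)) x * a (j # I[r := l])) = (\<Sum>r<k. 2 * ctr w a I)"
    by (intro sum.cong refl) simp
  then show ?thesis by (subst sum.swap) simp
qed

lemma contract_lie_function:
  assumes f: "smooth f" and a: "symmetric_array a"
  shows "contract k a (lie_function b X f) x = (\<Sum>i\<in>UNIV. X x $ i * partial i (contract k a f) x)
    + contract k (slot_action X x a) f x + b * divergence X x * contract k a f x
    + real k * (b * (real CARD('m) + 1) + real k - 1) * contract (k - 1) (ctr w a) f x"
  using a
proof (induction k arbitrary: a x)
  case 0
  have "contract 0 a f = (\<lambda>x. a [] * f x)" by (intro ext) simp
  then show ?case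
    by (simp add: lie_function_def slot_action_def partial_cmult smooth_differentiable[OF f] sum_distrib_left algebra_simps)
next
  case (Suc k)
  note a = Suc.prems
  let ?\<nu> = "b * (real CARD('m) + 1)"
  let ?a = "\<lambda>j I. a (j # I)"
  define T where "T j = contract k (?a j) f" for j
  define U where "U j = contract (k - 1) (ctr w (?a j)) f" for j
  have sc: "smooth (contract n u f)" for n u using smooth_contract[OF f, of "\<lambda>x. u" n] by simp
  have sT: "smooth (T j)" and sU: "smooth (U j)" for j unfolding T_def U_def by (rule sc)+
  have sS: "smooth (\<lambda>y. slot_action X y (?a j) I)" for j I
    unfolding slot_action_def by (intro smooth_sum smooth_mult DX_smooth smooth_const)
  have sTS: "smooth (\<lambda>y. contract k (slot_action X y (?a j)) f y)" for j by (rule smooth_contract[OF f sS])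
  define C where "C = real k * (?\<nu> + real k - 1)"
  have IH: "contract k (?a j) (lie_function b X f) = (\<lambda>y. (\<Sum>i\<in>UNIV. X y $ i * partial i (T j) y)
      + contract k (slot_action X y (?a j)) f y + b * divergence X y * T j y + C * U j y)" for j
    unfolding T_def U_def C_def by (rule ext, rule Suc.IH[OF symmetric_array_slot[OF a]])
  have dS: "partial j (\<lambda>y. slot_action X y (?a j) I) x = (\<Sum>r<k. \<Sum>l\<in>UNIV. partial j (DX l (I ! r)) x * a (j # I[r := l]))"
    if "length I = k" for j I
  proof -
    have d: "(\<lambda>y. DX l b y * a') differentiable (at x)" for l b a'
      by (intro smooth_differentiable smooth_mult DX_smooth smooth_const)
    show ?thesis
      unfolding slot_action_def that
      by (subst partial_sum) (auto simp: partial_sum d partial_mult smooth_differentiable[OF DX_smooth]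
          intro!: differentiable_sum)
  qed
  have P: "partial j (contract k (?a j) (lie_function b X f)) x =
      (\<Sum>i\<in>UNIV. DX j i x * partial i (T j) x + X x $ i * partial j (partial i (T j)) x)
      + ((\<Sum>I | length I = k. (\<Sum>r<k. \<Sum>l\<in>UNIV. partial j (DX l (I ! r)) x * a (j # I[r := l])) * partials I f x)
        + (\<Sum>I | length I = k. slot_action X x (?a j) I * partial j (partials I f) x))
      + (?\<nu> * w j * T j x + b * divergence X x * partial j (T j) x)
      + C * partial j (U j) x" for j
  proof -
    have s1: "smooth (\<lambda>y. X y $ i * partial i (T j) y)" for i by (intro smooth_mult X_smooth smooth_partial sT)
    have s2: "smooth (\<lambda>y. b * divergence X y * T j y)" by (intro smooth_mult smooth_const divergence_smooth sT)
    have s3: "smooth (\<lambda>y. C * U j y)" by (intro smooth_mult smooth_const sU)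
    have "partial j (contract k (?a j) (lie_function b X f)) x =
       partial j (\<lambda>y. \<Sum>i\<in>UNIV. X y $ i * partial i (T j) y) x + partial j (\<lambda>y. contract k (slot_action X y (?a j)) f y) x
       + partial j (\<lambda>y. b * divergence X y * T j y) x + partial j (\<lambda>y. C * U j y) x"
      unfolding IH by (simp only: partial_add smooth_differentiable[OF smooth_add[OF smooth_add[OF smooth_sum[OF s1] sTS] s2]]
          smooth_differentiable[OF smooth_add[OF smooth_sum[OF s1] sTS]] smooth_differentiable[OF smooth_sum[OF s1]]
          smooth_differentiable[OF sTS] smooth_differentiable[OF s2] smooth_differentiable[OF s3])
    moreover have "partial j (\<lambda>y. \<Sum>i\<in>UNIV. X y $ i * partial i (T j) y) x =
        (\<Sum>i\<in>UNIV. DX j i x * partial i (T j) x + X x $ i * partial j (partial i (T j)) x)"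
      by (subst partial_sum) (auto simp: partial_mult smooth_differentiable[OF s1] smooth_differentiable[OF X_smooth]
          smooth_differentiable[OF smooth_partial[OF sT]])
    moreover have "partial j (\<lambda>y. contract k (slot_action X y (?a j)) f y) x =
        (\<Sum>I | length I = k. (\<Sum>r<k. \<Sum>l\<in>UNIV. partial j (DX l (I ! r)) x * a (j # I[r := l])) * partials I f x)
        + (\<Sum>I | length I = k. slot_action X x (?a j) I * partial j (partials I f) x)"
      unfolding partial_contract(1)[OF f smooth_differentiable[OF sS]] unfolding contract_def
      by (intro arg_cong2[where f = "(+)"] sum.cong refl) (simp add: dS)
    moreover have "partial j (\<lambda>y. b * divergence X y * T j y) x = ?\<nu> * w j * T j x + b * divergence X x * partial j (T j) x"
      unfolding partial_mult[OF smooth_differentiable[OF smooth_mult[OF smooth_const divergence_smooth]] smooth_differentiable[OF sT]]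
        partial_cmult[OF smooth_differentiable[OF divergence_smooth]] partial_divergence by simp
    moreover have "partial j (\<lambda>y. C * U j y) x = C * partial j (U j) x"
      by (rule partial_cmult[OF smooth_differentiable[OF sU]])
    ultimately show ?thesis by simp
  qed
  have sumT: "(\<lambda>y. \<Sum>j\<in>UNIV. partial j (T j) y) = contract (Suc k) a f"
    unfolding T_def using sum_partial_contract[OF f] by blast
  have e1: "(\<Sum>j\<in>UNIV. \<Sum>i\<in>UNIV. X x $ i * partial j (partial i (T j)) x) = (\<Sum>i\<in>UNIV. X x $ i * partial i (contract (Suc k) a f) x)"
  proof -
    have "partial i (contract (Suc k) a f) x = (\<Sum>j\<in>UNIV. partial j (partial i (T j)) x)" for i
      unfolding sumT[symmetric] by (subst partial_sum)
        (auto simp: smooth_differentiable[OF smooth_partial[OF sT]] intro!: sum.cong partial_commute[OF sT])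
    then show ?thesis by (subst sum.swap) (simp add: sum_distrib_left)
  qed
  have e2: "(\<Sum>j\<in>UNIV. \<Sum>I | length I = k. (\<Sum>r<k. \<Sum>l\<in>UNIV. partial j (DX l (I ! r)) x * a (j # I[r := l])) * partials I f x) =
      2 * real k * contract k (ctr w a) f x"
    by (subst sum.swap) (simp add: sum_distrib_right[symmetric] sum_second_derivative_slots[OF a] contract_def sum_distrib_left mult.assoc)
  have e3: "(\<Sum>j\<in>UNIV. \<Sum>i\<in>UNIV. DX j i x * partial i (T j) x) + (\<Sum>j\<in>UNIV. \<Sum>I | length I = k. slot_action X x (?a j) I * partial j (partials I f) x)
      = contract (Suc k) (slot_action X x a) f x"
  proof -
    have "(\<Sum>j\<in>UNIV. \<Sum>i\<in>UNIV. DX j i x * partial i (T j) x) =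
      (\<Sum>i\<in>UNIV. \<Sum>I | length I = k. \<Sum>j\<in>UNIV. DX j i x * (a (j # I) * partial i (partials I f) x))"
      unfolding T_def partial_contract_const[OF f] sum_distrib_left
      by (subst sum.swap, rule sum.cong[OF refl], rule sum.swap)
    then show ?thesis
      unfolding contract_Suc slot_action_Cons by (simp add: distrib_right sum.distrib sum_distrib_right mult.assoc)
  qed
  have e4: "(\<Sum>j\<in>UNIV. w j * T j x) = contract k (ctr w a) f x"
    unfolding T_def contract_scale[symmetric] contract_sum[symmetric] ctr_def ..
  have e5: "C * (\<Sum>j\<in>UNIV. partial j (U j) x) = C * contract k (ctr w a) f x"
  proof (cases k)
    case (Suc k')
    have "(\<Sum>j\<in>UNIV. partial j (U j) x) = (\<Sum>j\<in>UNIV. partial j (contract k' (\<lambda>I. ctr w a (j # I)) f) x)"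
      unfolding U_def Suc ctr_slot[OF a] by simp
    then show ?thesis using sum_partial_contract[OF f, of k' "ctr w a" x] Suc by simp
  qed (simp add: C_def)
  have "contract (Suc k) a (lie_function b X f) x = (\<Sum>j\<in>UNIV. partial j (contract k (?a j) (lie_function b X f)) x)"
    by (rule sum_partial_contract[OF lie_function_smooth[OF f], symmetric])
  also have "\<dots> = ((\<Sum>j\<in>UNIV. \<Sum>i\<in>UNIV. DX j i x * partial i (T j) x) + (\<Sum>j\<in>UNIV. \<Sum>i\<in>UNIV. X x $ i * partial j (partial i (T j)) x))
      + ((\<Sum>j\<in>UNIV. \<Sum>I | length I = k. (\<Sum>r<k. \<Sum>l\<in>UNIV. partial j (DX l (I ! r)) x * a (j # I[r := l])) * partials I f x)
        + (\<Sum>j\<in>UNIV. \<Sum>I | length I = k. slot_action X x (?a j) I * partial j (partials I f) x))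
      + (?\<nu> * (\<Sum>j\<in>UNIV. w j * T j x) + b * divergence X x * (\<Sum>j\<in>UNIV. partial j (T j) x))
      + C * (\<Sum>j\<in>UNIV. partial j (U j) x)"
    unfolding P by (simp only: sum.distrib sum_distrib_left mult.assoc)
  also have "\<dots> = (\<Sum>i\<in>UNIV. X x $ i * partial i (contract (Suc k) a f) x) + contract (Suc k) (slot_action X x a) f x
      + b * divergence X x * contract (Suc k) a f x + (2 * real k + ?\<nu> + C) * contract k (ctr w a) f x"
    unfolding e1 e2 e3[symmetric] e4 e5 fun_cong[OF sumT] by (simp add: algebra_simps)
  also have "2 * real k + ?\<nu> + C = real (Suc k) * (?\<nu> + real (Suc k) - 1)"
    by (simp add: C_def algebra_simps)
  finally show ?case by simp
qed

lemma div_lie_array: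
  assumes A: "smooth_array A" and I: "length I = k"
  shows "div_array (lie_array c X A) x I = lie_array c X (div_array A) x I
    - (2 * real k + 1 + real CARD('m) - c * (real CARD('m) + 1)) * ctr w (A x) I"
proof -
  let ?m = "real CARD('m)"
  note sA = smooth_arrayD(1)[OF A] and symA = smooth_arrayD(2)[OF A]
  let ?D = "\<lambda>i J. partial i (\<lambda>y. A y J) x"
  have P: "partial i (\<lambda>y. lie_array c X A y (i # I)) x =
     (\<Sum>j\<in>UNIV. DX i j x * ?D j (i # I) + X x $ j * partial i (partial j (\<lambda>y. A y (i # I))) x)
     - ((\<Sum>l\<in>UNIV. partial i (DX l i) x * A x (l # I) + DX l i x * ?D i (l # I))
        + (\<Sum>r<k. \<Sum>l\<in>UNIV. partial i (DX l (I ! r)) x * A x (i # I[r := l]) + DX l (I ! r) x * ?D i (i # I[r := l])))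
     + (c * ((?m + 1) * w i) * A x (i # I) + c * divergence X x * ?D i (i # I))" for i
  proof -
    have s1: "smooth (\<lambda>y. X y $ j * partial j (\<lambda>z. A z J) y)" for j J by (intro smooth_mult X_smooth smooth_partial sA)
    have s2: "smooth (\<lambda>y. DX l b y * A y J)" for l b J by (intro smooth_mult DX_smooth sA)
    have s3: "smooth (\<lambda>y. c * divergence X y * A y J)" for J by (intro smooth_mult smooth_const divergence_smooth sA)
    have s4: "smooth (\<lambda>y. slot_action X y (A y) J)" for J
      unfolding slot_action_def by (intro smooth_sum s2)
    have s5: "smooth (\<lambda>y. slot_action X y (\<lambda>J. A y (i # J)) I)"
      unfolding slot_action_def by (intro smooth_sum s2)
    have "partial i (\<lambda>y. lie_array c X A y (i # I)) x = partial i (\<lambda>y. \<Sum>j\<in>UNIV. X y $ j * partial j (\<lambda>z. A z (i # I)) y) x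
       - partial i (\<lambda>y. slot_action X y (A y) (i # I)) x + partial i (\<lambda>y. c * divergence X y * A y (i # I)) x"
      unfolding lie_array_def
      by (simp only: partial_add partial_diff smooth_differentiable[OF smooth_sum[OF s1]] smooth_differentiable[OF s4]
          smooth_differentiable[OF s3] smooth_differentiable[OF smooth_diff[OF smooth_sum[OF s1] s4]])
    moreover have "partial i (\<lambda>y. \<Sum>j\<in>UNIV. X y $ j * partial j (\<lambda>z. A z (i # I)) y) x =
        (\<Sum>j\<in>UNIV. DX i j x * ?D j (i # I) + X x $ j * partial i (partial j (\<lambda>y. A y (i # I))) x)"
      by (subst partial_sum) (auto simp: partial_mult smooth_differentiable[OF s1] smooth_differentiable[OF X_smooth]
          smooth_differentiable[OF smooth_partial[OF sA]])
    moreover have "partial i (\<lambda>y. slot_action X y (A y) (i # I)) x =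
        (\<Sum>l\<in>UNIV. partial i (DX l i) x * A x (l # I) + DX l i x * ?D i (l # I))
        + (\<Sum>r<k. \<Sum>l\<in>UNIV. partial i (DX l (I ! r)) x * A x (i # I[r := l]) + DX l (I ! r) x * ?D i (i # I[r := l]))"
    proof -
      have q: "partial i (\<lambda>y. \<Sum>l\<in>UNIV. DX l b y * A y (J l)) x = (\<Sum>l\<in>UNIV. partial i (DX l b) x * A x (J l) + DX l b x * ?D i (J l))" for b J
        by (subst partial_sum) (auto simp: partial_mult smooth_differentiable[OF s2] smooth_differentiable[OF DX_smooth]
            smooth_differentiable[OF sA])
      have "partial i (\<lambda>y. slot_action X y (A y) (i # I)) x = partial i (\<lambda>y. \<Sum>l\<in>UNIV. DX l i y * A y (l # I)) x
          + partial i (\<lambda>y. slot_action X y (\<lambda>J. A y (i # J)) I) x"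
        unfolding slot_action_Cons by (simp only: partial_add smooth_differentiable[OF smooth_sum[OF s2]] smooth_differentiable[OF s5])
      also have "partial i (\<lambda>y. slot_action X y (\<lambda>J. A y (i # J)) I) x = (\<Sum>r<k. partial i (\<lambda>y. \<Sum>l\<in>UNIV. DX l (I ! r) y * A y (i # I[r := l])) x)"
        unfolding slot_action_def I by (rule partial_sum) (rule smooth_differentiable[OF smooth_sum[OF s2]])
      finally show ?thesis unfolding q .
    qed
    moreover have "partial i (\<lambda>y. c * divergence X y * A y (i # I)) x = c * ((?m + 1) * w i) * A x (i # I) + c * divergence X x * ?D i (i # I)"
      unfolding partial_mult[OF smooth_differentiable[OF smooth_mult[OF smooth_const divergence_smooth]] smooth_differentiable[OF sA]]
        partial_cmult[OF smooth_differentiable[OF divergence_smooth]] partial_divergence ..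
    ultimately show ?thesis by simp
  qed
  have e1: "(\<Sum>i\<in>UNIV. \<Sum>j\<in>UNIV. X x $ j * partial i (partial j (\<lambda>y. A y (i # I))) x) = (\<Sum>j\<in>UNIV. X x $ j * partial j (\<lambda>y. div_array A y I) x)"
  proof -
    have "partial j (\<lambda>y. div_array A y I) x = (\<Sum>i\<in>UNIV. partial i (partial j (\<lambda>y. A y (i # I))) x)" for j
      unfolding div_array_def by (subst partial_sum)
        (auto simp: smooth_differentiable[OF smooth_partial[OF sA]] intro!: sum.cong partial_commute[OF sA])
    then show ?thesis by (subst sum.swap) (simp add: sum_distrib_left)
  qed
  have e2: "(\<Sum>i\<in>UNIV. \<Sum>l\<in>UNIV. DX l i x * ?D i (l # I)) = (\<Sum>i\<in>UNIV. \<Sum>j\<in>UNIV. DX i j x * ?D j (i # I))"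
    by (rule sum.swap)
  have e3: "(\<Sum>i\<in>UNIV. \<Sum>l\<in>UNIV. partial i (DX l i) x * A x (l # I)) = (?m + 1) * ctr w (A x) I"
  proof -
    have "(\<Sum>i\<in>UNIV. \<Sum>l\<in>UNIV. partial i (DX l i) x * A x (l # I)) =
        (\<Sum>i\<in>(UNIV :: 'm set). \<Sum>l\<in>UNIV. w l * A x (l # I)) + (\<Sum>i\<in>UNIV. \<Sum>l\<in>UNIV. (if i = l then 1 else 0) * (w i * A x (l # I)))"
      unfolding X_second sum.distrib[symmetric] by (intro sum.cong refl) (simp add: distrib_right)
    then show ?thesis unfolding sum_kronecker' by (simp add: ctr_def distrib_right)
  qed
  have e4: "(\<Sum>i\<in>UNIV. \<Sum>r<k. \<Sum>l\<in>UNIV. DX l (I ! r) x * ?D i (i # I[r := l])) = slot_action X x (div_array A x) I"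
    unfolding slot_action_def div_array_def I sum_distrib_left
    by (subst sum.swap, rule sum.cong[OF refl], rule sum.swap)
  have "div_array (lie_array c X A) x I = (\<Sum>i\<in>UNIV. partial i (\<lambda>y. lie_array c X A y (i # I)) x)"
    by (rule div_array_def)
  also have "\<dots> = ((\<Sum>i\<in>UNIV. \<Sum>j\<in>UNIV. DX i j x * ?D j (i # I)) + (\<Sum>i\<in>UNIV. \<Sum>j\<in>UNIV. X x $ j * partial i (partial j (\<lambda>y. A y (i # I))) x))
     - (((\<Sum>i\<in>UNIV. \<Sum>l\<in>UNIV. partial i (DX l i) x * A x (l # I)) + (\<Sum>i\<in>UNIV. \<Sum>l\<in>UNIV. DX l i x * ?D i (l # I)))
        + ((\<Sum>i\<in>UNIV. \<Sum>r<k. \<Sum>l\<in>UNIV. partial i (DX l (I ! r)) x * A x (i # I[r := l]))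
           + (\<Sum>i\<in>UNIV. \<Sum>r<k. \<Sum>l\<in>UNIV. DX l (I ! r) x * ?D i (i # I[r := l]))))
     + (c * (?m + 1) * (\<Sum>i\<in>UNIV. w i * A x (i # I)) + c * divergence X x * (\<Sum>i\<in>UNIV. ?D i (i # I)))"
    unfolding P by (simp only: sum.distrib sum_subtractf sum_distrib_left mult.assoc)
  also have "\<dots> = lie_array c X (div_array A) x I - (2 * real k + 1 + ?m - c * (?m + 1)) * ctr w (A x) I"
    unfolding e1 e2 e3 e4 sum_second_derivative_slots[OF symA I] lie_array_def div_array_def[of A x I, symmetric] ctr_def[of w "A x" I, symmetric]
    by (simp add: algebra_simps)
  finally show ?thesis .
qed


lemma div_pow_lie_array:
  fixes k :: nat and c :: real
  assumes A: "smooth_array A"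
  defines "\<tau> \<equiv> 2 * real k + real CARD('m) - c * (real CARD('m) + 1)"
  shows "l \<le> k \<Longrightarrow> length I = k - l \<Longrightarrow> (div_array ^^ l) (lie_array c X A) x I =
    lie_array c X ((div_array ^^ l) A) x I - real l * (\<tau> - real l) * ctr w ((div_array ^^ (l - 1)) A x) I"
proof (induction l arbitrary: x I)
  case 0 then show ?case by simp
next
  case (Suc l)
  let ?Al = "(div_array ^^ l) A" and ?B = "(div_array ^^ (l - 1)) A"
  note sl = smooth_array_div_pow[OF A]
  have IH: "(div_array ^^ l) (lie_array c X A) y (i # I) =
      lie_array c X ?Al y (i # I) - real l * (\<tau> - real l) * ctr w (?B y) (i # I)" for y i
    using Suc.prems by (intro Suc.IH) auto
  have s1: "smooth (\<lambda>y. lie_array c X ?Al y J)" for J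
    by (rule smooth_arrayD(1)[OF lie_array_smooth_array[OF sl]])
  have s2: "smooth (\<lambda>y. ctr w (?B y) J)" for J
    unfolding ctr_def by (intro smooth_sum smooth_mult smooth_const smooth_arrayD(1)[OF sl])
  have "(div_array ^^ Suc l) (lie_array c X A) x I = div_array ((div_array ^^ l) (lie_array c X A)) x I" by simp
  also have "\<dots> = (\<Sum>i\<in>UNIV. partial i (\<lambda>y. lie_array c X ?Al y (i # I) - real l * (\<tau> - real l) * ctr w (?B y) (i # I)) x)"
    unfolding div_array_def[of "(div_array ^^ l) (lie_array c X A)" x I] IH ..
  also have "\<dots> = div_array (lie_array c X ?Al) x I - real l * (\<tau> - real l) * (\<Sum>i\<in>UNIV. partial i (\<lambda>y. ctr w (?B y) (i # I)) x)"
  proof -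
    have "partial i (\<lambda>y. lie_array c X ?Al y J - q * ctr w (?B y) J) x = partial i (\<lambda>y. lie_array c X ?Al y J) x - q * partial i (\<lambda>y. ctr w (?B y) J) x" for i J q
      unfolding partial_diff[OF smooth_differentiable[OF s1] smooth_differentiable[OF smooth_mult[OF smooth_const s2]]]
        partial_cmult[OF smooth_differentiable[OF s2]] ..
    then show ?thesis unfolding div_array_def[of "lie_array c X ?Al" x I] by (simp add: sum_subtractf sum_distrib_left)
  qed
  also have "div_array (lie_array c X ?Al) x I = lie_array c X ((div_array ^^ Suc l) A) x I
      - (\<tau> - 1 - 2 * real l) * ctr w (?Al x) I"
  proof -
    have "2 * real (k - Suc l) + 1 + real CARD('m) - c * (real CARD('m) + 1) = \<tau> - 1 - 2 * real l"
      using Suc.prems(1) by (simp add: \<tau>_def of_nat_diff)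
    then show ?thesis using div_lie_array[OF sl Suc.prems(2), where x = x and c = c and l1 = l] by simp
  qed
  also have "real l * (\<tau> - real l) * (\<Sum>i\<in>UNIV. partial i (\<lambda>y. ctr w (?B y) (i # I)) x) = real l * (\<tau> - real l) * ctr w (?Al x) I"
  proof (cases l)
    case (Suc l')
    have "(\<Sum>i\<in>UNIV. partial i (\<lambda>y. ctr w (?B y) (i # I)) x) = (\<Sum>i\<in>UNIV. \<Sum>j\<in>UNIV. w j * partial i (\<lambda>y. ?B y (j # i # I)) x)"
      unfolding ctr_def
      by (intro sum.cong refl, subst partial_sum)
        (auto simp: partial_cmult smooth_differentiable[OF smooth_arrayD(1)[OF sl]] intro!: differentiable_mult_real)
    also have "\<dots> = (\<Sum>j\<in>UNIV. w j * (\<Sum>i\<in>UNIV. partial i (\<lambda>y. ?B y (i # j # I)) x))"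
    proof -
      have "(\<lambda>y. ?B y (j # i # I)) = (\<lambda>y. ?B y (i # j # I))" for i j
        by (rule ext, rule symmetric_arrayD[OF smooth_arrayD(2)[OF sl]]) simp
      then show ?thesis by (subst sum.swap) (simp add: sum_distrib_left)
    qed
    also have "\<dots> = ctr w (?Al x) I"
      unfolding ctr_def Suc by (simp add: div_array_def[of "(div_array ^^ l') A"])
    finally show ?thesis by simp
  qed simp
  finally show ?case by (simp add: algebra_simps)
qed

lemma proj_quant_equivariant:
  assumes A: "smooth_array A" and f: "smooth f"
    and nz: "\<And>j. j < k \<Longrightarrow> 2 * real k + real CARD('m) - c * (real CARD('m) + 1) - 1 - real j \<noteq> 0"
  shows "lie_function (b + c) X (proj_quant b c k A f) x =
    proj_quant b c k (lie_array c X A) f x + proj_quant b c k A (lie_function b X f) x"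
proof -
  let ?\<nu> = "b * (real CARD('m) + 1)"
  define \<tau> where "\<tau> = 2 * real k + real CARD('m) - c * (real CARD('m) + 1)"
  define C where "C l = quant_coef ?\<nu> \<tau> (real k) l" for l
  let ?D = "\<lambda>l. (div_array ^^ l) A"
  let ?dX = "divergence X x"
  note sD = smooth_arrayD(1)[OF smooth_array_div_pow[OF A]] and symD = smooth_arrayD(2)[OF smooth_array_div_pow[OF A]]
  define W where "W l = contract (k - l - 1) (ctr w (?D l x)) f x" for l
  define E where "E l = (\<Sum>i\<in>UNIV. X x $ i * contract (k - l) (\<lambda>I. partial i (\<lambda>y. ?D l y I) x) f x)" for l
  define F where "F l = (\<Sum>i\<in>UNIV. X x $ i * partial i (contract (k - l) (?D l x) f) x)" for l
  define T where "T l = contract (k - l) (?D l x) f x" for l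
  define S where "S l = contract (k - l) (slot_action X x (?D l x)) f x" for l
  have sT: "smooth (\<lambda>y. contract (k - l) (?D l y) f y)" for l by (rule smooth_contract[OF f sD])
  have q: "proj_quant b c k A g = (\<lambda>y. \<Sum>l\<le>k. C l * contract (k - l) (?D l y) g y)" for g
    unfolding proj_quant_def C_def \<tau>_def ..
  have lhs: "lie_function (b + c) X (proj_quant b c k A f) x = (\<Sum>l\<le>k. C l * (E l + F l + (b + c) * ?dX * T l))"
  proof -
    have p: "partial i (\<lambda>y. contract (k - l) (?D l y) f y) x =
        contract (k - l) (\<lambda>I. partial i (\<lambda>y. ?D l y I) x) f x + partial i (contract (k - l) (?D l x) f) x" for i l
      using partial_contract(1)[OF f smooth_differentiable[OF sD]] partial_contract_const[OF f] by simp
    have "partial i (\<lambda>y. \<Sum>l\<le>k. C l * contract (k - l) (?D l y) f y) x = (\<Sum>l\<le>k. C l * partial i (\<lambda>y. contract (k - l) (?D l y) f y) x)" for i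
      by (subst partial_sum) (auto simp: partial_cmult smooth_differentiable[OF sT] intro!: differentiable_mult_real)
    then have "lie_function (b + c) X (proj_quant b c k A f) x =
        (\<Sum>i\<in>UNIV. X x $ i * (\<Sum>l\<le>k. C l * partial i (\<lambda>y. contract (k - l) (?D l y) f y) x)) + (b + c) * ?dX * (\<Sum>l\<le>k. C l * T l)"
      unfolding lie_function_def q T_def by simp
    also have "(\<Sum>i\<in>UNIV. X x $ i * (\<Sum>l\<le>k. C l * partial i (\<lambda>y. contract (k - l) (?D l y) f y) x)) = (\<Sum>l\<le>k. C l * (E l + F l))"
      unfolding sum_distrib_left E_def F_def sum.distrib[symmetric] p
      by (subst sum.swap, intro sum.cong refl) (simp add: algebra_simps)
    finally show ?thesis by (simp add: sum_distrib_left sum.distrib distrib_left mult.left_commute)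
  qed
  have r1: "proj_quant b c k (lie_array c X A) f x =
      (\<Sum>l\<le>k. C l * (E l - S l + c * ?dX * T l)) - (\<Sum>l\<le>k. C l * (real l * (\<tau> - l)) * W (l - 1))"
  proof -
    have "contract (k - l) ((div_array ^^ l) (lie_array c X A) x) f x = (E l - S l + c * ?dX * T l) - real l * (\<tau> - l) * W (l - 1)"
      if l: "l \<le> k" for l
    proof -
      have "contract (k - l) ((div_array ^^ l) (lie_array c X A) x) f x =
          contract (k - l) (\<lambda>I. lie_array c X (?D l) x I + (- (real l * (\<tau> - l))) * ctr w ((div_array ^^ (l - 1)) A x) I) f x"
        by (rule contract_cong) (simp add: div_pow_lie_array[OF A l] \<tau>_def)
      also have "\<dots> = contract (k - l) (lie_array c X (?D l) x) f x - real l * (\<tau> - l) * contract (k - l) (ctr w ((div_array ^^ (l - 1)) A x)) f x"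
        unfolding contract_add contract_scale by simp
      also have "real l * (\<tau> - l) * contract (k - l) (ctr w ((div_array ^^ (l - 1)) A x)) f x = real l * (\<tau> - l) * W (l - 1)"
        by (cases l) (simp_all add: W_def)
      also have "contract (k - l) (lie_array c X (?D l) x) f x = E l - S l + c * ?dX * T l"
      proof -
        have "contract (k - l) (lie_array c X (?D l) x) f x = contract (k - l) (\<lambda>I. (\<Sum>i\<in>UNIV. X x $ i * partial i (\<lambda>y. ?D l y I) x)
            + ((- 1) * slot_action X x (?D l x) I + c * ?dX * ?D l x I)) f x"
          by (rule contract_cong) (simp add: lie_array_def)
        then show ?thesis unfolding contract_add contract_scale contract_sum E_def S_def T_def by simp
      qed
      finally show ?thesis .
    qed
    then have "proj_quant b c k (lie_array c X A) f x = (\<Sum>l\<le>k. C l * ((E l - S l + c * ?dX * T l) - real l * (\<tau> - l) * W (l - 1)))"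
      unfolding proj_quant_def C_def[symmetric] \<tau>_def[symmetric] by (intro sum.cong refl) simp
    then show ?thesis unfolding right_diff_distrib[of "C _" "E _ - S _ + _"] sum_subtractf by (simp add: mult.assoc)
  qed
  have r2: "proj_quant b c k A (lie_function b X f) x =
      (\<Sum>l\<le>k. C l * (F l + S l + b * ?dX * T l)) + (\<Sum>l\<le>k. C l * (real (k - l) * (?\<nu> + real (k - l) - 1)) * W l)"
    unfolding q contract_lie_function[OF f symD] F_def S_def T_def W_def
    by (simp add: sum.distrib[symmetric] distrib_left mult.assoc)
  have cancel: "(\<Sum>l\<le>k. C l * (real l * (\<tau> - l)) * W (l - 1)) = (\<Sum>l\<le>k. C l * (real (k - l) * (?\<nu> + real (k - l) - 1)) * W l)"
  proof -
    have "(\<Sum>l\<le>k. C l * (real l * (\<tau> - l)) * W (l - 1)) = (\<Sum>l<k. C (Suc l) * (real (Suc l) * (\<tau> - Suc l)) * W l)"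
      unfolding lessThan_Suc_atMost[symmetric] sum.lessThan_Suc_shift by simp
    also have "\<dots> = (\<Sum>l<k. C l * (real (k - l) * (?\<nu> + real (k - l) - 1)) * W l)"
    proof (rule sum.cong[OF refl], rule arg_cong2[where f = "(*)", OF _ refl])
      fix l assume "l \<in> {..<k}"
      then have l: "l < k" by simp
      have "\<tau> - 1 - real l \<noteq> 0" using nz[OF l] by (simp add: \<tau>_def)
      from quant_coef_Suc[OF this, of ?\<nu> "real k"] l
      show "C (Suc l) * (real (Suc l) * (\<tau> - real (Suc l))) = C l * (real (k - l) * (?\<nu> + real (k - l) - 1))"
        by (simp add: C_def of_nat_diff algebra_simps)
    qed
    also have "\<dots> = (\<Sum>l\<le>k. C l * (real (k - l) * (?\<nu> + real (k - l) - 1)) * W l)"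
      unfolding lessThan_Suc_atMost[symmetric] by simp
    finally show ?thesis .
  qed
  have "(\<Sum>l\<le>k. C l * (E l + F l + (b + c) * ?dX * T l)) =
     (\<Sum>l\<le>k. C l * (E l - S l + c * ?dX * T l)) + (\<Sum>l\<le>k. C l * (F l + S l + b * ?dX * T l))"
    unfolding sum.distrib[symmetric] by (intro sum.cong refl) (simp add: algebra_simps)
  then show ?thesis unfolding lhs r1 r2 cancel by simp
qed

end

lemma infinitesimal_homography_field:
  assumes "X \<in> infinitesimal_homographies"
  obtains w where "projective_field X w"
proof -
  obtain v B u where X: "X = (\<lambda>x. v + B *v x + (u \<bullet> x) *\<^sub>R x)"
    using assms unfolding infinitesimal_homographies_def by blast
  define p where "p x = (\<Sum>k\<in>UNIV. u $ k * x $ k)" for x :: "real^'a"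
  have s1: "smooth (\<lambda>x. v $ a + (\<Sum>k\<in>UNIV. B $ a $ k * x $ k))" for a
    by (intro smooth_add smooth_sum smooth_mult smooth_const smooth_coord)
  have sl: "smooth p" unfolding p_def[abs_def] by (intro smooth_sum smooth_mult smooth_const smooth_coord)
  have s2: "smooth (\<lambda>x. p x * x $ a)" for a by (intro smooth_mult sl smooth_coord)
  have Xa: "X x $ a = (v $ a + (\<Sum>k\<in>UNIV. B $ a $ k * x $ k)) + p x * x $ a" for x a
    unfolding X p_def by (simp add: matrix_vector_mult_def inner_vec_def)
  have lin: "partial j (\<lambda>x. \<Sum>k\<in>UNIV. t k * x $ k) y = t j" for t :: "'a \<Rightarrow> real" and j y
  proof -
    have "partial j (\<lambda>x. \<Sum>k\<in>UNIV. t k * x $ k) y = (\<Sum>k\<in>UNIV. t k * (if k = j then 1 else 0))"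
      by (subst partial_sum) (auto simp: partial_cmult partial_coord intro!: differentiable_mult_real)
    also have "\<dots> = (\<Sum>k\<in>UNIV. if k = j then t k else 0)" by (intro sum.cong refl) simp
    finally show ?thesis by simp
  qed
  have d: "(\<lambda>x. \<Sum>k\<in>UNIV. t k * x $ k) differentiable (at y)" for t :: "'a \<Rightarrow> real" and y
    by (intro smooth_differentiable smooth_sum smooth_mult smooth_const smooth_coord)
  have P: "partial j (\<lambda>y. X y $ a) = (\<lambda>y. B $ a $ j + (u $ j * y $ a + p y * (if a = j then 1 else 0)))" for j a
  proof
    fix y
    have "partial j (\<lambda>y. X y $ a) y = partial j (\<lambda>x. v $ a + (\<Sum>k\<in>UNIV. B $ a $ k * x $ k)) y + partial j (\<lambda>x. p x * x $ a) y"
      unfolding Xa by (rule partial_add[OF smooth_differentiable[OF s1] smooth_differentiable[OF s2]])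
    then show "partial j (\<lambda>y. X y $ a) y = B $ a $ j + (u $ j * y $ a + p y * (if a = j then 1 else 0))"
      using lin[of j "\<lambda>k. u $ k" y]
      by (simp add: partial_add d lin partial_mult smooth_differentiable[OF sl] partial_coord p_def[abs_def])
  qed
  have "projective_field X (\<lambda>j. u $ j)"
  proof
    show "smooth (\<lambda>x. X x $ a)" for a unfolding Xa by (rule smooth_add[OF s1 s2])
    fix i j a x
    have t1: "smooth (\<lambda>y. u $ j * y $ a)" and t2: "smooth (\<lambda>y. p y * (if a = j then 1 else 0))"
      by (intro smooth_mult smooth_const smooth_coord sl)+
    have "partial i (\<lambda>y. B $ a $ j + (u $ j * y $ a + p y * (if a = j then 1 else 0))) x =
        u $ j * (if a = i then 1 else 0) + u $ i * (if a = j then 1 else 0)"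
      using lin[of i "\<lambda>k. u $ k" x]
      by (simp add: partial_add smooth_differentiable[OF t1] smooth_differentiable[OF t2]
          smooth_differentiable[OF smooth_add[OF t1 t2]] partial_mult smooth_differentiable[OF sl] partial_coord p_def[abs_def])
    then show "partial i (partial j (\<lambda>y. X y $ a)) x = (if a = i then 1 else 0) * u $ j + (if a = j then 1 else 0) * u $ i"
      unfolding P by simp
  qed
  then show ?thesis by (rule that)
qed

abbreviation euclidean_chart :: "(real^'m::finite, 'm) chart" where
  "euclidean_chart \<equiv> (UNIV, id)"

lemma euclidean_chart_simps:
  "image_of (euclidean_chart :: (real^'m::finite, 'm) chart) = UNIV"
  "overlap (euclidean_chart :: (real^'m::finite, 'm) chart) euclidean_chart = UNIV"
  "in_coords id (euclidean_chart :: (real^'m::finite, 'm) chart) euclidean_chart = (\<lambda>x. x)"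
  by (auto simp: image_of_def overlap_def in_coords_def point_def)

lemma projective_change_id: "projective_change UNIV (\<lambda>x :: real^'m::finite. x) (\<lambda>x. mat 1) (\<lambda>x i. 0)"
proof -
  have "(*v) (mat 1 :: real^'m^'m) = (\<lambda>x. x)" by (rule ext) simp
  then show ?thesis by unfold_locales (auto simp: invertible_def)
qed

lemma jacobian_ident: "jacobian (\<lambda>x :: real^'m::finite. x) (at y) = mat 1"
  using projective_change.jacobian_eq[OF projective_change_id] by simp

lemma matrix_inv_one: "matrix_inv (mat 1 :: real^'m::finite^'m) = mat 1"
  using projective_change.H_inverse(1)[OF projective_change_id] by simp

lemma euclidean_density_iff:
  fixes \<psi> :: "(real^'m::finite, 'm) density"
  shows "\<psi> \<in> densities euclidean_atlas b \<longleftrightarrow> smooth (\<psi> euclidean_chart) \<and> (\<forall>\<kappa>. \<kappa> \<noteq> euclidean_chart \<longrightarrow> \<psi> \<kappa> = (\<lambda>x. 0))"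
  unfolding densities_def mem_Collect_eq euclidean_atlas_def
  by (auto simp: euclidean_chart_simps pull_density_def jacobian_ident fun_eq_iff)

lemma pull_symbol_ident: "pull_symbol c (\<lambda>x. x) a x I = a x I"
proof -
  have "pull_symbol c (\<lambda>x. x) a x I = (\<Sum>J | length J = length I. tpow (mat 1) I J * a x J)"
    unfolding pull_symbol_def jacobian_ident matrix_inv_one
    by (simp, intro sum.cong refl arg_cong2[where f = "(*)"]) (simp add: prod_eq_tpow)
  also have "\<dots> = (\<Sum>J | length J = length I. if J = I then a x J else 0)"
    by (intro sum.cong refl) (auto simp: tpow_one)
  also have "\<dots> = a x I" by (subst sum.delta) auto
  finally show ?thesis .
qed

lemma euclidean_symbol_iff:
  fixes A :: "(real^'m::finite, 'm) symbol"
  shows "A \<in> symbols euclidean_atlas c \<longleftrightarrow> smooth_array (A euclidean_chart) \<and>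
    (\<exists>n. \<forall>x I. length I > n \<longrightarrow> A euclidean_chart x I = 0) \<and> (\<forall>\<kappa>. \<kappa> \<noteq> euclidean_chart \<longrightarrow> A \<kappa> = (\<lambda>x I. 0))"
    (is "_ \<longleftrightarrow> ?s \<and> ?n \<and> ?z")
proof
  assume A: "A \<in> symbols euclidean_atlas c"
  have M: "euclidean_chart \<in> euclidean_atlas" by (simp add: euclidean_atlas_def)
  have "smooth (\<lambda>x. A euclidean_chart x I)" for I
    using symbolsD(4)[OF A M] unfolding euclidean_chart_simps .
  moreover have "symmetric_array (A euclidean_chart x)" for x
    unfolding symmetric_array_def using symbolsD(3)[OF A] by blast
  moreover have ?n using symbolsD(2)[OF A] by blast
  moreover have ?z using symbolsD(1)[OF A] by (auto simp: euclidean_atlas_def fun_eq_iff)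
  ultimately show "?s \<and> ?n \<and> ?z" unfolding smooth_array_def by blast
next
  assume R: "?s \<and> ?n \<and> ?z"
  then obtain n where n: "\<And>x I. length I > n \<Longrightarrow> A euclidean_chart x I = 0" by blast
  have z: "A \<kappa> x I = 0" if "\<kappa> \<noteq> euclidean_chart" for \<kappa> x I
  proof -
    have "A \<kappa> = (\<lambda>x I. 0)" using R that by blast
    then show ?thesis by simp
  qed
  show "A \<in> symbols euclidean_atlas c"
    unfolding symbols_def mem_Collect_eq
  proof (intro conjI allI impI ballI exI[of _ n])
    show "A \<kappa> x I = 0" if "\<kappa> \<notin> euclidean_atlas \<or> x \<notin> image_of \<kappa>" for \<kappa> x I
      using that z[of \<kappa> x I] by (cases "\<kappa> = euclidean_chart") (auto simp: euclidean_atlas_def euclidean_chart_simps)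
    show "A \<kappa> x I = 0" if "length I > n" for \<kappa> x I
      using n[OF that] z by (cases "\<kappa> = euclidean_chart") auto
    show "A \<kappa> x I = A \<kappa> x J" if m: "mset I = mset J" for \<kappa> x I J
    proof (cases "\<kappa> = euclidean_chart")
      case True
      then show ?thesis using symmetric_arrayD[OF smooth_arrayD(2)[OF conjunct1[OF R]] m] by simp
    qed (simp add: z)
    show "smooth_on (image_of \<kappa>) (\<lambda>x. A \<kappa> x I)" if "\<kappa> \<in> euclidean_atlas" for \<kappa> I
      using that smooth_arrayD(1)[OF conjunct1[OF R]] by (simp add: euclidean_atlas_def euclidean_chart_simps)
    show "A \<kappa> x I = pull_symbol c (in_coords id \<kappa> \<kappa>') (A \<kappa>') x I" if "\<kappa> \<in> euclidean_atlas" "\<kappa>' \<in> euclidean_atlas" for \<kappa> \<kappa>' x I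
      using that by (simp add: euclidean_atlas_def euclidean_chart_simps pull_symbol_ident)
  qed
qed

lemma euclidean_projective_atlas: "projective_atlas (euclidean_atlas :: (real^'m::finite, 'm) atlas)"
proof
  fix \<kappa> \<kappa>' :: "(real^'m, 'm) chart"
  assume \<kappa>: "\<kappa> \<in> euclidean_atlas"
  then have [simp]: "\<kappa> = euclidean_chart" by (simp add: euclidean_atlas_def)
  show "image_of \<kappa> = UNIV" by (simp add: euclidean_chart_simps)
  show "\<exists>H \<beta>. projective_change (overlap \<kappa> \<kappa>') (in_coords id \<kappa> \<kappa>') H \<beta>" if "\<kappa>' \<in> euclidean_atlas"
    using that projective_change_id by (auto simp: euclidean_atlas_def euclidean_chart_simps)
  show "\<exists>\<psi>\<in>densities euclidean_atlas b. \<exists>u. smooth u \<and> u z \<noteq> 0 \<and> \<psi> \<kappa> = (\<lambda>x. monomial_at z I x * u x)" for b z I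
    by (rule bexI[of _ "\<lambda>\<kappa>. if \<kappa> = euclidean_chart then monomial_at z I else (\<lambda>x. 0)"], rule exI[of _ "\<lambda>x. 1"])
      (auto simp: euclidean_density_iff smooth_monomial_at)
next
  have "(\<lambda>\<kappa> x k i j. 0) \<in> torsion_free_connections (euclidean_atlas :: (real^'m, 'm) atlas)"
    unfolding torsion_free_connections_def euclidean_atlas_def
    using projective_change.second_partials[OF projective_change_id, of _ _ _ "_ :: 'm"]
    by (simp add: Let_def euclidean_chart_simps)
  then show "torsion_free_connections (euclidean_atlas :: (real^'m, 'm) atlas) \<noteq> {}" by blast
qed

theorem euclidean_equivariant:
  assumes nz: "\<And>k j. j < k \<Longrightarrow> 2 * real k + real CARD('m::finite) - c * (real CARD('m) + 1) - 1 - real j \<noteq> 0"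
  shows "infinitesimally_equivariant b c
    (local_ordering_op (euclidean_atlas :: (real^'m, 'm) atlas) b (\<lambda>\<kappa>. proj_quant b c))"
  unfolding infinitesimally_equivariant_def
proof (intro ballI)
  fix X :: "real^'m \<Rightarrow> real^'m" and A :: "(real^'m, 'm) symbol" and \<psi> :: "(real^'m, 'm) density"
  assume "X \<in> infinitesimal_homographies" and A: "A \<in> symbols euclidean_atlas c" and \<psi>: "\<psi> \<in> densities euclidean_atlas b"
  then obtain w where "projective_field X w" by (metis infinitesimal_homography_field)
  then interpret F: projective_field X w .
  interpret L: local_ordering "euclidean_atlas :: (real^'m, 'm) atlas" b c "\<lambda>\<kappa>. proj_quant b c"
    by (rule projective_atlas.proj_quant_local_ordering[OF euclidean_projective_atlas nz])
  note A' = A[unfolded euclidean_symbol_iff] and \<psi>' = \<psi>[unfolded euclidean_density_iff]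
  have sA: "smooth_array (A euclidean_chart)" and s\<psi>: "smooth (\<psi> euclidean_chart)" using A' \<psi>' by blast+
  have lieA: "lie_symbol c X A \<kappa> = lie_array c X (A \<kappa>)" for \<kappa>
    unfolding lie_symbol_def lie_array_def slot_action_def ..
  have lie\<psi>: "lie_density b X \<psi> \<kappa> = lie_function b X (\<psi> \<kappa>)" for b \<kappa> and \<psi> :: "(real^'m, 'm) density"
    unfolding lie_density_def lie_function_def ..
  obtain n where n: "\<And>\<kappa> x I. length I > n \<Longrightarrow> A \<kappa> x I = 0" using symbolsD(2)[OF A] by blast
  have n': "lie_symbol c X A \<kappa> x I = 0" if "length I > n" for \<kappa> x I
    unfolding lieA lie_array_def slot_action_def using n that by simp
  have lA: "lie_symbol c X A \<in> symbols euclidean_atlas c"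
    unfolding euclidean_symbol_iff
  proof (intro conjI allI impI)
    show "smooth_array (lie_symbol c X A euclidean_chart)" unfolding lieA by (rule F.lie_array_smooth_array[OF sA])
    show "\<exists>n. \<forall>x I. n < length I \<longrightarrow> lie_symbol c X A euclidean_chart x I = 0" using n' by blast
    show "lie_symbol c X A \<kappa> = (\<lambda>x I. 0)" if "\<kappa> \<noteq> euclidean_chart" for \<kappa>
    proof -
      have "A \<kappa> = (\<lambda>x I. 0)" using A' that by blast
      then show ?thesis by (simp add: lieA lie_array_def slot_action_def fun_eq_iff)
    qed
  qed
  have l\<psi>: "lie_density b X \<psi> \<in> densities euclidean_atlas b"
  proof -
    have "lie_function b X (\<psi> \<kappa>) = (\<lambda>x. 0)" if "\<kappa> \<noteq> euclidean_chart" for \<kappa>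
    proof -
      have z: "\<psi> \<kappa> = (\<lambda>x. 0)" using \<psi>' that by blast
      show ?thesis unfolding z by (rule ext) (simp add: lie_function_def)
    qed
    then show ?thesis unfolding euclidean_density_iff lie\<psi> using F.lie_function_smooth[OF s\<psi>] by blast
  qed
  have M: "euclidean_chart \<in> (euclidean_atlas :: (real^'m, 'm) atlas)" by (simp add: euclidean_atlas_def)
  show "lie_density (b + c) X (L.quantize A \<psi>) =
      (\<lambda>\<kappa> x. L.quantize (lie_symbol c X A) \<psi> \<kappa> x + L.quantize A (lie_density b X \<psi>) \<kappa> x)"
  proof (intro ext)
    fix \<kappa> :: "(real^'m, 'm) chart" and x
    show "lie_density (b + c) X (L.quantize A \<psi>) \<kappa> x = L.quantize (lie_symbol c X A) \<psi> \<kappa> x + L.quantize A (lie_density b X \<psi>) \<kappa> x"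
    proof (cases "\<kappa> = euclidean_chart")
      case False
      then have z: "L.quantize B \<phi> \<kappa> = (\<lambda>x. 0)" for B \<phi> by (simp add: local_ordering_op_def euclidean_atlas_def)
      show ?thesis unfolding lie\<psi> z lie_function_def by simp
    next
      case True
      have sq: "smooth (proj_quant b c k (A euclidean_chart) (\<psi> euclidean_chart))" for k
        unfolding proj_quant_def[abs_def]
        by (intro smooth_sum smooth_mult smooth_const smooth_contract s\<psi> smooth_arrayD(1)[OF smooth_array_div_pow[OF sA]])
      have e: "L.quantize A \<psi> euclidean_chart = (\<lambda>x. \<Sum>k\<le>n. proj_quant b c k (A euclidean_chart) (\<psi> euclidean_chart) x)"
        by (rule ext, rule L.ordering_eq[OF A n \<psi> M])
      have "lie_density (b + c) X (L.quantize A \<psi>) euclidean_chart x =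
         (\<Sum>k\<le>n. lie_function (b + c) X (proj_quant b c k (A euclidean_chart) (\<psi> euclidean_chart)) x)"
      proof -
        have "partial i (\<lambda>x. \<Sum>k\<le>n. proj_quant b c k (A euclidean_chart) (\<psi> euclidean_chart) x) x =
            (\<Sum>k\<le>n. partial i (proj_quant b c k (A euclidean_chart) (\<psi> euclidean_chart)) x)" for i
          by (rule partial_sum) (rule smooth_differentiable[OF sq])
        then have "lie_density (b + c) X (L.quantize A \<psi>) euclidean_chart x =
           (\<Sum>i\<in>UNIV. \<Sum>k\<le>n. X x $ i * partial i (proj_quant b c k (A euclidean_chart) (\<psi> euclidean_chart)) x)
           + (\<Sum>k\<le>n. (b + c) * divergence X x * proj_quant b c k (A euclidean_chart) (\<psi> euclidean_chart) x)"
          unfolding lie\<psi> e lie_function_def by (simp add: sum_distrib_left)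
        then show ?thesis unfolding lie_function_def sum.distrib by (subst (asm) sum.swap)
      qed
      also have "\<dots> = (\<Sum>k\<le>n. proj_quant b c k (lie_array c X (A euclidean_chart)) (\<psi> euclidean_chart) x
          + proj_quant b c k (A euclidean_chart) (lie_function b X (\<psi> euclidean_chart)) x)"
        by (intro sum.cong refl F.proj_quant_equivariant sA s\<psi> nz)
      also have "\<dots> = L.quantize (lie_symbol c X A) \<psi> euclidean_chart x + L.quantize A (lie_density b X \<psi>) euclidean_chart x"
      proof -
        have "L.quantize (lie_symbol c X A) \<psi> euclidean_chart x =
            (\<Sum>k\<le>n. proj_quant b c k (lie_symbol c X A euclidean_chart) (\<psi> euclidean_chart) x)"
          by (rule L.ordering_eq[OF lA n' \<psi> M])
        moreover have "L.quantize A (lie_density b X \<psi>) euclidean_chart x =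
            (\<Sum>k\<le>n. proj_quant b c k (A euclidean_chart) (lie_density b X \<psi> euclidean_chart) x)"
          by (rule L.ordering_eq[OF A n l\<psi> M])
        ultimately show ?thesis unfolding sum.distrib by (simp only: lieA lie\<psi>)
      qed
      finally show ?thesis unfolding True .
    qed
  qed
qed

theorem mainTheorem6:
  fixes b c :: real
  assumes "CARD('m::finite) \<ge> 2"
    and "c \<notin> {(real j + real CARD('m)) / (real CARD('m) + 1) | j :: nat. True}"
  shows "(\<exists>\<rho> :: ((real^'m) \<times> real, 'm) symbol \<Rightarrow> ((real^'m) \<times> real, 'm) operator.
            ordering_prescription sphere_atlas b c \<rho> \<and> homography_equivariant b c \<rho>) \<and>
         (\<exists>\<rho> :: (real^'m, 'm) symbol \<Rightarrow> (real^'m, 'm) operator.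
            ordering_prescription euclidean_atlas b c \<rho> \<and> infinitesimally_equivariant b c \<rho>)"
proof
  have nz: "2 * real k + real CARD('m) - c * (real CARD('m) + 1) - 1 - real j \<noteq> 0" if "j < k" for k j
    using nonresonant[OF assms(2) _ that] by simp
  have S: "local_ordering (sphere_atlas :: ((real^'m) \<times> real, 'm) atlas) b c (\<lambda>\<kappa>. proj_quant b c)"
    by (rule projective_atlas.proj_quant_local_ordering[OF sphere_projective_atlas nz])
  show "\<exists>\<rho> :: ((real^'m) \<times> real, 'm) symbol \<Rightarrow> ((real^'m) \<times> real, 'm) operator.
      ordering_prescription sphere_atlas b c \<rho> \<and> homography_equivariant b c \<rho>"
    using projective_atlas.std_prescription[OF sphere_projective_atlas S] sphere_equivariant[OF S] by blast
  have E: "local_ordering (euclidean_atlas :: (real^'m, 'm) atlas) b c (\<lambda>\<kappa>. proj_quant b c)"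
    by (rule projective_atlas.proj_quant_local_ordering[OF euclidean_projective_atlas nz])
  show "\<exists>\<rho> :: (real^'m, 'm) symbol \<Rightarrow> (real^'m, 'm) operator.
      ordering_prescription euclidean_atlas b c \<rho> \<and> infinitesimally_equivariant b c \<rho>"
    using projective_atlas.std_prescription[OF euclidean_projective_atlas E] euclidean_equivariant[OF nz] by blast
qed

end
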